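(* Let $X$ be a Banach space, let $(T_t)_{t\ge0}$ be a bounded $C_0$-semigroup on $X$ with infinitesimal generator $-A$, and let $\mathcal{T}_A=\{T_t:t\ge0\}$. The following are equivalent: (i) $\mathcal{T}_A$ is $\gamma$-bounded; (ii) there exists a $\gamma$-bounded homomorphism $\rho_{0,A}\colon\mathcal{A}_0(\mathbb{C}_+)\to B(X)$ such that $\rho_{0,A}(L_b)=\int_0^\infty b(t)T_tdt$ for all $b\in L^1(0,\infty)$. In this case $\rho_{0,A}$ is unique and $\gamma(\mathcal{T}_A)\le\gamma(\rho_{0,A})\le\gamma(\mathcal{T}_A)^2$. Furthermore, in this case there exists a unique bounded homomorphism $\rho_A\colon\mathcal{A}(\mathbb{C}_+)\to B(X)$ extending $\rho_{0,A}$; it is $\gamma$-bounded and $\gamma(\rho_A)=\gamma(\rho_{0,A})$.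
   Context: $\gamma$-boundedness: let $(\gamma_n)_{n\ge1}$ be independent complex standard Gaussian variables on a probability space; $G(X)$ is the closure of $\{\sum_{k=1}^N\gamma_k\otimes x_k\}$ in $L^2(\Sigma;X)$. A bounded set $\mathcal{T}\subset B(X)$ is $\gamma$-bounded if there is $C$ with $\|\sum_{k=1}^N\gamma_k\otimes S_kx_k\|_{G(X)}\le C\|\sum_{k=1}^N\gamma_k\otimes x_k\|_{G(X)}$ for all finite families $S_k\in\mathcal{T}$, $x_k\in X$; the least such $C$ is $\gamma(\mathcal{T})$. A bounded linear map $\rho\colon Z\to B(X)$ is $\gamma$-bounded if $\rho(\mathrm{Ball}(Z))$ is, and $\gamma(\rho)=\gamma(\rho(\mathrm{Ball}(Z)))$. Function algebras: $H^1(\mathbb{R})=\{h\in L^1:\widehat h(u)=0\ \forall u\le0\}$ with $\widehat h(u)=\int h(t)e^{-itu}dt$; $\mathcal{A}_0(\mathbb{R})$ (resp. $\mathcal{A}(\mathbb{R})$) is the set of $F=\sum_kf_k\star h_k$ (pointwise) with $(f_k)$ in $C_0(\mathbb{R})$ (resp. $BUC(\mathbb{R})$), $(h_k)\subset H^1(\mathbb{R})$, $\sum_k\|f_k\|_\infty\|h_k\|_1<\infty$, normed by the infimum of these sums. For such $F$ (which lie in $H^\infty(\mathbb{R})$), $\widetilde F(z)=\mathcal{P}[F](iz)$ on $\mathbb{C}_+=\{\mathrm{Re}\,z>0\}$, $\mathcal{P}[F]$ being the Poisson (analytic) extension to the upper half-plane; $\mathcal{A}_0(\mathbb{C}_+)$,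 $\mathcal{A}(\mathbb{C}_+)$ are the corresponding spaces of $\widetilde F$ with transferred norms (Banach algebras under pointwise multiplication). $L_b(z)=\int_0^\infty e^{-tz}b(t)dt$, which lies in $\mathcal{A}_0(\mathbb{C}_+)$. *)

theory Defs
  imports "HOL-Analysis.Analysis" "HOL-Probability.Probability"
begin

text \<open>The library has no class of complex normed spaces. A complex Banach space is
  a real Banach space X together with J = multiplication by i, such that the induced
  complex scalar multiplication is compatible with the norm.\<close>

definition cscale :: "('a::real_vector \<Rightarrow> 'a) \<Rightarrow> complex \<Rightarrow> 'a \<Rightarrow> 'a" where
  "cscale J c x = Re c *\<^sub>R x + Im c *\<^sub>R J x"

definition complex_structure :: "('a::banach \<Rightarrow> 'a) \<Rightarrow> bool" where
  "complex_structure J \<longleftrightarrow> linear J \<and> (\<forall>x. J (J x) = - x) \<and>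
     (\<forall>c x. norm (cscale J c x) = cmod c * norm x)"

definition cbounded_op :: "('a::banach \<Rightarrow> 'a) \<Rightarrow> ('a \<Rightarrow> 'a) \<Rightarrow> bool" where
  "cbounded_op J S \<longleftrightarrow> bounded_linear S \<and> (\<forall>x. S (J x) = J (S x))"

definition bounded_C0_semigroup :: "('a::banach \<Rightarrow> 'a) \<Rightarrow> (real \<Rightarrow> 'a \<Rightarrow> 'a) \<Rightarrow> bool" where
  "bounded_C0_semigroup J T \<longleftrightarrow>
     (\<forall>t\<ge>0. cbounded_op J (T t)) \<and> T 0 = id \<and>
     (\<forall>s\<ge>0. \<forall>t\<ge>0. T (s + t) = T s \<circ> T t) \<and>
     (\<forall>x. continuous_on {0..} (\<lambda>t. T t x)) \<and>
     (\<exists>M. \<forall>t\<ge>0. onorm (T t) \<le> M)"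

definition cgauss :: "complex measure" where
  "cgauss = density lborel (\<lambda>z. ennreal (exp (- (cmod z)\<^sup>2) / pi))"

text \<open>Norm in G(X) of sum gamma_k (x) x_k, realised on the canonical product probability space.\<close>
definition gauss_norm :: "('a::banach \<Rightarrow> 'a) \<Rightarrow> 'a list \<Rightarrow> real" where
  "gauss_norm J xs = sqrt (integral\<^sup>L (PiM {..<length xs} (\<lambda>_. cgauss))
      (\<lambda>\<omega>. (norm (\<Sum>k<length xs. cscale J (\<omega> k) (xs ! k)))\<^sup>2))"

definition gamma_ineq :: "('a::banach \<Rightarrow> 'a) \<Rightarrow> ('a \<Rightarrow> 'a) set \<Rightarrow> real \<Rightarrow> bool" where
  "gamma_ineq J \<T> C \<longleftrightarrow> (\<forall>Ss xs. length Ss = length xs \<longrightarrow> set Ss \<subseteq> \<T> \<longrightarrow>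
      gauss_norm J (map2 (\<lambda>S x. S x) Ss xs) \<le> C * gauss_norm J xs)"

definition gamma_bounded :: "('a::banach \<Rightarrow> 'a) \<Rightarrow> ('a \<Rightarrow> 'a) set \<Rightarrow> bool" where
  "gamma_bounded J \<T> \<longleftrightarrow> (\<forall>S\<in>\<T>. cbounded_op J S) \<and> (\<exists>M. \<forall>S\<in>\<T>. onorm S \<le> M) \<and>
     (\<exists>C. gamma_ineq J \<T> C)"

definition gamma_const :: "('a::banach \<Rightarrow> 'a) \<Rightarrow> ('a \<Rightarrow> 'a) set \<Rightarrow> real" where
  "gamma_const J \<T> = Inf {C. 0 \<le> C \<and> gamma_ineq J \<T> C}"

definition fourier :: "(real \<Rightarrow> complex) \<Rightarrow> real \<Rightarrow> complex" where
  "fourier h u = integral\<^sup>L lborel (\<lambda>t. h t * exp (- \<i> * complex_of_real (t * u)))"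

definition H1 :: "(real \<Rightarrow> complex) set" where
  "H1 = {h. integrable lborel h \<and> (\<forall>u\<le>0. fourier h u = 0)}"

definition L1norm :: "(real \<Rightarrow> complex) \<Rightarrow> real" where
  "L1norm h = integral\<^sup>L lborel (\<lambda>t. cmod (h t))"

definition supnorm :: "(real \<Rightarrow> complex) \<Rightarrow> real" where
  "supnorm f = (SUP t. cmod (f t))"

definition C0R :: "(real \<Rightarrow> complex) set" where
  "C0R = {f. continuous_on UNIV f \<and> (f \<longlongrightarrow> 0) at_infinity}"

definition BUCR :: "(real \<Rightarrow> complex) set" where
  "BUCR = {f. uniformly_continuous_on UNIV f \<and> bounded (range f)}"

definition conv :: "(real \<Rightarrow> complex) \<Rightarrow> (real \<Rightarrow> complex) \<Rightarrow> real \<Rightarrow> complex" where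
  "conv f h s = integral\<^sup>L lborel (\<lambda>t. f (s - t) * h t)"

definition is_rep :: "(real \<Rightarrow> complex) set \<Rightarrow> (real \<Rightarrow> complex)
     \<Rightarrow> (nat \<Rightarrow> real \<Rightarrow> complex) \<Rightarrow> (nat \<Rightarrow> real \<Rightarrow> complex) \<Rightarrow> bool" where
  "is_rep S F f h \<longleftrightarrow> (\<forall>k. f k \<in> S \<and> h k \<in> H1) \<and>
     summable (\<lambda>k. supnorm (f k) * L1norm (h k)) \<and>
     (\<forall>s. F s = (\<Sum>k. conv (f k) (h k) s))"

text \<open>A_0(R) for S = C0R, A(R) for S = BUCR, with the projective norm.\<close>
definition Aspace :: "(real \<Rightarrow> complex) set \<Rightarrow> (real \<Rightarrow> complex) set" where
  "Aspace S = {F. \<exists>f h. is_rep S F f h}"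

definition Anorm :: "(real \<Rightarrow> complex) set \<Rightarrow> (real \<Rightarrow> complex) \<Rightarrow> real" where
  "Anorm S F = Inf {(\<Sum>k. supnorm (f k) * L1norm (h k)) | f h. is_rep S F f h}"

definition poisson :: "(real \<Rightarrow> complex) \<Rightarrow> complex \<Rightarrow> complex" where
  "poisson F w = integral\<^sup>L lborel
     (\<lambda>t. complex_of_real (Im w / ((Re w - t)\<^sup>2 + (Im w)\<^sup>2) / pi) * F t)"

definition tilde :: "(real \<Rightarrow> complex) \<Rightarrow> complex \<Rightarrow> complex" where
  "tilde F z = (if 0 < Re z then poisson F (\<i> * z) else 0)"

definition AspaceC :: "(real \<Rightarrow> complex) set \<Rightarrow> (complex \<Rightarrow> complex) set" where
  "AspaceC S = tilde ` Aspace S"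

definition AnormC :: "(real \<Rightarrow> complex) set \<Rightarrow> (complex \<Rightarrow> complex) \<Rightarrow> real" where
  "AnormC S G = Inf {Anorm S F | F. F \<in> Aspace S \<and> tilde F = G}"

definition laplace :: "(real \<Rightarrow> complex) \<Rightarrow> complex \<Rightarrow> complex" where
  "laplace b z = (if 0 < Re z then (LINT t:{0..}|lborel. exp (- complex_of_real t * z) * b t) else 0)"

definition bounded_hom :: "('a::banach \<Rightarrow> 'a) \<Rightarrow> (complex \<Rightarrow> complex) set
     \<Rightarrow> ((complex \<Rightarrow> complex) \<Rightarrow> real) \<Rightarrow> ((complex \<Rightarrow> complex) \<Rightarrow> 'a \<Rightarrow> 'a) \<Rightarrow> bool" where
  "bounded_hom J Z N \<rho> \<longleftrightarrow>
     (\<forall>F\<in>Z. cbounded_op J (\<rho> F)) \<and>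
     (\<forall>F\<in>Z. \<forall>G\<in>Z. \<rho> (\<lambda>z. F z + G z) = (\<lambda>x. \<rho> F x + \<rho> G x)) \<and>
     (\<forall>c. \<forall>F\<in>Z. \<rho> (\<lambda>z. c * F z) = (\<lambda>x. cscale J c (\<rho> F x))) \<and>
     (\<forall>F\<in>Z. \<forall>G\<in>Z. \<rho> (\<lambda>z. F z * G z) = \<rho> F \<circ> \<rho> G) \<and>
     (\<exists>C. \<forall>F\<in>Z. onorm (\<rho> F) \<le> C * N F)"

definition unit_ball :: "(complex \<Rightarrow> complex) set \<Rightarrow> ((complex \<Rightarrow> complex) \<Rightarrow> real)
     \<Rightarrow> (complex \<Rightarrow> complex) set" where
  "unit_ball Z N = {F\<in>Z. N F \<le> 1}"

definition gamma_bounded_map :: "('a::banach \<Rightarrow> 'a) \<Rightarrow> (complex \<Rightarrow> complex) set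
     \<Rightarrow> ((complex \<Rightarrow> complex) \<Rightarrow> real) \<Rightarrow> ((complex \<Rightarrow> complex) \<Rightarrow> 'a \<Rightarrow> 'a) \<Rightarrow> bool" where
  "gamma_bounded_map J Z N \<rho> \<longleftrightarrow> gamma_bounded J (\<rho> ` unit_ball Z N)"

definition gamma_map :: "('a::banach \<Rightarrow> 'a) \<Rightarrow> (complex \<Rightarrow> complex) set
     \<Rightarrow> ((complex \<Rightarrow> complex) \<Rightarrow> real) \<Rightarrow> ((complex \<Rightarrow> complex) \<Rightarrow> 'a \<Rightarrow> 'a) \<Rightarrow> real" where
  "gamma_map J Z N \<rho> = gamma_const J (\<rho> ` unit_ball Z N)"

text \<open>Property (ii): gamma-bounded homomorphism on A_0(C_+) with rho(L_b) = int_0^infty b(t) T_t dt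
  (strong integral, taken as the Henstock-Kurzweil integral of t |-> b(t) T_t x).\<close>
definition rho0_prop :: "('a::banach \<Rightarrow> 'a) \<Rightarrow> (real \<Rightarrow> 'a \<Rightarrow> 'a)
     \<Rightarrow> ((complex \<Rightarrow> complex) \<Rightarrow> 'a \<Rightarrow> 'a) \<Rightarrow> bool" where
  "rho0_prop J T \<rho> \<longleftrightarrow>
     bounded_hom J (AspaceC C0R) (AnormC C0R) \<rho> \<and>
     gamma_bounded_map J (AspaceC C0R) (AnormC C0R) \<rho> \<and>
     (\<forall>b. set_integrable lborel {0..} b \<longrightarrow>
        \<rho> (laplace b) = (\<lambda>x. integral {0..} (\<lambda>t. cscale J (b t) (T t x))))"

definition extends_on :: "(complex \<Rightarrow> complex) set \<Rightarrow> ((complex \<Rightarrow> complex) \<Rightarrow> 'a \<Rightarrow> 'a)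
     \<Rightarrow> ((complex \<Rightarrow> complex) \<Rightarrow> 'a \<Rightarrow> 'a) \<Rightarrow> bool" where
  "extends_on Z \<rho>' \<rho> \<longleftrightarrow> (\<forall>F\<in>Z. \<rho>' F = \<rho> F)"

end

theory Submission
 imports Defs "HOL-Complex_Analysis.Complex_Analysis" "HOL-Computational_Algebra.Fundamental_Theorem_Algebra"
begin

text \<open>For \<open>h \<in> H\<^sup>1\<close> the function \<open>f \<star> h\<close>, with \<open>f\<close> the inverse Fourier transform of an integrable
 \<open>\<phi>\<close>, is the transform of \<open>\<phi> \<cdot> fourier h\<close>, so the calculus must send it to the integral of \<open>\<phi>(u) (fourier h)(u) T\<^sub>u\<close>.
 These operators, over all \<open>\<bar>f\<bar> \<le> 1\<close> and \<open>h\<close> in the unit ball of \<open>H\<^sup>1\<close>, are gamma-bounded: after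
 discretisation a Fejer mean of \<open>h\<close> is an analytic polynomial, which Riesz factorisation writes as
 a product of two polynomials that are bounded by one in \<open>L\<^sup>2\<close>, and the operator becomes a Hankel
 form in \<open>T\<^sub>p T\<^sub>q\<close>. Unitary invariance of Gaussian sums makes all other factors contractive, and
 gamma-boundedness of the semigroup is used once for \<open>T\<^sub>p\<close> and once for \<open>T\<^sub>q\<close>, whence the square.

 Convexity extends the bound to transforms in the unit ball of \<open>\<A>\<^sub>0\<close>, and density defines
 \<open>\<rho>\<^sub>0\<close>. For the product inequality, substituting \<open>t + r\<close> for the second variable writes
 \<open>(f\<^sub>1 \<star> h\<^sub>1)(f\<^sub>2 \<star> h\<^sub>2)\<close> as the integral over \<open>r\<close> of \<open>k\<^sub>r \<star> m\<^sub>r\<close>, where \<open>k\<^sub>r(s) = f\<^sub>1(s) f\<^sub>2(s - r)\<close> and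
 \<open>m\<^sub>r(t) = h\<^sub>1(t) h\<^sub>2(t + r)\<close> is in \<open>H\<^sup>1\<close> for almost every \<open>r\<close>. So \<open>\<A>\<^sub>0\<close> is an ideal of \<open>\<A>\<close>. It
 has elements \<open>e\<^sub>t\<^sub>,\<^sub>n\<close> in its unit ball with \<open>\<rho>\<^sub>0(e\<^sub>t\<^sub>,\<^sub>n) \<rightarrow> T\<^sub>t\<close> strongly; this gives the lower estimate of
 \<open>\<gamma>(\<rho>\<^sub>0)\<close>, and at \<open>t = 0\<close> it forces \<open>\<rho>(F) = lim \<rho>\<^sub>0(F e\<^sub>0\<^sub>,\<^sub>n)\<close>.\<close>

text \<open>Factoring an \<open>H1\<close> function on the line into square-integrable factors is
  replaced by factoring polynomials, whose zeros can be treated one at a time. The price is a double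
  limit: a mesh \<open>1 / (k + 1)\<close>, and a period \<open>N\<close> that must exceed the
  degrees of the factors, over which \<open>k\<close> gives no control. In the Hankel form the first
  function enters only through samples of \<open>ift \<phi>\<close>, whose bound by one makes a
  diagonal matrix a contraction. A second obstacle lies between finite sums and the whole algebra.
  Its norm bounds the error of an approximation by \<open>ift b\<close> uniformly, whereas
  \<open>op\<close> is controlled at the outset only by the \<open>L1\<close> norm of the kernel.
  Damping by \<open>exp (- e * u)\<close> makes bounded kernels integrable; it is multiplicative for
  convolution and respects \<open>H1\<close>, so the estimate is proved for damped kernels and
  \<open>e\<close> then tends to zero. In the product formula the integral over \<open>r\<close> is
  not a series of elementary convolutions. Dyadic step functions in \<open>r\<close> make it one,
  and uniform continuity of the second function makes the successive corrections summable.\<close>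

abbreviation (input) L1 where "L1 \<equiv> integrable lborel"
abbreviation (input) cr where "cr \<equiv> complex_of_real"
abbreviation (input) seqlim (infix "---->" 60) where "f ----> l \<equiv> f \<longlonglongrightarrow> l"

lemmas measurable_contI = borel_measurable_continuous_onI
lemmas lborel_affine = lborel_integral_real_affine
lemmas bint_add = Bochner_Integration.integral_add
lemmas bint_cong = Bochner_Integration.integral_cong
lemmas bint_diff = Bochner_Integration.integral_diff
lemmas bint_nonneg = Bochner_Integration.integral_nonneg
lemmas bint_sum = Bochner_Integration.integral_sum
lemmas bint_zero = Bochner_Integration.integral_zero
lemmas bintble_add = Bochner_Integration.integrable_add
lemmas bintble_bound = Bochner_Integration.integrable_bound
lemmas bintble_cong = Bochner_Integration.integrable_cong
lemmas bintble_diff = Bochner_Integration.integrable_diff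
lemmas bintble_sum = Bochner_Integration.integrable_sum

section \<open>Complex Gaussian sums\<close>

text \<open>Variance 1/2 in each of the two real coordinates is what makes the second moment of the
  complex Gaussian equal to one.\<close>

lemma normal_density_sqrt_half: "normal_density 0 (1 / sqrt 2) x = exp (- x\<^sup>2) / sqrt pi"
 by (simp add: normal_density_def power_divide real_sqrt_divide)

lemma cgauss_eq:
 "cgauss = density lborel (\<lambda>z. \<Prod>b\<in>Basis. ennreal (normal_density 0 (1 / sqrt 2) (z \<bullet> b)))"
proof -
 have "ennreal (exp (- (cmod z)\<^sup>2) / pi)
   = (\<Prod>b\<in>Basis. ennreal (normal_density 0 (1 / sqrt 2) (z \<bullet> b)))" for z
 proof -
  have "ennreal (exp (- (cmod z)\<^sup>2) / pi)
    = ennreal (normal_density 0 (1 / sqrt 2) (Re z) * normal_density 0 (1 / sqrt 2) (Im z))"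
   unfolding normal_density_sqrt_half by (simp add: cmod_power2 exp_add[symmetric] field_simps flip: exp_diff)
  then show ?thesis by (simp add: Basis_complex_def inner_complex_def ennreal_mult)
 qed
 then show ?thesis unfolding cgauss_def by presburger
qed

lemma sets_cgauss [simp, measurable_cong]: "sets cgauss = sets borel" by (simp add: cgauss_def)

lemma space_cgauss [simp]: "space cgauss = UNIV" by (simp add: cgauss_def)

lemma nn_integral_normal_density_half:
 "(\<integral>\<^sup>+x. ennreal (normal_density 0 (1 / sqrt 2) x) \<partial>lborel) = 1"
 using nn_integral_eq_integral[OF integrable_normal_density[of "1 / sqrt 2" 0]]
  integral_normal_density[of "1 / sqrt 2" 0] by simp

lemma prob_space_cgauss: "prob_space cgauss"
proof
 have "emeasure cgauss UNIV
   = (\<integral>\<^sup>+z. (\<Prod>b\<in>Basis. ennreal (normal_density 0 (1 / sqrt 2) (z \<bullet> b))) \<partial>(lborel :: complex measure))"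
  unfolding cgauss_eq by (subst emeasure_density) auto
 also have "... = 1" by (subst nn_integral_lborel_prod) (auto simp: nn_integral_normal_density_half)
 finally show "emeasure cgauss (space cgauss) = 1" by simp
qed

interpretation cgauss: prob_space cgauss by (rule prob_space_cgauss)

lemma cgauss_second_moment: "has_bochner_integral cgauss (\<lambda>z. (cmod z)^2) 1"
proof (rule has_bochner_integral_nn_integral)
 let ?d = "normal_density 0 (1 / sqrt 2)"
 have sq: "(\<integral>\<^sup>+x. ennreal (x^2 * ?d x) \<partial>lborel) = ennreal (1/2)"
 proof -
  have "has_bochner_integral lborel (\<lambda>x. ?d x * x^2) (1/2)"
   using normal_moment_even[of "1 / sqrt 2" 0 1] by (simp add: power_divide)
  then have "has_bochner_integral lborel (\<lambda>x. x^2 * ?d x) (1/2)" by (simp add: mult.commute)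
  then have "L1 (\<lambda>x. x^2 * ?d x)" "(LBINT x. x^2 * ?d x) = 1/2"
   unfolding has_bochner_integral_iff by blast+
  then show ?thesis using nn_integral_eq_integral[of lborel "\<lambda>x. x^2 * ?d x"] by (simp only:) simp
 qed
 \<comment> \<open>The square of a single coordinate is absorbed into the product density, so that
   the integral factors and only one factor differs from one.\<close>
 have *: "(\<integral>\<^sup>+z. (\<Prod>b\<in>Basis. ennreal ((if b = b0 then (z \<bullet> b)\<^sup>2 else 1) * ?d (z \<bullet> b)))
   \<partial>(lborel :: complex measure)) = ennreal (1/2)" if "b0 \<in> Basis" for b0
 proof -
  have "(\<integral>\<^sup>+x. ennreal ((if b = b0 then x\<^sup>2 else 1) * ?d x) \<partial>lborel)
    = (if b = b0 then ennreal (1/2) else 1)" for b :: complex using sq nn_integral_normal_density_half by auto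
  then show ?thesis using that by (subst nn_integral_lborel_prod) (auto simp: prod.delta)
 qed
 have "(\<integral>\<^sup>+z. ennreal ((cmod z)^2) \<partial>cgauss)
   = (\<integral>\<^sup>+z. (\<Prod>b\<in>Basis. ennreal (?d (z \<bullet> b))) * ennreal ((cmod z)^2) \<partial>lborel)"
  unfolding cgauss_eq by (subst nn_integral_density) auto
 also have "... = (\<integral>\<^sup>+z. (\<Prod>b\<in>Basis. ennreal ((if b = 1 then (z \<bullet> b)\<^sup>2 else 1) * ?d (z \<bullet> b)))
   + (\<Prod>b\<in>Basis. ennreal ((if b = \<i> then (z \<bullet> b)\<^sup>2 else 1) * ?d (z \<bullet> b))) \<partial>lborel)"
  by (rule nn_integral_cong)
   (simp add: Basis_complex_def inner_complex_def cmod_power2 flip: ennreal_mult ennreal_plus,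
   simp add: algebra_simps)
 also have "... = ennreal (1/2) + ennreal (1/2)" by (subst nn_integral_add, measurable)
   (subst *, simp add: Basis_complex_def, subst *, simp_all add: Basis_complex_def)
 also have "... = ennreal 1" by (subst ennreal_plus[symmetric]) auto
 finally show "(\<integral>\<^sup>+z. ennreal ((cmod z)^2) \<partial>cgauss) = ennreal 1" .
qed auto

section \<open>Complex scalar multiplication on the Banach space\<close>

locale cstruct =
 fixes J :: "'a::banach => 'a"
 assumes complex_structure: "complex_structure J"
begin

abbreviation cs :: "complex => 'a => 'a" (infixr "*\<^sub>J" 75) where
 "c *\<^sub>J x \<equiv> cscale J c x"

lemma norm_cs [simp]: "norm (c *\<^sub>J x) = cmod c * norm x"
 using complex_structure by (simp add: complex_structure_def)

lemma linear_J: "linear J" and J_J [simp]: "J (J x) = - x"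
 using complex_structure by (auto simp: complex_structure_def)

lemma norm_J [simp]: "norm (J x) = norm x" using norm_cs[of \<i> x] by (simp add: cscale_def)

lemma bounded_linear_J: "bounded_linear J"
 using linear_J by (intro linear_conv_bounded_linear[THEN iffD1] bounded_linear_intro[of J 1])
  (auto simp: linear_add linear_cmul)

sublocale J: bounded_linear J by (rule bounded_linear_J)

sublocale C: vector_space "cscale J" by standard (simp_all add: cscale_def J.add J.scaleR J.neg algebra_simps)

lemma cs_of_real [simp]: "cr r *\<^sub>J x = r *\<^sub>R x" by (simp add: cscale_def)

lemma J_cs: "J (c *\<^sub>J x) = c *\<^sub>J J x" by (simp add: cscale_def J.add J.scaleR)

lemma cs_scaleR: "c *\<^sub>J (r *\<^sub>R x) = (c * of_real r) *\<^sub>J x"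
 by (simp add: cscale_def J.scaleR algebra_simps)

lemma bounded_bilinear_cs: "bounded_bilinear (cscale J)"
proof
 show "\<exists>K. \<forall>a b. norm (a *\<^sub>J b) <= norm a * norm b * K" by (intro exI[of _ 1]) simp
qed (auto simp: C.scale_left_distrib C.scale_right_distrib,
 auto simp: cscale_def J.scaleR algebra_simps)

sublocale B: bounded_bilinear "cscale J" by (rule bounded_bilinear_cs)

lemma continuous_on_cs [continuous_intros]:
 "continuous_on S f ==> continuous_on S g ==> continuous_on S (\<lambda>t. f t *\<^sub>J g t)"
 by (rule B.continuous_on)

lemma cbounded_op_cs: "cbounded_op J S ==> S (c *\<^sub>J x) = c *\<^sub>J S x"
 by (auto simp: cbounded_op_def cscale_def linear_simps)

end

text \<open>The squared norm, over any finite index set instead of a list: product index sets carry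
  the matrix arguments, and the square is what convexity and dominated convergence act on.\<close>

definition gam2 :: "('a::banach => 'a) => 'i set => ('i => 'a) => real" where
 "gam2 J I x = integral\<^sup>L (PiM I (\<lambda>_. cgauss)) (\<lambda>\<omega>. (norm (\<Sum>i\<in>I. cscale J (\<omega> i) (x i)))^2)"

lemma gauss_norm_gam2: "gauss_norm J xs = sqrt (gam2 J {..<length xs} ((!) xs))"
 by (simp add: gauss_norm_def gam2_def)

lemma gam2_nonneg: "0 <= gam2 J I x" by (simp add: gam2_def)

lemma gam2_cong: "(\<And>i. i \<in> I ==> x i = y i) ==> gam2 J I x = gam2 J I y"
 by (simp add: gam2_def cong: sum.cong)

text \<open>With countably many coordinates the Borel sets of the product topology are generated by
  the coordinate maps; coordinates outside \<open>I\<close> are constantly \<open>undefined\<close>,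
  hence measurable too. Continuous functions of the Gaussian vector thereby become measurable, which
  is the reason for the \<open>countable\<close> index types below.\<close>

lemma measurable_PiM_to_borel:
 assumes "\<And>i. sets (M i) = sets (borel :: complex measure)"
 shows "(\<lambda>\<omega>. \<omega>) \<in> PiM I M \<rightarrow>\<^sub>M (borel :: ('i::countable => complex) measure)"
proof (rule measurable_coordinatewise_then_product)
 fix i
 show "(\<lambda>\<omega>. \<omega> i) \<in> borel_measurable (PiM I M)"
 proof (cases "i \<in> I")
  case True
  then show ?thesis using measurable_component_singleton[of i I M] assms measurable_cong_sets by blast
 next
  case False
  then have "\<And>\<omega>. \<omega> \<in> space (PiM I M) ==> \<omega> i = undefined"
   by (auto simp: space_PiM PiE_def extensional_def)
  then show ?thesis
   using measurable_cong[of "PiM I M" "\<lambda>\<omega>. \<omega> i" "\<lambda>_. undefined" borel] by simp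
 qed
qed

section \<open>Integrability, limits and reindexing of Gaussian sums\<close>

context cstruct
begin

lemma measurable_gauss_sum [measurable]:
 fixes x :: "'i::countable => 'a"
 shows "(\<lambda>\<omega>. norm (\<Sum>i\<in>I. \<omega> i *\<^sub>J x i)) \<in> borel_measurable (PiM I (\<lambda>_. cgauss))"
proof -
 have "continuous_on UNIV (\<lambda>\<omega> :: 'i => complex. norm (\<Sum>i\<in>I. \<omega> i *\<^sub>J x i))"
  by (intro continuous_intros continuous_on_product_coordinates)
 then show ?thesis
  using measurable_compose[OF measurable_PiM_to_borel[of "\<lambda>_. cgauss" I] measurable_contI] by simp
qed

lemma integrable_cmod_sq_component:
 assumes "i \<in> I"
 shows "integrable (PiM I (\<lambda>_. cgauss)) (\<lambda>\<omega>. (cmod (\<omega> i))^2)"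
proof -
 have "integrable (distr (PiM I (\<lambda>_. cgauss)) cgauss (\<lambda>\<omega>. \<omega> i)) (\<lambda>z. (cmod z)^2)"
  using cgauss_second_moment
  by (subst distr_PiM_component) (auto simp: assms prob_space_cgauss has_bochner_integral_iff)
 then show ?thesis using assms by (subst (asm) integrable_distr_eq) auto
qed

text \<open>By Cauchy-Schwarz. The majorant sees the vectors only through their norms, so one
  function dominates a whole convergent sequence.\<close>

lemma gauss_sum_bound:
 "(norm (\<Sum>i\<in>I. \<omega> i *\<^sub>J x i))^2 <= (\<Sum>i\<in>I. (cmod (\<omega> i))^2 * (norm (x i))^2) * real (card I)"
proof -
 have "(norm (\<Sum>i\<in>I. \<omega> i *\<^sub>J x i))^2 <= (\<Sum>i\<in>I. cmod (\<omega> i) * norm (x i))^2"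
  by (intro power_mono order_trans[OF norm_sum]) auto
 also have "... <= (\<Sum>i\<in>I. (cmod (\<omega> i) * norm (x i))^2) * real (card I)"
  by (rule sum_squared_le_sum_of_squares)
 finally show ?thesis by (simp add: power_mult_distrib)
qed

lemma integrable_gauss_sum:
 fixes x :: "'i::countable => 'a"
 assumes "finite I"
 shows "integrable (PiM I (\<lambda>_. cgauss)) (\<lambda>\<omega>. (norm (\<Sum>i\<in>I. \<omega> i *\<^sub>J x i))^2)"
proof (rule bintble_bound)
 show "integrable (PiM I (\<lambda>_. cgauss))
   (\<lambda>\<omega>. (\<Sum>i\<in>I. (cmod (\<omega> i))^2 * (norm (x i))^2) * real (card I))"
  by (intro integrable_mult_left bintble_sum integrable_cmod_sq_component)
 show "AE \<omega> in PiM I (\<lambda>_. cgauss). norm ((norm (\<Sum>i\<in>I. \<omega> i *\<^sub>J x i))^2)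
   <= norm ((\<Sum>i\<in>I. (cmod (\<omega> i))^2 * (norm (x i))^2) * real (card I))"
  by (intro AE_I2) (use gauss_sum_bound in \<open>force simp: sum_nonneg\<close>)
qed measurable

text \<open>Through this continuity an estimate for approximating operators passes to their strong
  limits with the same constant.\<close>

lemma gam2_tendsto:
 fixes x :: "nat => 'i::countable => 'a"
 assumes fin: "finite I" and lim: "\<And>i. i \<in> I ==> (\<lambda>n. x n i) ----> y i"
 shows "(\<lambda>n. gam2 J I (x n)) ----> gam2 J I y"
proof -
 have "\<exists>B. \<forall>n. norm (x n i) <= B" if "i \<in> I" for i
  using convergent_imp_Bseq[OF convergentI[OF lim[OF that]]] by (auto simp: Bseq_def)
 then obtain B where B: "\<And>i n. i \<in> I ==> norm (x n i) <= B i" by metis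
 show ?thesis unfolding gam2_def
 proof (rule integral_dominated_convergence)
  show "integrable (PiM I (\<lambda>_. cgauss))
    (\<lambda>\<omega>. (\<Sum>i\<in>I. (cmod (\<omega> i))^2 * (B i)^2) * real (card I))"
   by (intro integrable_mult_left bintble_sum integrable_cmod_sq_component)
  show "AE \<omega> in PiM I (\<lambda>_. cgauss). (\<lambda>n. (norm (\<Sum>i\<in>I. \<omega> i *\<^sub>J x n i))^2)
    ----> (norm (\<Sum>i\<in>I. \<omega> i *\<^sub>J y i))^2"
   by (intro AE_I2 tendsto_intros B.tendsto lim) auto
  show "AE \<omega> in PiM I (\<lambda>_. cgauss). norm ((norm (\<Sum>i\<in>I. \<omega> i *\<^sub>J x n i))^2)
    <= (\<Sum>i\<in>I. (cmod (\<omega> i))^2 * (B i)^2) * real (card I)" for n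
  proof (rule AE_I2)
   fix \<omega>
   have "(\<Sum>i\<in>I. (cmod (\<omega> i))^2 * (norm (x n i))^2) <= (\<Sum>i\<in>I. (cmod (\<omega> i))^2 * (B i)^2)"
    by (intro sum_mono mult_left_mono power_mono B) auto
   then show "norm ((norm (\<Sum>i\<in>I. \<omega> i *\<^sub>J x n i))^2)
     <= (\<Sum>i\<in>I. (cmod (\<omega> i))^2 * (B i)^2) * real (card I)"
    using order_trans[OF gauss_sum_bound[of \<omega> "x n" I] mult_right_mono] by simp
  qed
 qed auto
qed

lemma gam2_convex:
 fixes x :: "'l => 'i::countable => 'a"
 assumes "finite I" "finite L" "\<And>l. l \<in> L ==> 0 <= a l" "sum a L = 1"
 shows "gam2 J I (\<lambda>i. \<Sum>l\<in>L. a l *\<^sub>R x l i) <= (\<Sum>l\<in>L. a l * gam2 J I (x l))"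
proof -
 have "gam2 J I (\<lambda>i. \<Sum>l\<in>L. a l *\<^sub>R x l i) <= integral\<^sup>L (PiM I (\<lambda>_. cgauss))
   (\<lambda>\<omega>. \<Sum>l\<in>L. a l * (norm (\<Sum>i\<in>I. \<omega> i *\<^sub>J x l i))^2)"
  unfolding gam2_def
 proof (rule integral_mono)
  fix \<omega>
  have "norm (\<Sum>i\<in>I. \<omega> i *\<^sub>J (\<Sum>l\<in>L. a l *\<^sub>R x l i)) = norm (\<Sum>l\<in>L. a l *\<^sub>R (\<Sum>i\<in>I. \<omega> i *\<^sub>J x l i))"
   by (simp add: C.scale_sum_right scaleR_sum_right B.scaleR_right)
    (subst sum.swap, rule refl)
  also have "... <= (\<Sum>l\<in>L. a l * norm (\<Sum>i\<in>I. \<omega> i *\<^sub>J x l i))"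
   by (rule order_trans[OF norm_sum]) (auto intro!: sum_mono simp: assms(3))
  finally have "(norm (\<Sum>i\<in>I. \<omega> i *\<^sub>J (\<Sum>l\<in>L. a l *\<^sub>R x l i)))^2
    <= (\<Sum>l\<in>L. a l * norm (\<Sum>i\<in>I. \<omega> i *\<^sub>J x l i))^2" by (rule power_mono) simp
  also have "... <= (\<Sum>l\<in>L. a l * (norm (\<Sum>i\<in>I. \<omega> i *\<^sub>J x l i))^2)"
   using convex_on_sum[OF \<open>finite L\<close> _ convex_power2, of a "\<lambda>l. norm (\<Sum>i\<in>I. \<omega> i *\<^sub>J x l i)"] assms
   by fastforce
  finally show "(norm (\<Sum>i\<in>I. \<omega> i *\<^sub>J (\<Sum>l\<in>L. a l *\<^sub>R x l i)))^2
    <= (\<Sum>l\<in>L. a l * (norm (\<Sum>i\<in>I. \<omega> i *\<^sub>J x l i))^2)" .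
 qed (auto intro!: bintble_sum integrable_mult_right integrable_gauss_sum assms)
 also have "... = (\<Sum>l\<in>L. a l * gam2 J I (x l))"
  unfolding gam2_def using integrable_gauss_sum[OF \<open>finite I\<close>] by simp
 finally show ?thesis .
qed

lemma gam2_scaleR: "gam2 J I (\<lambda>i. r *\<^sub>R x i) = r^2 * gam2 J I x" unfolding gam2_def
 by (simp add: B.scaleR_right power_mult_distrib flip: scaleR_sum_right)

lemma gam2_singleton:
 fixes x :: "'i::countable => 'a"
 shows "gam2 J {i} x = (norm (x i))^2"
proof -
 have "gam2 J {i} x = (norm (x i))^2 * integral\<^sup>L (PiM {i} (\<lambda>_. cgauss)) (\<lambda>\<omega>. (cmod (\<omega> i))^2)"
  by (simp add: gam2_def power_mult_distrib mult.commute)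
 also have "integral\<^sup>L (PiM {i} (\<lambda>_. cgauss)) (\<lambda>\<omega>. (cmod (\<omega> i))^2)
   = integral\<^sup>L (distr (PiM {i} (\<lambda>_. cgauss)) cgauss (\<lambda>\<omega>. \<omega> i)) (\<lambda>z. (cmod z)^2)"
  by (subst integral_distr) auto
 also have "... = 1" using cgauss_second_moment by (subst distr_PiM_component)
   (auto simp: prob_space_cgauss has_bochner_integral_iff)
 finally show ?thesis by simp
qed

text \<open>A marginal of the product measure is again a product measure, so renaming indices and
  dropping zero vectors cost nothing.\<close>

lemma gam2_embed:
 fixes x :: "'k::countable => 'a" and f :: "'i::countable => 'k"
 assumes fin: "finite K" and f: "inj_on f I" "f ` I \<subseteq> K" and 0: "\<And>k. k \<in> K - f ` I ==> x k = 0"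
 shows "gam2 J K x = gam2 J I (x \<circ> f)"
proof -
 have finI: "finite I" using f fin by (meson finite_imageD finite_subset)
 let ?t = "\<lambda>\<omega>. \<lambda>n\<in>I. \<omega> (f n)"
 have d: "distr (PiM K (\<lambda>_. cgauss)) (PiM I (\<lambda>_. cgauss)) ?t = PiM I (\<lambda>_. cgauss)"
  using distr_PiM_reindex[of K "\<lambda>_. cgauss" f I] f prob_space_cgauss by auto
 have "gam2 J I (x \<circ> f) = integral\<^sup>L (distr (PiM K (\<lambda>_. cgauss)) (PiM I (\<lambda>_. cgauss)) ?t)
   (\<lambda>\<omega>. (norm (\<Sum>i\<in>I. \<omega> i *\<^sub>J x (f i)))^2)" unfolding gam2_def d by simp
 also have "... = integral\<^sup>L (PiM K (\<lambda>_. cgauss)) (\<lambda>\<omega>. (norm (\<Sum>i\<in>I. ?t \<omega> i *\<^sub>J x (f i)))^2)"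
  by (rule integral_distr) (use f in \<open>auto intro!: measurable_restrict measurable_component_singleton\<close>)
 also have "... = gam2 J K x"
 proof -
  have "(\<Sum>i\<in>I. ?t \<omega> i *\<^sub>J x (f i)) = (\<Sum>k\<in>K. \<omega> k *\<^sub>J x k)" for \<omega>
  proof -
   have "(\<Sum>i\<in>I. ?t \<omega> i *\<^sub>J x (f i)) = (\<Sum>k\<in>f ` I. \<omega> k *\<^sub>J x k)"
    by (simp add: sum.reindex[OF f(1)])
   also have "... = (\<Sum>k\<in>K. \<omega> k *\<^sub>J x k)"
    using f fin 0 by (intro sum.mono_neutral_left) auto
   finally show ?thesis .
  qed
  then show ?thesis by (simp add: gam2_def)
 qed
 finally show ?thesis by simp
qed

end

subsection \<open>Unitary invariance\<close>

text \<open>Both orthogonality relations belong to the definition, so that the transpose of a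
  unitary matrix is unitary by symmetry.\<close>

definition unitary_on :: "'i set => ('i => 'i => complex) => bool" where
 "unitary_on P U \<longleftrightarrow>
  (\<forall>p\<in>P. \<forall>p'\<in>P. (\<Sum>q\<in>P. cnj (U q p) * U q p') = (if p = p' then 1 else 0)) \<and>
  (\<forall>p\<in>P. \<forall>p'\<in>P. (\<Sum>q\<in>P. U p q * cnj (U p' q)) = (if p = p' then 1 else 0))"

lemma PiM_lborel_translate:
 fixes a :: "'i => complex"
 assumes fin: "finite I" and f: "f \<in> borel_measurable (PiM I (\<lambda>_. lborel))"
 shows "(\<integral>\<^sup>+\<omega>. f (\<lambda>i\<in>I. \<omega> i + a i) \<partial>PiM I (\<lambda>_. lborel)) = (\<integral>\<^sup>+\<omega>. f \<omega> \<partial>PiM I (\<lambda>_. lborel))"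
proof -
 interpret product_sigma_finite "\<lambda>_ :: 'i. lborel :: complex measure" by standard
 let ?L = "PiM I (\<lambda>_. lborel :: complex measure)" and ?t = "\<lambda>\<omega>. \<lambda>i\<in>I. \<omega> i + a i"
 have m: "?t \<in> ?L \<rightarrow>\<^sub>M ?L" by (intro measurable_restrict) measurable
 have "distr ?L ?L ?t = ?L"
 proof (rule PiM_eqI[OF fin])
  fix A :: "'i => complex set" assume A: "\<And>i. i \<in> I ==> A i \<in> sets lborel"
  have [measurable]: "i \<in> I ==> (+) (a i) -` A i \<in> sets borel" for i
   using measurable_sets_borel[of "(+) (a i)" borel "A i"] A by auto
  have "?t -` Pi\<^sub>E I A \<inter> space ?L = Pi\<^sub>E I (\<lambda>i. (+) (a i) -` A i)"
   by (auto simp: space_PiM PiE_def Pi_def add.commute)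
  then have "emeasure (distr ?L ?L ?t) (Pi\<^sub>E I A) = emeasure ?L (Pi\<^sub>E I (\<lambda>i. (+) (a i) -` A i))"
   using A fin by (subst emeasure_distr[OF m]) (auto intro!: sets_PiM_I_finite)
  also have "... = (\<Prod>i\<in>I. emeasure lborel ((+) (a i) -` A i))"
   using fin by (subst emeasure_PiM) auto
  also have "... = (\<Prod>i\<in>I. emeasure lborel (A i))"
  proof (rule prod.cong[OF refl])
   fix i assume "i \<in> I"
   have "emeasure lborel (A i) = emeasure (distr lborel borel ((+) (a i))) (A i)"
    by (subst lborel_distr_plus) (rule refl)
   then show "emeasure lborel ((+) (a i) -` A i) = emeasure lborel (A i)"
    using A[OF \<open>i \<in> I\<close>] by (simp add: emeasure_distr)
  qed
  finally show "emeasure (distr ?L ?L ?t) (Pi\<^sub>E I A) = (\<Prod>i\<in>I. emeasure lborel (A i))" .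
 qed simp
 then show ?thesis using nn_integral_distr[OF m, of f] f by simp
qed

text \<open>Lebesgue measure is, up to a factor, the only translation invariant measure; the factor
 is found by comparing the measures of the unit ball.\<close>

lemma PiM_lborel_isometry:
 fixes V :: "('i => complex) => 'i => complex"
 defines "L \<equiv> \<lambda>I. PiM I (\<lambda>_ :: 'i. lborel :: complex measure)"
 assumes fin: "finite I" and V: "V \<in> L I \<rightarrow>\<^sub>M L I"
  and add: "\<And>x y. V (\<lambda>i\<in>I. x i + y i) = (\<lambda>i\<in>I. V x i + V y i)"
  and surj: "\<And>y. y \<in> space (L I) ==> \<exists>x. V x = y"
  and iso: "\<And>x. x \<in> space (L I) ==> (\<Sum>i\<in>I. (cmod (V x i))^2) = (\<Sum>i\<in>I. (cmod (x i))^2)"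
  and f: "f \<in> borel_measurable (L I)"
 shows "(\<integral>\<^sup>+x. f (V x) \<partial>L I) = (\<integral>\<^sup>+x. f x \<partial>L I)"
proof -
 interpret product_sigma_finite "\<lambda>_ :: 'i. lborel :: complex measure" by standard
 interpret sigma_finite_measure "L I" unfolding L_def by (rule sigma_finite[OF fin])
 interpret P: pair_sigma_finite "L I" "L I" ..
 define b :: "('i => complex) => ennreal" where "b x = (if (\<Sum>i\<in>I. (cmod (x i))^2) < 1 then 1 else 0)" for x
 define c where "c = (\<integral>\<^sup>+y. f (\<lambda>i\<in>I. - y i) \<partial>L I)"
 have comp [measurable]: "i \<in> I ==> (\<lambda>x. x i) \<in> borel_measurable (L I)" for i
  unfolding L_def by measurable
 have restr: "(\<lambda>x. \<lambda>i\<in>I. g x i) \<in> M \<rightarrow>\<^sub>M L I"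
  if "\<And>i. i \<in> I ==> (\<lambda>x. g x i) \<in> borel_measurable M" for M :: "'m measure" and g
  unfolding L_def using that by (intro measurable_restrict) simp
 have b [measurable]: "b \<in> borel_measurable (L I)" unfolding b_def by measurable
 note f [measurable]
 have tr: "(\<integral>\<^sup>+x. g (\<lambda>i\<in>I. x i + a i) \<partial>L I) = (\<integral>\<^sup>+x. g x \<partial>L I)"
  if "g \<in> borel_measurable (L I)" for g and a :: "'i => complex"
  using PiM_lborel_translate[OF fin, of g a] that unfolding L_def .
 have spaceD: "(\<lambda>i\<in>I. x i) = x" if "x \<in> space (L I)" for x
  using that unfolding L_def by (auto simp: space_PiM PiE_restrict)
 \<comment> \<open>Uniqueness of an invariant measure by Fubini: translate \<open>y\<close> by
   \<open>W x\<close>, then \<open>x\<close> by a preimage of \<open>- y\<close>, and finally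
   \<open>y\<close> once more. What remains is \<open>c\<close> times the volume of the ball, which
   does not depend on \<open>W\<close>; so \<open>V\<close> and the identity give the same
   value.\<close>
 have key: "(\<integral>\<^sup>+x. f (W x) \<partial>L I) * (\<integral>\<^sup>+x. b x \<partial>L I) = c * (\<integral>\<^sup>+x. b x \<partial>L I)"
  if W [measurable]: "W \<in> L I \<rightarrow>\<^sub>M L I" and Wadd: "\<And>x y. W (\<lambda>i\<in>I. x i + y i) = (\<lambda>i\<in>I. W x i + W y i)"
   and Wsurj: "\<And>y. y \<in> space (L I) ==> \<exists>x. W x = y"
   and Wiso: "\<And>x. x \<in> space (L I) ==> b (W x) = b x" for W
 proof -
  have Wsp: "W x \<in> space (L I)" if "x \<in> space (L I)" for x using measurable_space[OF W that] .
  have Wc [measurable]: "(\<lambda>x. W x i) \<in> borel_measurable (L I)" if "i \<in> I" for i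
   using measurable_compose[OF W comp[OF that]] .
  have m1 [measurable]: "(\<lambda>p. \<lambda>i\<in>I. snd p i + W (fst p) i) \<in> L I \<Otimes>\<^sub>M L I \<rightarrow>\<^sub>M L I"
   by (rule restr) measurable
  have m2 [measurable]: "(\<lambda>p. \<lambda>i\<in>I. W (fst p) i - snd p i) \<in> L I \<Otimes>\<^sub>M L I \<rightarrow>\<^sub>M L I"
   by (rule restr) measurable
  have "(\<integral>\<^sup>+x. f (W x) \<partial>L I) * (\<integral>\<^sup>+x. b x \<partial>L I) = (\<integral>\<^sup>+x. \<integral>\<^sup>+y. f (W x) * b y \<partial>L I \<partial>L I)"
   by (simp add: nn_integral_multc nn_integral_cmult)
  also have "... = (\<integral>\<^sup>+x. \<integral>\<^sup>+y. f (W x) * b (\<lambda>i\<in>I. y i + W x i) \<partial>L I \<partial>L I)"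
  proof (rule nn_integral_cong)
   show "(\<integral>\<^sup>+y. f (W x) * b y \<partial>L I) = (\<integral>\<^sup>+y. f (W x) * b (\<lambda>i\<in>I. y i + W x i) \<partial>L I)" for x
    using tr[of "\<lambda>y. f (W x) * b y" "W x"] by simp
  qed
  also have "... = (\<integral>\<^sup>+y. \<integral>\<^sup>+x. f (W x) * b (\<lambda>i\<in>I. y i + W x i) \<partial>L I \<partial>L I)"
   using P.Fubini'[of "\<lambda>x y. f (W x) * b (\<lambda>i\<in>I. y i + W x i)"]
    measurable_compose[OF m1 b] by (simp add: case_prod_beta')
  also have "... = (\<integral>\<^sup>+y. \<integral>\<^sup>+x. f (\<lambda>i\<in>I. W x i - y i) * b (W x) \<partial>L I \<partial>L I)"
  proof (rule nn_integral_cong)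
   fix y assume y: "y \<in> space (L I)"
   obtain a where a: "W a = (\<lambda>i\<in>I. - y i)"
    using Wsurj[of "\<lambda>i\<in>I. - y i"] by (auto simp: L_def space_PiM)
   have "(\<lambda>x. f (W x) * b (\<lambda>i\<in>I. y i + W x i)) \<in> borel_measurable (L I)"
   proof -
    have "(\<lambda>x. \<lambda>i\<in>I. y i + W x i) \<in> L I \<rightarrow>\<^sub>M L I" by (rule restr) measurable
    from measurable_compose[OF this b] show ?thesis by measurable
   qed
   from tr[OF this, of a, symmetric]
   have "(\<integral>\<^sup>+x. f (W x) * b (\<lambda>i\<in>I. y i + W x i) \<partial>L I)
     = (\<integral>\<^sup>+x. f (\<lambda>i\<in>I. W x i - y i) * b (\<lambda>i\<in>I. W x i) \<partial>L I)"
    by (simp add: Wadd a cong: restrict_cong)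
   also have "... = (\<integral>\<^sup>+x. f (\<lambda>i\<in>I. W x i - y i) * b (W x) \<partial>L I)"
    by (intro nn_integral_cong) (simp add: spaceD Wsp)
   finally show "(\<integral>\<^sup>+x. f (W x) * b (\<lambda>i\<in>I. y i + W x i) \<partial>L I)
     = (\<integral>\<^sup>+x. f (\<lambda>i\<in>I. W x i - y i) * b (W x) \<partial>L I)" .
  qed
  also have "... = (\<integral>\<^sup>+x. \<integral>\<^sup>+y. f (\<lambda>i\<in>I. W x i - y i) * b (W x) \<partial>L I \<partial>L I)"
   using P.Fubini'[of "\<lambda>x y. f (\<lambda>i\<in>I. W x i - y i) * b (W x)"]
    measurable_compose[OF m2 f] by (simp add: case_prod_beta')
  also have "... = (\<integral>\<^sup>+x. c * b x \<partial>L I)"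
  proof (rule nn_integral_cong)
   fix x assume x: "x \<in> space (L I)"
   have mx: "(\<lambda>y. f (\<lambda>i\<in>I. W x i - y i)) \<in> borel_measurable (L I)"
   proof -
    have "(\<lambda>y. \<lambda>i\<in>I. W x i - y i) \<in> L I \<rightarrow>\<^sub>M L I" by (rule restr) measurable
    from measurable_compose[OF this f] show ?thesis .
   qed
   have "(\<integral>\<^sup>+y. f (\<lambda>i\<in>I. W x i - y i) \<partial>L I) = c"
    using tr[OF mx, of "W x", symmetric] by (simp add: c_def cong: restrict_cong)
   then show "(\<integral>\<^sup>+y. f (\<lambda>i\<in>I. W x i - y i) * b (W x) \<partial>L I) = c * b x"
    using mx by (simp add: nn_integral_multc Wiso[OF x])
  qed
  also have "... = c * (\<integral>\<^sup>+x. b x \<partial>L I)" by (simp add: nn_integral_cmult)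
  finally show ?thesis .
 qed
 have "(\<integral>\<^sup>+x. f (V x) \<partial>L I) * (\<integral>\<^sup>+x. b x \<partial>L I) = c * (\<integral>\<^sup>+x. b x \<partial>L I)"
  using V surj by (intro key add) (auto simp: b_def iso)
 moreover have "(\<integral>\<^sup>+x. f (\<lambda>i\<in>I. x i) \<partial>L I) * (\<integral>\<^sup>+x. b x \<partial>L I) = c * (\<integral>\<^sup>+x. b x \<partial>L I)"
  by (rule key, rule restr) (auto simp: spaceD intro!: exI spaceD)
 moreover have "(\<integral>\<^sup>+x. f (\<lambda>i\<in>I. x i) \<partial>L I) = (\<integral>\<^sup>+x. f x \<partial>L I)"
  by (intro nn_integral_cong) (simp add: spaceD)
 ultimately have eq: "(\<integral>\<^sup>+x. f (V x) \<partial>L I) * (\<integral>\<^sup>+x. b x \<partial>L I) = (\<integral>\<^sup>+x. f x \<partial>L I) * (\<integral>\<^sup>+x. b x \<partial>L I)"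
  by simp
 have ball: "0 < emeasure lborel (ball (0 :: complex) r)" if "0 < r" for r
  using that by (simp add: emeasure_ball ennreal_zero_less_mult_iff zero_less_power)
 \<comment> \<open>The volume of the ball must be neither zero nor infinite before it can be
   cancelled. A polydisc of this radius lies inside the ball, and the polydisc of radius one
   contains it.\<close>
 define r where "r = 1 / sqrt (real (card I) + 1)"
 have r: "0 < r" "real (card I) * r^2 < 1" by (auto simp: r_def power_divide divide_simps)
 have "(\<integral>\<^sup>+x. b x \<partial>L I) \<noteq> 0"
 proof -
  have "emeasure (L I) (Pi\<^sub>E I (\<lambda>_. ball 0 r)) = (\<integral>\<^sup>+x. indicator (Pi\<^sub>E I (\<lambda>_. ball 0 r)) x \<partial>L I)"
   using fin by (subst nn_integral_indicator) (auto simp: L_def intro!: sets_PiM_I_finite)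
  also have "... <= (\<integral>\<^sup>+x. b x \<partial>L I)"
  proof (rule nn_integral_mono)
   fix x
   have "(\<Sum>i\<in>I. (cmod (x i))^2) < 1" if "x \<in> Pi\<^sub>E I (\<lambda>_. ball 0 r)"
   proof -
    have "(\<Sum>i\<in>I. (cmod (x i))^2) <= (\<Sum>i\<in>I. r^2)"
     using that by (intro sum_mono power_mono) (auto simp: PiE_iff dist_norm less_imp_le)
    then show ?thesis using r by simp
   qed
   then show "indicator (Pi\<^sub>E I (\<lambda>_. ball 0 r)) x <= b x" by (auto simp: b_def indicator_def)
  qed
  finally have "emeasure (L I) (Pi\<^sub>E I (\<lambda>_. ball 0 r)) <= (\<integral>\<^sup>+x. b x \<partial>L I)" .
  moreover have "emeasure (L I) (Pi\<^sub>E I (\<lambda>_. ball 0 r)) \<noteq> 0"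
   unfolding L_def using fin ball[OF r(1)] by (subst emeasure_PiM) (auto simp: prod_zero_iff)
  ultimately show ?thesis by auto
 qed
 moreover have "(\<integral>\<^sup>+x. b x \<partial>L I) \<noteq> top"
 proof -
  have "(\<integral>\<^sup>+x. b x \<partial>L I) <= (\<integral>\<^sup>+x. indicator (Pi\<^sub>E I (\<lambda>_. ball 0 1)) x \<partial>L I)"
  proof (rule nn_integral_mono)
   fix x assume x: "x \<in> space (L I)"
   have "cmod (x i) < 1" if "(\<Sum>i\<in>I. (cmod (x i))^2) < 1" "i \<in> I" for i
   proof -
    have "(cmod (x i))^2 <= (\<Sum>i\<in>I. (cmod (x i))^2)" using that(2) fin by (intro member_le_sum) auto
    then show ?thesis using that(1) power2_less_imp_less[of "cmod (x i)" 1] by simp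
   qed
   then show "b x <= indicator (Pi\<^sub>E I (\<lambda>_. ball 0 1)) x"
    using x by (auto simp: b_def indicator_def L_def space_PiM PiE_iff)
  qed
  also have "... = emeasure (L I) (Pi\<^sub>E I (\<lambda>_. ball 0 1))"
   using fin by (subst nn_integral_indicator) (auto simp: L_def intro!: sets_PiM_I_finite)
  also have "... < top" unfolding L_def using fin emeasure_lborel_ball_finite[of "0 :: complex" 1]
   by (subst emeasure_PiM) (auto simp: power_less_top_ennreal)
  finally show ?thesis by simp
 qed
 ultimately show ?thesis using eq by (metis ennreal_mult_divide_eq)
qed

text \<open>The product of the Gaussian densities depends on \<open>\<omega>\<close> only through
  the Euclidean norm, which is exactly what a unitary change of variables preserves.\<close>

lemma PiM_cgauss_density:
 assumes fin: "finite I"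
 shows "density (PiM I (\<lambda>_. lborel))
   (\<lambda>\<omega>. ennreal (exp (- (\<Sum>i\<in>I. (cmod (\<omega> i))^2)) / pi ^ card I)) = PiM I (\<lambda>_. cgauss)"
proof -
 interpret L: product_sigma_finite "\<lambda>_ :: 'a. lborel :: complex measure" by standard
 interpret G: product_sigma_finite "\<lambda>_ :: 'a. cgauss" by standard
 have dens: "ennreal (exp (- (\<Sum>i\<in>I. (cmod (\<omega> i))^2)) / pi ^ card I)
   = (\<Prod>i\<in>I. ennreal (exp (- (cmod (\<omega> i))\<^sup>2) / pi))" for \<omega>
  by (simp add: prod_ennreal prod_dividef exp_sum[OF fin] flip: sum_negf)
 show ?thesis
 proof (rule G.PiM_eqI[OF fin])
  show "sets (density (PiM I (\<lambda>_. lborel))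
   (\<lambda>\<omega>. ennreal (exp (- (\<Sum>i\<in>I. (cmod (\<omega> i))^2)) / pi ^ card I))) = sets (PiM I (\<lambda>_. cgauss))"
   by (simp only: sets_density) (rule sets_PiM_cong, auto)
  fix A :: "'a => complex set" assume A: "\<And>i. i \<in> I ==> A i \<in> sets cgauss"
  have "emeasure (density (PiM I (\<lambda>_. lborel))
    (\<lambda>\<omega>. ennreal (exp (- (\<Sum>i\<in>I. (cmod (\<omega> i))^2)) / pi ^ card I))) (Pi\<^sub>E I A)
    = (\<integral>\<^sup>+\<omega>. ennreal (exp (- (\<Sum>i\<in>I. (cmod (\<omega> i))^2)) / pi ^ card I) * indicator (Pi\<^sub>E I A) \<omega>
      \<partial>PiM I (\<lambda>_. lborel))"
   using A fin by (subst emeasure_density) (auto intro!: sets_PiM_I_finite)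
  also have "... = (\<integral>\<^sup>+\<omega>. (\<Prod>i\<in>I. ennreal (exp (- (cmod (\<omega> i))\<^sup>2) / pi) * indicator (A i) (\<omega> i))
      \<partial>PiM I (\<lambda>_. lborel))"
  proof (rule nn_integral_cong)
   fix \<omega> assume "\<omega> \<in> space (PiM I (\<lambda>_. lborel :: complex measure))"
   then have "\<omega> \<in> extensional I" by (auto simp: space_PiM PiE_def)
   then have "indicator (Pi\<^sub>E I A) \<omega> = (\<Prod>i\<in>I. indicator (A i) (\<omega> i) :: ennreal)"
    using fin by (auto simp: indicator_def PiE_def Pi_def prod_zero_iff)
   then show "ennreal (exp (- (\<Sum>i\<in>I. (cmod (\<omega> i))^2)) / pi ^ card I) * indicator (Pi\<^sub>E I A) \<omega>
     = (\<Prod>i\<in>I. ennreal (exp (- (cmod (\<omega> i))\<^sup>2) / pi) * indicator (A i) (\<omega> i))"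
    unfolding dens by (simp add: prod.distrib)
  qed
  also have "... = (\<Prod>i\<in>I. \<integral>\<^sup>+z. ennreal (exp (- (cmod z)\<^sup>2) / pi) * indicator (A i) z \<partial>lborel)"
   using A by (subst L.product_nn_integral_prod[OF fin]) auto
  also have "... = (\<Prod>i\<in>I. emeasure cgauss (A i))"
   using A by (intro prod.cong refl) (simp add: cgauss_def emeasure_density)
  finally show "emeasure (density (PiM I (\<lambda>_. lborel))
    (\<lambda>\<omega>. ennreal (exp (- (\<Sum>i\<in>I. (cmod (\<omega> i))^2)) / pi ^ card I))) (Pi\<^sub>E I A)
    = (\<Prod>i\<in>I. emeasure cgauss (A i))" .
 qed
qed

lemma distr_PiM_cgauss_unitary:
 fixes U :: "'i => 'i => complex"
 assumes fin: "finite I" and U: "unitary_on I U"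
 defines "V \<equiv> \<lambda>\<omega>. \<lambda>j\<in>I. \<Sum>i\<in>I. U i j * \<omega> i"
 shows "V \<in> PiM I (\<lambda>_. cgauss) \<rightarrow>\<^sub>M PiM I (\<lambda>_. cgauss)"
  and "distr (PiM I (\<lambda>_. cgauss)) (PiM I (\<lambda>_. cgauss)) V = PiM I (\<lambda>_. cgauss)"
proof -
 let ?L = "PiM I (\<lambda>_. lborel :: complex measure)" and ?G = "PiM I (\<lambda>_. cgauss)"
 let ?d = "\<lambda>\<omega>. ennreal (exp (- (\<Sum>i\<in>I. (cmod (\<omega> i))^2)) / pi ^ card I)"
 have sets_eq: "sets ?G = sets ?L" by (rule sets_PiM_cong) auto
 have VL: "V \<in> ?L \<rightarrow>\<^sub>M ?L" unfolding V_def by (intro measurable_restrict) measurable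
 then show VG: "V \<in> ?G \<rightarrow>\<^sub>M ?G" using measurable_cong_sets[OF sets_eq sets_eq] by blast
 have iso: "(\<Sum>j\<in>I. (cmod (V x j))^2) = (\<Sum>i\<in>I. (cmod (x i))^2)" for x
 proof -
  have "cr (\<Sum>j\<in>I. (cmod (V x j))^2) = (\<Sum>j\<in>I. (\<Sum>i\<in>I. U i j * x i) * (\<Sum>k\<in>I. cnj (U k j) * cnj (x k)))"
   unfolding of_real_sum by (intro sum.cong refl) (simp only: complex_norm_square, simp add: V_def)
  also have "... = (\<Sum>i\<in>I. \<Sum>k\<in>I. x i * cnj (x k) * (\<Sum>j\<in>I. U i j * cnj (U k j)))"
  proof -
   have "(\<Sum>j\<in>I. (\<Sum>i\<in>I. U i j * x i) * (\<Sum>k\<in>I. cnj (U k j) * cnj (x k)))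
     = (\<Sum>j\<in>I. \<Sum>i\<in>I. \<Sum>k\<in>I. x i * cnj (x k) * (U i j * cnj (U k j)))"
    by (simp add: sum_product mult_ac)
   also have "... = (\<Sum>i\<in>I. \<Sum>j\<in>I. \<Sum>k\<in>I. x i * cnj (x k) * (U i j * cnj (U k j)))"
    by (rule sum.swap)
   also have "... = (\<Sum>i\<in>I. \<Sum>k\<in>I. \<Sum>j\<in>I. x i * cnj (x k) * (U i j * cnj (U k j)))"
    by (intro sum.cong refl sum.swap)
   finally show ?thesis by (simp add: sum_distrib_left)
  qed
  also have "... = (\<Sum>i\<in>I. \<Sum>k\<in>I. if i = k then x i * cnj (x k) else 0)"
   using U by (intro sum.cong refl) (auto simp: unitary_on_def)
  also have "... = cr (\<Sum>i\<in>I. (cmod (x i))^2)"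
   using fin by (simp only: of_real_sum complex_norm_square) (simp add: sum.delta')
  finally show ?thesis by (simp only: of_real_eq_iff)
 qed
 have inv: "(\<integral>\<^sup>+x. f (V x) \<partial>?L) = (\<integral>\<^sup>+x. f x \<partial>?L)" if "f \<in> borel_measurable ?L" for f
 proof (rule PiM_lborel_isometry[OF fin VL _ _ _ that])
  show "V (\<lambda>i\<in>I. x i + y i) = (\<lambda>i\<in>I. V x i + V y i)" for x y
   by (auto simp: V_def fun_eq_iff distrib_left sum.distrib)
  show "\<exists>x. V x = y" if y: "y \<in> space ?L" for y
  proof
   have "V (\<lambda>i. \<Sum>k\<in>I. cnj (U i k) * y k) j = y j" if j: "j \<in> I" for j
   proof -
    have "V (\<lambda>i. \<Sum>k\<in>I. cnj (U i k) * y k) j = (\<Sum>k\<in>I. y k * (\<Sum>i\<in>I. cnj (U i k) * U i j))"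
     using j unfolding V_def restrict_apply sum_distrib_left by (simp, subst sum.swap) (simp add: mult_ac)
    also have "... = (\<Sum>k\<in>I. if k = j then y k else 0)"
     using U j by (intro sum.cong refl) (auto simp: unitary_on_def)
    finally show ?thesis using fin j by simp
   qed
   then show "V (\<lambda>i. \<Sum>k\<in>I. cnj (U i k) * y k) = y"
    using y by (auto simp: fun_eq_iff V_def space_PiM PiE_def extensional_def)
  qed
 qed (rule iso)
 have cm [measurable]: "i \<in> I ==> (\<lambda>x. x i) \<in> borel_measurable ?L" for i by measurable
 have dm [measurable]: "?d \<in> borel_measurable ?L" by measurable
 show "distr ?G ?G V = ?G"
 proof (rule measure_eqI)
  fix A assume "A \<in> sets (distr ?G ?G V)"
  then have A: "A \<in> sets ?G" and AL [measurable]: "A \<in> sets ?L" by (auto simp: sets_eq)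
  have "emeasure (distr ?G ?G V) A = (\<integral>\<^sup>+x. indicator A x \<partial>distr ?G ?G V)"
   using A by simp
  also have "... = (\<integral>\<^sup>+x. indicator A (V x) \<partial>?G)"
   using A VG by (subst nn_integral_distr) auto
  also have "... = (\<integral>\<^sup>+x. ?d x * indicator A (V x) \<partial>?L)"
   unfolding PiM_cgauss_density[OF fin, symmetric] using VL by (subst nn_integral_density) auto
  also have "... = (\<integral>\<^sup>+x. ?d (V x) * indicator A (V x) \<partial>?L)" by (simp add: iso)
  also have "... = (\<integral>\<^sup>+x. ?d x * indicator A x \<partial>?L)"
   by (rule inv[of "\<lambda>x. ?d x * indicator A x"]) measurable
  also have "... = emeasure ?G A"
   unfolding PiM_cgauss_density[OF fin, symmetric] by (subst emeasure_density) auto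
  finally show "emeasure (distr ?G ?G V) A = emeasure ?G A" .
 qed simp
qed

text \<open>The vertical chord of the unit circle through \<open>cmod d\<close> has this midpoint;
  rotate it by the argument of \<open>d\<close>. A contraction of coefficients is thus an average of
  pure phases.\<close>

lemma complex_average_unimodular:
 assumes "cmod d <= 1"
 obtains u u' where "cmod u = 1" "cmod u' = 1" "d = (u + u') / 2"
proof
 let ?a = "arccos (cmod d)" and ?t = "Arg d"
 have "cis (?t + ?a) + cis (?t - ?a) = 2 * of_real (cos ?a) * cis ?t"
  by (auto simp: complex_eq_iff cos_add cos_diff sin_add sin_diff)
 also have "cos ?a = cmod d" using assms by (intro cos_arccos) (auto intro: order_trans[of _ 0])
 also have "2 * of_real (cmod d) * cis ?t = 2 * d" using rcis_cmod_Arg[of d] by (simp add: rcis_def)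
 finally show "d = (cis (?t + ?a) + cis (?t - ?a)) / 2" by simp
qed auto

text \<open>A Householder reflection. Let \<open>e\<close> be the unit vector at \<open>p0\<close>.
  The phase \<open>z\<close> makes the entry of \<open>cnj z * w\<close> at \<open>p0\<close> real
  and nonnegative, and the reflection along \<open>u = cnj z * w - e\<close> maps \<open>e\<close>
  to \<open>cnj z * w\<close>; multiplying by \<open>z\<close> restores \<open>w\<close>. It
  degenerates when \<open>u\<close> vanishes, and the first case, where \<open>w\<close> is a
  multiple of \<open>e\<close>, is done by a diagonal matrix.\<close>

lemma unitary_on_column:
 assumes fin: "finite P" and p0: "p0 \<in> P" and w: "(\<Sum>p\<in>P. (cmod (w p))^2) = 1"
 obtains U where "unitary_on P U" "\<And>p. p \<in> P ==> U p p0 = w p"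
proof (cases "cmod (w p0) = 1")
 case True
 have "(\<Sum>p\<in>P - {p0}. (cmod (w p))^2) = 0" using w fin p0 True by (simp add: sum.remove[of P p0])
 then have 0: "w p = 0" if "p \<in> P" "p \<noteq> p0" for p
  using that fin by (subst (asm) sum_nonneg_eq_0_iff) auto
 have "w p0 * cnj (w p0) = 1" using True by (simp add: complex_norm_square[symmetric])
 then have "unitary_on P (\<lambda>p q. if p = q then w p0 else 0)"
  using fin by (auto simp: unitary_on_def if_distrib[of cnj] if_distrib[of "\<lambda>c. c * _"]
    if_distrib[of "\<lambda>c. _ * c"] mult.commute cong: if_cong)
 then show thesis by (rule that) (auto simp: 0)
next
 case False
 define r where "r = cmod (w p0)"
 define z where "z = (if w p0 = 0 then 1 else w p0 / of_real r)"
 have z1: "cmod z = 1" and zr: "w p0 = z * of_real r" by (auto simp: z_def r_def norm_divide)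
 have zz: "z * cnj z = 1" "cnj z * z = 1" using z1 by (simp_all add: complex_norm_square[symmetric] mult.commute)
 have zzc: "z * (cnj z * c) = c" for c using zz by (simp flip: mult.assoc)
 have "r <= 1"
 proof -
  have "r^2 <= (\<Sum>p\<in>P. (cmod (w p))^2)" unfolding r_def by (rule member_le_sum) (use fin p0 in auto)
  then show ?thesis using w power2_le_imp_le[of r 1] by simp
 qed
 with False have k: "0 < 1 - r" by (simp add: r_def)
 define k where "k = cr (1 - r)"
 have k0: "k \<noteq> 0" using k by (simp add: k_def del: of_real_diff)
 have kc: "cnj k = k" by (simp add: k_def)
 define u where "u p = cnj z * w p - (if p = p0 then 1 else 0)" for p
 have up0: "u p0 = - k" using zz by (simp add: u_def zr k_def flip: mult.assoc)
 have wc: "(\<Sum>p\<in>P. cr ((cmod (w p))^2)) = 1" by (simp only: w of_real_1 flip: of_real_sum)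
 \<comment> \<open>The squared length of \<open>u\<close> is \<open>2 * k\<close>, so dividing by
   \<open>k\<close> in \<open>H\<close> below is the usual reflection formula.\<close>
 have uu: "(\<Sum>p\<in>P. u p * cnj (u p)) = 2 * k"
 proof -
  have "(\<Sum>p\<in>P. u p * cnj (u p)) = (\<Sum>p\<in>P. of_real ((cmod (w p))^2)
    - (if p = p0 then cnj z * w p + z * cnj (w p) - 1 else 0))"
   by (intro sum.cong refl) (auto simp: u_def algebra_simps zzc simp flip: complex_norm_square)
  also have "... = 1 - (cnj z * w p0 + z * cnj (w p0) - 1)" using fin p0 by (simp only: sum_subtractf wc) simp
  also have "... = 2 * k" using zz by (simp add: zr k_def algebra_simps)
  finally show ?thesis .
 qed
 define H where "H p q = (if p = q then 1 else 0) - u p * cnj (u q) / k" for p q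
 have cH: "cnj (H q p) = H p q" for p q by (auto simp: H_def k_def)
 have HH: "(\<Sum>q\<in>P. H p q * H q p') = (if p = p' then 1 else 0)" if "p \<in> P" "p' \<in> P" for p p'
 proof -
  have "H p q * H q p' = (if p = q then (if q = p' then 1 else 0) else 0)
    - (if q = p' then u p * cnj (u q) / k else 0) - (if p = q then u q * cnj (u p') / k else 0)
    + u p * cnj (u p') / k^2 * (u q * cnj (u q))" for q
   using k0 by (auto simp: H_def field_simps power2_eq_square)
  note HHq = this
  have "(\<Sum>q\<in>P. u p * cnj (u p') / k^2 * (u q * cnj (u q))) = u p * cnj (u p') / k^2 * (2 * k)"
   by (simp only: uu flip: sum_distrib_left)
  then have "(\<Sum>q\<in>P. H p q * H q p') = (if p = p' then 1 else 0)
    - u p * cnj (u p') / k - u p * cnj (u p') / k + u p * cnj (u p') / k^2 * (2 * k)"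
   using fin that by (simp only: HHq sum.distrib sum_subtractf) simp
  also have "... = (if p = p' then 1 else 0)" using k0 by (simp add: field_simps power2_eq_square)
  finally show ?thesis .
 qed
 have "unitary_on P (\<lambda>p q. z * H p q)"
 proof -
  have e1: "cnj z * H p q * (z * H q p') = H p q * H q p'" for p q p' by (simp add: mult_ac zzc)
  have e2: "z * H p q * (cnj z * H q p') = H p q * H q p'" for p q p' by (simp add: mult_ac zzc)
  show ?thesis by (simp only: unitary_on_def complex_cnj_mult cH e1 e2) (simp add: HH)
 qed
 moreover have "z * H p p0 = w p" if "p \<in> P" for p
 proof -
  have "H p p0 = (if p = p0 then 1 else 0) + u p" using k0 kc by (simp add: H_def up0)
  then show ?thesis using zz by (simp add: u_def flip: mult.assoc)
 qed
 ultimately show thesis by (rule that)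
qed

lemma unitary_on_transpose: "unitary_on P U ==> unitary_on P (\<lambda>p q. U q p)"
 by (auto simp: unitary_on_def mult.commute)

lemma unitary_on_block:
 assumes "finite K" "finite P" and U: "\<And>k. k \<in> K ==> unitary_on P (U k)"
 shows "unitary_on (K \<times> P) (\<lambda>(k, p) (l, q). if k = l then U k p q else 0)"
proof -
 let ?M = "\<lambda>(k, p) (l, q). if k = l then U k p q else 0"
 have 1: "(\<Sum>z\<in>K \<times> P. cnj (?M z (k, p)) * ?M z (k', p')) = (if k = k' \<and> p = p' then 1 else 0)"
  if "k \<in> K" "k' \<in> K" "p \<in> P" "p' \<in> P" for k k' p p'
 proof -
  have "(\<Sum>z\<in>K \<times> P. cnj (?M z (k, p)) * ?M z (k', p'))
   = (\<Sum>l\<in>K. if l = k then if k = k' then \<Sum>q\<in>P. cnj (U k q p) * U k q p' else 0 else 0)"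
   by (subst sum.cartesian_product', cases "k = k'") (auto intro!: sum.cong sum.neutral)
  then show ?thesis using assms that U[of k] by (auto simp: unitary_on_def)
 qed
 have 2: "(\<Sum>z\<in>K \<times> P. ?M (k, p) z * cnj (?M (k', p') z)) = (if k = k' \<and> p = p' then 1 else 0)"
  if "k \<in> K" "k' \<in> K" "p \<in> P" "p' \<in> P" for k k' p p'
 proof -
  have "(\<Sum>z\<in>K \<times> P. ?M (k, p) z * cnj (?M (k', p') z))
   = (\<Sum>l\<in>K. if l = k then if k = k' then \<Sum>q\<in>P. U k p q * cnj (U k p' q) else 0 else 0)"
   by (subst sum.cartesian_product', cases "k = k'") (auto intro!: sum.cong sum.neutral)
  then show ?thesis using assms that U[of k] by (auto simp: unitary_on_def)
 qed
 show ?thesis unfolding unitary_on_def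
  by (intro conjI ballI; elim SigmaE; hypsubst; unfold prod.inject; rule 1 2; assumption)
qed

section \<open>Contraction, row and column estimates for Gaussian sums\<close>

context cstruct
begin

text \<open>Moving the matrix from the vectors to the Gaussian variables transposes it, and the
  Gaussian law is invariant under unitary maps.\<close>

lemma gam2_unitary:
 fixes x :: "'i::countable => 'a"
 assumes fin: "finite I" and U: "unitary_on I U"
 shows "gam2 J I (\<lambda>i. \<Sum>j\<in>I. U i j *\<^sub>J x j) = gam2 J I x"
proof -
 let ?G = "PiM I (\<lambda>_. cgauss)" and ?V = "\<lambda>\<omega>. \<lambda>j\<in>I. \<Sum>i\<in>I. U i j * \<omega> i"
 note V = distr_PiM_cgauss_unitary[OF fin U]
 have "gam2 J I x = integral\<^sup>L (distr ?G ?G ?V) (\<lambda>\<omega>. (norm (\<Sum>j\<in>I. \<omega> j *\<^sub>J x j))^2)"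
  unfolding gam2_def V(2) ..
 also have "... = integral\<^sup>L ?G (\<lambda>\<omega>. (norm (\<Sum>j\<in>I. ?V \<omega> j *\<^sub>J x j))^2)"
  by (rule integral_distr[OF V(1)]) measurable
 also have "... = gam2 J I (\<lambda>i. \<Sum>j\<in>I. U i j *\<^sub>J x j)"
 proof -
  have "(\<Sum>j\<in>I. ?V \<omega> j *\<^sub>J x j) = (\<Sum>i\<in>I. \<omega> i *\<^sub>J (\<Sum>j\<in>I. U i j *\<^sub>J x j))" for \<omega>
   by (simp add: C.scale_sum_left C.scale_sum_right, subst sum.swap) (simp add: mult.commute)
  then show ?thesis by (simp add: gam2_def)
 qed
 finally show ?thesis by simp
qed

lemma gam2_phase:
 fixes x :: "'i::countable => 'a"
 assumes fin: "finite I" and d: "\<And>i. i \<in> I ==> cmod (d i) = 1"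
 shows "gam2 J I (\<lambda>i. d i *\<^sub>J x i) = gam2 J I x"
proof -
 have "d i * cnj (d i) = 1" if "i \<in> I" for i
  using d[OF that] by (simp add: complex_norm_square[symmetric])
 then have "unitary_on I (\<lambda>p q. if p = q then d p else 0)"
  using fin by (auto simp: unitary_on_def if_distrib[of cnj] if_distrib[of "\<lambda>c. c * _"]
    if_distrib[of "\<lambda>c. _ * c"] mult.commute cong: if_cong)
 from gam2_unitary[OF fin this, of x]
 show ?thesis using fin by (subst (asm) gam2_cong[of I _ "\<lambda>i. d i *\<^sub>J x i"])
   (auto simp: if_distrib[of "\<lambda>c. c *\<^sub>J _"] cong: if_cong)
qed

text \<open>The coefficients are inserted one at a time. Each is the mean of two phases; phases
  leave \<open>gam2\<close> unchanged, and \<open>gam2\<close> is convex.\<close>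

lemma gam2_contraction:
 fixes x :: "'i::countable => 'a"
 assumes fin: "finite I" and d: "\<And>i. i \<in> I ==> cmod (d i) <= 1"
 shows "gam2 J I (\<lambda>i. d i *\<^sub>J x i) <= gam2 J I x"
proof -
 have "gam2 J I (\<lambda>i. if i \<in> F then d i *\<^sub>J x i else x i) <= gam2 J I x" if "finite F" "F \<subseteq> I" for F
  using that
 proof (induction F)
  case (insert k F)
  define y where "y i = (if i \<in> F then d i *\<^sub>J x i else x i)" for i
  obtain u u' where u: "cmod u = 1" "cmod u' = 1" "d k = (u + u') / 2"
   using complex_average_unimodular[of "d k"] d insert.prems by auto
  define e where "e l i = (if i = k then if l then u else u' else 1)" for l i
  have "gam2 J I (\<lambda>i. if i \<in> insert k F then d i *\<^sub>J x i else x i)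
    = gam2 J I (\<lambda>i. \<Sum>l\<in>UNIV. (1/2) *\<^sub>R (e l i *\<^sub>J y i))"
  proof (rule gam2_cong)
   fix i
   have "d k *\<^sub>J x k = (1/2) *\<^sub>R (u *\<^sub>J x k) + (1/2) *\<^sub>R (u' *\<^sub>J x k)"
    unfolding u(3) by (simp add: C.scale_left_distrib[symmetric] B.scaleR_left[symmetric]
      scaleR_conv_of_real add_divide_distrib flip: scaleR_add_right)
   then show "(if i \<in> insert k F then d i *\<^sub>J x i else x i) = (\<Sum>l\<in>UNIV. (1/2) *\<^sub>R (e l i *\<^sub>J y i))"
    using insert.hyps by (auto simp: UNIV_bool e_def y_def add.commute simp flip: scaleR_left_distrib)
  qed
  also have "... <= (\<Sum>l\<in>(UNIV :: bool set). (1/2) * gam2 J I (\<lambda>i. e l i *\<^sub>J y i))"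
   by (rule gam2_convex[OF fin]) auto
  also have "... = gam2 J I y" using gam2_phase[OF fin, of "e _" y] u by (simp add: e_def UNIV_bool)
  also have "... <= gam2 J I x" using insert unfolding y_def by auto
  finally show ?case .
 qed simp
 from this[OF fin order_refl] show ?thesis
  by (subst (asm) gam2_cong[of I _ "\<lambda>i. d i *\<^sub>J x i"]) auto
qed

lemma gam2_block_unitary:
 fixes x :: "'k::countable \<times> 'p::countable => 'a"
 assumes "finite K" "finite P" "\<And>k. k \<in> K ==> unitary_on P (U k)"
 shows "gam2 J (K \<times> P) (\<lambda>(k, p). \<Sum>q\<in>P. U k p q *\<^sub>J x (k, q)) = gam2 J (K \<times> P) x"
proof -
 have "gam2 J (K \<times> P) (\<lambda>(k, p). \<Sum>q\<in>P. U k p q *\<^sub>J x (k, q))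
   = gam2 J (K \<times> P) (\<lambda>i. \<Sum>j\<in>K \<times> P. (\<lambda>(k, p) (l, q). if k = l then U k p q else 0) i j *\<^sub>J x j)"
 proof (rule gam2_cong)
  fix i assume "i \<in> K \<times> P"
  then obtain k p where i: "i = (k, p)" "k \<in> K" "p \<in> P" by auto
  have "(\<Sum>j\<in>K \<times> P. (case j of (l, q) => if k = l then U k p q else 0) *\<^sub>J x j)
    = (\<Sum>l\<in>K. if l = k then \<Sum>q\<in>P. U k p q *\<^sub>J x (k, q) else 0)"
   by (subst sum.cartesian_product') (auto intro!: sum.cong)
  then show "(case i of (k, p) => \<Sum>q\<in>P. U k p q *\<^sub>J x (k, q))
    = (\<Sum>j\<in>K \<times> P. (\<lambda>(k, p) (l, q). if k = l then U k p q else 0) i j *\<^sub>J x j)"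
   using assms(1) i by (simp add: i(1))
 qed
 also have "... = gam2 J (K \<times> P) x" using assms by (intro gam2_unitary unitary_on_block) auto
 finally show ?thesis .
qed

lemma normalise_vector:
 fixes w :: "'p => complex"
 assumes "finite P" "p0 \<in> P" "(\<Sum>p\<in>P. (cmod (w p))^2) <= 1"
 obtains n v where "0 <= n" "n <= 1" "(\<Sum>p\<in>P. (cmod (v p))^2) = 1" "\<And>p. p \<in> P ==> w p = of_real n * v p"
proof (cases "(\<Sum>p\<in>P. (cmod (w p))^2) = 0")
 case True
 then have "\<forall>p\<in>P. w p = 0" using assms by (auto simp: sum_nonneg_eq_0_iff)
 then show thesis using assms
  by (intro that[of 0 "\<lambda>p. if p = p0 then 1 else 0"]) (auto simp: if_distrib[of norm] if_distrib[of "\<lambda>c. c^2"] cong: if_cong)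
next
 case False
 define n where "n = sqrt (\<Sum>p\<in>P. (cmod (w p))^2)"
 have n: "0 < n" "n^2 = (\<Sum>p\<in>P. (cmod (w p))^2)" using False by (auto simp: n_def sum_nonneg less_le)
 show thesis
 proof (rule that[of n "\<lambda>p. w p / of_real n"])
  show "(\<Sum>p\<in>P. (cmod (w p / of_real n))^2) = 1"
   using n False by (simp add: norm_divide power_divide flip: sum_divide_distrib)
 qed (use n assms in \<open>auto simp: n_def\<close>)
qed

text \<open>Put a multiple of \<open>x k\<close>, with factor at most one, at position
  \<open>p0\<close> of block \<open>k\<close> and rotate the block by a unitary matrix whose column
  \<open>p0\<close> is the normalised \<open>w k\<close>. Only reindexing, unitary invariance and
  contraction are used.\<close>

lemma gam2_column:
 fixes x :: "'k::countable => 'a" and w :: "'k => 'p::countable => complex"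
 assumes fin: "finite K" "finite P" and w: "\<And>k. k \<in> K ==> (\<Sum>p\<in>P. (cmod (w k p))^2) <= 1"
 shows "gam2 J (K \<times> P) (\<lambda>(k, p). w k p *\<^sub>J x k) <= gam2 J K x"
proof (cases "P = {}")
 case True
 then show ?thesis using gam2_nonneg[of J K x] by (simp add: gam2_def)
next
 case False
 then obtain p0 where p0: "p0 \<in> P" by auto
 have "\<exists>n U. 0 <= n \<and> n <= 1 \<and> unitary_on P U \<and> (\<forall>p\<in>P. w k p = of_real n * U p p0)" if "k \<in> K" for k
  using normalise_vector[OF fin(2) p0 w[OF that]] unitary_on_column[OF fin(2) p0] by metis
 then obtain n U where nU: "\<And>k. k \<in> K ==> 0 <= n k" "\<And>k. k \<in> K ==> n k <= (1::real)"
   "\<And>k. k \<in> K ==> unitary_on P (U k)" "\<And>k p. k \<in> K ==> p \<in> P ==> w k p = of_real (n k) * U k p p0"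
  by metis
 define y where "y = (\<lambda>(k, q). if q = p0 then of_real (n k) *\<^sub>J x k else 0)"
 have "gam2 J (K \<times> P) (\<lambda>(k, p). w k p *\<^sub>J x k) = gam2 J (K \<times> P) (\<lambda>(k, p). \<Sum>q\<in>P. U k p q *\<^sub>J y (k, q))"
 proof (rule gam2_cong, clarify)
  fix k p assume "k \<in> K" "p \<in> P"
  have "(\<Sum>q\<in>P. U k p q *\<^sub>J y (k, q)) = (\<Sum>q\<in>P. if q = p0 then w k p *\<^sub>J x k else 0)"
   using nU(4)[OF \<open>k \<in> K\<close> \<open>p \<in> P\<close>] by (intro sum.cong) (auto simp: y_def cs_scaleR mult.commute)
  then show "w k p *\<^sub>J x k = (\<Sum>q\<in>P. U k p q *\<^sub>J y (k, q))" using fin p0 by simp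
 qed
 also have "... = gam2 J (K \<times> P) y" by (rule gam2_block_unitary[OF fin nU(3)])
 also have "... = gam2 J K (y \<circ> (\<lambda>k. (k, p0)))"
  by (rule gam2_embed) (use fin p0 in \<open>auto simp: inj_on_def y_def\<close>)
 also have "... = gam2 J K (\<lambda>k. of_real (n k) *\<^sub>J x k)" by (simp add: y_def o_def)
 also have "... <= gam2 J K x" using nU by (intro gam2_contraction[OF fin(1)]) auto
 finally show ?thesis .
qed

text \<open>Dual to the column estimate: rotate each block so that the row functional becomes a
  multiple of the coordinate \<open>p0\<close>, then discard the remaining coordinates, which is a
  contraction with coefficients zero and one.\<close>

lemma gam2_row:
 fixes z :: "'k::countable \<times> 'p::countable => 'a" and v :: "'k => 'p => complex"
 assumes fin: "finite K" "finite P" and v: "\<And>k. k \<in> K ==> (\<Sum>p\<in>P. (cmod (v k p))^2) <= 1"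
 shows "gam2 J K (\<lambda>k. \<Sum>p\<in>P. v k p *\<^sub>J z (k, p)) <= gam2 J (K \<times> P) z"
proof (cases "P = {}")
 case True
 then show ?thesis by (simp add: gam2_def)
next
 case False
 then obtain p0 where p0: "p0 \<in> P" by auto
 have "\<exists>n U. 0 <= n \<and> n <= 1 \<and> unitary_on P U \<and> (\<forall>p\<in>P. v k p = of_real n * U p p0)" if "k \<in> K" for k
  using normalise_vector[OF fin(2) p0 v[OF that]] unitary_on_column[OF fin(2) p0] by metis
 then obtain n U where nU: "\<And>k. k \<in> K ==> 0 <= n k" "\<And>k. k \<in> K ==> n k <= (1::real)"
   "\<And>k. k \<in> K ==> unitary_on P (U k)" "\<And>k p. k \<in> K ==> p \<in> P ==> v k p = of_real (n k) * U k p p0"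
  by metis
 define y where "y = (\<lambda>(k, p). \<Sum>q\<in>P. U k q p *\<^sub>J z (k, q))"
 define y0 where "y0 = (\<lambda>(k, p). (if p = p0 then 1 else 0) *\<^sub>J y (k, p))"
 have "gam2 J K (\<lambda>k. \<Sum>p\<in>P. v k p *\<^sub>J z (k, p)) = gam2 J K (\<lambda>k. of_real (n k) *\<^sub>J y (k, p0))"
  using nU(4) by (intro gam2_cong) (simp add: y_def scaleR_sum_right flip: C.scale_scale)
 also have "... <= gam2 J K (\<lambda>k. y (k, p0))" using nU by (intro gam2_contraction[OF fin(1)]) auto
 also have "... = gam2 J K (y0 \<circ> (\<lambda>k. (k, p0)))" by (simp add: y0_def o_def)
 also have "... = gam2 J (K \<times> P) y0"
  by (rule gam2_embed[symmetric]) (use fin p0 in \<open>auto simp: inj_on_def y0_def\<close>)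
 also have "... = gam2 J (K \<times> P) (\<lambda>i. (if snd i = p0 then 1 else 0) *\<^sub>J y i)"
  by (simp add: y0_def case_prod_beta')
 also have "... <= gam2 J (K \<times> P) y" by (rule gam2_contraction) (use fin in auto)
 also have "... = gam2 J (K \<times> P) z"
  unfolding y_def using gam2_block_unitary[OF fin, of "\<lambda>k p q. U k q p" z] nU(3) unitary_on_transpose by blast
 finally show ?thesis .
qed

text \<open>The square root of each weight is used twice: once to spread \<open>x k\<close> over
  \<open>L\<close> as a column, once to recombine as a row. Hence the weights may depend on
  \<open>k\<close> and the constant \<open>D\<close> is kept, so the estimate for a family extends
  to its convex hull.\<close>

lemma gam2_convex_combination:
 fixes x :: "'k::countable => 'a" and S :: "'k => 'l::countable => 'a => 'a"
 assumes fin: "finite K" "finite L" and c: "\<And>k l. 0 <= c k l" "\<And>k. k \<in> K ==> (\<Sum>l\<in>L. c k l) <= 1"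
  and lin: "\<And>k l r y. S k l (r *\<^sub>R y) = r *\<^sub>R S k l y" and D: "0 <= D"
  and bound: "\<And>y. gam2 J (K \<times> L) (\<lambda>(k, l). S k l (y (k, l))) <= D * gam2 J (K \<times> L) y"
 shows "gam2 J K (\<lambda>k. \<Sum>l\<in>L. c k l *\<^sub>R S k l (x k)) <= D * gam2 J K x"
proof -
 let ?w = "\<lambda>k l. cr (sqrt (c k l))"
 have w: "(\<Sum>l\<in>L. (cmod (?w k l))^2) <= 1" if "k \<in> K" for k using c that by simp
 have "gam2 J K (\<lambda>k. \<Sum>l\<in>L. c k l *\<^sub>R S k l (x k))
   = gam2 J K (\<lambda>k. \<Sum>l\<in>L. ?w k l *\<^sub>J (\<lambda>(k, l). S k l (sqrt (c k l) *\<^sub>R x k)) (k, l))"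
  using c(1) by (simp add: lin)
 also have "... <= gam2 J (K \<times> L) (\<lambda>(k, l). S k l (sqrt (c k l) *\<^sub>R x k))"
  by (rule gam2_row[OF fin w])
 also have "... = gam2 J (K \<times> L) (\<lambda>(k, l). S k l ((\<lambda>(k, l). ?w k l *\<^sub>J x k) (k, l)))" by simp
 also have "... <= D * gam2 J (K \<times> L) (\<lambda>(k, l). ?w k l *\<^sub>J x k)" by (rule bound)
 also have "... <= D * gam2 J K x" by (intro mult_left_mono gam2_column[OF fin w] D)
 finally show ?thesis .
qed

lemma gamma_ineq_gam2:
 fixes x :: "'i::countable => 'a"
 assumes "gamma_ineq J \<T> C" "0 <= C" "finite I" "\<And>i. i \<in> I ==> S i \<in> \<T>"
 shows "gam2 J I (\<lambda>i. S i (x i)) <= C^2 * gam2 J I x"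
proof -
 define n where "n = card I"
 obtain h where h: "bij_betw h {..<n} I"
  using ex_bij_betw_nat_finite[OF assms(3)] by (auto simp: n_def atLeast0LessThan)
 have emb: "gam2 J I y = gam2 J {..<n} (y \<circ> h)" for y :: "'i => 'a"
  by (rule gam2_embed) (use h assms in \<open>auto simp: bij_betw_def\<close>)
 let ?Ss = "map (\<lambda>k. S (h k)) [0..<n]" and ?xs = "map (\<lambda>k. x (h k)) [0..<n]"
 have "gauss_norm J (map2 (\<lambda>S x. S x) ?Ss ?xs) <= C * gauss_norm J ?xs"
  by (rule assms(1)[unfolded gamma_ineq_def, rule_format]) (use assms(4) h in \<open>auto simp: bij_betw_def\<close>)
 moreover have "gauss_norm J (map2 (\<lambda>S x. S x) ?Ss ?xs) = sqrt (gam2 J I (\<lambda>i. S i (x i)))"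
  by (simp add: gauss_norm_gam2 emb, rule gam2_cong, simp)
 moreover have "gauss_norm J ?xs = sqrt (gam2 J I x)" by (simp add: gauss_norm_gam2 emb, rule gam2_cong, simp)
 ultimately have "sqrt (gam2 J I (\<lambda>i. S i (x i))) <= sqrt (C^2 * gam2 J I x)"
  using assms(2) by (simp add: real_sqrt_mult)
 then show ?thesis by simp
qed

lemma gam2_gamma_ineq:
 assumes "0 <= C" and "\<And>n S x. (\<And>i. i < n ==> S i \<in> \<T>) ==>
   gam2 J {..<n} (\<lambda>i::nat. S i (x i)) <= C^2 * gam2 J {..<n} x"
 shows "gamma_ineq J \<T> C" unfolding gamma_ineq_def
proof (intro allI impI)
 fix Ss :: "('a => 'a) list" and xs :: "'a list"
 assume *: "length Ss = length xs" "set Ss \<subseteq> \<T>"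
 have "gam2 J {..<length xs} (\<lambda>i. (Ss ! i) (xs ! i)) <= C^2 * gam2 J {..<length xs} ((!) xs)"
  using * by (intro assms(2)) (auto simp: subset_iff)
 then have "sqrt (gam2 J {..<length xs} (\<lambda>i. (Ss ! i) (xs ! i))) <= sqrt (C^2 * gam2 J {..<length xs} ((!) xs))"
  by simp
 moreover have "gam2 J {..<length xs} ((!) (map2 (\<lambda>S x. S x) Ss xs)) = gam2 J {..<length xs} (\<lambda>i. (Ss ! i) (xs ! i))"
  using * by (intro gam2_cong) auto
 ultimately show "gauss_norm J (map2 (\<lambda>S x. S x) Ss xs) <= C * gauss_norm J xs"
  using * assms(1) by (simp add: gauss_norm_gam2 real_sqrt_mult)
qed

end

section \<open>Hankel forms on finite Gaussian sums\<close>

lemma sum_cis_roots_unity: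
 fixes m :: int
 assumes "\<bar>m\<bar> < int N"
 shows "(\<Sum>j<N. cis (2 * pi * real j * of_int m / real N)) = (if m = 0 then of_nat N else 0)"
proof (cases "m = 0")
 case False
 let ?z = "cis (2 * pi * of_int m / real N)"
 have N: "0 < N" using assms by auto
 have "?z \<noteq> 1"
 proof
  assume "?z = 1"
  then have "cos (2 * pi * of_int m / real N) = 1" by (simp add: complex_eq_iff)
  then obtain n :: int where "2 * pi * of_int m / real N = of_int n * 2 * pi" by (auto simp: cos_one_2pi_int)
  then have "of_int m = (of_int n * real N :: real)" using N by (simp add: field_simps)
  then have "m = n * int N" by (metis of_int_eq_iff of_int_mult of_int_of_nat_eq)
  then have "int N dvd m" by simp
  then show False using assms False zdvd_imp_le[of "int N" "\<bar>m\<bar>"] by auto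
 qed
 moreover have "?z ^ N = 1"
 proof -
  have "?z ^ N = cis (real N * (2 * pi * of_int m / real N))" by (rule Complex.DeMoivre)
  also have "... = cis (2 * pi * of_int m)" using N by simp
  finally show ?thesis by (simp add: complex_eq_iff cos_int_2pin sin_int_2pin)
 qed
 moreover have "(\<Sum>j<N. cis (2 * pi * real j * of_int m / real N)) = (\<Sum>j<N. ?z ^ j)"
  by (intro sum.cong refl) (simp add: Complex.DeMoivre mult_ac)
 ultimately show ?thesis using False by (simp add: sum_gp_strict)
qed simp

text \<open>The shift \<open>c\<close> multiplies the column \<open>q\<close> by a phase and keeps
  the matrix unitary. It is there because the interpolation kernel \<open>kappa\<close> is an
  average over shifts \<open>l\<close>.\<close>

lemma unitary_on_dft:
 assumes N: "0 < N"
 shows "unitary_on {..<N} (\<lambda>j q. cis (- 2 * pi * (real j - c) * real q / real N) / of_real (sqrt (real N)))"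
  (is "unitary_on _ ?U")
proof -
 have sq: "cr (sqrt (real N)) * cr (sqrt (real N)) = of_nat N" by (simp flip: of_real_mult)
 have A: "(\<Sum>j<N. cnj (?U j p) * ?U j p') = (if p = p' then 1 else 0)" if "p < N" "p' < N" for p p'
 proof -
  have "cnj (?U j p) * ?U j p' = cis (- 2 * pi * c * (real p - real p') / real N) / of_nat N
    * cis (2 * pi * real j * of_int (int p - int p') / real N)" for j
  proof -
   have "cnj (?U j p) * ?U j p' = cis (- (- 2 * pi * (real j - c) * real p / real N)
     + - 2 * pi * (real j - c) * real p' / real N) / of_nat N"
    by (simp only: complex_cnj_divide cis_cnj complex_cnj_complex_of_real times_divide_times_eq sq cis_mult)
   also have "- (- 2 * pi * (real j - c) * real p / real N) + - 2 * pi * (real j - c) * real p' / real N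
     = - 2 * pi * c * (real p - real p') / real N + 2 * pi * real j * of_int (int p - int p') / real N"
    using N by (simp add: field_simps)
   finally show ?thesis by (simp only: cis_mult[symmetric] times_divide_eq_left)
  qed
  then have "(\<Sum>j<N. cnj (?U j p) * ?U j p') = cis (- 2 * pi * c * (real p - real p') / real N) / of_nat N
    * (\<Sum>j<N. cis (2 * pi * real j * of_int (int p - int p') / real N))" by (simp add: sum_distrib_left)
  also have "... = (if p = p' then 1 else 0)" using that N by (subst sum_cis_roots_unity) auto
  finally show ?thesis .
 qed
 have B: "(\<Sum>q<N. ?U p q * cnj (?U p' q)) = (if p = p' then 1 else 0)" if "p < N" "p' < N" for p p'
 proof -
  have "?U p q * cnj (?U p' q) = cis (2 * pi * real q * of_int (int p' - int p) / real N) / of_nat N" for q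
  proof -
   have "?U p q * cnj (?U p' q) = cis (- 2 * pi * (real p - c) * real q / real N
     + - (- 2 * pi * (real p' - c) * real q / real N)) / of_nat N"
    by (simp only: complex_cnj_divide cis_cnj complex_cnj_complex_of_real times_divide_times_eq sq cis_mult)
   also have "- 2 * pi * (real p - c) * real q / real N + - (- 2 * pi * (real p' - c) * real q / real N)
     = 2 * pi * real q * of_int (int p' - int p) / real N" using N by (simp add: field_simps)
   finally show ?thesis .
  qed
  then have "(\<Sum>q<N. ?U p q * cnj (?U p' q))
    = (\<Sum>q<N. cis (2 * pi * real q * of_int (int p' - int p) / real N)) / of_nat N"
   by (simp add: sum_divide_distrib)
  also have "... = (if p = p' then 1 else 0)" using that N by (subst sum_cis_roots_unity) auto
  finally show ?thesis .
 qed
 show ?thesis unfolding unitary_on_def using A B by (simp only: lessThan_iff Ball_def) blast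
qed

context cstruct
begin

text \<open>The Hankel form factors as: pairing with \<open>v\<close>, semigroup, inverse DFT, multiplication by \<open>y\<close>,
 DFT, semigroup, spreading along \<open>w\<close>. Only the two semigroup steps cost a factor.\<close>

lemma gam2_hankel:
 fixes A :: "nat => 'a => 'a" and w v y :: "'i::countable => nat => complex" and x :: "'i => 'a"
  and c :: real
 assumes fin: "finite I" and N: "0 < N" and D: "0 <= D"
  and A: "\<And>n. cbounded_op J (A n)" "\<And>p q z. A p (A q z) = A (p + q) z"
  and bound: "\<And>z. gam2 J (I \<times> {..<N}) (\<lambda>(i, n). A n (z (i, n))) <= D * gam2 J (I \<times> {..<N}) z"
  and w: "\<And>i. i \<in> I ==> (\<Sum>q<N. (cmod (w i q))^2) <= 1"
  and v: "\<And>i. i \<in> I ==> (\<Sum>p<N. (cmod (v i p))^2) <= 1"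
  and y: "\<And>i j. i \<in> I ==> j < N ==> cmod (y i j) <= 1"
 defines "a \<equiv> \<lambda>i n. (\<Sum>j<N. y i j * cis (- 2 * pi * (real j - c) * real n / real N)) / of_nat N"
 shows "gam2 J I (\<lambda>i. \<Sum>p<N. \<Sum>q<N. (v i p * w i q * a i (p + q)) *\<^sub>J A (p + q) (x i)) <= D^2 * gam2 J I x"
proof -
 let ?P = "{..<N}"
 define U where "U j q = cis (- 2 * pi * (real j - c) * real q / real N) / of_real (sqrt (real N))" for j q :: nat
 have U: "unitary_on ?P U" using unitary_on_dft[OF N, of c] by (simp add: U_def[abs_def])
 \<comment> \<open>The entries are characters in the second index, so a product of two entries
   depends on \<open>p + q\<close> alone. This is what writes the Hankel matrix
   \<open>a i (p + q)\<close> as the transpose of \<open>U\<close> times a diagonal matrix times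
   \<open>U\<close>.\<close>
 have UU: "U j p * U j q = cis (- 2 * pi * (real j - c) * real (p + q) / real N) / of_nat N" for j p q
 proof -
  have "cr (sqrt (real N)) * cr (sqrt (real N)) = of_nat N" by (simp flip: of_real_mult)
  then have "U j p * U j q = cis (- 2 * pi * (real j - c) * real p / real N
    + - 2 * pi * (real j - c) * real q / real N) / of_nat N"
   by (simp only: U_def times_divide_times_eq cis_mult)
  also have "- 2 * pi * (real j - c) * real p / real N + - 2 * pi * (real j - c) * real q / real N
    = - 2 * pi * (real j - c) * real (p + q) / real N" using N by (simp add: field_simps)
  finally show ?thesis .
 qed
 define z1 where "z1 = (\<lambda>(i, q). w i q *\<^sub>J x i)"
 define z2 where "z2 = (\<lambda>(i, q). A q (z1 (i, q)))"
 define z3 where "z3 = (\<lambda>(i, j). \<Sum>q\<in>?P. U j q *\<^sub>J z2 (i, q))"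
 define z4 where "z4 = (\<lambda>k. (case k of (i, j) => y i j) *\<^sub>J z3 k)"
 define z5 where "z5 = (\<lambda>(i, p). \<Sum>j\<in>?P. U j p *\<^sub>J z4 (i, j))"
 define z6 where "z6 = (\<lambda>(i, p). A p (z5 (i, p)))"
 let ?g = "gam2 J (I \<times> ?P)"
 have lin: "A n (\<Sum>s\<in>F. f s *\<^sub>J g s) = (\<Sum>s\<in>F. f s *\<^sub>J A n (g s))" for n F and f :: "nat => complex" and g
 proof -
  have "bounded_linear (A n)" using A(1) by (simp add: cbounded_op_def)
  then show ?thesis by (simp add: linear_sum bounded_linear.linear cbounded_op_cs[OF A(1)])
 qed
 have "(\<Sum>p\<in>?P. v i p *\<^sub>J z6 (i, p))
   = (\<Sum>p<N. \<Sum>q<N. (v i p * w i q * a i (p + q)) *\<^sub>J A (p + q) (x i))" for i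
 proof (rule sum.cong[OF refl])
  fix p
  have "z6 (i, p) = (\<Sum>j<N. \<Sum>q<N. (U j p * y i j * U j q * w i q) *\<^sub>J A (p + q) (x i))"
  proof -
   have 1: "z6 (i, p) = (\<Sum>j\<in>?P. U j p *\<^sub>J A p (z4 (i, j)))"
    by (simp only: z6_def z5_def prod.case lin)
   have 2: "A p (z4 (i, j)) = y i j *\<^sub>J (\<Sum>q\<in>?P. U j q *\<^sub>J A p (z2 (i, q)))" for j
    by (simp only: z4_def z3_def prod.case lin cbounded_op_cs[OF A(1)])
   have 3: "A p (z2 (i, q)) = w i q *\<^sub>J A (p + q) (x i)" for q
    by (simp only: z2_def z1_def prod.case cbounded_op_cs[OF A(1)] A(2))
   show ?thesis unfolding 1 2 3 by (simp add: C.scale_sum_right mult.assoc)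
  qed
  also have "... = (\<Sum>q<N. (w i q * (\<Sum>j<N. y i j * (U j p * U j q))) *\<^sub>J A (p + q) (x i))"
   by (subst sum.swap) (simp add: C.scale_sum_left sum_distrib_left mult_ac)
  also have "... = (\<Sum>q<N. (w i q * a i (p + q)) *\<^sub>J A (p + q) (x i))"
   unfolding UU a_def by (simp add: sum_divide_distrib)
  finally show "v i p *\<^sub>J z6 (i, p) = (\<Sum>q<N. (v i p * w i q * a i (p + q)) *\<^sub>J A (p + q) (x i))"
   by (simp add: C.scale_sum_right mult.assoc)
 qed
 then have "gam2 J I (\<lambda>i. \<Sum>p<N. \<Sum>q<N. (v i p * w i q * a i (p + q)) *\<^sub>J A (p + q) (x i))
   = gam2 J I (\<lambda>i. \<Sum>p\<in>?P. v i p *\<^sub>J z6 (i, p))" by simp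
 also have "... <= ?g z6" by (rule gam2_row[OF fin _ v]) auto
 also have "... <= D * ?g z5" unfolding z6_def by (rule bound)
 also have "?g z5 = ?g z4" unfolding z5_def
  by (rule gam2_block_unitary[OF fin, of ?P "\<lambda>_ p j. U j p"]) (auto intro: unitary_on_transpose U)
 also have "?g z4 <= ?g z3" unfolding z4_def by (rule gam2_contraction) (use fin y in auto)
 also have "?g z3 = ?g z2"
  unfolding z3_def by (rule gam2_block_unitary[OF fin, of ?P "\<lambda>_. U"]) (auto intro: U)
 also have "?g z2 <= D * ?g z1" unfolding z2_def by (rule bound)
 also have "?g z1 <= gam2 J I x" unfolding z1_def by (rule gam2_column[OF fin _ w]) auto
 finally show ?thesis using D by (simp add: mult_left_mono power2_eq_square mult.assoc)
qed

text \<open>Grouping the Hankel sum by \<open>n = p + q\<close> produces the coefficients of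
  \<open>W i * V i\<close>. The bound \<open>r\<close> on the two squared coefficient norms is
  normalised away by dividing each factor by \<open>sqrt r\<close>, and comes back as
  \<open>r\<close> in front.\<close>

lemma gam2_hankel_poly:
 fixes A :: "nat => 'a => 'a" and W V :: "'i::countable => complex poly" and y :: "'i => nat => complex"
  and c :: real
 assumes fin: "finite I" and N: "0 < N" and D: "0 <= D" and r: "0 < r"
  and A: "\<And>n. cbounded_op J (A n)" "\<And>p q z. A p (A q z) = A (p + q) z"
  and bound: "\<And>z. gam2 J (I \<times> {..<N}) (\<lambda>(i, n). A n (z (i, n))) <= D * gam2 J (I \<times> {..<N}) z"
  and W: "\<And>i. i \<in> I ==> (\<Sum>q<N. (cmod (coeff (W i) q))^2) <= r" "\<And>i. i \<in> I ==> degree (W i) < N"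
  and V: "\<And>i. i \<in> I ==> (\<Sum>p<N. (cmod (coeff (V i) p))^2) <= r" "\<And>i. i \<in> I ==> degree (V i) < N"
  and y: "\<And>i j. i \<in> I ==> j < N ==> cmod (y i j) <= 1"
 defines "a \<equiv> \<lambda>i n. (\<Sum>j<N. y i j * cis (- 2 * pi * (real j - c) * real n / real N)) / of_nat N"
 shows "gam2 J I (\<lambda>i. \<Sum>n<2*N. (coeff (W i * V i) n * a i n) *\<^sub>J A n (x i)) <= (D * r)^2 * gam2 J I x"
proof -
 let ?s = "cr (sqrt r)"
 have norm1: "(\<Sum>q<N. (cmod (f q / ?s))^2) <= 1" if "(\<Sum>q<N. (cmod (f q))^2) <= r" for f
  using that r by (simp add: norm_divide power_divide flip: sum_divide_distrib)
 have ss: "?s * ?s = of_real r" "?s \<noteq> 0" using r by (simp_all flip: of_real_mult)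
 have "(\<Sum>n<2*N. (coeff (W i * V i) n * a i n) *\<^sub>J A n (x i))
   = r *\<^sub>R (\<Sum>p<N. \<Sum>q<N. (coeff (W i) p / ?s * (coeff (V i) q / ?s) * a i (p + q)) *\<^sub>J A (p + q) (x i))"
  if i: "i \<in> I" for i
 proof -
  let ?f = "\<lambda>p q. (coeff (W i) p * coeff (V i) q * a i (p + q)) *\<^sub>J A (p + q) (x i)"
  have "(\<Sum>n<2*N. (coeff (W i * V i) n * a i n) *\<^sub>J A n (x i)) = (\<Sum>n<2*N. \<Sum>p\<le>n. ?f p (n - p))"
   by (simp add: coeff_mult sum_distrib_right C.scale_sum_left)
  also have "... = (\<Sum>(p, q)\<in>{(p, q). p + q < 2 * N}. ?f p q)"
   by (rule sum.triangle_reindex[symmetric])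
  also have "... = (\<Sum>(p, q)\<in>{..<N} \<times> {..<N}. ?f p q)"
  proof (rule sum.mono_neutral_right)
   show "finite {(p, q). p + q < 2 * N}" by (rule finite_subset[of _ "{..<2*N} \<times> {..<2*N}"]) auto
   show "\<forall>pq\<in>{(p, q). p + q < 2 * N} - {..<N} \<times> {..<N}. (case pq of (p, q) => ?f p q) = 0"
   proof (intro ballI)
    fix pq assume pq: "pq \<in> {(p, q). p + q < 2 * N} - {..<N} \<times> {..<N}"
    obtain p q where [simp]: "pq = (p, q)" by fastforce
    have "coeff (W i) p = 0 \<or> coeff (V i) q = 0"
     using W(2)[OF i] V(2)[OF i] pq by (auto intro!: coeff_eq_0)
    then show "(case pq of (p, q) => ?f p q) = 0" by auto
   qed
  qed auto
  also have "... = (\<Sum>p<N. \<Sum>q<N. ?f p q)" by (rule sum.cartesian_product[symmetric])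
  also have "... = r *\<^sub>R (\<Sum>p<N. \<Sum>q<N. (coeff (W i) p / ?s * (coeff (V i) q / ?s) * a i (p + q)) *\<^sub>J A (p + q) (x i))"
   using r ss by (simp add: C.scale_sum_right flip: cs_of_real)
  finally show ?thesis .
 qed
 then have "gam2 J I (\<lambda>i. \<Sum>n<2*N. (coeff (W i * V i) n * a i n) *\<^sub>J A n (x i))
   = gam2 J I (\<lambda>i. r *\<^sub>R (\<Sum>p<N. \<Sum>q<N. (coeff (W i) p / ?s * (coeff (V i) q / ?s) * a i (p + q)) *\<^sub>J A (p + q) (x i)))"
  by (rule gam2_cong)
 also have "... = r^2 * gam2 J I (\<lambda>i. \<Sum>p<N. \<Sum>q<N. (coeff (W i) p / ?s * (coeff (V i) q / ?s) * a i (p + q)) *\<^sub>J A (p + q) (x i))"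
  by (rule gam2_scaleR)
 also have "... <= r^2 * (D^2 * gam2 J I x)" unfolding a_def
  by (intro mult_left_mono gam2_hankel[OF fin N D A bound, where w = "\<lambda>i q. coeff (V i) q / ?s"]
    norm1 W(1) V(1) y) auto
 finally show ?thesis by (simp add: power_mult_distrib mult_ac)
qed

end

subsection \<open>The discrete Fejer kernel\<close>

text \<open>The one-sided Dirichlet kernel; its squared modulus is \<open>N\<close> times the Fejer
  kernel.\<close>

definition dkern :: "nat => real => complex" where
 "dkern N t = (\<Sum>j<N. cis (real j * t))"

lemma dkern_sq: "cr ((cmod (dkern N t))^2) = (\<Sum>j<N. \<Sum>l<N. cis ((real j - real l) * t))"
 by (simp only: complex_norm_square) (simp add: dkern_def sum_product cis_cnj cis_mult left_diff_distrib)

text \<open>Exact quadrature: the squared modulus is a trigonometric polynomial with frequencies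
  below \<open>M\<close> in absolute value, and \<open>M <= N\<close> equispaced nodes see only its
  constant term.\<close>

lemma sum_dkern_sq:
 assumes "M <= N" "0 < N"
 shows "(\<Sum>n<N. (cmod (dkern M (2 * pi * real n / real N - t)))^2) = real N * real M"
proof -
 have "cr (\<Sum>n<N. (cmod (dkern M (2 * pi * real n / real N - t)))^2)
   = (\<Sum>n<N. \<Sum>j<M. \<Sum>l<M. cis ((real j - real l) * (2 * pi * real n / real N - t)))"
  by (simp only: of_real_sum dkern_sq)
 also have "... = (\<Sum>j<M. \<Sum>l<M. \<Sum>n<N. cis ((real j - real l) * (2 * pi * real n / real N - t)))"
  by (subst sum.swap) (intro sum.cong refl sum.swap)
 also have "... = (\<Sum>j<M. \<Sum>l<M. if l = j then of_nat N else 0)"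
 proof (intro sum.cong refl)
  fix j l assume "j \<in> {..<M}" "l \<in> {..<M}"
  have "(real j - real l) * (2 * pi * real n / real N - t)
    = - (real j - real l) * t + 2 * pi * real n * of_int (int j - int l) / real N" for n
   by (simp add: algebra_simps diff_divide_distrib)
  then have "(\<Sum>n<N. cis ((real j - real l) * (2 * pi * real n / real N - t)))
    = cis (- (real j - real l) * t) * (\<Sum>n<N. cis (2 * pi * real n * of_int (int j - int l) / real N))"
   by (simp only: cis_mult[symmetric] sum_distrib_left)
  also have "... = (if l = j then of_nat N else 0)"
   using \<open>j \<in> _\<close> \<open>l \<in> _\<close> assms by (subst sum_cis_roots_unity) auto
  finally show "(\<Sum>n<N. cis ((real j - real l) * (2 * pi * real n / real N - t)))
    = (if l = j then of_nat N else 0)" .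
 qed
 also have "... = cr (real N * real M)" by (simp add: sum.delta mult.commute)
 finally show ?thesis by (simp only: of_real_eq_iff)
qed

text \<open>The Fejer kernel with period \<open>N\<close>, scaled to the value one at zero. Its
  translates by \<open>0, ..., N - 1\<close> form a nonnegative partition of unity, so it
  interpolates between integer nodes.\<close>

definition kappa :: "nat => real => real" where
 "kappa N x = (cmod (dkern N (2 * pi * x / real N)))^2 / (real N)^2"

lemma kappa_nonneg: "0 <= kappa N x" by (simp add: kappa_def)

lemma kappa_minus: "kappa N (- x) = kappa N x"
proof -
 have "dkern N (- t) = cnj (dkern N t)" for t by (simp add: dkern_def cis_cnj)
 then show ?thesis by (simp add: kappa_def)
qed

lemma sum_kappa:
 assumes "0 < N"
 shows "(\<Sum>n<N. kappa N (v - real n)) = 1"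
proof -
 have "(\<Sum>n<N. kappa N (v - real n)) = (\<Sum>n<N. kappa N (real n - v))"
  using kappa_minus by (metis minus_diff_eq)
 also have "... = (\<Sum>n<N. (cmod (dkern N (2 * pi * real n / real N - 2 * pi * v / real N)))^2) / (real N)^2"
  by (simp add: kappa_def sum_divide_distrib diff_divide_distrib right_diff_distrib)
 also have "... = 1" using assms by (subst sum_dkern_sq) (auto simp: power2_eq_square)
 finally show ?thesis .
qed

text \<open>The double sum is read as an average over \<open>l\<close>: for fixed \<open>l\<close>
  the inner sum is a discrete Fourier transform shifted by \<open>l\<close>, the form that the
  Hankel estimate takes.\<close>

lemma kappa_eq_average:
 "cr (kappa N x)
  = (\<Sum>l<N. (\<Sum>j<N. cis (2 * pi * (real j - real l) * x / real N)) / of_nat N) / of_nat N"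
proof -
 have "cr (kappa N x) = (\<Sum>j<N. \<Sum>l<N. cis ((real j - real l) * (2 * pi * x / real N))) / (of_nat N)^2"
  unfolding kappa_def of_real_divide dkern_sq by simp
 also have "... = (\<Sum>l<N. \<Sum>j<N. cis ((real j - real l) * (2 * pi * x / real N))) / (of_nat N)^2"
  by (subst sum.swap) simp
 finally show ?thesis by (simp add: sum_divide_distrib power2_eq_square mult_ac)
qed

lemma cmod_dkern_le:
 assumes "sin (t / 2) \<noteq> 0"
 shows "cmod (dkern N t) <= 1 / \<bar>sin (t / 2)\<bar>"
proof -
 have c: "cmod (cis t - 1) = 2 * \<bar>sin (t / 2)\<bar>"
 proof -
  have "(cmod (cis t - 1))^2 = (cos t - 1)^2 + (sin t)^2" by (simp add: cmod_power2)
  also have "... = 2 - 2 * cos t" using sin_cos_squared_add[of t] by (simp add: power2_eq_square algebra_simps)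
  also have "... = (2 * \<bar>sin (t / 2)\<bar>)^2" using cos_double_sin[of "t / 2"] by (simp add: power_mult_distrib)
  finally show ?thesis by (rule power2_eq_imp_eq) auto
 qed
 then have "cis t \<noteq> 1" using assms by auto
 have "dkern N t = (\<Sum>j<N. cis t ^ j)" by (simp add: dkern_def Complex.DeMoivre)
 also have "... = (cis t ^ N - 1) / (cis t - 1)"
  using \<open>cis t \<noteq> 1\<close> by (subst geometric_sum) auto
 finally have "cmod (dkern N t) = cmod (cis t ^ N - 1) / (2 * \<bar>sin (t / 2)\<bar>)"
  by (simp add: norm_divide c)
 also have "... <= 2 / (2 * \<bar>sin (t / 2)\<bar>)"
  by (intro divide_right_mono order_trans[OF norm_triangle_ineq4]) (auto simp: norm_power)
 finally show ?thesis by simp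
qed

text \<open>A crude form of Jordan's inequality: a derivative test up to \<open>pi / 6\<close>,
  beyond it the value 1/2 of the sine together with \<open>pi < 4\<close>.\<close>

lemma sin_ge_quarter:
 assumes "0 <= x" "x <= pi / 2"
 shows "x / 4 <= sin x"
proof (cases "x <= pi / 6")
 case True
 have "sin 0 - 0 / 4 <= sin x - x / 4"
 proof (rule DERIV_nonneg_imp_nondecreasing[OF assms(1)])
  fix t assume t: "0 <= t" "t <= x"
  have "cos (pi / 3) <= cos t" using t True pi_gt_zero by (intro cos_monotone_0_pi_le) auto
  then have "0 <= cos t - 1 / 4" by (simp add: cos_60)
  moreover have "((\<lambda>t. sin t - t / 4) has_real_derivative (cos t - 1 / 4)) (at t)"
   by (auto intro!: derivative_eq_intros)
  ultimately show "\<exists>y. ((\<lambda>t. sin t - t / 4) has_real_derivative y) (at t) \<and> 0 <= y" by blast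
 qed
 then show ?thesis by simp
next
 case False
 have "1 / 2 = sin (pi / 6)" by (simp add: sin_30)
 also have "... <= sin x" using False assms pi_gt_zero by (intro sin_monotone_2pi_le) auto
 finally show ?thesis using assms pi_less_4 by linarith
qed

lemma kappa_le:
 assumes "0 < N" "x \<noteq> 0" "\<bar>x\<bar> <= real N / 2"
 shows "kappa N x <= 4 / x^2"
proof -
 define t where "t = pi * \<bar>x\<bar> / real N"
 have "1 * (\<bar>x\<bar> / real N) < pi * (\<bar>x\<bar> / real N)"
  using assms pi_gt3 by (intro mult_strict_right_mono) auto
 then have "2 * (\<bar>x\<bar> / real N) < t \<or> \<bar>x\<bar> / real N < t" by (simp add: t_def)
 have t: "0 <= t" "t <= pi / 2" using assms by (auto simp: t_def field_simps)
 have "2 * (\<bar>x\<bar> / real N) <= pi * (\<bar>x\<bar> / real N)"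
  using pi_ge_two by (intro mult_right_mono) auto
 then have "\<bar>x\<bar> / (2 * real N) <= t / 4" by (simp add: t_def)
 also have "... <= sin t" by (rule sin_ge_quarter[OF t])
 finally have s: "\<bar>x\<bar> / (2 * real N) <= \<bar>sin t\<bar>" by linarith
 have pos: "0 < \<bar>x\<bar> / (2 * real N)" using assms by simp
 have half: "2 * pi * \<bar>x\<bar> / real N / 2 = t" by (simp add: t_def)
 have "sin t \<noteq> 0" using s pos by linarith
 have "kappa N x = kappa N \<bar>x\<bar>" using kappa_minus[of N x] by (auto simp: abs_if)
 also have "... <= (1 / \<bar>sin t\<bar>)^2 / (real N)^2"
  unfolding kappa_def using cmod_dkern_le[of "2 * pi * \<bar>x\<bar> / real N" N] \<open>sin t \<noteq> 0\<close>
  by (intro divide_right_mono power_mono) (simp_all only: half, auto)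
 also have "... <= (1 / (\<bar>x\<bar> / (2 * real N)))^2 / (real N)^2"
  using s pos by (intro divide_right_mono power_mono divide_left_mono mult_pos_pos) (linarith | simp)+
 also have "... = 4 / x^2" using assms by (simp add: power_divide power_mult_distrib)
 finally show ?thesis .
qed

text \<open>Periodicity: beyond half the period it is the distance to \<open>N\<close> that governs
  the decay.\<close>

lemma kappa_le_shift:
 assumes "0 < N" "real N / 2 <= x" "x < real N"
 shows "kappa N x <= 4 / (real N - x)^2"
proof -
 have "dkern N (2 * pi * x / real N) = dkern N (2 * pi * (x - real N) / real N)" unfolding dkern_def
 proof (intro sum.cong refl)
  fix j
  have "real j * (2 * pi * x / real N) = real j * (2 * pi * (x - real N) / real N) + 2 * pi * real j"
   using assms(1) by (simp add: field_simps)
  then have "cis (real j * (2 * pi * x / real N))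
    = cis (real j * (2 * pi * (x - real N) / real N)) * cis (2 * pi * real j)" by (simp only: cis_mult)
  also have "cis (2 * pi * real j) = 1"
   using cos_int_2pin[of "int j"] sin_int_2pin[of "int j"] by (simp add: complex_eq_iff)
  finally show "cis (real j * (2 * pi * x / real N)) = cis (real j * (2 * pi * (x - real N) / real N))"
   by simp
 qed
 then have "kappa N x = kappa N (x - real N)" by (simp add: kappa_def)
 also have "... <= 4 / (x - real N)^2" using assms by (intro kappa_le) auto
 finally show ?thesis by (simp add: power2_commute)
qed

text \<open>Comparison with a telescoping sum. It is stated over integers so that nodes to the left,
  and nodes wrapped around the period, are covered by reflecting the index.\<close>

lemma sum_inverse_squares_le:
 fixes S :: "int set" and c A :: real
 assumes "finite S" "1 < A" and S: "\<And>n. n \<in> S ==> A <= of_int n - c"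
 shows "(\<Sum>n\<in>S. 1 / (of_int n - c)^2) <= 1 / (A - 1)"
proof -
 define m where "m = \<lceil>c + A\<rceil>"
 define a where "a = of_int m - c"
 have a: "A <= a" unfolding a_def m_def by linarith
 have m: "m <= n" if "n \<in> S" for n using S[OF that] unfolding m_def by linarith
 obtain K where K: "\<And>n. n \<in> S ==> nat (n - m) < K"
  using finite_nat_set_iff_bounded[of "(\<lambda>n. nat (n - m)) ` S"] assms(1) by auto
 have "(\<Sum>n\<in>S. 1 / (of_int n - c)^2) = (\<Sum>k\<in>(\<lambda>n. nat (n - m)) ` S. 1 / (a + real k)^2)"
  using m by (subst sum.reindex) (auto simp: inj_on_def a_def eq_nat_nat_iff)
 also have "... <= (\<Sum>k<K. 1 / (a + real k)^2)" using K by (intro sum_mono2) auto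
 also have "... <= 1 / (a - 1) - 1 / (a - 1 + real K)"
 proof (induction K)
  case (Suc K)
  have pos: "0 < a - 1 + real K" using a assms by linarith
  have "1 / (a + real K)^2 <= 1 / ((a - 1 + real K) * (a + real K))"
   using pos by (intro divide_left_mono) (auto simp: power2_eq_square)
  also have "... = 1 / (a - 1 + real K) - 1 / (a - 1 + real (Suc K))" using pos by (simp add: field_simps)
  finally show ?case using Suc by simp
 qed simp
 also have "... <= 1 / (a - 1)" using a assms by simp
 also have "... <= 1 / (A - 1)" using a assms by (intro divide_left_mono) auto
 finally show ?thesis .
qed

text \<open>Three groups of nodes contribute \<open>4 / (A - 1)\<close> each: to the right of
  \<open>v\<close> within half a period (\<open>R\<close>), to the left (\<open>L\<close>), and
  wrapped around (\<open>W\<close>). For the last group the relevant distance is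
  \<open>real N + v - real n\<close>, and it is the alternative \<open>A <= v\<close> in the
  hypothesis that keeps this distance at least \<open>A\<close>.\<close>

lemma sum_kappa_far:
 assumes N: "0 < N" "\<bar>v\<bar> <= real N / 4" and A: "1 < A"
  and F: "F \<subseteq> {..<N}" "\<And>n. n \<in> F ==> A <= \<bar>real n - v\<bar>"
   "\<And>n. n \<in> F ==> real n - v <= real N / 2 \<or> A <= v"
 shows "(\<Sum>n\<in>F. kappa N (v - real n)) <= 12 / (A - 1)"
proof -
 have fin: "finite F" using F(1) finite_subset by auto
 define R where "R = {n \<in> F. v <= real n \<and> real n - v <= real N / 2}"
 define L where "L = {n \<in> F. real n < v}"
 define W where "W = {n \<in> F. real N / 2 < real n - v}"
 have sets: "F = R \<union> (L \<union> W)" "R \<inter> (L \<union> W) = {}" "L \<inter> W = {}" and fins: "finite R" "finite L" "finite W"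
  using fin N by (auto simp: R_def L_def W_def)
 have R: "(\<Sum>n\<in>R. kappa N (v - real n)) <= 4 * (1 / (A - 1))"
 proof -
  have "(\<Sum>n\<in>R. kappa N (v - real n)) <= (\<Sum>n\<in>R. 4 * (1 / (real n - v)^2))"
  proof (rule sum_mono)
   fix n assume n: "n \<in> R"
   then have "A <= real n - v" using F(2)[of n] by (auto simp: R_def)
   then have "kappa N (v - real n) <= 4 / (v - real n)^2" using n A by (intro kappa_le N) (auto simp: R_def)
   then show "kappa N (v - real n) <= 4 * (1 / (real n - v)^2)" by (simp add: power2_commute)
  qed
  also have "... = 4 * (\<Sum>n\<in>int ` R. 1 / (of_int n - v)^2)"
   by (simp add: sum.reindex sum_distrib_left)
  also have "... <= 4 * (1 / (A - 1))"
   using fins F(2) by (intro mult_left_mono sum_inverse_squares_le A) (force simp: R_def)+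
  finally show ?thesis .
 qed
 have L: "(\<Sum>n\<in>L. kappa N (v - real n)) <= 4 * (1 / (A - 1))"
 proof -
  have "(\<Sum>n\<in>L. kappa N (v - real n)) <= (\<Sum>n\<in>L. 4 * (1 / (real n - v)^2))"
  proof (rule sum_mono)
   fix n assume n: "n \<in> L"
   then have "kappa N (v - real n) <= 4 / (v - real n)^2" using N by (intro kappa_le N) (auto simp: L_def)
   then show "kappa N (v - real n) <= 4 * (1 / (real n - v)^2)" by (simp add: power2_commute)
  qed
  also have "... = 4 * (\<Sum>n\<in>(\<lambda>n. - int n) ` L. 1 / (of_int n - (- v))^2)"
   by (simp add: sum.reindex inj_on_def sum_distrib_left power2_commute)
  also have "... <= 4 * (1 / (A - 1))"
   using fins F(2) by (intro mult_left_mono sum_inverse_squares_le A) (force simp: L_def)+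
  finally show ?thesis .
 qed
 have W: "(\<Sum>n\<in>W. kappa N (v - real n)) <= 4 * (1 / (A - 1))"
 proof -
  have v: "A <= v" if "n \<in> W" for n using F(3)[of n] that by (auto simp: W_def)
  have "(\<Sum>n\<in>W. kappa N (v - real n)) <= (\<Sum>n\<in>W. 4 * (1 / (real N + v - real n)^2))"
  proof (rule sum_mono)
   fix n assume n: "n \<in> W"
   have "kappa N (v - real n) = kappa N (real n - v)" using kappa_minus by (metis minus_diff_eq)
   also have "... <= 4 / (real N - (real n - v))^2"
    using n v[OF n] A F(1) by (intro kappa_le_shift N) (auto simp: W_def)
   finally show "kappa N (v - real n) <= 4 * (1 / (real N + v - real n)^2)" by (simp add: algebra_simps)
  qed
  also have "... = 4 * (\<Sum>n\<in>(\<lambda>n. int N - int n) ` W. 1 / (of_int n - (- v))^2)"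
   by (simp add: sum.reindex inj_on_def sum_distrib_left algebra_simps)
  also have "... <= 4 * (1 / (A - 1))"
   using fins F(1) v by (intro mult_left_mono sum_inverse_squares_le A) (force simp: W_def)+
  finally show ?thesis .
 qed
 have "(\<Sum>n\<in>F. kappa N (v - real n)) = (\<Sum>n\<in>R. kappa N (v - real n)) + ((\<Sum>n\<in>L. kappa N (v - real n)) + (\<Sum>n\<in>W. kappa N (v - real n)))"
  using sets fins by (metis sum.union_disjoint finite_UnI)
 then show ?thesis using R L W by simp
qed

section \<open>Quadrature for Fejer means and for polynomial coefficients\<close>

lemma triangle_sum:
 fixes c :: "nat => complex"
 shows "(\<Sum>a<M. \<Sum>b\<le>a. c (a - b)) = (\<Sum>n<M. of_nat (M - n) * c n)"
proof (induction M)
 case (Suc M)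
 have "(\<Sum>b\<le>M. c (M - b)) = (\<Sum>n\<le>M. c n)"
  by (rule sum.reindex_bij_witness[of _ "\<lambda>n. M - n" "\<lambda>n. M - n"]) auto
 also have "... = (\<Sum>n<Suc M. c n)" by (simp add: lessThan_Suc_atMost)
 finally have "(\<Sum>a<Suc M. \<Sum>b\<le>a. c (a - b)) = (\<Sum>n<M. of_nat (M - n) * c n) + (\<Sum>n<Suc M. c n)"
  using Suc by simp
 also have "... = (\<Sum>n<Suc M. of_nat (Suc M - n) * c n)"
  by (simp add: Suc_diff_le algebra_simps sum.distrib flip: sum.distrib)
 finally show ?case .
qed simp

text \<open>The inner sum is \<open>g\<close> integrated against the nonnegative Fejer kernel
  \<open>F\<close>, because the terms with negative frequency vanish for \<open>g \<in> H1\<close>.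
  Summing over the \<open>N\<close> nodes under the integral, exact quadrature replaces the kernel
  by the constant \<open>N\<close>. So the discrete mean of the modulus is at most the
  \<open>L1\<close> norm, uniformly in the mesh \<open>\<tau>\<close>.\<close>

lemma fejer_poly_mean_le:
 assumes g: "g \<in> H1" and M: "0 < M" "M <= N" and \<tau>: "0 <= \<tau>"
 shows "(\<Sum>j<N. cmod (\<Sum>n<M. of_real (1 - real n / real M) * fourier g (real n * \<tau>)
   * cis (2 * pi * real j * real n / real N))) <= real N * L1norm g"
proof -
 have int: "L1 g" and neg: "\<And>u. u <= 0 ==> fourier g u = 0" using g by (auto simp: H1_def)
 have N: "0 < N" using M by simp
 have ints: "L1 (\<lambda>t. g t * cis (a * t + b))" for a b
 proof (rule bintble_bound[OF int])
  have [measurable]: "(\<lambda>t. cis (a * t + b)) \<in> borel_measurable borel"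
   by (intro measurable_contI continuous_intros)
  have [measurable]: "g \<in> borel_measurable borel" using int by simp
  show "(\<lambda>t. g t * cis (a * t + b)) \<in> borel_measurable lborel" by measurable
 qed (simp add: norm_mult)
 have fou: "fourier g u * cis b = (LBINT t. g t * cis (- u * t + b))" for u b
 proof -
  have "fourier g u = (LBINT t. g t * cis (- u * t))"
   unfolding fourier_def by (intro bint_cong refl) (simp add: cis_conv_exp mult_ac)
  then have "fourier g u * cis b = (LBINT t. g t * cis (- u * t) * cis b)" by simp
  then show ?thesis by (simp add: mult.assoc cis_mult)
 qed
 define F where "F \<theta> t = (cmod (dkern M (\<theta> - \<tau> * t)))^2 / real M" for \<theta> t
 have F: "of_real (F \<theta> t) = (\<Sum>a<M. \<Sum>b<M. cis (- (real a - real b) * \<tau> * t + (real a - real b) * \<theta>)) / of_nat M" for \<theta> t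
  unfolding F_def of_real_divide dkern_sq by (simp add: algebra_simps)
 have intF: "L1 (\<lambda>t. g t * of_real (F \<theta> t))" for \<theta>
  unfolding F sum_distrib_left times_divide_eq_right by (intro integrable_divide bintble_sum ints)
 have eq: "(\<Sum>n<M. of_real (1 - real n / real M) * fourier g (real n * \<tau>) * cis (\<theta> * real n))
   = (LBINT t. g t * of_real (F \<theta> t))" for \<theta>
 proof -
  have "(LBINT t. g t * of_real (F \<theta> t))
    = (\<Sum>a<M. \<Sum>b<M. fourier g ((real a - real b) * \<tau>) * cis ((real a - real b) * \<theta>)) / of_nat M"
  proof -
   have "(LBINT t. g t * of_real (F \<theta> t))
     = (LBINT t. (\<Sum>a<M. \<Sum>b<M. g t * cis (- (real a - real b) * \<tau> * t + (real a - real b) * \<theta>)) / of_nat M)"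
    by (simp only: F sum_distrib_left times_divide_eq_right)
   also have "... = (\<Sum>a<M. \<Sum>b<M. LBINT t. g t * cis (- (real a - real b) * \<tau> * t + (real a - real b) * \<theta>)) / of_nat M"
    by (simp only: integral_divide_zero bint_sum bintble_sum ints)
   finally show ?thesis by (simp only: fou minus_mult_left)
  qed
  also have "(\<Sum>a<M. \<Sum>b<M. fourier g ((real a - real b) * \<tau>) * cis ((real a - real b) * \<theta>))
    = (\<Sum>a<M. \<Sum>b\<le>a. fourier g (real (a - b) * \<tau>) * cis (real (a - b) * \<theta>))"
  proof (rule sum.cong[OF refl])
   fix a assume "a \<in> {..<M}"
   have "(\<Sum>b<M. fourier g ((real a - real b) * \<tau>) * cis ((real a - real b) * \<theta>))
     = (\<Sum>b\<le>a. fourier g ((real a - real b) * \<tau>) * cis ((real a - real b) * \<theta>))"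
    using \<open>a \<in> _\<close> \<tau> by (intro sum.mono_neutral_right) (auto simp: neg mult_nonpos_nonneg)
   then show "(\<Sum>b<M. fourier g ((real a - real b) * \<tau>) * cis ((real a - real b) * \<theta>))
     = (\<Sum>b\<le>a. fourier g (real (a - b) * \<tau>) * cis (real (a - b) * \<theta>))"
    by (simp add: of_nat_diff)
  qed
  also have "... = (\<Sum>n<M. of_nat (M - n) * (fourier g (real n * \<tau>) * cis (real n * \<theta>)))"
   by (rule triangle_sum)
  also have "... / of_nat M = (\<Sum>n<M. of_real (1 - real n / real M) * fourier g (real n * \<tau>) * cis (\<theta> * real n))"
   unfolding sum_divide_distrib using M by (intro sum.cong refl) (simp add: of_nat_diff field_simps)
  finally show ?thesis by simp
 qed
 have F0: "0 <= F \<theta> t" for \<theta> t by (simp add: F_def)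
 have intFn: "L1 (\<lambda>t. cmod (g t) * F \<theta> t)" for \<theta>
  using integrable_norm[OF intF[of \<theta>]] F0 by (simp add: norm_mult)
 have "(\<Sum>j<N. cmod (\<Sum>n<M. of_real (1 - real n / real M) * fourier g (real n * \<tau>)
   * cis (2 * pi * real j * real n / real N)))
   = (\<Sum>j<N. cmod (LBINT t. g t * of_real (F (2 * pi * real j / real N) t)))" by (simp add: eq[symmetric])
 also have "... <= (\<Sum>j<N. LBINT t. cmod (g t) * F (2 * pi * real j / real N) t)"
  by (intro sum_mono order_trans[OF integral_norm_bound]) (simp add: norm_mult F0)
 also have "... = (LBINT t. (\<Sum>j<N. cmod (g t) * F (2 * pi * real j / real N) t))"
  by (rule bint_sum[symmetric]) (rule intFn)
 also have "... = (LBINT t. cmod (g t) * real N)"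
 proof (intro bint_cong refl)
  fix t
  have "(\<Sum>j<N. F (2 * pi * real j / real N) t) = real N"
   using sum_dkern_sq[OF M(2) N, of "\<tau> * t"] M by (simp add: F_def flip: sum_divide_distrib)
  then show "(\<Sum>j<N. cmod (g t) * F (2 * pi * real j / real N) t) = cmod (g t) * real N"
   by (simp flip: sum_distrib_left)
 qed
 also have "... = real N * L1norm g" by (simp add: L1norm_def)
 finally show ?thesis .
qed

text \<open>The discrete Parseval identity; degree below \<open>N\<close> excludes aliasing.\<close>

lemma sum_coeff_sq_eq_mean:
 assumes "degree W < N"
 shows "(\<Sum>n<N. (cmod (coeff W n))^2) = (\<Sum>j<N. (cmod (poly W (cis (2 * pi * real j / real N))))^2) / real N"
proof -
 let ?c = "coeff W"
 have N: "0 < N" using assms by simp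
 have pol: "poly W (cis (2 * pi * real j / real N)) = (\<Sum>n<N. ?c n * cis (2 * pi * real j * real n / real N))" for j
 proof -
  have "poly W z = (\<Sum>n<N. ?c n * z ^ n)" for z
   unfolding poly_altdef using assms by (intro sum.mono_neutral_left) (auto intro!: coeff_eq_0)
  then show ?thesis by (simp add: Complex.DeMoivre mult_ac)
 qed
 have "cr (\<Sum>j<N. (cmod (poly W (cis (2 * pi * real j / real N))))^2)
   = (\<Sum>j<N. \<Sum>n<N. \<Sum>m<N. ?c n * cnj (?c m) * cis (2 * pi * real j * of_int (int n - int m) / real N))"
  unfolding of_real_sum
 proof (rule sum.cong[OF refl])
  fix j
  let ?A = "\<lambda>n. 2 * pi * real j * real n / real N"
  have "cr ((cmod (poly W (cis (2 * pi * real j / real N))))^2)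
    = (\<Sum>n<N. ?c n * cis (?A n)) * (\<Sum>m<N. cnj (?c m) * cis (- ?A m))"
   unfolding complex_norm_square pol by (simp add: cis_cnj)
  also have "... = (\<Sum>n<N. \<Sum>m<N. ?c n * cnj (?c m) * cis (?A n + - ?A m))"
   by (simp add: sum_product mult_ac cis_mult)
  also have "... = (\<Sum>n<N. \<Sum>m<N. ?c n * cnj (?c m) * cis (2 * pi * real j * of_int (int n - int m) / real N))"
   by (simp add: right_diff_distrib diff_divide_distrib)
  finally show "cr ((cmod (poly W (cis (2 * pi * real j / real N))))^2)
    = (\<Sum>n<N. \<Sum>m<N. ?c n * cnj (?c m) * cis (2 * pi * real j * of_int (int n - int m) / real N))" .
 qed
 also have "... = (\<Sum>n<N. \<Sum>m<N. \<Sum>j<N. ?c n * cnj (?c m) * cis (2 * pi * real j * of_int (int n - int m) / real N))"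
  by (subst sum.swap) (intro sum.cong refl sum.swap)
 also have "... = (\<Sum>n<N. \<Sum>m<N. if m = n then ?c n * cnj (?c m) * of_nat N else 0)"
 proof (intro sum.cong refl)
  fix n m assume "n \<in> {..<N}" "m \<in> {..<N}"
  then have "(\<Sum>j<N. cis (2 * pi * real j * of_int (int n - int m) / real N)) = (if m = n then of_nat N else 0)"
   by (subst sum_cis_roots_unity) auto
  then show "(\<Sum>j<N. ?c n * cnj (?c m) * cis (2 * pi * real j * of_int (int n - int m) / real N))
    = (if m = n then ?c n * cnj (?c m) * of_nat N else 0)" by (simp flip: sum_distrib_left)
 qed
 also have "... = cr ((\<Sum>n<N. (cmod (?c n))^2) * real N)"
  unfolding of_real_mult of_real_sum complex_norm_square by (simp add: sum_distrib_right)
 finally have "(\<Sum>j<N. (cmod (poly W (cis (2 * pi * real j / real N))))^2) = (\<Sum>n<N. (cmod (?c n))^2) * real N"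
  by (simp only: of_real_eq_iff)
 then show ?thesis using N by simp
qed

section \<open>Riesz factorisation of polynomials\<close>

text \<open>The radius \<open>2 / (1 + cmod a)\<close> exceeds one and still keeps
  \<open>cmod (a * z)\<close> below one, so \<open>1 - a * z\<close> stays in the right half-plane,
  away from the cut of \<open>csqrt\<close>.\<close>

lemma holomorphic_sqrt_linear:
 assumes "cmod a < 1"
 shows "(\<lambda>z. csqrt (1 - a * z)) holomorphic_on ball 0 (2 / (1 + cmod a))"
  and "z \<in> ball 0 (2 / (1 + cmod a)) ==> 1 - a * z \<noteq> 0"
proof -
 have "cmod (a * z) < 1" if "z \<in> ball 0 (2 / (1 + cmod a))" for z
 proof (cases "a = 0")
  case False
  have "cmod (a * z) < cmod a * (2 / (1 + cmod a))"
   unfolding norm_mult using that False by (intro mult_strict_left_mono) auto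
  also have "... <= 1" using assms by (simp add: divide_simps add_pos_nonneg)
  finally show ?thesis .
 qed simp
 then have pos: "0 < Re (1 - a * z)" if "z \<in> ball 0 (2 / (1 + cmod a))" for z
  using complex_Re_le_cmod[of "a * z"] that by fastforce
 then show "(\<lambda>z. csqrt (1 - a * z)) holomorphic_on ball 0 (2 / (1 + cmod a))"
  by (intro holomorphic_intros) (force simp: complex_nonpos_Reals_iff)
 show "z \<in> ball 0 (2 / (1 + cmod a)) ==> 1 - a * z \<noteq> 0"
  using pos[of z] by (metis less_irrefl zero_complex.sel(1))
qed

text \<open>Induction over the roots. A root outside the closed disc gives \<open>z - a\<close> a
  holomorphic square root, which goes to both factors. For a root inside,
  \<open>cmod (z - a) = cmod (1 - cnj a * z)\<close> on the circle; with \<open>s\<close> the square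
  root of \<open>1 - cnj a * z\<close>, one factor receives \<open>(z - a) / s\<close> and the other
  \<open>s\<close>. Either way both factors gain the modulus \<open>sqrt (cmod (z - a))\<close> on
  the circle. A disc of radius above one survives since no root lies on the circle.\<close>

lemma holomorphic_riesz_factor:
 fixes p :: "complex poly"
 assumes "p \<noteq> 0" "\<And>z. cmod z = 1 ==> poly p z \<noteq> 0"
 shows "\<exists>R>1. \<exists>w v. w holomorphic_on ball 0 R \<and> v holomorphic_on ball 0 R \<and>
  (\<forall>z\<in>ball 0 R. w z * v z = poly p z) \<and>
  (\<forall>z. cmod z = 1 \<longrightarrow> (cmod (w z))^2 = cmod (poly p z) \<and> (cmod (v z))^2 = cmod (poly p z))"
 using assms
proof (induction "degree p" arbitrary: p)
 case 0
 then obtain c where p: "p = [:c:]" by (metis degree_eq_zeroE)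
 have c: "csqrt c * csqrt c = c" by (metis power2_csqrt power2_eq_square)
 then have "(cmod (csqrt c))^2 = cmod c" by (metis norm_mult power2_eq_square)
 with c show ?case unfolding p by (intro exI[of _ 2] conjI exI[of _ "\<lambda>_. csqrt c"]) auto
next
 case (Suc n)
 have "\<not> (\<exists>a l. a \<noteq> 0 \<and> l = 0 \<and> p = pCons a l)" using Suc.hyps(2) by auto
 then obtain a where a: "poly p a = 0" using fundamental_theorem_of_algebra_alt by blast
 then obtain q where p: "p = [:- a, 1:] * q" by (metis dvdE poly_eq_0_iff_dvd)
 have q0: "q \<noteq> 0" using Suc.prems(1) p by auto
 have "degree p = Suc (degree q)" using q0 unfolding p by (subst degree_mult_eq) auto
 then have dq: "n = degree q" using Suc.hyps(2) by simp
 have pz: "poly p z = (z - a) * poly q z" for z by (simp add: p algebra_simps)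
 have a1: "cmod a \<noteq> 1" using Suc.prems(2) a by blast
 have "poly q z \<noteq> 0" if "cmod z = 1" for z using Suc.prems(2)[OF that] pz by auto
 from Suc.hyps(1)[OF dq q0 this] obtain R w v where R: "1 < R" "w holomorphic_on ball 0 R" "v holomorphic_on ball 0 R"
  and wv: "\<And>z. z \<in> ball 0 R ==> w z * v z = poly q z"
  and circ: "\<And>z. cmod z = 1 ==> (cmod (w z))^2 = cmod (poly q z)" "\<And>z. cmod z = 1 ==> (cmod (v z))^2 = cmod (poly q z)"
  by blast
 have csq: "csqrt b * csqrt b = b" "(cmod (csqrt b))^2 = cmod b" for b
  by (metis power2_csqrt power2_eq_square, metis norm_power power2_csqrt)
 show ?case
 proof (cases "1 < cmod a")
  case True
  have a': "cmod (1 / a) < 1" "a \<noteq> 0" using True by (auto simp: norm_divide divide_less_eq)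
  define R' where "R' = min R (2 / (1 + cmod (1 / a)))"
  \<comment> \<open>The constant \<open>- a\<close> is split off before the root is taken, since
    \<open>csqrt\<close> is holomorphic at \<open>1 - z / a\<close> but may meet its cut at
    \<open>z - a\<close>.\<close>
  define s where "s z = csqrt (- a) * csqrt (1 - (1 / a) * z)" for z
  have "1 < 2 / (1 + cmod (1 / a))" using a' by (simp add: divide_simps add_pos_nonneg)
  then have "1 < R'" using R(1) by (simp add: R'_def)
  moreover have "s holomorphic_on ball 0 R'" unfolding s_def
   by (intro holomorphic_on_mult holomorphic_on_const
     holomorphic_on_subset[OF holomorphic_sqrt_linear(1)[OF a'(1)]]) (auto simp: R'_def)
  then have "(\<lambda>z. w z * s z) holomorphic_on ball 0 R'" "(\<lambda>z. v z * s z) holomorphic_on ball 0 R'"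
   using R by (auto intro!: holomorphic_on_mult simp: R'_def elim: holomorphic_on_subset)
  moreover have ss: "s z * s z = z - a" for z
  proof -
   have "s z * s z = (csqrt (- a) * csqrt (- a)) * (csqrt (1 - (1 / a) * z) * csqrt (1 - (1 / a) * z))"
    by (simp add: s_def)
   then show ?thesis using a'(2) by (simp only: csq) (simp add: field_simps)
  qed
  moreover have "w z * s z * (v z * s z) = poly p z" if "z \<in> ball 0 R'" for z
  proof -
   have "w z * s z * (v z * s z) = (w z * v z) * (s z * s z)" by simp
   also have "... = poly q z * (z - a)" unfolding ss using wv[of z] that by (simp add: R'_def)
   finally show ?thesis by (simp add: pz mult.commute)
  qed
  moreover have "(cmod (s z))^2 = cmod (z - a)" for z using ss[of z] by (metis norm_mult power2_eq_square)
  then have "(cmod (w z * s z))^2 = cmod (poly p z)" "(cmod (v z * s z))^2 = cmod (poly p z)"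
   if "cmod z = 1" for z using circ[OF that] by (simp_all add: norm_mult power_mult_distrib pz)
  ultimately show ?thesis by blast
 next
  case False
  then have a': "cmod (cnj a) < 1" using a1 by simp
  define R' where "R' = min R (2 / (1 + cmod (cnj a)))"
  define s where "s z = csqrt (1 - cnj a * z)" for z
  have "1 < 2 / (1 + cmod (cnj a))" using a' by (simp add: divide_simps add_pos_nonneg)
  then have R': "1 < R'" using R(1) by (simp add: R'_def)
  have s0: "s z \<noteq> 0" if "z \<in> ball 0 R'" for z
   using holomorphic_sqrt_linear(2)[OF a', of z] that by (auto simp: R'_def s_def)
  have hs: "s holomorphic_on ball 0 R'"
   unfolding s_def by (rule holomorphic_on_subset[OF holomorphic_sqrt_linear(1)[OF a']]) (auto simp: R'_def)
  have hwv: "w holomorphic_on ball 0 R'" "v holomorphic_on ball 0 R'"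
   using R by (auto simp: R'_def elim: holomorphic_on_subset)
  have "(\<lambda>z. w z * ((z - a) / s z)) holomorphic_on ball 0 R'" "(\<lambda>z. v z * s z) holomorphic_on ball 0 R'"
   using hs hwv s0 by (auto intro!: holomorphic_intros)
  moreover have "w z * ((z - a) / s z) * (v z * s z) = poly p z" if "z \<in> ball 0 R'" for z
   using wv[of z] that s0[OF that] by (simp add: pz R'_def field_simps)
  moreover have "(cmod (w z * ((z - a) / s z)))^2 = cmod (poly p z)" "(cmod (v z * s z))^2 = cmod (poly p z)"
   if z: "cmod z = 1" for z
  proof -
   have "z * cnj z = 1" using z by (simp add: complex_norm_square[symmetric])
   then have "1 - cnj a * z = z * cnj (z - a)" by (simp add: algebra_simps)
   then have s2: "(cmod (s z))^2 = cmod (z - a)"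
    unfolding s_def csq by (metis z complex_mod_cnj mult_1 norm_mult)
   have "s z \<noteq> 0" using s0[of z] z R' by simp
   then have "cmod (z - a) \<noteq> 0" using s2 by (metis norm_eq_zero zero_eq_power2)
   then show "(cmod (w z * ((z - a) / s z)))^2 = cmod (poly p z)"
    using circ(1)[OF z] s2 by (simp add: norm_mult norm_divide power_mult_distrib power_divide pz)
     (simp add: power2_eq_square)
   show "(cmod (v z * s z))^2 = cmod (poly p z)"
    using circ(2)[OF z] s2 by (simp add: norm_mult power_mult_distrib pz)
  qed
  ultimately show ?thesis using R' by blast
 qed
qed

lemma holomorphic_poly_approx:
 assumes w: "w holomorphic_on ball 0 R" and r: "0 < r" "r < R" and e: "0 < e"
 obtains W where "\<And>z. cmod z <= r ==> cmod (poly W z - w z) <= e"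
proof -
 define c where "c n = (deriv ^^ n) w 0 / fact n" for n
 have sums: "(\<lambda>n. c n * z ^ n) sums w z" if "cmod z < R" for z
  using holomorphic_power_series[OF w, of z] that by (simp add: c_def)
 define x where "x = cr ((r + R) / 2)"
 have x: "cmod x = (r + R) / 2" using r unfolding x_def norm_of_real by simp
 have sm: "summable (\<lambda>n. cmod (c n * of_real r ^ n))"
  using powser_insidea[of c x "of_real r"] sums[of x] x r sums_summable by fastforce
 obtain d where d: "\<And>n. n \<ge> d ==> norm (\<Sum>i. cmod (c (i + n) * of_real r ^ (i + n))) < e"
  using suminf_exist_split[OF e sm] by auto
 define W where "W = (\<Sum>n<d. monom (c n) n)"
 show thesis
 proof (rule that[of W])
  fix z :: complex assume z: "cmod z <= r"
  have zn: "cmod (c n * z ^ n) <= cmod (c n * of_real r ^ n)" for n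
   using z r by (simp add: norm_mult norm_power mult_left_mono power_mono)
  have sz: "(\<lambda>n. c n * z ^ n) sums w z" using z r by (intro sums) auto
  have smz: "summable (\<lambda>n. cmod (c n * z ^ n))"
   by (rule summable_comparison_test'[OF sm, of 0]) (use zn in auto)
  have "w z = (\<Sum>n. c (n + d) * z ^ (n + d)) + (\<Sum>n<d. c n * z ^ n)"
   using suminf_split_initial_segment[OF sums_summable[OF sz], of d] sums_unique[OF sz] by simp
  moreover have "poly W z = (\<Sum>n<d. c n * z ^ n)" by (simp add: W_def poly_sum poly_monom)
  ultimately have "cmod (poly W z - w z) = cmod (\<Sum>n. c (n + d) * z ^ (n + d))"
   by (simp add: norm_minus_commute)
  also have "... <= (\<Sum>n. cmod (c (n + d) * z ^ (n + d)))"
   using summable_ignore_initial_segment[OF smz, of d] by (intro summable_norm)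
  also have "... <= (\<Sum>n. cmod (c (n + d) * of_real r ^ (n + d)))"
   using summable_ignore_initial_segment[OF smz, of d] summable_ignore_initial_segment[OF sm, of d]
   by (intro suminf_le zn)
  also have "... <= e" using d[of d] by auto
  finally show "cmod (poly W z - w z) <= e" .
 qed
qed

text \<open>Cauchy's coefficient estimate, read off from the discrete Parseval identity for the
  dilated polynomial, and summed as a geometric series. The bound must hold on a circle of radius
  above one to yield the sum of the coefficients.\<close>

lemma coeff_sum_le_of_bound:
 fixes Q :: "complex poly"
 assumes r: "1 < r" and Q: "\<And>z. cmod z = r ==> cmod (poly Q z) <= e"
 shows "(\<Sum>n<N. cmod (coeff Q n)) <= e * (r / (r - 1))"
proof -
 have e: "0 <= e" using Q[of "of_real r"] r by (auto intro: order_trans[OF norm_ge_zero])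
 let ?P = "pcompose Q [:0, of_real r:]"
 have cf: "cmod (coeff Q n) <= e * (1 / r) ^ n" for n
 proof -
  define M where "M = Suc (max n (degree ?P))"
  have "(cmod (coeff ?P n))^2 <= (\<Sum>n<M. (cmod (coeff ?P n))^2)"
   by (rule member_le_sum) (auto simp: M_def)
  also have "... = (\<Sum>j<M. (cmod (poly ?P (cis (2 * pi * real j / real M))))^2) / real M"
   by (rule sum_coeff_sq_eq_mean) (auto simp: M_def)
  also have "... <= (\<Sum>j<M. e^2) / real M" using r by (intro divide_right_mono sum_mono power_mono)
    (auto simp: poly_pcompose norm_mult intro!: Q)
  also have "... = e^2" by (simp add: M_def)
  finally have "cmod (coeff ?P n) <= e" using e power2_le_imp_le by blast
  then show ?thesis using r by (simp add: coeff_pcompose_linear norm_mult norm_power field_simps)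
 qed
 have "(\<Sum>n<N. cmod (coeff Q n)) <= (\<Sum>n<N. e * (1 / r) ^ n)" by (rule sum_mono) (rule cf)
 also have "... <= e * (\<Sum>n. (1 / r) ^ n)"
  using r e by (simp only: sum_distrib_left[symmetric]) (intro mult_left_mono sum_le_suminf summable_geometric, auto)
 also have "(\<Sum>n. (1 / r) ^ n) = r / (r - 1)" using r by (subst suminf_geometric) (auto simp: field_simps)
 finally show ?thesis .
qed

text \<open>A dilation by \<open>s\<close> slightly below one moves all roots off the circle, since
  only finitely many moduli are forbidden. The holomorphic factors live on a disc of radius above
  one, so Taylor polynomials approximate them uniformly on a circle \<open>r > 1\<close>, and this
  controls the sum of the coefficient errors.\<close>

lemma riesz_factorisation_poly:
 fixes p :: "complex poly"
 assumes \<eta>: "0 < \<eta>"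
 obtains W V where "\<And>z. cmod z = 1 ==> (cmod (poly W z))^2 <= cmod (poly p z) + \<eta>"
  "\<And>z. cmod z = 1 ==> (cmod (poly V z))^2 <= cmod (poly p z) + \<eta>"
  "\<And>N. (\<Sum>n<N. cmod (coeff (W * V - p) n)) <= \<eta>"
proof (cases "p = 0")
 case True
 then show thesis using \<eta> by (intro that[of 0 0]) auto
next
 case False
 define d where "d s = (\<Sum>n\<le>degree p. cmod (coeff p n) * \<bar>s ^ n - 1\<bar>)" for s :: real
 have "isCont d 1" unfolding d_def by (intro continuous_intros)
 then have "(d \<longlongrightarrow> d 1) (at 1)" by (simp add: isCont_def)
 then have "eventually (\<lambda>s. d s < \<eta> / 2) (at 1)"
  using \<eta> by (elim order_tendstoD(2)) (simp add: d_def)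
 then obtain \<delta> where \<delta>: "0 < \<delta>" "\<And>s. s \<noteq> 1 ==> dist s 1 < \<delta> ==> d s < \<eta> / 2"
  by (auto simp: eventually_at)
 have "finite (cmod ` {z. poly p z = 0})" using poly_roots_finite[OF False] by simp
 moreover have "infinite {max (1 - \<delta>) 0<..<1::real}" using \<delta>(1) by (intro infinite_Ioo) auto
 ultimately have "infinite ({max (1 - \<delta>) 0<..<1} - cmod ` {z. poly p z = 0})"
  by (rule Diff_infinite_finite)
 then obtain s where s: "s \<in> {max (1 - \<delta>) 0<..<1}" "s \<notin> cmod ` {z. poly p z = 0}"
  by (metis Diff_iff ex_in_conv finite.emptyI)
 then have s01: "0 < s" "s < 1" "d s < \<eta> / 2" using \<delta>(2)[of s] by (auto simp: dist_real_def)
 define q where "q = pcompose p [:0, of_real s:]"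
 have cq: "coeff q n = of_real s ^ n * coeff p n" for n by (simp add: q_def coeff_pcompose_linear)
 have pq: "(\<Sum>n<N. cmod (coeff (q - p) n)) <= \<eta> / 2" for N
 proof -
  have eq: "cmod (coeff (q - p) n) = cmod (coeff p n) * \<bar>s ^ n - 1\<bar>" for n
  proof -
   have "coeff (q - p) n = coeff p n * of_real (s ^ n - 1)" by (simp add: cq algebra_simps)
   then show ?thesis by (simp only: norm_mult norm_of_real)
  qed
  have "(\<Sum>n<N. cmod (coeff (q - p) n)) <= (\<Sum>n<N + Suc (degree p). cmod (coeff p n) * \<bar>s ^ n - 1\<bar>)"
   unfolding eq by (intro sum_mono2) auto
  also have "... = d s" unfolding d_def by (intro sum.mono_neutral_right) (auto intro: coeff_eq_0)
  finally show ?thesis using s01 by simp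
 qed
 have "q \<noteq> 0" using False s01 by (auto simp: poly_eq_iff cq)
 moreover have "poly q z \<noteq> 0" if "cmod z = 1" for z
 proof
  assume "poly q z = 0"
  then have "poly p (of_real s * z) = 0" by (simp add: q_def poly_pcompose mult.commute)
  moreover have "cmod (of_real s * z) = s" using that s01 by (simp add: norm_mult)
  ultimately show False using s(2) by (auto simp: image_iff)
 qed
 ultimately obtain R w v where R: "1 < R" and hol: "w holomorphic_on ball 0 R" "v holomorphic_on ball 0 R"
  and wv: "\<And>z. z \<in> ball 0 R ==> w z * v z = poly q z"
  and circ: "\<And>z. cmod z = 1 ==> (cmod (w z))^2 = cmod (poly q z)" "\<And>z. cmod z = 1 ==> (cmod (v z))^2 = cmod (poly q z)"
  using holomorphic_riesz_factor[of q] by blast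
 define r where "r = (1 + R) / 2"
 have r: "1 < r" "r < R" using R by (auto simp: r_def)
 have "continuous_on (cball 0 r) w" "continuous_on (cball 0 r) v"
  using hol r by (auto intro!: holomorphic_on_imp_continuous_on elim: holomorphic_on_subset)
 then have "bounded (w ` cball 0 r)" "bounded (v ` cball 0 r)"
  by (auto intro!: compact_imp_bounded compact_continuous_image)
 then obtain B1 B2 where B12: "\<And>z. cmod z <= r ==> cmod (w z) <= B1" "\<And>z. cmod z <= r ==> cmod (v z) <= B2"
  unfolding bounded_iff by (metis imageI mem_cball_0)
 define B where "B = max 0 (max B1 B2)"
 have B: "0 <= B" "cmod z <= r ==> cmod (w z) <= B" "cmod z <= r ==> cmod (v z) <= B" for z
  using B12[of z] by (auto simp: B_def)
 \<comment> \<open>With factors bounded by \<open>B\<close> and errors \<open>e <= 1\<close>, both a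
   product and a square change by at most \<open>e * (2 * B + 1)\<close>; the quotient
   \<open>r / (r - 1)\<close> is the cost of passing to coefficients.\<close>
 define e where "e = min 1 (\<eta> / 2 / ((2 * B + 1) * (r / (r - 1))))"
 have rr: "1 <= r / (r - 1)" using r by simp
 have B1: "0 < 2 * B + 1" using B by simp
 have pos: "0 < (2 * B + 1) * (r / (r - 1))" using B1 rr by (intro mult_pos_pos) linarith+
 have "0 < \<eta> / 2 / ((2 * B + 1) * (r / (r - 1)))" using \<eta> pos by (intro divide_pos_pos) auto
 then have e: "0 < e" "e <= 1" unfolding e_def by (simp_all only: min_less_iff_conj zero_less_one min.cobounded1)
 have "e <= \<eta> / 2 / ((2 * B + 1) * (r / (r - 1)))" by (simp add: e_def)
 then have e1: "e * (2 * B + 1) * (r / (r - 1)) <= \<eta> / 2" by (simp only: pos_le_divide_eq[OF pos] mult.assoc)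
 have "e * (2 * B + 1) * 1 <= e * (2 * B + 1) * (r / (r - 1))" using rr e B1 by (intro mult_left_mono) auto
 then have e2: "e * (2 * B + 1) <= \<eta> / 2" using order_trans[OF _ e1] by (simp only: mult_1_right)
 obtain W where W: "\<And>z. cmod z <= r ==> cmod (poly W z - w z) <= e"
  using holomorphic_poly_approx[OF hol(1) _ r(2) e(1)] r by auto
 obtain V where V: "\<And>z. cmod z <= r ==> cmod (poly V z - v z) <= e"
  using holomorphic_poly_approx[OF hol(2) _ r(2) e(1)] r by auto
 have qp: "cmod (poly q z) <= cmod (poly p z) + \<eta> / 2" if "cmod z = 1" for z
 proof -
  have "cmod (poly (q - p) z) <= (\<Sum>n\<le>degree (q - p). cmod (coeff (q - p) n * z ^ n))"
   unfolding poly_altdef by (rule norm_sum)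
  also have "... <= \<eta> / 2" using pq[of "Suc (degree (q - p))"] that
   by (simp add: norm_mult norm_power lessThan_Suc_atMost del: coeff_diff)
  finally have "cmod (poly q z - poly p z) <= \<eta> / 2" by simp
  then show ?thesis using norm_triangle_sub[of "poly q z" "poly p z"] by linarith
 qed
 have sqb: "(cmod x)^2 <= (cmod y)^2 + e * (2 * B + 1)" if "cmod (x - y) <= e" "cmod y <= B" for x y :: complex
 proof -
  have "cmod x <= cmod y + e" using that norm_triangle_sub[of x y] by linarith
  then have "(cmod x)^2 <= (cmod y + e)^2" by (intro power_mono) auto
  also have "... = (cmod y)^2 + e * (2 * cmod y + e)" by (simp add: power2_eq_square algebra_simps)
  also have "... <= (cmod y)^2 + e * (2 * B + 1)" using that e by (intro add_left_mono mult_left_mono) auto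
  finally show ?thesis .
 qed
 show thesis
 proof (rule that[of W V])
  show "(cmod (poly W z))^2 <= cmod (poly p z) + \<eta>" if z: "cmod z = 1" for z
   using sqb[OF W[of z] B(2)[of z]] circ(1)[OF z] qp[OF z] e2 z r by auto
  show "(cmod (poly V z))^2 <= cmod (poly p z) + \<eta>" if z: "cmod z = 1" for z
   using sqb[OF V[of z] B(3)[of z]] circ(2)[OF z] qp[OF z] e2 z r by auto
  have "cmod (poly (W * V - q) z) <= e * (2 * B + 1)" if z: "cmod z = r" for z
  proof -
   have "poly (W * V - q) z = (poly W z - w z) * (poly V z - v z) + (poly W z - w z) * v z + w z * (poly V z - v z)"
    using wv[of z] z r by (simp add: algebra_simps)
   also have "cmod ... <= e * e + e * B + B * e" using W[of z] V[of z] B(2,3)[of z] z B(1) e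
    by (intro norm_triangle_mono) (auto simp: norm_mult intro!: mult_mono)
   also have "... <= e * (2 * B + 1)" using mult_left_mono[OF e(2), of e] e by (simp add: algebra_simps)
   finally show ?thesis .
  qed
  from coeff_sum_le_of_bound[OF r(1) this]
  have 1: "(\<Sum>n<N. cmod (coeff (W * V - q) n)) <= \<eta> / 2" for N using e1 order_trans by blast
  show "(\<Sum>n<N. cmod (coeff (W * V - p) n)) <= \<eta>" for N
  proof -
   have "(\<Sum>n<N. cmod (coeff (W * V - p) n)) <= (\<Sum>n<N. cmod (coeff (W * V - q) n) + cmod (coeff (q - p) n))"
    by (intro sum_mono) (simp, metis diff_add_cancel diff_add_eq norm_triangle_ineq add_diff_eq)
   then show ?thesis using 1[of N] pq[of N] by (simp add: sum.distrib)
  qed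
 qed
qed

section \<open>Integrals of scalar functions against bounded continuous orbits\<close>

text \<open>The Riemann sums of \<open>fs n - f\<close> are bounded in norm by those of the scalar
  function \<open>e n\<close>, so the Cauchy criterion for Riemann sums passes from
  \<open>fs n\<close> to \<open>f\<close>. This reduces integrability in an arbitrary Banach space
  to scalar estimates.\<close>

lemma has_integral_L1_limit:
 fixes f :: "real => 'b::banach" and e :: "nat => real => real"
 assumes fs: "\<And>n. fs n integrable_on UNIV" and e: "\<And>n. (e n has_integral E n) UNIV"
  and le: "\<And>n x. norm (fs n x - f x) <= e n x" and E: "E ----> 0"
 shows "f integrable_on UNIV" "\<And>n. norm (integral UNIV (fs n) - integral UNIV f) <= E n"
proof -
 have e0: "0 <= e n x" for n x using le[of n x] norm_ge_zero order_trans by blast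
 have eint: "e n integrable_on UNIV" and Eint: "integral UNIV (e n) = E n" for n
  using e by (auto simp: integrable_on_def integral_unique)
 have ebox: "e n integrable_on cbox a b" "integral (cbox a b) (e n) <= E n" for n a b
 proof -
  show *: "e n integrable_on cbox a b" using eint by (rule integrable_on_subcbox) simp
  have "integral (cbox a b) (e n) <= integral UNIV (e n)"
   by (rule integral_subset_le[OF _ * eint]) (auto simp: e0)
  then show "integral (cbox a b) (e n) <= E n" by (simp add: Eint)
 qed
 have fbox: "fs n integrable_on cbox a b" for n a b using fs by (rule integrable_on_subcbox) simp
 have fint: "f integrable_on cbox a b" for a b unfolding integrable_Cauchy
 proof (intro allI impI)
  fix \<epsilon> :: real assume \<epsilon>: "0 < \<epsilon>"
  have "eventually (\<lambda>n. E n < \<epsilon> / 8) sequentially"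
   using order_tendstoD(2)[OF E, of "\<epsilon> / 8"] \<epsilon> by simp
  then obtain n where n: "E n < \<epsilon> / 8" by (auto simp: eventually_sequentially)
  have "(fs n has_integral integral (cbox a b) (fs n)) (cbox a b)" using fbox by blast
  then obtain g1 where g1: "gauge g1" "\<And>p. p tagged_division_of cbox a b ==> g1 fine p ==>
    norm ((\<Sum>(x, k)\<in>p. measure lborel k *\<^sub>R fs n x) - integral (cbox a b) (fs n)) < \<epsilon> / 8"
   using \<epsilon> unfolding has_integral by (metis zero_less_divide_iff zero_less_numeral)
  have "(e n has_integral integral (cbox a b) (e n)) (cbox a b)" using ebox by blast
  then obtain g2 where g2: "gauge g2" "\<And>p. p tagged_division_of cbox a b ==> g2 fine p ==>
    norm ((\<Sum>(x, k)\<in>p. measure lborel k *\<^sub>R e n x) - integral (cbox a b) (e n)) < \<epsilon> / 8"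
   using \<epsilon> unfolding has_integral by (metis zero_less_divide_iff zero_less_numeral)
  \<comment> \<open>One eighth comes from the gauge for \<open>fs n\<close> and two from the
    majorant \<open>e n\<close>; two fine partitions then differ by less than
    \<open>\<epsilon>\<close>.\<close>
  have close: "norm ((\<Sum>(x, k)\<in>p. measure lborel k *\<^sub>R f x) - integral (cbox a b) (fs n)) < 3 * \<epsilon> / 8"
   if p: "p tagged_division_of cbox a b" "(\<lambda>x. g1 x \<inter> g2 x) fine p" for p
  proof -
   have fine: "g1 fine p" "g2 fine p" using p(2) by (auto simp: fine_Int)
   have "norm ((\<Sum>(x, k)\<in>p. measure lborel k *\<^sub>R fs n x) - (\<Sum>(x, k)\<in>p. measure lborel k *\<^sub>R f x))
     = norm (\<Sum>(x, k)\<in>p. measure lborel k *\<^sub>R (fs n x - f x))"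
    by (simp add: sum_subtractf[symmetric] case_prod_unfold scaleR_diff_right)
   also have "... <= (\<Sum>(x, k)\<in>p. measure lborel k *\<^sub>R e n x)"
    by (rule order_trans[OF norm_sum]) (auto intro!: sum_mono mult_left_mono le simp: case_prod_unfold)
   also have "... < integral (cbox a b) (e n) + \<epsilon> / 8"
    using g2(2)[OF p(1) fine(2)] unfolding real_norm_def by linarith
   also have "... <= 2 * \<epsilon> / 8" using ebox(2)[of a b n] n by simp
   finally have 1: "norm ((\<Sum>(x, k)\<in>p. measure lborel k *\<^sub>R fs n x) - (\<Sum>(x, k)\<in>p. measure lborel k *\<^sub>R f x)) < 2 * \<epsilon> / 8" .
   show ?thesis
    using norm_triangle_lt[of "(\<Sum>(x, k)\<in>p. measure lborel k *\<^sub>R f x) - (\<Sum>(x, k)\<in>p. measure lborel k *\<^sub>R fs n x)"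
      "(\<Sum>(x, k)\<in>p. measure lborel k *\<^sub>R fs n x) - integral (cbox a b) (fs n)" "3 * \<epsilon> / 8"]
     1 g1(2)[OF p(1) fine(1)] by (simp add: norm_minus_commute)
  qed
  show "\<exists>\<gamma>. gauge \<gamma> \<and> (\<forall>p1 p2. p1 tagged_division_of cbox a b \<and> \<gamma> fine p1 \<and>
    p2 tagged_division_of cbox a b \<and> \<gamma> fine p2 \<longrightarrow>
    norm ((\<Sum>(x, k)\<in>p1. measure lborel k *\<^sub>R f x) - (\<Sum>(x, k)\<in>p2. measure lborel k *\<^sub>R f x)) < \<epsilon>)"
  proof (intro exI[of _ "\<lambda>x. g1 x \<inter> g2 x"] conjI allI impI)
   show "gauge (\<lambda>x. g1 x \<inter> g2 x)" using g1 g2 by auto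
   fix p1 p2 assume "p1 tagged_division_of cbox a b \<and> (\<lambda>x. g1 x \<inter> g2 x) fine p1 \<and>
    p2 tagged_division_of cbox a b \<and> (\<lambda>x. g1 x \<inter> g2 x) fine p2"
   then have "norm ((\<Sum>(x, k)\<in>p1. measure lborel k *\<^sub>R f x) - integral (cbox a b) (fs n)) < 3 * \<epsilon> / 8"
    "norm ((\<Sum>(x, k)\<in>p2. measure lborel k *\<^sub>R f x) - integral (cbox a b) (fs n)) < 3 * \<epsilon> / 8"
    using close by blast+
   then show "norm ((\<Sum>(x, k)\<in>p1. measure lborel k *\<^sub>R f x) - (\<Sum>(x, k)\<in>p2. measure lborel k *\<^sub>R f x)) < \<epsilon>"
    using norm_triangle_ineq4[of "(\<Sum>(x, k)\<in>p1. measure lborel k *\<^sub>R f x) - integral (cbox a b) (fs n)"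
      "(\<Sum>(x, k)\<in>p2. measure lborel k *\<^sub>R f x) - integral (cbox a b) (fs n)"] \<epsilon> by simp
  qed
 qed
 have fbd: "norm (integral (cbox a b) (fs n) - integral (cbox a b) f) <= E n" for n a b
 proof -
  have "norm (integral (cbox a b) (\<lambda>x. fs n x - f x)) <= integral (cbox a b) (e n)"
   by (intro integral_norm_bound_integral integrable_diff fint fbox ebox le)
  then show ?thesis using ebox(2)[of a b n] unfolding integral_diff[OF fbox fint] by linarith
 qed
 show 1: "f integrable_on UNIV"
 proof (rule integrable_alt[THEN iffD2], intro conjI allI impI)
  show "(\<lambda>x. if x \<in> UNIV then f x else 0) integrable_on cbox a b" for a b using fint by simp
  fix \<epsilon> :: real assume \<epsilon>: "0 < \<epsilon>"
  have "eventually (\<lambda>n. E n < \<epsilon> / 4) sequentially"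
   using order_tendstoD(2)[OF E, of "\<epsilon> / 4"] \<epsilon> by simp
  then obtain n where n: "E n < \<epsilon> / 4" by (auto simp: eventually_sequentially)
  have "\<exists>B>0. \<forall>a b c d. ball 0 B \<subseteq> cbox a b \<and> ball 0 B \<subseteq> cbox c d \<longrightarrow>
    norm (integral (cbox a b) (\<lambda>x. if x \<in> UNIV then fs n x else 0)
     - integral (cbox c d) (\<lambda>x. if x \<in> UNIV then fs n x else 0)) < \<epsilon> / 2"
   using integrable_alt[THEN iffD1, OF fs[of n], THEN conjunct2, THEN spec[of _ "\<epsilon> / 2"]] \<epsilon>
   by (simp only: half_gt_zero_iff)
  then obtain B where B: "0 < B" "\<And>a b c d. ball 0 B \<subseteq> cbox a b ==> ball 0 B \<subseteq> cbox c d ==>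
    norm (integral (cbox a b) (fs n) - integral (cbox c d) (fs n)) < \<epsilon> / 2"
   by (simp only: UNIV_I if_True) blast
  show "\<exists>B>0. \<forall>a b c d. ball 0 B \<subseteq> cbox a b \<and> ball 0 B \<subseteq> cbox c d \<longrightarrow>
    norm (integral (cbox a b) (\<lambda>x. if x \<in> UNIV then f x else 0)
     - integral (cbox c d) (\<lambda>x. if x \<in> UNIV then f x else 0)) < \<epsilon>"
  proof (intro exI[of _ B] conjI allI impI B(1))
   fix a b c d :: real assume "ball 0 B \<subseteq> cbox a b \<and> ball 0 B \<subseteq> cbox c d"
   then have *: "norm (integral (cbox a b) (fs n) - integral (cbox c d) (fs n)) < \<epsilon> / 2" using B by blast
   have "norm (integral (cbox a b) f - integral (cbox c d) f)
     = norm ((integral (cbox a b) (fs n) - integral (cbox c d) (fs n))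
      + ((integral (cbox c d) (fs n) - integral (cbox c d) f)
      - (integral (cbox a b) (fs n) - integral (cbox a b) f)))" by simp
   also have "... <= norm (integral (cbox a b) (fs n) - integral (cbox c d) (fs n)) + (E n + E n)"
    by (intro norm_triangle_mono order_refl order_trans[OF norm_triangle_ineq4] add_mono fbd)
   also have "... < \<epsilon>" using * n by simp
   finally show "norm (integral (cbox a b) (\<lambda>x. if x \<in> UNIV then f x else 0)
     - integral (cbox c d) (\<lambda>x. if x \<in> UNIV then f x else 0)) < \<epsilon>" by simp
  qed
 qed
 show "norm (integral UNIV (fs n) - integral UNIV f) <= E n" for n
 proof -
  have "norm (integral UNIV (\<lambda>x. fs n x - f x)) <= integral UNIV (e n)"
   by (intro integral_norm_bound_integral integrable_diff 1 fs eint le)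
  then show ?thesis by (simp add: integral_diff 1 fs Eint)
 qed
qed

lemma integral_tendsto_0:
 fixes s :: "nat => 'm => real"
 assumes "integrable M w" "\<And>n. s n \<in> borel_measurable M"
  "\<And>x. (\<lambda>n. s n x) ----> 0" "\<And>n x. \<bar>s n x\<bar> <= w x"
 shows "(\<lambda>n. integral\<^sup>L M (s n)) ----> 0"
 using integral_dominated_convergence[where f = "\<lambda>_. 0" and s = s and w = w and M = M] assms by simp

definition cell :: "nat => int => real set" where
 "cell n k = {t. \<lfloor>t * real n\<rfloor> = k}"

definition grid :: "nat => real => real" where
 "grid n t = of_int \<lfloor>t * real n\<rfloor> / real n"

lemma cell_sets [measurable]: "cell n k \<in> sets borel" unfolding cell_def by measurable

lemma grid_tendsto: "(\<lambda>n. grid (Suc n) t) ----> t"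
proof (rule Lim_null_comparison[THEN LIM_zero_cancel])
 show "\<forall>\<^sub>F n in sequentially. norm (grid (Suc n) t - t) <= inverse (real (Suc n))"
 proof (intro always_eventually allI)
  fix n
  have "\<bar>of_int \<lfloor>t * real (Suc n)\<rfloor> - t * real (Suc n)\<bar> <= 1" by linarith
  then have "\<bar>of_int \<lfloor>t * real (Suc n)\<rfloor> - t * real (Suc n)\<bar> / real (Suc n) <= 1 / real (Suc n)"
   by (intro divide_right_mono) auto
  moreover have "grid (Suc n) t - t = (of_int \<lfloor>t * real (Suc n)\<rfloor> - t * real (Suc n)) / real (Suc n)"
   by (simp add: grid_def field_simps del: of_nat_Suc)
  ultimately show "norm (grid (Suc n) t - t) <= inverse (real (Suc n))"
   by (simp add: abs_divide inverse_eq_divide del: of_nat_Suc)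
 qed
 show "(\<lambda>n. inverse (real (Suc n))) ----> 0" by (rule LIMSEQ_inverse_real_of_nat)
qed

lemma integrable_mult_bounded:
 fixes f g :: "real => complex"
 assumes f: "L1 f" and g: "g \<in> borel_measurable borel" and B: "\<And>t. cmod (g t) <= B"
 shows "L1 (\<lambda>t. f t * g t)"
proof (rule bintble_bound)
 show "L1 (\<lambda>t. B * cmod (f t))" using f by auto
 show "(\<lambda>t. f t * g t) \<in> borel_measurable lborel" using f g by simp
 show "AE t in lborel. norm (f t * g t) <= norm (B * cmod (f t))"
 proof (rule AE_I2)
  fix t
  have "0 <= B" using B[of t] norm_ge_zero order_trans by blast
  then show "norm (f t * g t) <= norm (B * cmod (f t))"
   using B[of t] by (simp add: norm_mult mult.commute[of B] mult_left_mono)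
 qed
qed

lemma integrable_mult_bounded_real:
 fixes f g :: "real => real"
 assumes f: "L1 f" and g: "g \<in> borel_measurable borel" and B: "\<And>t. \<bar>g t\<bar> <= B"
 shows "L1 (\<lambda>t. f t * g t)"
proof (rule bintble_bound)
 show "L1 (\<lambda>t. B * \<bar>f t\<bar>)" using f by auto
 show "(\<lambda>t. f t * g t) \<in> borel_measurable lborel" using f g by simp
 show "AE t in lborel. norm (f t * g t) <= norm (B * \<bar>f t\<bar>)"
 proof (rule AE_I2)
  fix t
  have "0 <= B" using B[of t] by linarith
  then show "norm (f t * g t) <= norm (B * \<bar>f t\<bar>)"
   using B[of t] by (simp add: abs_mult mult.commute[of B] mult_left_mono)
 qed
qed

section \<open>Riemann sums and Fubini for the vector-valued integral\<close>

context cstruct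
begin

definition vint :: "(real => complex) => (real => 'a) => 'a" where
 "vint b g = integral UNIV (\<lambda>t. b t *\<^sub>J g t)"

definition cont_bdd :: "(real => 'a) => bool" where
 "cont_bdd g \<longleftrightarrow> continuous_on UNIV g \<and> (\<exists>B. \<forall>t. norm (g t) <= B)"

text \<open>The orbit is frozen at the left end of each cell, while the density is integrated
  exactly over it. Only scalar integrals occur, so scalar Fubini applies term by term;
  \<open>c\<close> is a translation of the orbit.\<close>

definition riem :: "nat => real => (real => complex) => (real => 'a) => 'a" where
 "riem n c b g = (\<Sum>k\<in>{- int (n * n)..<int (n * n)}.
   (LBINT t. b t * indicator (cell n k) (t + c)) *\<^sub>J g (of_int k / real n))"

text \<open>The pointwise error of freezing \<open>g\<close>: its oscillation within a cell inside
  the window of the sum, all of \<open>g\<close> outside.\<close>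

definition osc :: "nat => (real => 'a) => real => real" where
 "osc n g t = (if t \<in> {- real n..<real n} then norm (g (grid n t) - g t) else norm (g t))"

lemma osc_nonneg: "0 <= osc n g t" by (simp add: osc_def)

lemma osc_le: "(\<And>t. norm (g t) <= B) ==> osc n g t <= 2 * B"
proof -
 assume B: "\<And>t. norm (g t) <= B"
 have "norm (g (grid n t) - g t) <= B + B" by (intro order_trans[OF norm_triangle_ineq4] add_mono B)
 moreover have "norm (g t) <= B" "0 <= B" using B[of t] norm_ge_zero order_trans by blast+
 ultimately show ?thesis by (auto simp: osc_def)
qed

lemma osc_measurable:
 assumes "cont_bdd g"
 shows "osc n g \<in> borel_measurable borel"
proof -
 have c: "continuous_on UNIV g" using assms by (simp add: cont_bdd_def)
 have "continuous_on UNIV (\<lambda>p :: real \<times> real. norm (g (fst p) - g (snd p)))"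
  by (intro continuous_intros continuous_on_compose2[OF c]) auto
 then have m: "(\<lambda>p :: real \<times> real. norm (g (fst p) - g (snd p))) \<in> borel_measurable borel"
  by (rule measurable_contI)
 have "(\<lambda>t. (grid n t, t)) \<in> borel \<rightarrow>\<^sub>M (borel :: (real \<times> real) measure)"
  unfolding grid_def by measurable
 from measurable_compose[OF this m] have m1: "(\<lambda>t. norm (g (grid n t) - g t)) \<in> borel_measurable borel" by simp
 have m2: "(\<lambda>t. norm (g t)) \<in> borel_measurable borel"
  using c by (intro measurable_contI continuous_intros)
 show ?thesis unfolding osc_def using m1 m2 by measurable
qed

lemma osc_tendsto:
 assumes "cont_bdd g"
 shows "(\<lambda>n. osc (Suc n) g t) ----> 0"
proof -
 have "isCont g t" using assms by (simp add: cont_bdd_def continuous_on_eq_continuous_at)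
 then have "(\<lambda>n. norm (g (grid (Suc n) t) - g t)) ----> norm (g t - g t)"
  by (intro tendsto_intros isCont_tendsto_compose[OF _ grid_tendsto])
 then have lim: "(\<lambda>n. norm (g (grid (Suc n) t) - g t)) ----> 0" by simp
 obtain N :: nat where N: "\<bar>t\<bar> < real N" using reals_Archimedean2 by blast
 have "eventually (\<lambda>n. norm (g (grid (Suc n) t) - g t) = osc (Suc n) g t) sequentially"
  unfolding eventually_sequentially
 proof (intro exI[of _ N] allI impI)
  fix n assume "N <= n"
  then have "real N <= real (Suc n)" by simp
  then have "t \<in> {- real (Suc n)..<real (Suc n)}" using N unfolding atLeastLessThan_iff by linarith
  then show "norm (g (grid (Suc n) t) - g t) = osc (Suc n) g t" by (simp add: osc_def)
 qed
 from tendsto_cong[OF this] lim show ?thesis by blast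
qed

lemma has_integral_cs_const:
 assumes "L1 b"
 shows "((\<lambda>t. b t *\<^sub>J x) has_integral integral\<^sup>L lborel b *\<^sub>J x) UNIV"
 using has_integral_linear[OF has_integral_integral_lborel[OF assms] B.bounded_linear_left[of x]]
 by (simp add: o_def)

lemma integrable_cell: "L1 b ==> L1 (\<lambda>t. b t * indicator (cell n k) (t + c))"
 for b :: "real => complex" by (rule integrable_mult_bounded[where B = 1]) (auto simp: indicator_def)

lemma riem_has_integral:
 assumes b: "L1 b"
 shows "((\<lambda>t. b t *\<^sub>J (if t + c \<in> {- real (Suc n)..<real (Suc n)} then g (grid (Suc n) (t + c)) else 0))
   has_integral riem (Suc n) c b g) UNIV"
proof -
 let ?N = "Suc n"
 let ?S = "{- int (?N * ?N)..<int (?N * ?N)}"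
 have "((\<lambda>t. \<Sum>k\<in>?S. (b t * indicator (cell ?N k) (t + c)) *\<^sub>J g (of_int k / real ?N)) has_integral riem ?N c b g) UNIV"
  unfolding riem_def by (intro has_integral_sum has_integral_cs_const integrable_cell b) simp
 moreover have "(\<Sum>k\<in>?S. (b t * indicator (cell ?N k) (t + c)) *\<^sub>J g (of_int k / real ?N))
   = b t *\<^sub>J (if t + c \<in> {- real ?N..<real ?N} then g (grid ?N (t + c)) else 0)" for t
 proof -
  let ?k = "\<lfloor>(t + c) * real ?N\<rfloor>"
  have "(\<Sum>k\<in>?S. (b t * indicator (cell ?N k) (t + c)) *\<^sub>J g (of_int k / real ?N))
    = (\<Sum>k\<in>?S. if k = ?k then b t *\<^sub>J g (of_int k / real ?N) else 0)"
   by (intro sum.cong refl) (auto simp: cell_def indicator_def)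
  also have "... = (if ?k \<in> ?S then b t *\<^sub>J g (grid ?N (t + c)) else 0)" by (simp add: grid_def)
  also have "?k \<in> ?S \<longleftrightarrow> t + c \<in> {- real ?N..<real ?N}"
  proof -
   have "?k \<in> ?S \<longleftrightarrow> - (real ?N * real ?N) <= (t + c) * real ?N \<and> (t + c) * real ?N < real ?N * real ?N"
    by (simp only: atLeastLessThan_iff le_floor_iff floor_less_iff of_int_minus of_int_mult of_int_of_nat_eq of_nat_mult)
   also have "... \<longleftrightarrow> (- real ?N) * real ?N <= (t + c) * real ?N \<and> (t + c) * real ?N < real ?N * real ?N"
    by (simp only: minus_mult_left)
   also have "... \<longleftrightarrow> - real ?N <= t + c \<and> t + c < real ?N"
    by (intro conj_cong mult_le_cancel_right_pos mult_less_cancel_right_pos) auto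
   finally show ?thesis by simp
  qed
  finally show ?thesis by simp
 qed
 ultimately show ?thesis by simp
qed

text \<open>The error is \<open>cmod (b t)\<close> times a function bounded by \<open>2 * B\<close>
  and tending to zero pointwise, hence tends to zero in \<open>L1\<close>; integrability of the
  limit comes with it.\<close>

lemma vint_approx:
 assumes b: "L1 b" and g: "cont_bdd g"
 shows "(\<lambda>t. b t *\<^sub>J g (t + c)) integrable_on UNIV"
  and "norm (riem (Suc n) c b g - vint b (\<lambda>t. g (t + c))) <= (LBINT t. cmod (b t) * osc (Suc n) g (t + c))"
  and "(\<lambda>n. LBINT t. cmod (b t) * osc (Suc n) g (t + c)) ----> 0"
proof -
 obtain B where B: "\<And>t. norm (g t) <= B" using g by (auto simp: cont_bdd_def)
 note [measurable] = osc_measurable[OF g] borel_measurable_integrable[OF b]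
 let ?e = "\<lambda>n t. cmod (b t) * osc (Suc n) g (t + c)"
 have int: "L1 (?e n)" for n using integrable_norm[OF b] osc_le[OF B] osc_nonneg
  by (intro integrable_mult_bounded_real[where B = "2 * B"]) auto
 show lim: "(\<lambda>n. LBINT t. ?e n t) ----> 0"
 proof (rule integral_tendsto_0[where s = ?e])
  show "L1 (\<lambda>t. cmod (b t) * (2 * B))" using b by auto
  show "(\<lambda>n. ?e n t) ----> 0" for t by (intro tendsto_mult_right_zero osc_tendsto g)
  show "\<bar>?e n t\<bar> <= cmod (b t) * (2 * B)" for n t
   using osc_le[OF B] osc_nonneg by (auto simp: abs_mult intro!: mult_left_mono)
 qed auto
 let ?f = "\<lambda>n t. b t *\<^sub>J (if t + c \<in> {- real (Suc n)..<real (Suc n)} then g (grid (Suc n) (t + c)) else 0)"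
 have le: "norm (?f n t - b t *\<^sub>J g (t + c)) <= ?e n t" for n t
  by (simp add: osc_def norm_minus_commute flip: C.scale_right_diff_distrib)
 have fint: "?f n integrable_on UNIV" for n using riem_has_integral[OF b] by blast
 have eint: "(?e n has_integral (LBINT t. ?e n t)) UNIV" for n by (rule has_integral_integral_lborel[OF int])
 show "(\<lambda>t. b t *\<^sub>J g (t + c)) integrable_on UNIV"
  by (rule has_integral_L1_limit(1)[OF fint eint le lim])
 show "norm (riem (Suc n) c b g - vint b (\<lambda>t. g (t + c))) <= (LBINT t. ?e n t)"
  using has_integral_L1_limit(2)[OF fint eint le lim, of n] integral_unique[OF riem_has_integral[OF b, of c n g]]
  by (simp add: vint_def)
qed

lemma vint_integrable: "L1 b ==> cont_bdd g ==> (\<lambda>t. b t *\<^sub>J g t) integrable_on UNIV"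
 using vint_approx(1)[of b g 0] by simp

lemma norm_integral_le_LINT:
 fixes f :: "real => 'b::banach"
 assumes "f integrable_on UNIV" "L1 e" "\<And>t. norm (f t) <= e t"
 shows "norm (integral UNIV f) <= (LBINT t. e t)"
 using integral_norm_bound_integral[OF assms(1) _ assms(3)] has_integral_integral_lborel[OF assms(2)]
 by (auto simp: integrable_on_def integral_unique)

lemma norm_measurable: "cont_bdd g ==> (\<lambda>t. norm (g t)) \<in> borel_measurable borel"
 by (intro measurable_contI continuous_intros) (auto simp: cont_bdd_def)

lemma vint_norm_le:
 assumes "L1 b" "cont_bdd g"
 shows "norm (vint b g) <= (LBINT t. cmod (b t) * norm (g t))" unfolding vint_def
proof (rule norm_integral_le_LINT[OF vint_integrable[OF assms]])
 obtain B where "\<And>t. norm (g t) <= B" using assms by (auto simp: cont_bdd_def)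
 then show "L1 (\<lambda>t. cmod (b t) * norm (g t))"
  using assms by (intro integrable_mult_bounded_real[where B = B] norm_measurable) auto
qed simp

lemma vint_norm_le_const:
 assumes "L1 b" "cont_bdd g" "\<And>t. norm (g t) <= B"
 shows "norm (vint b g) <= (LBINT t. cmod (b t)) * B"
proof -
 have "(LBINT t. cmod (b t) * norm (g t)) <= (LBINT t. cmod (b t) * B)"
  using assms order_trans[OF norm_ge_zero assms(3)]
  by (intro integral_mono integrable_mult_bounded_real[where B = B] norm_measurable)
   (auto intro: mult_left_mono)
 then show ?thesis using vint_norm_le[OF assms(1,2)] by simp
qed

lemma vint_add_left: "L1 b ==> L1 b' ==> cont_bdd g ==>
  vint (\<lambda>t. b t + b' t) g = vint b g + vint b' g"
 by (simp add: vint_def C.scale_left_distrib integral_add vint_integrable)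

lemma vint_diff_left: "L1 b ==> L1 b' ==> cont_bdd g ==>
  vint (\<lambda>t. b t - b' t) g = vint b g - vint b' g"
 by (simp add: vint_def C.scale_left_diff_distrib integral_diff vint_integrable)

lemma vint_diff_right: "L1 b ==> cont_bdd g ==> cont_bdd g' ==>
  vint b (\<lambda>t. g t - g' t) = vint b g - vint b g'"
 by (simp add: vint_def C.scale_right_diff_distrib integral_diff vint_integrable)

lemma vint_sum_left: "finite K ==> (\<And>k. k \<in> K ==> L1 (b k)) ==> cont_bdd g ==>
  vint (\<lambda>t. \<Sum>k\<in>K. b k t) g = (\<Sum>k\<in>K. vint (b k) g)"
 by (simp add: vint_def C.scale_sum_left integral_sum vint_integrable)

lemma vint_op:
 assumes "L1 b" "cont_bdd g" "cbounded_op J S"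
 shows "vint b (\<lambda>t. S (g t)) = S (vint b g)"
proof -
 have "bounded_linear S" using assms(3) by (simp add: cbounded_op_def)
 from integral_linear[OF vint_integrable[OF assms(1,2)] this] show ?thesis
  by (simp add: vint_def o_def cbounded_op_cs[OF assms(3)])
qed

lemma cbounded_op_scale: "cbounded_op J (\<lambda>x. c *\<^sub>J x)"
proof -
 have "J (c *\<^sub>J x) = c *\<^sub>J J x" for x by (rule J_cs)
 then show ?thesis by (simp add: cbounded_op_def B.bounded_linear_right)
qed

lemma vint_scale_left:
 assumes "L1 b" "cont_bdd g"
 shows "vint (\<lambda>t. c * b t) g = c *\<^sub>J vint b g"
 using vint_op[OF assms cbounded_op_scale[of c]] by (simp add: vint_def mult.commute)

lemma cont_bdd_shift: "cont_bdd g ==> cont_bdd (\<lambda>t. g (t + c))"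
 unfolding cont_bdd_def by (auto intro!: continuous_intros continuous_on_compose2[of UNIV g])

lemma cont_bdd_vint_shift:
 assumes b: "L1 b" and g: "cont_bdd g"
 shows "cont_bdd (\<lambda>c. vint b (\<lambda>t. g (t + c)))"
proof -
 obtain B where B: "\<And>t. norm (g t) <= B" using g by (auto simp: cont_bdd_def)
 have "norm (vint b (\<lambda>t. g (t + c))) <= (LBINT t. cmod (b t)) * B" for c
  by (rule vint_norm_le_const[OF b cont_bdd_shift[OF g] B])
 moreover have "continuous_on UNIV (\<lambda>c. vint b (\<lambda>t. g (t + c)))"
  unfolding continuous_on_sequentially
 proof (intro ballI allI impI, simp add: o_def)
  fix c :: real and u assume u: "u ----> c"
  have cg: "isCont g t" for t using g by (simp add: cont_bdd_def continuous_on_eq_continuous_at)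
  let ?e = "\<lambda>n t. cmod (b t) * norm (g (t + u n) - g (t + c))"
  have cb: "cont_bdd (\<lambda>t. g (t + u n) - g (t + c))" for n
  proof -
   have "norm (g (t + u n) - g (t + c)) <= B + B" for t
    by (intro order_trans[OF norm_triangle_ineq4] add_mono B)
   then show ?thesis using cont_bdd_shift[OF g, of "u n"] cont_bdd_shift[OF g, of c]
    unfolding cont_bdd_def by (auto intro!: continuous_intros)
  qed
  have "(\<lambda>n. LBINT t. ?e n t) ----> 0"
  proof (rule integral_tendsto_0[where s = ?e])
   show "L1 (\<lambda>t. cmod (b t) * (2 * B))" using b by auto
   show "(\<lambda>n. ?e n t) ----> 0" for t
   proof -
    have "(\<lambda>n. norm (g (t + u n) - g (t + c))) ----> norm (g (t + c) - g (t + c))"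
     by (intro tendsto_intros isCont_tendsto_compose[OF cg] u)
    then show "(\<lambda>n. ?e n t) ----> 0" by (intro tendsto_mult_right_zero) simp
   qed
   show "\<bar>?e n t\<bar> <= cmod (b t) * (2 * B)" for n t
   proof -
    have "norm (g (t + u n) - g (t + c)) <= B + B" by (intro order_trans[OF norm_triangle_ineq4] add_mono B)
    then show "\<bar>?e n t\<bar> <= cmod (b t) * (2 * B)" by (simp add: abs_mult mult_left_mono)
   qed
   show "(\<lambda>t. ?e n t) \<in> borel_measurable lborel" for n
    using norm_measurable[OF cb] borel_measurable_integrable[OF b] by simp
  qed
  then show "(\<lambda>n. vint b (\<lambda>t. g (t + u n))) ----> vint b (\<lambda>t. g (t + c))"
  proof (rule Lim_null_comparison[THEN LIM_zero_cancel, rotated], intro always_eventually allI)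
   fix n
   show "norm (vint b (\<lambda>t. g (t + u n)) - vint b (\<lambda>t. g (t + c))) <= (LBINT t. ?e n t)"
    using vint_norm_le[OF b cb[of n]] vint_diff_right[OF b cont_bdd_shift[OF g] cont_bdd_shift[OF g]] by simp
  qed
 qed
 ultimately show ?thesis unfolding cont_bdd_def by blast
qed

end

text \<open>The test function is kept general: indicators of cells are inserted for the
  vector-valued Fubini theorem, exponentials for the Fourier transform.\<close>

lemma conv_Fubini:
 fixes a b :: "real => complex"
 assumes a: "L1 a" and b: "L1 b"
  and \<psi>: "\<psi> \<in> borel_measurable borel" "\<And>t. cmod (\<psi> t) <= B"
 shows "L1 (conv b a)"
  and "(LBINT r. conv b a r * \<psi> r) = (LBINT t. a t * (LBINT s. b s * \<psi> (s + t)))"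
proof -
 note [measurable] = borel_measurable_integrable[OF a, simplified] borel_measurable_integrable[OF b, simplified] \<psi>(1)
 have shift: "L1 (\<lambda>r. b (r - t))" for t using lborel_integrable_real_affine[OF b, of 1 "- t"] by simp
 have main: "integrable (lborel \<Otimes>\<^sub>M lborel) (\<lambda>(t, r). b (r - t) * a t * \<psi>' r)"
  if [measurable]: "\<psi>' \<in> borel_measurable borel" and B: "\<And>t. cmod (\<psi>' t) <= B'" for \<psi>' B'
 proof (rule lborel_pair.Fubini_integrable)
  have inn: "L1 (\<lambda>r. b (r - t) * a t * \<psi>' r)" for t
   by (rule integrable_mult_bounded[OF _ that(1) B]) (use shift in auto)
  show "AE t in lborel. L1 (\<lambda>r. case (t, r) of (t, r) => b (r - t) * a t * \<psi>' r)"
   using inn by simp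
  have B0: "0 <= B'" using B[of 0] norm_ge_zero order_trans by blast
  have le: "(LBINT r. norm (case (t, r) of (t, r) => b (r - t) * a t * \<psi>' r))
    <= cmod (a t) * (B' * (LBINT s. cmod (b s)))" for t
  proof -
   have "(LBINT r. norm (b (r - t) * a t * \<psi>' r)) <= (LBINT r. cmod (b (r - t)) * (cmod (a t) * B'))"
   proof (rule integral_mono)
    show "L1 (\<lambda>r. norm (b (r - t) * a t * \<psi>' r))" using integrable_norm[OF inn] .
    show "L1 (\<lambda>r. cmod (b (r - t)) * (cmod (a t) * B'))" using integrable_norm[OF shift[of t]] by auto
    show "norm (b (r - t) * a t * \<psi>' r) <= cmod (b (r - t)) * (cmod (a t) * B')" for r
     using B[of r] by (simp add: norm_mult mult.assoc mult_left_mono)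
   qed
   also have "... = (LBINT s. cmod (b s)) * (cmod (a t) * B')"
    using lborel_affine[of 1 "\<lambda>s. cmod (b s)" "- t"] by simp
   finally show ?thesis by (simp add: mult_ac)
  qed
  show "L1 (\<lambda>t. LBINT r. norm (case (t, r) of (t, r) => b (r - t) * a t * \<psi>' r))"
  proof (rule bintble_bound)
   show "L1 (\<lambda>t. cmod (a t) * (B' * (LBINT s. cmod (b s))))" using a by auto
   show "(\<lambda>t. LBINT r. norm (case (t, r) of (t, r) => b (r - t) * a t * \<psi>' r)) \<in> borel_measurable lborel"
    by measurable
  qed (use le in \<open>auto intro!: AE_I2 order_trans[OF _ abs_ge_self]\<close>)
 qed measurable
 have "integrable (lborel \<Otimes>\<^sub>M lborel) (\<lambda>(t, r). b (r - t) * a t * 1)"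
  by (rule main[of "\<lambda>_. 1" 1]) auto
 then have "integrable (lborel \<Otimes>\<^sub>M lborel) (\<lambda>(t, r). b (r - t) * a t)" by simp
 from lborel_pair.integrable_snd[OF this]
 show "L1 (conv b a)" by (simp add: conv_def[abs_def])
 have "(LBINT r. conv b a r * \<psi> r) = (LBINT r. LBINT t. b (r - t) * a t * \<psi> r)"
  by (simp add: conv_def)
 also have "... = (LBINT t. LBINT r. b (r - t) * a t * \<psi> r)"
  by (rule lborel_pair.Fubini_integral[OF main[OF \<psi>]])
 also have "... = (LBINT t. a t * (LBINT s. b s * \<psi> (s + t)))"
 proof (intro bint_cong refl)
  fix t
  have "(LBINT r. b (r - t) * a t * \<psi> r) = a t * (LBINT r. b (r - t) * \<psi> r)"
   by (simp flip: integral_mult_right_zero add: mult_ac)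
  also have "(LBINT r. b (r - t) * \<psi> r) = (LBINT s. b s * \<psi> (s + t))"
   using lborel_affine[of 1 "\<lambda>r. b (r - t) * \<psi> r" t] by (simp add: add.commute)
  finally show "(LBINT r. b (r - t) * a t * \<psi> r) = a t * (LBINT s. b s * \<psi> (s + t))" .
 qed
 finally show "(LBINT r. conv b a r * \<psi> r) = (LBINT t. a t * (LBINT s. b s * \<psi> (s + t)))" .
qed

context cstruct
begin

text \<open>For Riemann sums the identity is scalar Fubini, with indicators of cells as test
  functions: \<open>riem\<close> of the convolution is the integral of \<open>a t\<close> times
  \<open>riem\<close> of \<open>b\<close> translated by \<open>t\<close>. Both sides
  converge.\<close>

lemma vint_conv:
 assumes a: "L1 a" and b: "L1 b" and g: "cont_bdd g"
 shows "vint (conv b a) g = vint a (\<lambda>t. vint b (\<lambda>s. g (s + t)))"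
proof -
 obtain B where B: "\<And>t. norm (g t) <= B" using g by (auto simp: cont_bdd_def)
 have B0: "0 <= B" using B[of 0] norm_ge_zero order_trans by blast
 have cab: "L1 (conv b a)" using conv_Fubini(1)[OF a b, of "\<lambda>_. 1" 1] by simp
 note [measurable] = osc_measurable[OF g] borel_measurable_integrable[OF a, simplified] borel_measurable_integrable[OF b, simplified]
 define \<eta> where "\<eta> n t = (LBINT s. cmod (b s) * osc (Suc n) g (s + t))" for n t
 have \<eta>m [measurable]: "\<eta> n \<in> borel_measurable borel" for n unfolding \<eta>_def by measurable
 have \<eta>le: "\<bar>\<eta> n t\<bar> <= (LBINT s. cmod (b s)) * (2 * B)" for n t
 proof -
  have "\<eta> n t <= (LBINT s. cmod (b s) * (2 * B))" unfolding \<eta>_def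
   using integrable_norm[OF b] osc_le[OF B] osc_nonneg B0
   by (intro integral_mono integrable_mult_bounded_real[where B = "2 * B"]) (auto intro: mult_left_mono)
  moreover have "0 <= \<eta> n t" unfolding \<eta>_def by (intro bint_nonneg) (simp add: osc_nonneg)
  ultimately show ?thesis by simp
 qed
 have lim: "(\<lambda>n. LBINT t. cmod (a t) * \<eta> n t) ----> 0"
 proof (rule integral_tendsto_0[where s = "\<lambda>n t. cmod (a t) * \<eta> n t"])
  show "L1 (\<lambda>t. cmod (a t) * ((LBINT s. cmod (b s)) * (2 * B)))" using a by auto
  show "(\<lambda>n. cmod (a t) * \<eta> n t) ----> 0" for t
   unfolding \<eta>_def by (intro tendsto_mult_right_zero vint_approx(3) b g)
  show "\<bar>cmod (a t) * \<eta> n t\<bar> <= cmod (a t) * ((LBINT s. cmod (b s)) * (2 * B))" for n t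
   using \<eta>le by (simp add: abs_mult mult_left_mono)
 qed auto
 let ?H = "\<lambda>t. vint b (\<lambda>s. g (s + t))"
 have Hint: "(\<lambda>t. a t *\<^sub>J ?H t) integrable_on UNIV"
  by (rule vint_integrable[OF a cont_bdd_vint_shift[OF b g]])
 have R: "norm (riem (Suc n) 0 (conv b a) g - vint a ?H) <= (LBINT t. cmod (a t) * \<eta> n t)" for n
 proof -
  let ?N = "Suc n"
  let ?S = "{- int (?N * ?N)..<int (?N * ?N)}"
  let ?w = "\<lambda>k t. LBINT s. b s * indicator (cell ?N k) (s + t)"
  have wm: "?w k \<in> borel_measurable borel" for k by measurable
  have wle: "cmod (?w k t) <= (LBINT s. cmod (b s))" for k t
  proof -
   have "cmod (?w k t) <= (LBINT s. cmod (b s * indicator (cell ?N k) (s + t)))" by (rule integral_norm_bound)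
   also have "... <= (LBINT s. cmod (b s))"
    using b by (intro integral_mono integrable_norm integrable_cell) (auto simp: norm_mult indicator_def)
   finally show ?thesis .
  qed
  have wint: "L1 (\<lambda>t. a t * ?w k t)" for k by (rule integrable_mult_bounded[OF a wm wle])
  have "riem ?N 0 (conv b a) g = (\<Sum>k\<in>?S. (LBINT t. a t * ?w k t) *\<^sub>J g (of_int k / real ?N))"
   unfolding riem_def add_0_right by (subst conv_Fubini(2)[OF a b, where B = 1]) (auto simp: indicator_def)
  then have h: "((\<lambda>t. \<Sum>k\<in>?S. (a t * ?w k t) *\<^sub>J g (of_int k / real ?N)) has_integral riem ?N 0 (conv b a) g) UNIV"
   using has_integral_cs_const[OF wint] by (auto intro!: has_integral_sum)
  have eq: "(\<Sum>k\<in>?S. (a t * ?w k t) *\<^sub>J g (of_int k / real ?N)) = a t *\<^sub>J riem ?N t b g" for t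
   by (simp add: riem_def C.scale_sum_right)
  have "norm (integral UNIV (\<lambda>t. a t *\<^sub>J riem ?N t b g - a t *\<^sub>J ?H t)) <= (LBINT t. cmod (a t) * \<eta> n t)"
  proof (rule norm_integral_le_LINT)
   show "(\<lambda>t. a t *\<^sub>J riem ?N t b g - a t *\<^sub>J ?H t) integrable_on UNIV"
    using h unfolding eq by (intro integrable_diff Hint) blast
   show "L1 (\<lambda>t. cmod (a t) * \<eta> n t)"
    using integrable_norm[OF a] \<eta>le by (intro integrable_mult_bounded_real) auto
   show "norm (a t *\<^sub>J riem ?N t b g - a t *\<^sub>J ?H t) <= cmod (a t) * \<eta> n t" for t
    using vint_approx(2)[OF b g, of n t] unfolding \<eta>_def
    by (simp add: mult_left_mono flip: C.scale_right_diff_distrib)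
  qed
  moreover have "integral UNIV (\<lambda>t. a t *\<^sub>J riem ?N t b g - a t *\<^sub>J ?H t) = riem ?N 0 (conv b a) g - vint a ?H"
   using h Hint unfolding eq vint_def by (subst integral_diff) (auto simp: integral_unique)
  ultimately show ?thesis by simp
 qed
 have "(\<lambda>n. riem (Suc n) 0 (conv b a) g) ----> vint a ?H"
  by (rule Lim_null_comparison[THEN LIM_zero_cancel, OF _ lim]) (use R in auto)
 moreover have "(\<lambda>n. riem (Suc n) 0 (conv b a) g) ----> vint (conv b a) g"
  by (rule Lim_null_comparison[THEN LIM_zero_cancel, OF _ vint_approx(3)[OF cab g, of 0]])
   (use vint_approx(2)[OF cab g, of _ 0] in auto)
 ultimately show ?thesis by (rule LIMSEQ_unique[symmetric])
qed

end

section \<open>The semigroup calculus on integrable functions\<close>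

text \<open>The inverse Fourier transform without the factor \<open>1 / (2 * pi)\<close>. In this
  normalisation \<open>ift b\<close> is the boundary function of the Laplace transform of
  \<open>b\<close>.\<close>

definition ift :: "(real => complex) => real => complex" where
 "ift b s = (LBINT u. b u * cis (s * u))"

text \<open>Densities on the half line, extended by zero. The vanishing is pointwise and not almost
  everywhere, so that case distinctions on the sign of \<open>t\<close> close at once.\<close>

definition PL1 :: "(real => complex) set" where
 "PL1 = {b. L1 b \<and> (\<forall>t<0. b t = 0)}"

lemma integrable_mult_cis:
 assumes "L1 b"
 shows "L1 (\<lambda>u. b u * cis (s * u + c))"
proof (rule integrable_mult_bounded[OF assms, where B = 1])
 show "(\<lambda>u. cis (s * u + c)) \<in> borel_measurable borel"
  by (intro measurable_contI continuous_intros)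
qed simp

lemma fourier_eq_ift: "fourier h u = ift h (- u)" unfolding fourier_def ift_def
 by (intro bint_cong refl) (simp add: cis_conv_exp mult_ac)

lemma cmod_ift_le: "L1 b ==> cmod (ift b s) <= L1norm b" unfolding ift_def L1norm_def
 by (rule order_trans[OF integral_norm_bound]) (simp add: norm_mult)

lemma continuous_on_ift:
 assumes b: "L1 b"
 shows "continuous_on UNIV (ift b)" unfolding continuous_on_sequentially
proof (intro ballI allI impI, simp add: o_def)
 fix s :: real and u assume u: "u ----> s"
 note [measurable] = borel_measurable_integrable[OF b]
 have [measurable]: "(\<lambda>t. cis (a * t)) \<in> borel_measurable borel" for a
  by (intro measurable_contI continuous_intros)
 show "(\<lambda>n. ift b (u n)) ----> ift b s" unfolding ift_def
 proof (rule integral_dominated_convergence)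
  show "L1 (\<lambda>t. cmod (b t))" using b by simp
  have "continuous_on UNIV cis" by (rule continuous_on_cis[OF continuous_on_id])
  then have "isCont cis t" for t by (simp add: continuous_on_eq_continuous_at)
  then show "AE t in lborel. (\<lambda>n. b t * cis (u n * t)) ----> b t * cis (s * t)"
   by (intro AE_I2 tendsto_intros isCont_tendsto_compose[of _ cis] u)
 qed (auto simp: norm_mult)
qed

lemma L1norm_nonneg: "0 <= L1norm h" by (simp add: L1norm_def)

lemma cmod_fourier_le: "L1 b ==> cmod (fourier b s) <= L1norm b"
 unfolding fourier_eq_ift by (rule cmod_ift_le)

lemma continuous_on_fourier: "L1 b ==> continuous_on UNIV (fourier b)" unfolding fourier_eq_ift[abs_def]
 by (intro continuous_on_compose2[OF continuous_on_ift] continuous_intros) auto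

lemma measurable_fourier: "L1 b ==> fourier b \<in> borel_measurable borel"
 by (intro measurable_contI continuous_on_fourier)

lemma integrable_mult_fourier:
 "L1 \<phi> ==> L1 h ==> L1 (\<lambda>u. \<phi> u * fourier h u)"
 by (rule integrable_mult_bounded[OF _ measurable_fourier cmod_fourier_le])

lemma mult_fourier_PL1: "L1 \<phi> ==> h \<in> H1 ==> (\<lambda>u. \<phi> u * fourier h u) \<in> PL1"
 using integrable_mult_fourier by (auto simp: PL1_def H1_def)

lemma conv_PL1:
 assumes "a \<in> PL1" "b \<in> PL1"
 shows "conv b a \<in> PL1"
proof -
 have "conv b a r = 0" if "r < 0" for r
 proof -
  have "b (r - t) * a t = 0" for t using assms that by (cases "t < 0") (auto simp: PL1_def)
  then show ?thesis by (simp only: conv_def bint_zero)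
 qed
 then show ?thesis using conv_Fubini(1)[of a b "\<lambda>_. 1" 1] assms by (auto simp: PL1_def)
qed

lemma conv_commute: "conv a b = conv b a"
proof
 fix r
 show "conv a b r = conv b a r" using lborel_affine[of "- 1" "\<lambda>t. a (r - t) * b t" r]
  by (simp add: conv_def mult.commute)
qed

lemma ift_conv:
 assumes "L1 a" "L1 b"
 shows "ift (conv b a) s = ift a s * ift b s"
proof -
 have "ift (conv b a) s = (LBINT t. a t * (LBINT v. b v * cis (s * (v + t))))" unfolding ift_def
  by (rule conv_Fubini(2)[OF assms, where B = 1]) (auto intro!: measurable_contI continuous_intros)
 also have "... = (LBINT t. a t * cis (s * t) * ift b s)"
 proof (intro bint_cong refl)
  fix t
  have "(LBINT v. b v * cis (s * (v + t))) = (LBINT v. b v * cis (s * v) * cis (s * t))"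
   by (simp add: distrib_left mult.assoc flip: cis_mult)
  also have "... = ift b s * cis (s * t)" unfolding ift_def by (rule integral_mult_left_zero)
  finally show "a t * (LBINT v. b v * cis (s * (v + t))) = a t * cis (s * t) * ift b s" by (simp add: mult_ac)
 qed
 finally show ?thesis by (simp add: ift_def)
qed

section \<open>Orbits and integrals of the semigroup against densities\<close>

locale c0_semigroup = cstruct J for J :: "'a::banach => 'a" +
 fixes T :: "real => 'a => 'a"
 assumes semigroup: "bounded_C0_semigroup J T"
begin

lemma T_op: "0 <= t ==> cbounded_op J (T t)"
 and T_0 [simp]: "T 0 = id"
 and T_add: "0 <= s ==> 0 <= t ==> T (s + t) x = T s (T t x)"
 and T_cont: "continuous_on {0..} (\<lambda>t. T t x)"
 using semigroup by (auto simp: bounded_C0_semigroup_def)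

lemma T_bound: "\<exists>M\<ge>0. \<forall>t\<ge>0. \<forall>x. norm (T t x) <= M * norm x"
proof -
 obtain M where M: "\<And>t. 0 <= t ==> onorm (T t) <= M"
  using semigroup by (auto simp: bounded_C0_semigroup_def)
 have bl: "bounded_linear (T t)" if "0 <= t" for t using T_op[OF that] by (simp add: cbounded_op_def)
 have "0 <= M" using onorm_pos_le[OF bl[of 0]] M[of 0] by simp
 moreover have "norm (T t x) <= M * norm x" if "0 <= t" for t x
  using onorm[OF bl[OF that], of x] M[OF that] by (meson mult_right_mono norm_ge_zero order_trans)
 ultimately show ?thesis by blast
qed

definition bnd :: real where "bnd = (SOME M. 0 <= M \<and> (\<forall>t\<ge>0. \<forall>x. norm (T t x) <= M * norm x))"

lemma bnd_nonneg: "0 <= bnd" and norm_T_le: "0 <= t ==> norm (T t x) <= bnd * norm x"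
 using someI_ex[OF T_bound] by (auto simp: bnd_def)

text \<open>The constant extension to negative times keeps the orbit bounded and continuous on the
  whole line.\<close>

definition orb :: "'a => real => 'a" where "orb x t = T (max t 0) x"

lemma norm_orb_le: "norm (orb x t) <= bnd * norm x" by (simp add: orb_def norm_T_le)

lemma cont_bdd_orb: "cont_bdd (orb x)"
proof -
 have "continuous_on UNIV (orb x)"
  unfolding orb_def by (rule continuous_on_compose2[OF T_cont]) (auto intro!: continuous_intros)
 then show ?thesis using norm_orb_le unfolding cont_bdd_def by blast
qed

definition op :: "(real => complex) => 'a => 'a" where "op b x = vint b (orb x)"

lemma norm_op_le: "L1 b ==> norm (op b x) <= L1norm b * bnd * norm x"
 using vint_norm_le_const[OF _ cont_bdd_orb norm_orb_le, of b x] by (simp add: op_def L1norm_def mult.assoc)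

lemma op_add_left: "L1 b ==> L1 b' ==> op (\<lambda>t. b t + b' t) x = op b x + op b' x"
 unfolding op_def by (intro vint_add_left cont_bdd_orb)

lemma op_diff_left: "L1 b ==> L1 b' ==> op (\<lambda>t. b t - b' t) x = op b x - op b' x"
 unfolding op_def by (intro vint_diff_left cont_bdd_orb)

lemma op_scale_left: "L1 b ==> op (\<lambda>t. c * b t) x = c *\<^sub>J op b x"
 unfolding op_def by (intro vint_scale_left cont_bdd_orb)

lemma op_sum_left: "finite K ==> (\<And>k. k \<in> K ==> L1 (b k)) ==>
  op (\<lambda>t. \<Sum>k\<in>K. b k t) x = (\<Sum>k\<in>K. op (b k) x)"
 unfolding op_def by (intro vint_sum_left cont_bdd_orb)

lemma cbounded_op_op:
 assumes b: "L1 b"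
 shows "cbounded_op J (op b)"
proof -
 have bl: "bounded_linear (T (max t 0))" for t using T_op[of "max t 0"] by (simp add: cbounded_op_def)
 have add: "op b (x + y) = op b x + op b y" for x y
 proof -
  have "op b (x + y) = integral UNIV (\<lambda>t. b t *\<^sub>J orb x t + b t *\<^sub>J orb y t)"
   unfolding op_def vint_def by (simp add: orb_def linear_simps(1)[OF bl] C.scale_right_distrib)
  then show ?thesis by (simp add: integral_add vint_integrable[OF b cont_bdd_orb] op_def vint_def)
 qed
 have scale: "op b (r *\<^sub>R x) = r *\<^sub>R op b x" for r x
 proof -
  have "orb (r *\<^sub>R x) = (\<lambda>t. of_real r *\<^sub>J orb x t)"
   by (simp add: fun_eq_iff orb_def linear_simps(5)[OF bl])
  then show ?thesis
   using vint_op[OF b cont_bdd_orb cbounded_op_scale[of "of_real r"], of x] by (simp add: op_def)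
 qed
 have J: "op b (J x) = J (op b x)" for x
 proof -
  have "orb (J x) = (\<lambda>t. J (orb x t))" using T_op by (simp add: fun_eq_iff orb_def cbounded_op_def)
  moreover have "cbounded_op J J" by (simp add: cbounded_op_def bounded_linear_J)
  ultimately show ?thesis using vint_op[OF b cont_bdd_orb, of J x] by (simp add: op_def)
 qed
 have "bounded_linear (op b)" by (rule bounded_linear_intro[where K = "L1norm b * bnd"])
   (use add scale norm_op_le[OF b] in \<open>auto simp: mult_ac\<close>)
 then show ?thesis using J by (simp add: cbounded_op_def)
qed

text \<open>The vector-valued Fubini theorem makes the convolution an iterated integral, and
  \<open>T t\<close> is pulled out of the inner one. Since both densities vanish on the negative
  axis, the semigroup law is used for nonnegative times only.\<close>

lemma op_conv:
 assumes a: "a \<in> PL1" and b: "b \<in> PL1"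
 shows "op (conv b a) x = op a (op b x)"
proof -
 have ai: "L1 a" and bi: "L1 b" using a b by (auto simp: PL1_def)
 have "op (conv b a) x = vint a (\<lambda>t. vint b (\<lambda>s. orb x (s + t)))"
  unfolding op_def by (rule vint_conv[OF ai bi cont_bdd_orb])
 also have "... = vint a (orb (op b x))" unfolding vint_def[of a]
 proof (rule arg_cong[where f = "integral UNIV"], rule ext)
  fix t
  show "a t *\<^sub>J vint b (\<lambda>s. orb x (s + t)) = a t *\<^sub>J orb (op b x) t"
  proof (cases "t < 0")
   case True
   then show ?thesis using a by (simp add: PL1_def)
  next
   case False
   have "vint b (\<lambda>s. orb x (s + t)) = vint b (\<lambda>s. T t (orb x s))" unfolding vint_def
   proof (rule arg_cong[where f = "integral UNIV"], rule ext)
    fix s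
    show "b s *\<^sub>J orb x (s + t) = b s *\<^sub>J T t (orb x s)"
     using b False T_add[of t s x] by (cases "s < 0") (simp_all add: PL1_def orb_def max_absorb1 add.commute)
   qed
   also have "... = T t (op b x)"
    unfolding op_def by (rule vint_op[OF bi cont_bdd_orb T_op]) (use False in auto)
   finally show ?thesis using False by (simp add: orb_def)
  qed
 qed
 finally show ?thesis by (simp add: op_def)
qed

lemma op_commute: "a \<in> PL1 ==> b \<in> PL1 ==> op a (op b x) = op b (op a x)"
 by (metis op_conv conv_commute)

lemma integral_eq_op:
 "integral {0..} (\<lambda>t. cscale J (b t) (T t x)) = op (\<lambda>t. indicator {0..} t * b t) x"
proof -
 have "integral {0..} (\<lambda>t. cscale J (b t) (T t x)) = integral UNIV (\<lambda>t. if t \<in> {0..} then cscale J (b t) (T t x) else 0)"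
  by (rule integral_restrict_UNIV[symmetric])
 also have "(\<lambda>t. if t \<in> {0..} then cscale J (b t) (T t x) else 0) = (\<lambda>t. (indicator {0..} t * b t) *\<^sub>J orb x t)"
  by (auto simp: fun_eq_iff orb_def indicator_def max_def)
 finally show ?thesis by (simp add: op_def vint_def)
qed

end

section \<open>The estimate for one elementary convolution by discretisation\<close>

locale gamma_semigroup = c0_semigroup +
 fixes C :: real
 assumes C: "0 <= C" "gamma_ineq J (T ` {0..}) C"
begin

lemma gam2_T:
 fixes x :: "'i::countable => 'a"
 assumes "finite I" "\<And>i. i \<in> I ==> 0 <= t i"
 shows "gam2 J I (\<lambda>i. T (t i) (x i)) <= C^2 * gam2 J I x"
 by (rule gamma_ineq_gam2[OF C(2,1) assms(1)]) (use assms(2) in auto)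

text \<open>The orbit in \<open>op (\<lambda>u. \<phi> u * fourier g u) x\<close> is sampled with
  mesh \<open>1 / (k + 1)\<close> up to time \<open>k + 1\<close>, hence the
  \<open>(k + 1)^2\<close> nodes. The weight \<open>1 - n / (k + 1)^2\<close> turns the samples of
  \<open>fourier g\<close> into the coefficients of a Fejer mean; \<open>kappa\<close> interpolates
  in \<open>u\<close>, with its period \<open>N\<close> counted in mesh units.\<close>

definition disc :: "nat => nat => (real => complex) => (real => complex) => 'a => 'a" where
 "disc k N \<phi> g x = (\<Sum>n<(Suc k)^2. (LBINT u. \<phi> u * of_real (kappa N (u * real (Suc k) - real n))) *\<^sub>J
  ((1 - real n / real ((Suc k)^2)) *\<^sub>R (fourier g (real n / real (Suc k)) *\<^sub>J orb x (real n / real (Suc k)))))"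

lemma kappa_continuous: "continuous_on UNIV (kappa N)"
 unfolding kappa_def[abs_def] dkern_def by (cases "N = 0") (auto intro!: continuous_intros)

lemma kappa_measurable [measurable]: "kappa N \<in> borel_measurable borel"
 by (intro measurable_contI kappa_continuous)

lemma kappa_le_1: "0 < N ==> kappa N x <= 1"
proof -
 assume N: "0 < N"
 have "cmod (dkern N t) <= real N" for t unfolding dkern_def by (rule order_trans[OF norm_sum]) simp
 then have "(cmod (dkern N (2 * pi * x / real N)))^2 <= (real N)^2" by (intro power_mono) auto
 then show ?thesis using N by (simp add: kappa_def)
qed

lemma cont_bdd_fourier_orb:
 assumes g: "L1 g"
 shows "cont_bdd (\<lambda>u. fourier g u *\<^sub>J orb x u)" "norm (fourier g u *\<^sub>J orb x u) <= L1norm g * (bnd * norm x)"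
proof -
 show le: "norm (fourier g u *\<^sub>J orb x u) <= L1norm g * (bnd * norm x)" for u
  using cmod_fourier_le[OF g] norm_orb_le L1norm_nonneg by (simp add: mult_mono)
 show "cont_bdd (\<lambda>u. fourier g u *\<^sub>J orb x u)"
  using le continuous_on_fourier[OF g] cont_bdd_orb[of x] unfolding cont_bdd_def
  by (auto intro!: continuous_intros)
qed

text \<open>The weights \<open>kappa\<close> are a partition of unity around the node position
  \<open>v = u * (k + 1)\<close>. Nodes at distance below \<open>A\<close> are handled by continuity
  of \<open>B\<close>, the Cesaro factor costing
  \<open>(\<bar>u\<bar> + \<delta>) * K / (k + 1)\<close>; the nodes in \<open>F\<close> by the
  decay of \<open>kappa\<close>. There remain wrapped nodes with \<open>v < A\<close>: they force
  \<open>u <= 0\<close>, so \<open>B u = 0\<close>, and the lower bound on the period puts them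
  beyond the range of the sum, where the padded values \<open>y n\<close> vanish as well.\<close>

lemma disc_pointwise:
 assumes B: "cont_bdd B" "\<And>t. norm (B t) <= K" "\<And>t. t <= 0 ==> B t = 0" and N: "\<And>k. 4 * (Suc k)^2 <= N k"
 shows "(\<lambda>k. (\<Sum>n<(Suc k)^2. of_real (kappa (N k) (u * real (Suc k) - real n)) *\<^sub>J
   ((1 - real n / real ((Suc k)^2)) *\<^sub>R B (real n / real (Suc k))))) ----> B u"
  (is "?S ----> _") unfolding LIMSEQ_iff
proof (intro allI impI)
 fix \<epsilon> :: real assume \<epsilon>: "0 < \<epsilon>"
 have K: "0 <= K" using B(2)[of 0] norm_ge_zero order_trans by blast
 have "isCont B u" using B(1) by (simp add: cont_bdd_def continuous_on_eq_continuous_at)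
 then obtain d where d: "0 < d" "\<And>t. \<bar>t - u\<bar> < d ==> norm (B t - B u) < \<epsilon> / 4"
  unfolding continuous_at_eps_delta using \<epsilon> by (metis dist_norm real_norm_def zero_less_divide_iff zero_less_numeral)
 \<comment> \<open>For positive \<open>u\<close> the radius is cut down to at most \<open>u\<close>,
   so that \<open>v < A\<close> is possible only when \<open>u <= 0\<close>.\<close>
 define \<delta> where "\<delta> = (if 0 < u then min d u else d)"
 have \<delta>: "0 < \<delta>" "0 < u ==> \<delta> <= u" "\<And>t. \<bar>t - u\<bar> < \<delta> ==> norm (B t - B u) < \<epsilon> / 4"
  using d by (auto simp: \<delta>_def split: if_splits)
 have "eventually (\<lambda>k. (\<bar>u\<bar> + \<delta>) * K / real (Suc k) < \<epsilon> / 4) sequentially"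
 proof -
  have "(\<lambda>k. (\<bar>u\<bar> + \<delta>) * K / real (Suc k)) ----> 0"
   by (rule tendsto_divide_0[OF tendsto_const filterlim_compose[OF filterlim_at_top_imp_at_infinity[OF filterlim_real_sequentially] filterlim_Suc]])
  then show ?thesis by (rule order_tendstoD(2)) (use \<epsilon> in simp)
 qed
 moreover have "eventually (\<lambda>k. 24 * K / (\<delta> * real (Suc k) - 1) < \<epsilon> / 4) sequentially"
 proof -
  have "filterlim (\<lambda>k. \<delta> * real (Suc k) + (- 1)) at_top sequentially"
   by (subst add.commute) (intro filterlim_tendsto_add_at_top[OF tendsto_const]
    filterlim_tendsto_pos_mult_at_top[OF tendsto_const \<delta>(1)]
    filterlim_compose[OF filterlim_real_sequentially filterlim_Suc])
  from tendsto_divide_0[OF tendsto_const filterlim_at_top_imp_at_infinity[OF this], of "24 * K"]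
  show ?thesis using \<epsilon> by (intro order_tendstoD(2)) auto
 qed
 moreover have "eventually (\<lambda>k. \<bar>u\<bar> + \<delta> + 2 / \<delta> <= real (Suc k)) sequentially"
 proof -
  have "filterlim (\<lambda>k. real (Suc k)) at_top sequentially"
   by (rule filterlim_compose[OF filterlim_real_sequentially filterlim_Suc])
  then show ?thesis by (rule filterlim_at_top[THEN iffD1, rule_format])
 qed
 ultimately have "eventually (\<lambda>k. norm (?S k - B u) < \<epsilon>) sequentially"
 proof eventually_elim
  case (elim k)
  define m where "m = Suc k"
  define v where "v = u * real m"
  define A where "A = \<delta> * real m"
  define y where "y n = (if n < m^2 then (1 - real n / real (m^2)) *\<^sub>R B (real n / real m) else 0)" for n
  let ?\<kappa> = "\<lambda>n. kappa (N k) (v - real n)"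
  have m: "0 < m" and mm: "\<bar>u\<bar> + \<delta> + 2 / \<delta> <= real m" using elim by (auto simp: m_def)
  have Nk: "4 * real (m^2) <= real (N k)" using N[of k] unfolding m_def by linarith
  have N0: "0 < N k" using N[of k] by (metis gr0I mult_is_0 not_numeral_le_zero le_zero_eq power_eq_0_iff nat.distinct(1) zero_neq_numeral)
  have mN: "m^2 <= N k" using N[of k] unfolding m_def by linarith
  have uv: "\<bar>v\<bar> <= real (m^2)" "\<bar>v\<bar> + A <= real (m^2)"
  proof -
   have "(\<bar>u\<bar> + \<delta>) * real m <= real m * real m"
    using mm \<delta>(1) by (intro mult_right_mono) (auto intro: order_trans[OF _ mm])
   moreover have "\<bar>v\<bar> = \<bar>u\<bar> * real m" by (simp add: v_def abs_mult)
   ultimately show "\<bar>v\<bar> + A <= real (m^2)" by (simp add: A_def power2_eq_square algebra_simps)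
   then show "\<bar>v\<bar> <= real (m^2)" using \<delta>(1) unfolding A_def by (smt (verit) mult_nonneg_nonneg of_nat_0_le_iff)
  qed
  have A: "1 < A"
  proof -
   have "2 / \<delta> <= real m" using mm \<delta>(1) by linarith
   then have "2 <= A" using \<delta>(1) by (simp add: A_def field_simps)
   then show ?thesis by simp
  qed
  have Sk: "?S k = (\<Sum>n<N k. ?\<kappa> n *\<^sub>R y n)"
  proof -
   have "?S k = (\<Sum>n<m^2. ?\<kappa> n *\<^sub>R y n)"
    unfolding v_def m_def[symmetric] by (intro sum.cong refl) (simp add: y_def)
   also have "... = (\<Sum>n<N k. ?\<kappa> n *\<^sub>R y n)"
    using mN by (intro sum.mono_neutral_left) (auto simp: y_def)
   finally show ?thesis .
  qed
  have yK: "norm (y n) <= K" for n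
  proof (cases "n < m^2")
   case True
   have c: "0 <= 1 - real n / real (m^2)" "1 - real n / real (m^2) <= 1" using True m by (auto simp: divide_simps)
   have "norm (y n) = (1 - real n / real (m^2)) * norm (B (real n / real m))" using True c(1) by (simp add: y_def)
   also have "... <= 1 * K" using c B(2) by (intro mult_mono) auto
   finally show ?thesis by simp
  qed (simp add: y_def K)
  define F where "F = {n \<in> {..<N k}. A <= \<bar>real n - v\<bar> \<and> (real n - v <= real (N k) / 2 \<or> A <= v)}"
  have near_far: "norm (y n - B u) <= (\<epsilon> / 4 + (\<bar>u\<bar> + \<delta>) * K / real m) + (if n \<in> F then 2 * K else 0)" if n: "n < N k" for n
  proof -
   have pos: "0 <= \<epsilon> / 4 + (\<bar>u\<bar> + \<delta>) * K / real m" using \<epsilon> K \<delta>(1) by simp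
   have "n \<in> F \<or> \<bar>real n - v\<bar> < A \<or> (A <= \<bar>real n - v\<bar> \<and> real (N k) / 2 < real n - v \<and> v < A)"
    using n by (auto simp: F_def)
   then consider "n \<in> F" | "\<bar>real n - v\<bar> < A" | "A <= \<bar>real n - v\<bar>" "real (N k) / 2 < real n - v" "v < A"
    by blast
   then show ?thesis
   proof cases
    case 1
    have "norm (y n - B u) <= K + K" by (intro order_trans[OF norm_triangle_ineq4] add_mono yK B(2))
    then show ?thesis using 1 pos by simp
   next
    case 2
    have nlt: "real n < \<bar>v\<bar> + A" using 2 by linarith
    then have nm: "n < m^2" using uv(2) by (metis le_less_trans less_le_trans of_nat_less_iff)
    have "\<bar>real n / real m - u\<bar> = \<bar>real n - v\<bar> / real m"
    proof -
     have "real n / real m - u = (real n - v) / real m" using m by (simp add: v_def field_simps)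
     then show ?thesis by (simp add: abs_divide)
    qed
    also have "... < \<delta>" using 2 m by (simp add: A_def divide_less_eq)
    finally have 1: "norm (B (real n / real m) - B u) < \<epsilon> / 4" by (rule \<delta>(3))
    have "y n - B u = (B (real n / real m) - B u) - (real n / real (m^2)) *\<^sub>R B (real n / real m)"
     using nm by (simp add: y_def algebra_simps)
    then have "norm (y n - B u) <= norm (B (real n / real m) - B u) + (real n / real (m^2)) * norm (B (real n / real m))"
     by (simp only:) (rule order_trans[OF norm_triangle_ineq4], simp)
    also have "(real n / real (m^2)) * norm (B (real n / real m)) <= (\<bar>v\<bar> + A) / real (m^2) * K"
     using nlt B(2) by (intro mult_mono divide_right_mono) auto
    also have "(\<bar>v\<bar> + A) / real (m^2) * K = (\<bar>u\<bar> + \<delta>) * K / real m"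
     using m by (simp add: v_def A_def abs_mult power2_eq_square field_simps)
    finally show ?thesis using 1 K by auto
   next
    case 3
    have "\<not> 0 < u"
    proof
     assume "0 < u"
     then have "\<delta> * real m <= u * real m" using \<delta>(2) by (intro mult_right_mono) auto
     then show False using 3 by (simp add: A_def v_def)
    qed
    then have "B u = 0" using B(3) by simp
    moreover have "\<not> n < m^2"
    proof
     assume "n < m^2"
     then have "real n < real (m^2)" by (simp only: of_nat_less_iff)
     then show False using 3(2) Nk uv(1) by linarith
    qed
    ultimately have "norm (y n - B u) = 0" by (simp add: y_def)
    moreover have "0 <= (if n \<in> F then 2 * K else 0)" using K by simp
    ultimately show ?thesis using pos by linarith
   qed
  qed
  have "norm (?S k - B u) = norm (\<Sum>n<N k. ?\<kappa> n *\<^sub>R (y n - B u))"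
   unfolding Sk using sum_kappa[OF N0, of v]
   by (simp add: scaleR_diff_right sum_subtractf flip: scaleR_sum_left)
  also have "... <= (\<Sum>n<N k. ?\<kappa> n * norm (y n - B u))"
   by (rule order_trans[OF norm_sum]) (simp add: kappa_nonneg)
  also have "... <= (\<Sum>n<N k. ?\<kappa> n * ((\<epsilon> / 4 + (\<bar>u\<bar> + \<delta>) * K / real m) + (if n \<in> F then 2 * K else 0)))"
   using near_far by (intro sum_mono mult_left_mono kappa_nonneg) auto
  also have "... = (\<epsilon> / 4 + (\<bar>u\<bar> + \<delta>) * K / real m) + 2 * K * (\<Sum>n\<in>F. ?\<kappa> n)"
  proof -
   have "(\<Sum>n<N k. ?\<kappa> n * (if n \<in> F then 2 * K else 0)) = (\<Sum>n\<in>F. 2 * K * ?\<kappa> n)"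
    by (rule sum.mono_neutral_cong_right) (auto simp: F_def)
   then show ?thesis
    by (simp only: distrib_left sum.distrib sum_distrib_left[symmetric] sum_distrib_right[symmetric]
      sum_kappa[OF N0, of v] mult_1_left)
  qed
  also have "2 * K * (\<Sum>n\<in>F. ?\<kappa> n) <= 2 * K * (12 / (A - 1))"
   using K uv(1) Nk by (intro mult_left_mono sum_kappa_far N0 A) (auto simp: F_def)
  also have "\<epsilon> / 4 + (\<bar>u\<bar> + \<delta>) * K / real m + 2 * K * (12 / (A - 1)) < \<epsilon>"
  proof -
   have "2 * K * (12 / (A - 1)) = 24 * K / (A - 1)" by simp
   then show ?thesis using elim(1,2) \<epsilon> unfolding m_def A_def by linarith
  qed
  finally show ?case by simp
 qed
 then show "\<exists>no. \<forall>k\<ge>no. norm (?S k - B u) < \<epsilon>" by (simp add: eventually_sequentially)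
qed

lemma disc_tendsto:
 assumes \<phi>: "L1 \<phi>" and g: "g \<in> H1" and N: "\<And>k. 4 * (Suc k)^2 <= N k"
 shows "(\<lambda>k. disc k (N k) \<phi> g x) ----> op (\<lambda>u. \<phi> u * fourier g u) x"
proof -
 have gi: "L1 g" and g0: "\<And>u. u <= 0 ==> fourier g u = 0" using g by (auto simp: H1_def)
 define B where "B u = fourier g u *\<^sub>J orb x u" for u
 define K where "K = L1norm g * (bnd * norm x)"
 have B: "cont_bdd B" "\<And>t. norm (B t) <= K" "\<And>t. t <= 0 ==> B t = 0"
  using cont_bdd_fourier_orb(1)[OF gi, of x] cont_bdd_fourier_orb(2)[OF gi, of _ x] g0 by (auto simp: B_def[abs_def] K_def)
 have K0: "0 <= K" using B(2)[of 0] norm_ge_zero order_trans by blast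
 define y where "y k n = (1 - real n / real ((Suc k)^2)) *\<^sub>R B (real n / real (Suc k))" for k n
 define S where "S k u = (\<Sum>n<(Suc k)^2. of_real (kappa (N k) (u * real (Suc k) - real n)) *\<^sub>J y k n)" for k u
 have N0: "0 < N k" for k
  using N[of k] by (metis gr0I mult_is_0 le_zero_eq power_eq_0_iff nat.distinct(1) zero_neq_numeral)
 have yK: "norm (y k n) <= K" if "n < (Suc k)^2" for k n
 proof -
  have "0 < real ((Suc k)^2)" by simp
  then have c: "0 <= 1 - real n / real ((Suc k)^2)" "1 - real n / real ((Suc k)^2) <= 1"
   using that by (auto simp only: divide_le_eq_1_pos le_diff_eq diff_le_eq of_nat_le_iff add_0_left intro!: add_increasing2 divide_nonneg_nonneg of_nat_0_le_iff)
  have "norm (y k n) = (1 - real n / real ((Suc k)^2)) * norm (B (real n / real (Suc k)))" using c(1) by (simp add: y_def)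
  also have "... <= 1 * K" using c B(2) by (intro mult_mono) auto
  finally show ?thesis by simp
 qed
 have SK: "norm (S k u) <= K" for k u
 proof -
  have mN: "(Suc k)^2 <= N k" using N[of k] by linarith
  have "norm (S k u) <= (\<Sum>n<(Suc k)^2. kappa (N k) (u * real (Suc k) - real n) * K)"
   unfolding S_def using yK by (intro order_trans[OF norm_sum] sum_mono) (auto simp: kappa_nonneg intro!: mult_left_mono)
  also have "... <= (\<Sum>n<N k. kappa (N k) (u * real (Suc k) - real n) * K)"
   using mN K0 kappa_nonneg by (intro sum_mono2) auto
  also have "... = K" using sum_kappa[OF N0, of k "u * real (Suc k)"] by (simp flip: sum_distrib_right)
  finally show ?thesis .
 qed
 have Sc: "continuous_on UNIV (S k)" for k unfolding S_def
  by (intro continuous_intros continuous_on_of_real continuous_on_compose2[OF kappa_continuous]) auto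
 have S: "cont_bdd (S k)" for k using Sc SK unfolding cont_bdd_def by blast
 have SB: "cont_bdd (\<lambda>u. S k u - B u)" for k
 proof -
  have "norm (S k u - B u) <= K + K" for u by (intro order_trans[OF norm_triangle_ineq4] add_mono SK B)
  then show ?thesis using Sc B(1) unfolding cont_bdd_def by (auto intro!: continuous_intros)
 qed
 have disc: "disc k (N k) \<phi> g x = vint \<phi> (S k)" for k
 proof -
  have "((\<lambda>u. \<Sum>n<(Suc k)^2. (\<phi> u * of_real (kappa (N k) (u * real (Suc k) - real n))) *\<^sub>J y k n)
    has_integral disc k (N k) \<phi> g x) UNIV" unfolding disc_def y_def B_def
   by (intro has_integral_sum has_integral_cs_const integrable_mult_bounded[OF \<phi>, where B = 1])
    (auto simp: kappa_nonneg kappa_le_1[OF N0])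
  then show ?thesis by (simp add: vint_def S_def C.scale_sum_right cs_scaleR integral_unique)
 qed
 have op: "op (\<lambda>u. \<phi> u * fourier g u) x = vint \<phi> B" by (simp add: op_def vint_def B_def)
 have "(\<lambda>k. LBINT u. cmod (\<phi> u) * norm (S k u - B u)) ----> 0"
 proof (rule integral_tendsto_0[where s = "\<lambda>k u. cmod (\<phi> u) * norm (S k u - B u)"])
  show "L1 (\<lambda>u. cmod (\<phi> u) * (2 * K))" using \<phi> by auto
  show "(\<lambda>u. cmod (\<phi> u) * norm (S k u - B u)) \<in> borel_measurable lborel" for k
   using norm_measurable[OF SB] borel_measurable_integrable[OF \<phi>] by simp
  show "(\<lambda>k. cmod (\<phi> u) * norm (S k u - B u)) ----> 0" for u
   using disc_pointwise[OF B N, of u] unfolding S_def y_def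
   by (intro tendsto_mult_right_zero tendsto_norm_zero LIM_zero)
  show "\<bar>cmod (\<phi> u) * norm (S k u - B u)\<bar> <= cmod (\<phi> u) * (2 * K)" for k u
  proof -
   have "norm (S k u - B u) <= K + K" by (intro order_trans[OF norm_triangle_ineq4] add_mono SK B)
   then show ?thesis by (simp add: abs_mult mult_left_mono)
  qed
 qed
 then show ?thesis
 proof (rule Lim_null_comparison[THEN LIM_zero_cancel, rotated], intro always_eventually allI)
  show "norm (disc k (N k) \<phi> g x - op (\<lambda>u. \<phi> u * fourier g u) x) <= (LBINT u. cmod (\<phi> u) * norm (S k u - B u))" for k
   unfolding disc op using vint_norm_le[OF \<phi> SB] vint_diff_right[OF \<phi> S B(1)] by simp
 qed
qed

text \<open>Integrating the averaged form of \<open>kappa\<close> against \<open>\<phi>\<close>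
  leaves only samples of \<open>ift \<phi>\<close>. Where these are bounded by one, they supply the
  diagonal of the Hankel form.\<close>

lemma LINT_mult_kappa:
 assumes \<phi>: "L1 \<phi>" and N: "0 < N"
 shows "(LBINT u. \<phi> u * of_real (kappa N (u * r - real n)))
  = (\<Sum>l<N. (\<Sum>j<N. ift \<phi> (2 * pi * r * (real j - real l) / real N)
    * cis (- 2 * pi * (real j - real l) * real n / real N)) / of_nat N) / of_nat N"
proof -
 let ?A = "\<lambda>j l. 2 * pi * r * (real j - real l) / real N"
 let ?B = "\<lambda>j l. - 2 * pi * (real j - real l) * real n / real N"
 have eq: "\<phi> u * of_real (kappa N (u * r - real n))
   = (\<Sum>l<N. (\<Sum>j<N. \<phi> u * cis (?A j l * u + ?B j l)) / of_nat N) / of_nat N" for u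
 proof -
  have "2 * pi * (real j - real l) * (u * r - real n) / real N = ?A j l * u + ?B j l" for j l
   using N by (simp add: field_simps)
  then show ?thesis unfolding kappa_eq_average by (simp only: sum_distrib_left times_divide_eq_right)
 qed
 have int: "L1 (\<lambda>u. \<phi> u * cis (?A j l * u + ?B j l))" for j l
  by (rule integrable_mult_cis[OF \<phi>])
 have val: "(LBINT u. \<phi> u * cis (?A j l * u + ?B j l)) = ift \<phi> (?A j l) * cis (?B j l)" for j l
  unfolding ift_def cis_mult[symmetric] mult.assoc[symmetric] by (rule integral_mult_left_zero)
 show ?thesis unfolding eq integral_divide_zero by (simp only: bint_sum integral_divide_zero bintble_sum
    integrable_divide int val)
qed

text \<open>For each shift \<open>l\<close> the operator with coefficients \<open>W i * V i\<close>
  is a Hankel form with constant \<open>C^2 * (1 + \<eta>)\<close>: the mean of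
  \<open>cmod (poly (p i))\<close> over the nodes is at most one, and Riesz factorisation adds
  \<open>\<eta>\<close>. Averaging over \<open>l\<close> reproduces the integrals against
  \<open>kappa\<close> and keeps the constant by convexity. The result \<open>Z\<close> misses
  \<open>disc\<close> only by the difference of \<open>W i * V i\<close> and
  \<open>p i\<close>.\<close>

lemma disc_approx:
 fixes x :: "'i::countable => 'a"
 assumes fin: "finite I" and \<phi>: "\<And>i. i \<in> I ==> L1 (\<phi> i)"
  and \<phi>1: "\<And>i s. i \<in> I ==> cmod (ift (\<phi> i) s) <= 1"
  and g: "\<And>i. i \<in> I ==> g i \<in> H1" "\<And>i. i \<in> I ==> L1norm (g i) <= 1" and \<eta>: "0 < \<eta>"
 shows "\<exists>N\<ge>4 * (Suc k)^2. \<exists>Z. gam2 J I Z <= (C^2 * (1 + \<eta>))^2 * gam2 J I x \<and>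
  (\<forall>i\<in>I. norm (Z i - disc k N (\<phi> i) (g i) (x i)) <= \<eta> * (bnd * norm (x i)))"
proof -
 let ?M = "(Suc k)^2" and ?\<tau> = "1 / real (Suc k)"
 define c where "c i n = cr (1 - real n / real ?M) * fourier (g i) (real n * ?\<tau>)" for i n
 define p where "p i = (\<Sum>n<?M. monom (c i n) n)" for i
 have cp: "coeff (p i) n = (if n < ?M then c i n else 0)" for i n by (simp add: p_def coeff_sum)
 have "\<exists>W V. (\<forall>z. cmod z = 1 \<longrightarrow> (cmod (poly W z))^2 <= cmod (poly (p i) z) + \<eta>) \<and>
   (\<forall>z. cmod z = 1 \<longrightarrow> (cmod (poly V z))^2 <= cmod (poly (p i) z) + \<eta>) \<and>
   (\<forall>N. (\<Sum>n<N. cmod (coeff (W * V - p i) n)) <= \<eta>)" for i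
  using riesz_factorisation_poly[OF \<eta>, of "p i"] by metis
 then obtain W V where W: "\<And>i z. cmod z = 1 ==> (cmod (poly (W i) z))^2 <= cmod (poly (p i) z) + \<eta>"
  and V: "\<And>i z. cmod z = 1 ==> (cmod (poly (V i) z))^2 <= cmod (poly (p i) z) + \<eta>"
  and WV: "\<And>i N. (\<Sum>n<N. cmod (coeff (W i * V i - p i) n)) <= \<eta>" by metis
 \<comment> \<open>The factors have degrees that are not controlled in advance, so the period is
   fixed only here. The summand \<open>4 * ?M\<close> serves the convergence of
   \<open>disc\<close>.\<close>
 define N where "N = 4 * ?M + (\<Sum>i\<in>I. Suc (degree (W i)) + Suc (degree (V i)))"
 have deg: "degree (W i) < N" "degree (V i) < N" if "i \<in> I" for i
 proof -
  have "Suc (degree (W i)) + Suc (degree (V i)) <= (\<Sum>i\<in>I. Suc (degree (W i)) + Suc (degree (V i)))"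
   using fin that by (intro member_le_sum) auto
  then show "degree (W i) < N" "degree (V i) < N" by (auto simp: N_def)
 qed
 have NM: "4 * ?M <= N" "?M <= N" "0 < N" by (auto simp: N_def)
 have pol: "poly (p i) (cis (2 * pi * real j / real N))
   = (\<Sum>n<?M. c i n * cis (2 * pi * real j * real n / real N))" for i j
  by (simp add: p_def poly_sum poly_monom Complex.DeMoivre mult_ac)
 have mean: "(\<Sum>j<N. cmod (poly (p i) (cis (2 * pi * real j / real N)))) <= real N" if "i \<in> I" for i
 proof -
  have "(\<Sum>j<N. cmod (poly (p i) (cis (2 * pi * real j / real N)))) <= real N * L1norm (g i)"
   unfolding pol c_def by (rule fejer_poly_mean_le[OF g(1)[OF that]]) (use NM in auto)
  also have "... <= real N * 1" using g(2)[OF that] by (intro mult_left_mono) auto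
  finally show ?thesis by simp
 qed
 have l2: "(\<Sum>q<N. (cmod (coeff Q q))^2) <= 1 + \<eta>"
  if i: "i \<in> I" and Q: "degree Q < N" "\<And>z. cmod z = 1 ==> (cmod (poly Q z))^2 <= cmod (poly (p i) z) + \<eta>" for i Q
 proof -
  have "(\<Sum>q<N. (cmod (coeff Q q))^2) <= (\<Sum>j<N. cmod (poly (p i) (cis (2 * pi * real j / real N))) + \<eta>) / real N"
   unfolding sum_coeff_sq_eq_mean[OF Q(1)] by (intro divide_right_mono sum_mono Q(2)) auto
  also have "... <= (real N + real N * \<eta>) / real N"
   using mean[OF i] by (intro divide_right_mono) (auto simp: sum.distrib)
  also have "... = 1 + \<eta>" using NM(3) by (simp add: add_divide_distrib)
  finally show ?thesis .
 qed
 define y where "y l i j = ift (\<phi> i) (2 * pi * real (Suc k) * (real j - real l) / real N)" for l i j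
 define a where "a l i n = (\<Sum>j<N. y l i j * cis (- 2 * pi * (real j - real l) * real n / real N)) / of_nat N" for l i n
 define A where "A n = T (real n * ?\<tau>)" for n :: nat
 define Z where "Z l i = (\<Sum>n<2*N. (coeff (W i * V i) n * a l i n) *\<^sub>J A n (x i))" for l i
 have gZ: "gam2 J I (Z l) <= (C^2 * (1 + \<eta>))^2 * gam2 J I x" for l unfolding Z_def a_def
 proof (rule gam2_hankel_poly[OF fin NM(3), where c = "real l"])
  show "cbounded_op J (A n)" for n unfolding A_def by (rule T_op) simp
  show "A p (A q z) = A (p + q) z" for p q z
  proof -
   have "real (p + q) * ?\<tau> = real p * ?\<tau> + real q * ?\<tau>" by (simp add: add_divide_distrib)
   then show ?thesis unfolding A_def by (simp only:, subst T_add) auto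
  qed
  show "gam2 J (I \<times> {..<N}) (\<lambda>(i, n). A n (z (i, n))) <= C^2 * gam2 J (I \<times> {..<N}) z" for z
   using gam2_T[of "I \<times> {..<N}" "\<lambda>(i, n). real n * ?\<tau>" z] fin by (simp add: A_def case_prod_beta')
  show "(\<Sum>q<N. (cmod (coeff (W i) q))^2) <= 1 + \<eta>" if "i \<in> I" for i using l2[OF that deg(1)[OF that] W] .
  show "(\<Sum>q<N. (cmod (coeff (V i) q))^2) <= 1 + \<eta>" if "i \<in> I" for i using l2[OF that deg(2)[OF that] V] .
 qed (use \<eta> deg \<phi>1 in \<open>auto simp: y_def\<close>)
 define Z' where "Z' i = (\<Sum>l<N. (1 / real N) *\<^sub>R Z l i)" for i
 have "gam2 J I Z' <= (\<Sum>l<N. (1 / real N) * gam2 J I (Z l))"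
  unfolding Z'_def using NM(3) by (intro gam2_convex fin) auto
 also have "... <= (\<Sum>l<N. (1 / real N) * ((C^2 * (1 + \<eta>))^2 * gam2 J I x))"
  by (intro sum_mono mult_left_mono gZ) auto
 also have "... = (C^2 * (1 + \<eta>))^2 * gam2 J I x" using NM(3) by simp
 finally have gZ': "gam2 J I Z' <= (C^2 * (1 + \<eta>))^2 * gam2 J I x" .
 define b where "b i n = (\<Sum>l<N. a l i n) / of_nat N" for i n
 have avg_le: "cmod ((\<Sum>j<N. f j) / of_nat N) <= 1" if "\<And>j. j < N ==> cmod (f j) <= 1" for f
 proof -
  have "cmod (\<Sum>j<N. f j) <= (\<Sum>j<N. 1)" using that by (intro order_trans[OF norm_sum] sum_mono) auto
  then show ?thesis using NM(3) by (simp add: norm_divide)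
 qed
 have b1: "cmod (b i n) <= 1" if "i \<in> I" for i n
  unfolding b_def a_def by (intro avg_le) (auto simp: norm_mult y_def \<phi>1[OF that])
 have "norm (Z' i - disc k N (\<phi> i) (g i) (x i)) <= \<eta> * (bnd * norm (x i))" if i: "i \<in> I" for i
 proof -
  have 1: "Z' i = (\<Sum>n<2*N. (coeff (W i * V i) n * b i n) *\<^sub>J A n (x i))"
  proof -
   have "Z' i = (\<Sum>l<N. \<Sum>n<2*N. (coeff (W i * V i) n * (a l i n / of_nat N)) *\<^sub>J A n (x i))"
    unfolding Z'_def Z_def scaleR_sum_right by (intro sum.cong refl) (simp flip: cs_of_real)
   also have "... = (\<Sum>n<2*N. \<Sum>l<N. (coeff (W i * V i) n * (a l i n / of_nat N)) *\<^sub>J A n (x i))"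
    by (rule sum.swap)
   finally show ?thesis by (simp add: b_def sum_divide_distrib sum_distrib_left C.scale_sum_left)
  qed
  have 2: "disc k N (\<phi> i) (g i) (x i) = (\<Sum>n<2*N. (coeff (p i) n * b i n) *\<^sub>J A n (x i))"
  proof -
   have "disc k N (\<phi> i) (g i) (x i) = (\<Sum>n<?M. (coeff (p i) n * b i n) *\<^sub>J A n (x i))"
    unfolding disc_def
   proof (rule sum.cong[OF refl])
    fix n assume n: "n \<in> {..<?M}"
    have bn: "(LBINT u. \<phi> i u * of_real (kappa N (u * real (Suc k) - real n))) = b i n"
     unfolding LINT_mult_kappa[OF \<phi>[OF i] NM(3)] b_def a_def y_def ..
    have An: "orb (x i) (real n / real (Suc k)) = A n (x i)" by (simp add: orb_def A_def max_absorb1)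
    show "(LBINT u. \<phi> i u * of_real (kappa N (u * real (Suc k) - real n))) *\<^sub>J
      ((1 - real n / real ?M) *\<^sub>R (fourier (g i) (real n / real (Suc k)) *\<^sub>J orb (x i) (real n / real (Suc k))))
     = (coeff (p i) n * b i n) *\<^sub>J A n (x i)"
     unfolding bn An cs_of_real[symmetric] C.scale_scale using n
     by (simp add: cp c_def mult_ac del: cs_of_real)
   qed
   also have "... = (\<Sum>n<2*N. (coeff (p i) n * b i n) *\<^sub>J A n (x i))"
    using NM(2) by (intro sum.mono_neutral_left) (auto simp: cp)
   finally show ?thesis .
  qed
  have "norm (Z' i - disc k N (\<phi> i) (g i) (x i)) = norm (\<Sum>n<2*N. (coeff (W i * V i - p i) n * b i n) *\<^sub>J A n (x i))"
   unfolding 1 2 by (simp add: left_diff_distrib C.scale_left_diff_distrib sum_subtractf)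
  also have "... <= (\<Sum>n<2*N. cmod (coeff (W i * V i - p i) n) * (bnd * norm (x i)))"
  proof (rule order_trans[OF norm_sum], rule sum_mono)
   fix n
   have "cmod (coeff (W i * V i - p i) n * b i n) * norm (A n (x i)) <= (cmod (coeff (W i * V i - p i) n) * 1) * (bnd * norm (x i))"
    unfolding norm_mult A_def by (intro mult_mono mult_left_mono b1[OF i] norm_T_le) auto
   then show "norm ((coeff (W i * V i - p i) n * b i n) *\<^sub>J A n (x i)) <= cmod (coeff (W i * V i - p i) n) * (bnd * norm (x i))"
    by (simp only: norm_cs mult_1_right)
  qed
  also have "... = (\<Sum>n<2*N. cmod (coeff (W i * V i - p i) n)) * (bnd * norm (x i))"
   by (rule sum_distrib_right[symmetric])
  also have "... <= \<eta> * (bnd * norm (x i))" using bnd_nonneg by (intro mult_right_mono WV) auto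
  finally show ?thesis .
 qed
 then show ?thesis using NM(1) gZ' by blast
qed

text \<open>Since \<open>gam2\<close> is a squared norm, the factor means a constant
  \<open>C^2\<close> for norms. First \<open>N\<close> and \<open>Z\<close> are taken from the
  discrete estimate for each \<open>k\<close>, then \<open>k\<close> tends to infinity.\<close>

theorem gam2_op_fourier_le:
 fixes x :: "'i::countable => 'a"
 assumes fin: "finite I" and \<phi>: "\<And>i. i \<in> I ==> L1 (\<phi> i)"
  and \<phi>1: "\<And>i s. i \<in> I ==> cmod (ift (\<phi> i) s) <= 1"
  and g: "\<And>i. i \<in> I ==> g i \<in> H1" "\<And>i. i \<in> I ==> L1norm (g i) <= 1"
 shows "gam2 J I (\<lambda>i. op (\<lambda>u. \<phi> i u * fourier (g i) u) (x i)) <= (C^2)^2 * gam2 J I x"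
proof -
 let ?\<eta> = "\<lambda>k. inverse (real (Suc k))"
 have "\<exists>N Z. 4 * (Suc k)^2 <= N \<and> gam2 J I Z <= (C^2 * (1 + ?\<eta> k))^2 * gam2 J I x \<and>
   (\<forall>i\<in>I. norm (Z i - disc k N (\<phi> i) (g i) (x i)) <= ?\<eta> k * (bnd * norm (x i)))" for k
  using disc_approx[OF fin \<phi> \<phi>1 g, where \<eta> = "?\<eta> k" and k = k and x = x] by (auto simp del: of_nat_Suc power_Suc)
 then obtain N Z where N: "\<And>k. 4 * (Suc k)^2 <= N k"
  and Z: "\<And>k. gam2 J I (Z k) <= (C^2 * (1 + ?\<eta> k))^2 * gam2 J I x"
  and Zd: "\<And>k i. i \<in> I ==> norm (Z k i - disc k (N k) (\<phi> i) (g i) (x i)) <= ?\<eta> k * (bnd * norm (x i))"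
  by metis
 have \<eta>0: "?\<eta> ----> 0" by (rule LIMSEQ_inverse_real_of_nat)
 have "(\<lambda>k. Z k i) ----> op (\<lambda>u. \<phi> i u * fourier (g i) u) (x i)" if i: "i \<in> I" for i
 proof -
  have "(\<lambda>k. Z k i - disc k (N k) (\<phi> i) (g i) (x i)) ----> 0"
   by (rule Lim_null_comparison[OF always_eventually tendsto_mult_left_zero[OF \<eta>0]])
    (use Zd[OF i] in blast)
  from tendsto_add[OF this disc_tendsto[OF \<phi>[OF i] g(1)[OF i] N, where x = "x i"]] show ?thesis by simp
 qed
 then have "(\<lambda>k. gam2 J I (Z k)) ----> gam2 J I (\<lambda>i. op (\<lambda>u. \<phi> i u * fourier (g i) u) (x i))"
  by (rule gam2_tendsto[OF fin])
 moreover have "(\<lambda>k. (C^2 * (1 + ?\<eta> k))^2 * gam2 J I x) ----> (C^2 * (1 + 0))^2 * gam2 J I x"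
  by (intro tendsto_intros \<eta>0)
 ultimately show ?thesis using Z by (auto intro: LIMSEQ_le)
qed

end

section \<open>Abel summation and the Fejer kernel on the line\<close>

text \<open>The Poisson kernel of the upper half-plane at height one.\<close>

definition pk :: "real => real" where "pk x = inverse (1 + x^2) / pi"

lemma pk_nonneg: "0 <= pk x" by (simp add: pk_def add_nonneg_nonneg)

lemma pk_measurable [measurable]: "pk \<in> borel_measurable borel" unfolding pk_def[abs_def] by measurable

lemma pk_has_integral: "has_bochner_integral lborel pk 1"
proof -
 have 1: "L1 (\<lambda>x::real. inverse (1 + x^2))"
  using integrable_inverse_1_plus_square by (simp add: set_integrable_def)
 have 2: "(LBINT x. inverse (1 + x^2)) = pi" using LBINT_inverse_1_plus_square
  by (simp add: interval_lebesgue_integral_def set_lebesgue_integral_def)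
 show ?thesis unfolding pk_def[abs_def] has_bochner_integral_iff using 1 2 by simp
qed

lemma integrable_pk: "L1 pk" and integral_pk: "(LBINT x. pk x) = 1"
 using pk_has_integral by (auto simp: has_bochner_integral_iff)

lemma half_line_exp:
 assumes e: "0 < e"
 shows "L1 (\<lambda>v. indicator {0<..} v * exp (- e * v) :: real)"
proof -
 have "set_integrable lborel {0<..} (\<lambda>v. exp (- (v * e)) :: real)"
  by (rule integrable_I0i_exp_mscale[OF e])
 then show ?thesis by (simp add: set_integrable_def mult.commute)
qed

lemma integrable_exp_abs:
 assumes e: "0 < e"
 shows "L1 (\<lambda>v. exp (- e * \<bar>v\<bar>) :: real)"
proof -
 let ?g = "\<lambda>v. indicator {0<..} v * exp (- e * v) :: real"
 have i: "L1 (\<lambda>v. ?g v + ?g (- v))"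
  using half_line_exp[OF e] lborel_integrable_real_affine[OF half_line_exp[OF e], of "- 1" 0] by simp
 have m: "(\<lambda>v. exp (- e * \<bar>v\<bar>) :: real) \<in> borel_measurable lborel" by measurable
 have ae: "AE v in lborel. ?g v + ?g (- v) = exp (- e * \<bar>v\<bar>)"
  using AE_lborel_singleton[of 0] by (rule eventually_mono) (auto simp: indicator_def)
 show ?thesis by (rule integrable_cong_AE_imp[OF i m ae])
qed

lemma integral_exp_half_line:
 assumes e: "0 < e"
 shows "L1 (\<lambda>v. indicator {0<..} v * (cr (exp (- e * v)) * cis (x * v)))"
  and "(LBINT v. indicator {0<..} v * (cr (exp (- e * v)) * cis (x * v))) = 1 / Complex e (- x)"
proof -
 let ?c = "Complex (- e) x"
 have c0: "?c \<noteq> 0" using e by (simp add: complex_eq_iff)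
 have ex: "cr (exp (- e * v)) * cis (x * v) = exp (of_real v * ?c)" for v
  by (simp add: complex_eq_iff Re_exp Im_exp mult.commute)
 have "L1 (\<lambda>v. cr (indicator {0<..} v * exp (- e * v)) * cis (x * v + 0))"
  by (rule integrable_mult_cis) (rule integrable_of_real[OF half_line_exp[OF e]])
 then show int: "L1 (\<lambda>v. indicator {0<..} v * (cr (exp (- e * v)) * cis (x * v)))"
  by (simp add: of_real_indicator mult.assoc)
 define F where "F v = exp (of_real v * ?c) / ?c" for v :: real
 have "(LBINT v=0..\<infinity>. exp (of_real v * ?c)) = 0 - F 0"
 proof (rule interval_integral_FTC_integrable)
  show "(F has_vector_derivative exp (of_real v * ?c)) (at v)" for v unfolding F_def
   by (rule has_vector_derivative_real_field) (use c0 in \<open>auto intro!: derivative_eq_intros\<close>)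
  show "set_integrable lborel (einterval 0 \<infinity>) (\<lambda>v. exp (of_real v * ?c))"
   using int by (simp add: set_integrable_def ex[symmetric] scaleR_conv_of_real of_real_indicator zero_ereal_def)
  have "isCont F 0" unfolding F_def using c0 by (intro continuous_intros) auto
  then have "(F \<longlongrightarrow> F 0) (at_right 0)" by (simp add: isCont_def filterlim_at_split)
  then show "((F \<circ> real_of_ereal) \<longlongrightarrow> F 0) (at_right 0)"
   by (simp add: zero_ereal_def ereal_tendsto_simps)
  have "filterlim (\<lambda>v::real. - e * v) at_bot at_top"
   using e by (intro filterlim_tendsto_neg_mult_at_bot[OF tendsto_const _ filterlim_ident]) auto
  then have "((\<lambda>v. exp (- e * v) / cmod ?c) \<longlongrightarrow> 0 / cmod ?c) at_top"
   using c0 by (intro tendsto_intros filterlim_compose[OF exp_at_bot]) auto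
  then have "((\<lambda>v. norm (F v)) \<longlongrightarrow> 0) at_top"
   by (simp add: F_def norm_divide norm_exp_eq_Re mult.commute)
  then show "((F \<circ> real_of_ereal) \<longlongrightarrow> 0) (at_left \<infinity>)"
   unfolding ereal_tendsto_simps by (rule tendsto_norm_zero_cancel)
 qed (auto intro!: continuous_intros)
 moreover have "(LBINT v=0..\<infinity>. exp (of_real v * ?c))
   = (LBINT v. indicator {0<..} v * (cr (exp (- e * v)) * cis (x * v)))"
  by (simp add: interval_lebesgue_integral_def set_lebesgue_integral_def ex[symmetric] scaleR_conv_of_real
    of_real_indicator zero_ereal_def)
 moreover have "0 - F 0 = 1 / Complex e (- x)"
 proof -
  have "Complex e (- x) = - ?c" by (simp add: complex_eq_iff)
  then show ?thesis by (simp add: F_def divide_minus_right)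
 qed
 ultimately show "(LBINT v. indicator {0<..} v * (cr (exp (- e * v)) * cis (x * v))) = 1 / Complex e (- x)"
  by simp
qed

lemma integral_exp_abs_cis:
 assumes e: "0 < e"
 shows "(LBINT v. cr (exp (- e * \<bar>v\<bar>)) * cis (x * v)) = of_real (2 * e / (e^2 + x^2))"
proof -
 let ?g = "\<lambda>x v. indicator {0<..} v * (cr (exp (- e * v)) * cis (x * v))"
 have int: "L1 (?g y)" for y by (rule integral_exp_half_line(1)[OF e])
 have int': "L1 (\<lambda>v. ?g y (- v))" for y
  using lborel_integrable_real_affine[OF int[of y], of "- 1" 0] by simp
 have "(LBINT v. cr (exp (- e * \<bar>v\<bar>)) * cis (x * v)) = (LBINT v. ?g x v + ?g (- x) (- v))"
 proof (rule integral_cong_AE)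
  show "AE v in lborel. cr (exp (- e * \<bar>v\<bar>)) * cis (x * v) = ?g x v + ?g (- x) (- v)"
   using AE_lborel_singleton[of 0] by (rule eventually_mono) (auto simp: indicator_def)
  show "(\<lambda>v. cr (exp (- e * \<bar>v\<bar>)) * cis (x * v)) \<in> borel_measurable lborel"
   by (simp, intro measurable_contI continuous_intros)
  show "(\<lambda>v. ?g x v + ?g (- x) (- v)) \<in> borel_measurable lborel"
   using int int' by (intro borel_measurable_add borel_measurable_integrable)
 qed
 also have "... = (LBINT v. ?g x v) + (LBINT v. ?g (- x) (- v))" by (rule bint_add[OF int int'])
 also have "(LBINT v. ?g (- x) (- v)) = (LBINT v. ?g (- x) v)"
  using lborel_affine[of "- 1" "?g (- x)" 0] by simp
 also have "(LBINT v. ?g x v) + (LBINT v. ?g (- x) v) = 1 / Complex e (- x) + 1 / Complex e x"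
  by (simp only: integral_exp_half_line(2)[OF e] minus_minus)
 also have "... = of_real (2 * e / (e^2 + x^2))"
 proof -
  have "0 < e^2 + x^2" using e by (simp add: add_pos_nonneg)
  then show ?thesis by (simp add: complex_eq_iff Re_divide Im_divide add_divide_distrib[symmetric])
    (simp add: power2_eq_square)
 qed
 finally show ?thesis .
qed

text \<open>In the applications \<open>\<psi>\<close> is an oscillating exponential, and the lemma
  justifies exchanging the integrals of a function and of a transform.\<close>

lemma integrable_pair_mult:
 fixes a b :: "real => complex"
 assumes a: "L1 a" and b: "L1 b"
  and \<psi> [measurable]: "\<psi> \<in> borel_measurable (borel \<Otimes>\<^sub>M borel)" and B: "\<And>p. cmod (\<psi> p) <= B"
 shows "integrable (lborel \<Otimes>\<^sub>M lborel) (\<lambda>(x, y). a x * b y * \<psi> (x, y))"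
proof (rule lborel_pair.Fubini_integrable)
 note [measurable] = borel_measurable_integrable[OF a, simplified] borel_measurable_integrable[OF b, simplified]
 show "(\<lambda>(x, y). a x * b y * \<psi> (x, y)) \<in> borel_measurable (lborel \<Otimes>\<^sub>M lborel)" by measurable
 have B0: "0 <= B" using B[of undefined] norm_ge_zero order_trans by blast
 have inn: "L1 (\<lambda>y. a x * b y * \<psi> (x, y))" for x
  by (rule integrable_mult_bounded[where B = B]) (use b B in auto)
 then show "AE x in lborel. L1 (\<lambda>y. case (x, y) of (x, y) => a x * b y * \<psi> (x, y))" by simp
 show "L1 (\<lambda>x. LBINT y. norm (case (x, y) of (x, y) => a x * b y * \<psi> (x, y)))"
 proof (rule bintble_bound)
  show "L1 (\<lambda>x. cmod (a x) * ((LBINT y. cmod (b y)) * B))" using a by auto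
  show "AE x in lborel. norm (LBINT y. norm (case (x, y) of (x, y) => a x * b y * \<psi> (x, y)))
    <= norm (cmod (a x) * ((LBINT y. cmod (b y)) * B))"
  proof (rule AE_I2)
   fix x
   have "(LBINT y. norm (a x * b y * \<psi> (x, y))) <= (LBINT y. cmod (a x) * (cmod (b y) * B))"
   proof (rule integral_mono)
    show "L1 (\<lambda>y. norm (a x * b y * \<psi> (x, y)))" by (rule integrable_norm[OF inn])
    show "L1 (\<lambda>y. cmod (a x) * (cmod (b y) * B))" using b by auto
    show "norm (a x * b y * \<psi> (x, y)) <= cmod (a x) * (cmod (b y) * B)" for y
     using B[of "(x, y)"] by (simp add: norm_mult mult.assoc mult_left_mono)
   qed
   then show "norm (LBINT y. norm (case (x, y) of (x, y) => a x * b y * \<psi> (x, y)))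
     <= norm (cmod (a x) * ((LBINT y. cmod (b y)) * B))" using B0 by simp
  qed
 qed measurable
qed

lemma cis_measurable [measurable]: "f \<in> borel_measurable M ==> (\<lambda>x. cis (f x)) \<in> borel_measurable M"
 by (rule measurable_compose[of f M borel cis], assumption)
  (intro measurable_contI continuous_intros)

lemma ift_mult_fourier:
 assumes \<phi>: "L1 \<phi>" and h: "L1 h"
 shows "ift (\<lambda>u. \<phi> u * fourier h u) s = conv (ift \<phi>) h s"
proof -
 have "integrable (lborel \<Otimes>\<^sub>M lborel) (\<lambda>(u, t). \<phi> u * h t * (\<lambda>(u, t). cis (s * u - t * u)) (u, t))"
  by (rule integrable_pair_mult[OF \<phi> h, where B = 1]) (auto simp: case_prod_beta')
 then have int: "integrable (lborel \<Otimes>\<^sub>M lborel) (\<lambda>(u, t). \<phi> u * h t * cis (s * u - t * u))" by simp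
 have "ift (\<lambda>u. \<phi> u * fourier h u) s = (LBINT u. LBINT t. \<phi> u * h t * cis (s * u - t * u))"
  unfolding ift_def[of _ s]
 proof (intro bint_cong refl)
  fix u
  have "(LBINT t. \<phi> u * h t * cis (s * u - t * u)) = (LBINT t. \<phi> u * cis (s * u) * (h t * cis (- u * t)))"
   by (intro bint_cong refl) (simp add: mult_ac cis_mult)
  then show "\<phi> u * fourier h u * cis (s * u) = (LBINT t. \<phi> u * h t * cis (s * u - t * u))"
   by (simp add: fourier_eq_ift ift_def)
 qed
 also have "... = (LBINT t. LBINT u. \<phi> u * h t * cis (s * u - t * u))"
  by (rule lborel_pair.Fubini_integral[OF int, symmetric])
 also have "... = conv (ift \<phi>) h s" unfolding conv_def
 proof (intro bint_cong refl)
  fix t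
  have "(LBINT u. \<phi> u * h t * cis (s * u - t * u)) = (LBINT u. \<phi> u * cis ((s - t) * u) * h t)"
   by (intro bint_cong refl) (simp add: algebra_simps)
  then show "(LBINT u. \<phi> u * h t * cis (s * u - t * u)) = ift \<phi> (s - t) * h t"
   by (simp add: ift_def)
 qed
 finally show ?thesis .
qed

text \<open>The Poisson integral at height \<open>e\<close> with the kernel rescaled to height one,
  so that limits in \<open>e\<close> are taken inside \<open>f\<close> under a fixed integrable
  weight.\<close>

definition abel :: "real => (real => complex) => real => complex" where
 "abel e f s = (LBINT x. f (s - e * x) * of_real (pk x))"

text \<open>The rescaled Poisson kernel is the transform of
  \<open>exp (- e * \<bar>v\<bar>) / (2 * pi)\<close>; thus an Abel mean is the transform of an
  integrable function even when \<open>fourier f\<close> is not integrable.\<close>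

lemma abel_eq_ift:
 assumes f: "L1 f" and e: "0 < e"
 shows "abel e f s = ift (\<lambda>v. of_real (exp (- e * \<bar>v\<bar>) / (2 * pi)) * fourier f v) s"
proof -
 have \<phi>: "L1 (\<lambda>v. cr (exp (- e * \<bar>v\<bar>) / (2 * pi)))"
  using integrable_exp_abs[OF e] by (intro integrable_of_real) auto
 have k: "ift (\<lambda>v. cr (exp (- e * \<bar>v\<bar>) / (2 * pi))) t = of_real (pk (t / e) / e)" for t
 proof -
  have "ift (\<lambda>v. cr (exp (- e * \<bar>v\<bar>) / (2 * pi))) t
    = (LBINT v. of_real (exp (- e * \<bar>v\<bar>)) * cis (t * v) / of_real (2 * pi))"
   unfolding ift_def by (intro bint_cong refl) simp
  also have "... = of_real (2 * e / (e^2 + t^2)) / of_real (2 * pi)"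
   by (subst integral_divide_zero) (simp only: integral_exp_abs_cis[OF e])
  also have "... = of_real (pk (t / e) / e)"
  proof -
   have "0 < e^2 + t^2" using e by (simp add: add_pos_nonneg)
   moreover have "2 * e / D / (2 * pi) = inverse (D / e^2) / pi / e" if "0 < D" for D
    using that e by (simp add: field_simps power2_eq_square)
   moreover have "1 + (t / e)^2 = (e^2 + t^2) / e^2" using e by (simp add: power_divide add_divide_distrib)
   ultimately have "2 * e / (e^2 + t^2) / (2 * pi) = pk (t / e) / e" unfolding pk_def by metis
   then show ?thesis by (metis of_real_divide)
  qed
  finally show ?thesis .
 qed
 have "ift (\<lambda>v. of_real (exp (- e * \<bar>v\<bar>) / (2 * pi)) * fourier f v) s
   = (LBINT t. of_real (pk ((s - t) / e) / e) * f t)"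
  unfolding ift_mult_fourier[OF \<phi> f] by (simp only: conv_def k)
 also have "... = e *\<^sub>R (LBINT x. of_real (pk x / e) * f (s - e * x))"
  using lborel_affine[of "- e" "\<lambda>t. of_real (pk ((s - t) / e) / e) * f t" s] e by simp
 also have "(LBINT x. of_real (pk x / e) * f (s - e * x)) = (LBINT x. of_real (1 / e) * (f (s - e * x) * of_real (pk x)))"
  by (intro bint_cong refl) simp
 also have "e *\<^sub>R (LBINT x. of_real (1 / e) * (f (s - e * x) * of_real (pk x))) = abel e f s"
  unfolding integral_mult_right_zero using e by (simp add: abel_def scaleR_conv_of_real)
 finally show ?thesis ..
qed

lemma integrable_mult_pk:
 assumes "f \<in> borel_measurable borel" "\<And>x. cmod (f x) <= B"
 shows "L1 (\<lambda>x. f x * cr (pk x))"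
 using integrable_mult_bounded[of "\<lambda>x. cr (pk x)" f B] integrable_of_real[OF integrable_pk, where 'a = complex] assms
 by (simp add: mult.commute)

lemma abel_tendsto:
 assumes f [measurable]: "f \<in> borel_measurable borel" and B: "\<And>x. cmod (f x) <= B" and c: "isCont f s"
 shows "(\<lambda>n. abel (inverse (real (Suc n))) f s) ----> f s"
proof -
 have "(\<lambda>n. abel (inverse (real (Suc n))) f s) ----> (LBINT x. f s * cr (pk x))" unfolding abel_def
 proof (rule integral_dominated_convergence)
  show "L1 (\<lambda>x. B * pk x)" using integrable_pk by simp
  show "AE x in lborel. (\<lambda>n. f (s - inverse (real (Suc n)) * x) * cr (pk x)) ----> f s * cr (pk x)"
  proof (intro AE_I2 tendsto_intros isCont_tendsto_compose[OF c])
   fix x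
   have "(\<lambda>n. s - inverse (real (Suc n)) * x) ----> s - 0 * x"
    by (intro tendsto_intros LIMSEQ_inverse_real_of_nat)
   then show "(\<lambda>n. s - inverse (real (Suc n)) * x) ----> s" by simp
  qed
  show "AE x in lborel. norm (f (s - inverse (real (Suc n)) * x) * cr (pk x)) <= B * pk x" for n
   using B pk_nonneg by (intro AE_I2) (simp add: norm_mult mult_right_mono)
 qed measurable
 also have "(LBINT x. f s * cr (pk x)) = f s" by (simp add: integral_pk)
 finally show ?thesis .
qed

text \<open>Both sides are limits of the same Abel means: one by continuity of \<open>f\<close> at
  \<open>s\<close>, the other by dominated convergence in the frequency variable.\<close>

lemma fourier_inversion:
 assumes f: "L1 f" "\<And>x. cmod (f x) <= B" "isCont f s" and F: "L1 (fourier f)"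
 shows "ift (fourier f) s = of_real (2 * pi) * f s"
proof -
 let ?e = "\<lambda>n. inverse (real (Suc n))"
 have fm [measurable]: "f \<in> borel_measurable borel" "fourier f \<in> borel_measurable borel"
  using borel_measurable_integrable[OF f(1)] borel_measurable_integrable[OF F] by simp_all
 have "(\<lambda>n. of_real (2 * pi) * abel (?e n) f s) ----> of_real (2 * pi) * f s"
  by (intro tendsto_intros abel_tendsto[where B = B] f fm)
 moreover have "(\<lambda>n. of_real (2 * pi) * abel (?e n) f s) ----> ift (fourier f) s"
 proof -
  have "of_real (2 * pi) * abel (?e n) f s = (LBINT v. of_real (exp (- ?e n * \<bar>v\<bar>)) * fourier f v * cis (s * v))" for n
  proof -
   have "of_real (2 * pi) * abel (?e n) f s
     = (LBINT v. of_real (2 * pi) * (of_real (exp (- ?e n * \<bar>v\<bar>) / (2 * pi)) * fourier f v * cis (s * v)))"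
    by (subst abel_eq_ift[OF f(1)]) (simp_all only: ift_def integral_mult_right_zero, simp)
   also have "... = (LBINT v. of_real (exp (- ?e n * \<bar>v\<bar>)) * fourier f v * cis (s * v))"
    by (intro bint_cong refl) simp
   finally show ?thesis .
  qed
  moreover have "(\<lambda>n. LBINT v. of_real (exp (- ?e n * \<bar>v\<bar>)) * fourier f v * cis (s * v)) ----> ift (fourier f) s"
   unfolding ift_def
  proof (rule integral_dominated_convergence)
   show "L1 (\<lambda>v. cmod (fourier f v))" using F by simp
   show "AE v in lborel. (\<lambda>n. of_real (exp (- ?e n * \<bar>v\<bar>)) * fourier f v * cis (s * v)) ----> fourier f v * cis (s * v)"
   proof (rule AE_I2)
    fix v
    have "(\<lambda>n. of_real (exp (- ?e n * \<bar>v\<bar>)) * fourier f v * cis (s * v)) ----> of_real (exp (- 0 * \<bar>v\<bar>)) * fourier f v * cis (s * v)"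
     by (intro tendsto_intros LIMSEQ_inverse_real_of_nat)
    then show "(\<lambda>n. of_real (exp (- ?e n * \<bar>v\<bar>)) * fourier f v * cis (s * v)) ----> fourier f v * cis (s * v)" by simp
   qed
   show "AE v in lborel. norm (of_real (exp (- ?e n * \<bar>v\<bar>)) * fourier f v * cis (s * v)) <= cmod (fourier f v)" for n
    by (intro AE_I2) (simp add: norm_mult mult_left_le_one_le del: of_nat_Suc)
  qed measurable
  ultimately show ?thesis by simp
 qed
 ultimately show ?thesis using LIMSEQ_unique by blast
qed

text \<open>The tent function is the self-convolution of an interval, so its transform is a square.\<close>

definition tent :: "real => real" where "tent u = max 0 (1 - \<bar>u\<bar>)"

definition box :: "real => complex" where "box = indicator {-1/2..1/2}"

definition fej :: "real => real" where
 "fej x = (cmod (ift box x))^2 / (2 * pi)"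

lemma tent_le: "0 <= tent u" "tent u <= 1" by (auto simp: tent_def)

lemma tent_continuous: "continuous_on S tent" unfolding tent_def[abs_def] by (intro continuous_intros)

lemma tent_measurable [measurable]: "tent \<in> borel_measurable borel"
 by (intro measurable_contI tent_continuous)

lemma fej_nonneg: "0 <= fej x" by (simp add: fej_def)

lemma integrable_interval_real: "L1 (indicator {a..b} :: real => real)"
 by (rule integrable_real_indicator) (auto simp: emeasure_lborel_Icc_eq)

lemma integrable_interval: "L1 (indicator {a..b} :: real => complex)"
proof -
 have "(\<lambda>x. cr (indicator {a..b} x)) = indicator {a..b}" by (auto simp: indicator_def fun_eq_iff)
 then show ?thesis using integrable_of_real[OF integrable_interval_real[of a b], where 'a = complex] by simp
qed

lemma integrable_box: "L1 box" unfolding box_def by (rule integrable_interval)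

lemma L1norm_box: "L1norm box = 1"
proof -
 have "cmod (box t) = indicator {-1/2..1/2::real} t" for t by (simp add: box_def indicator_def)
 then have "L1norm box = (LBINT t. indicator {-1/2..1/2::real} t)" by (simp add: L1norm_def)
 then show ?thesis by simp
qed

lemma ift_box: "ift box 0 = 1" "x \<noteq> 0 ==> ift box x = of_real (2 * sin (x / 2) / x)"
proof -
 have "ift box 0 = (LBINT u. cr (indicator {-1/2..1/2::real} u))"
  unfolding ift_def by (intro bint_cong refl) (simp add: box_def indicator_def)
 also have "... = of_real (LBINT u. indicator {-1/2..1/2::real} u)"
  by (rule integral_of_real) (rule integrable_interval_real)
 finally show "ift box 0 = 1" by simp
 assume x: "x \<noteq> 0"
 define G where "G z = exp (z * (\<i> * of_real x)) / (\<i> * of_real x)" for z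
 have "(LBINT u. indicator {-1/2..1/2} u *\<^sub>R cis (x * u)) = G (of_real (1/2)) - G (of_real (-1/2))"
 proof (rule integral_FTC_Icc)
  show "((\<lambda>u. G (of_real u)) has_vector_derivative cis (x * u)) (at u within {-1/2..1/2})" for u
  proof (rule has_vector_derivative_real_field)
   have "(G has_field_derivative exp (of_real u * (\<i> * of_real x))) (at (of_real u))"
    unfolding G_def using x by (auto intro!: derivative_eq_intros)
   then show "(G has_field_derivative cis (x * u)) (at (of_real u))" by (simp add: cis_conv_exp mult_ac)
  qed
  show "continuous_on {-1/2..1/2} (\<lambda>u. cis (x * u))" by (intro continuous_intros)
 qed simp
 also have "G (of_real (1/2)) - G (of_real (-1/2)) = (cis (x / 2) - cis (- (x / 2))) / (\<i> * of_real x)"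
  by (simp add: G_def cis_conv_exp diff_divide_distrib mult_ac)
 also have "... = of_real (2 * sin (x / 2) / x)"
  using x by (simp add: complex_eq_iff Re_divide Im_divide power2_eq_square)
 finally have "(LBINT u. indicator {-1/2..1/2} u *\<^sub>R cis (x * u)) = of_real (2 * sin (x / 2) / x)" .
 moreover have "ift box x = (LBINT u. indicator {-1/2..1/2} u *\<^sub>R cis (x * u))"
  unfolding ift_def by (intro bint_cong refl) (simp add: box_def indicator_def)
 ultimately show "ift box x = of_real (2 * sin (x / 2) / x)" by simp
qed

lemma conv_box: "conv box box = (\<lambda>u. of_real (tent u))"
proof
 fix u :: real
 let ?S = "{max (u - 1/2) (-1/2)..min (u + 1/2) (1/2)}"
 have "conv box box u = (LBINT t. cr (indicator ?S t))"
  unfolding conv_def box_def by (intro bint_cong refl) (auto simp: indicator_def)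
 also have "... = of_real (LBINT t. indicator ?S t)"
  by (rule integral_of_real) (rule integrable_interval_real)
 also have "(LBINT t. indicator ?S t) = tent u" by (auto simp: tent_def max_def min_def)
 finally show "conv box box u = cr (tent u)" .
qed

lemma integrable_tent: "L1 (\<lambda>u. cr (tent u))"
 using conv_Fubini(1)[OF integrable_box integrable_box, of "\<lambda>_. 1" 1] unfolding conv_box by simp

lemma ift_tent: "ift (\<lambda>u. of_real (tent u)) x = of_real (2 * pi * fej x)"
proof -
 have "ift box x \<in> \<real>" using ift_box(1) ift_box(2)[of x] by (cases "x = 0") auto
 then obtain y where y: "ift box x = of_real y" by (auto elim: Reals_cases)
 have "ift (\<lambda>u. of_real (tent u)) x = ift box x * ift box x"
  unfolding conv_box[symmetric] by (rule ift_conv[OF integrable_box integrable_box])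
 then show ?thesis by (simp add: y fej_def power2_eq_square)
qed

lemma fej_continuous: "continuous_on UNIV fej"
 unfolding fej_def[abs_def] by (intro continuous_intros continuous_on_ift integrable_box) simp

lemma fej_measurable [measurable]: "fej \<in> borel_measurable borel"
 by (intro measurable_contI fej_continuous)

lemma integrable_fej: "L1 fej"
proof (rule bintble_bound)
 show "L1 (\<lambda>x. 4 * pk x)" using integrable_pk by simp
 show "AE x in lborel. norm (fej x) <= norm (4 * pk x)"
 proof (rule AE_I2)
  fix x
  have "(cmod (ift box x))^2 <= 8 / (1 + x^2)"
  proof (cases "\<bar>x\<bar> <= 1")
   case True
   have "cmod (ift box x) <= L1norm box" by (rule cmod_ift_le[OF integrable_box])
   also have "... = 1" by (rule L1norm_box)
   finally have "(cmod (ift box x))^2 <= 1" by (simp add: power_le_one)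
   also have "1 <= 8 / (1 + x^2)" using True abs_square_le_1[of x] by (simp add: le_divide_eq add_pos_nonneg)
   finally show ?thesis .
  next
   case False
   then have x0: "x \<noteq> 0" by auto
   have "(cmod (ift box x))^2 = (2 * sin (x / 2) / x)^2"
    by (simp only: ift_box(2)[OF x0] norm_of_real power2_abs)
   also have "... = 4 * (sin (x / 2))^2 / x^2" by (simp add: power_divide power_mult_distrib)
   also have "... <= 4 * 1 / x^2" by (intro divide_right_mono mult_left_mono) (auto simp: abs_square_le_1)
   also have "... <= 8 / (1 + x^2)"
   proof -
    have "1 <= x^2" using False using one_le_power[of "\<bar>x\<bar>" 2] by simp
    then show ?thesis using x0 by (simp add: field_simps)
   qed
   finally show ?thesis .
  qed
  then have "fej x <= 8 / (1 + x^2) / (2 * pi)" unfolding fej_def by (intro divide_right_mono) auto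
  also have "... = 4 * pk x" by (simp add: pk_def inverse_eq_divide)
  finally show "norm (fej x) <= norm (4 * pk x)" using fej_nonneg[of x] by simp
 qed
qed measurable

lemma fej_minus: "fej (- x) = fej x"
 using ift_box(2)[of x] ift_box(2)[of "- x"] by (cases "x = 0") (auto simp: fej_def)

lemma fourier_tent: "fourier (\<lambda>u. of_real (tent u)) v = of_real (2 * pi * fej v)"
 by (simp only: fourier_eq_ift ift_tent fej_minus)

lemma ift_fej: "ift (\<lambda>x. of_real (fej x)) s = of_real (tent s)"
proof -
 have "ift (fourier (\<lambda>u. of_real (tent u))) s = of_real (2 * pi) * of_real (tent s)"
 proof (rule fourier_inversion[OF integrable_tent, where B = 1])
  show "isCont (\<lambda>x. cr (tent x)) s"
   using tent_continuous[of UNIV] by (intro continuous_intros) (simp add: continuous_on_eq_continuous_at)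
  show "L1 (fourier (\<lambda>u. of_real (tent u)))"
   unfolding fourier_tent[abs_def] using integrable_fej by (intro integrable_of_real) auto
 qed (use tent_le in auto)
 moreover have "ift (fourier (\<lambda>u. of_real (tent u))) s = of_real (2 * pi) * ift (\<lambda>x. of_real (fej x)) s"
  unfolding ift_def fourier_tent by (subst integral_mult_right_zero[symmetric]) (simp add: mult.assoc)
 ultimately show ?thesis by simp
qed

lemma integral_fej: "(LBINT x. fej x) = 1"
proof -
 have "cr (LBINT x. fej x) = ift (\<lambda>x. of_real (fej x)) 0"
  by (simp add: ift_def flip: integral_of_real)
 then show ?thesis by (simp add: ift_fej tent_def)
qed

text \<open>A dilated and modulated Fejer kernel. Its Fourier transform is the tent over
  \<open>{0..2 * t}\<close> with peak one at \<open>t\<close>, so it belongs to \<open>H1\<close>,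
  has norm one, and does not damp the frequency \<open>t\<close>.\<close>

definition hker :: "real => real => complex" where
 "hker t s = of_real (t * fej (t * s)) * cis (t * s)"

lemma fourier_hker:
 assumes t: "0 < t"
 shows "L1 (hker t)" "fourier (hker t) u = of_real (tent (u / t - 1))" "L1norm (hker t) = 1"
proof -
 have i0: "L1 (\<lambda>s. cr (t * fej (t * s)))"
  using lborel_integrable_real_affine[OF integrable_fej, of t 0] t by (intro integrable_of_real) simp
 show "L1 (hker t)" unfolding hker_def[abs_def] using integrable_mult_cis[OF i0, of t 0] by simp
 have "fourier (hker t) u = (LBINT s. of_real (t * fej (t * s)) * cis ((1 - u / t) * (t * s)))"
  unfolding fourier_eq_ift ift_def hker_def
  by (intro bint_cong refl) (use t in \<open>simp add: mult.assoc cis_mult algebra_simps\<close>)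
 also have "... = of_real t * (LBINT s. of_real (fej (t * s)) * cis ((1 - u / t) * (t * s)))"
  by (simp add: mult.assoc flip: integral_mult_right_zero)
 also have "... = (LBINT x. of_real (fej x) * cis ((1 - u / t) * x))"
  using lborel_affine[of t "\<lambda>x. of_real (fej x) * cis ((1 - u / t) * x)" 0] t
  by (simp add: scaleR_conv_of_real)
 also have "... = of_real (tent (1 - u / t))" using ift_fej by (simp add: ift_def)
 also have "tent (1 - u / t) = tent (u / t - 1)" by (simp add: tent_def abs_minus_commute)
 finally show "fourier (hker t) u = of_real (tent (u / t - 1))" .
 have "L1norm (hker t) = (LBINT s. t * fej (t * s))"
  unfolding L1norm_def hker_def using t fej_nonneg by (simp add: norm_mult)
 also have "... = 1" using lborel_affine[of t fej 0] t integral_fej by simp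
 finally show "L1norm (hker t) = 1" .
qed

lemma hker_H1: "0 < t ==> hker t \<in> H1" using fourier_hker by (auto simp: H1_def tent_def divide_le_0_iff)

subsection \<open>Density of transforms in \<open>C\<^sub>0\<close>\<close>

lemma C0R_small_outside:
 assumes "f \<in> C0R" "0 < \<epsilon>"
 obtains b where "0 < b" "\<And>x. b <= \<bar>x\<bar> ==> cmod (f x) < \<epsilon>"
proof -
 have "eventually (\<lambda>x. dist (f x) 0 < \<epsilon>) at_infinity"
  using assms by (intro tendstoD) (auto simp: C0R_def)
 then obtain b where "\<And>x. b <= norm x ==> cmod (f x) < \<epsilon>" by (auto simp: eventually_at_infinity)
 then show thesis by (intro that[of "max b 1"]) auto
qed

lemma C0R_bounded:
 assumes "f \<in> C0R"
 shows "bounded (range f)"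
proof -
 obtain b where b: "\<And>x. b <= \<bar>x\<bar> ==> cmod (f x) < 1" using C0R_small_outside[OF assms, of 1] by auto
 have "bounded (f ` {-b..b})"
  using assms by (intro compact_imp_bounded compact_continuous_image) (auto simp: C0R_def elim: continuous_on_subset)
 then obtain B where B: "\<And>x. x \<in> {-b..b} ==> cmod (f x) <= B" unfolding bounded_iff by blast
 have "cmod (f x) <= max B 1" for x
 proof (cases "b <= \<bar>x\<bar>")
  case False
  then have "x \<in> {-b..b}" by auto
  then show ?thesis using B by (simp add: le_max_iff_disj)
 qed (use b in \<open>force simp: le_max_iff_disj\<close>)
 then show ?thesis unfolding bounded_iff by blast
qed

lemma C0R_uniformly_continuous:
 assumes f: "f \<in> C0R"
 shows "uniformly_continuous_on UNIV f" unfolding uniformly_continuous_on_def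
proof (intro allI impI)
 fix \<epsilon> :: real assume \<epsilon>: "0 < \<epsilon>"
 obtain b where b: "0 < b" "\<And>x. b <= \<bar>x\<bar> ==> cmod (f x) < \<epsilon> / 2"
  using C0R_small_outside[OF f, of "\<epsilon> / 2"] \<epsilon> by auto
 have "uniformly_continuous_on {-b-1..b+1} f"
  using f by (intro compact_uniformly_continuous) (auto simp: C0R_def elim: continuous_on_subset)
 then obtain d where d: "0 < d" "\<And>x y. x \<in> {-b-1..b+1} ==> y \<in> {-b-1..b+1} ==> dist y x < d ==> dist (f y) (f x) < \<epsilon>"
  unfolding uniformly_continuous_on_def by (metis \<epsilon>)
 show "\<exists>d>0. \<forall>x\<in>UNIV. \<forall>y\<in>UNIV. dist y x < d \<longrightarrow> dist (f y) (f x) < \<epsilon>"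
 proof (intro exI[of _ "min d 1"] conjI ballI impI)
  fix x y :: real assume xy: "dist y x < min d 1"
  show "dist (f y) (f x) < \<epsilon>"
  proof (cases "x \<in> {-b-1..b+1} \<and> y \<in> {-b-1..b+1}")
   case True
   then show ?thesis using d(2) xy by simp
  next
   case False
   then have "b <= \<bar>x\<bar>" "b <= \<bar>y\<bar>" using xy by (auto simp: dist_real_def)
   then show ?thesis using b(2)[of x] b(2)[of y] norm_triangle_ineq4[of "f y" "f x"] by (simp add: dist_norm)
  qed
 qed (use d in auto)
qed

lemma C0R_subset_BUCR: "C0R \<subseteq> BUCR"
 using C0R_bounded C0R_uniformly_continuous by (auto simp: BUCR_def)

lemma C0R_compact_support:
 assumes "continuous_on UNIV f" "\<And>x. R <= \<bar>x\<bar> ==> f x = 0"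
 shows "f \<in> C0R"
proof -
 have "eventually (\<lambda>x. f x = 0) at_infinity" unfolding eventually_at_infinity using assms(2) by auto
 then show ?thesis using assms(1) unfolding C0R_def by (simp add: tendsto_eventually)
qed

lemma pk_tail:
 assumes "0 < \<eta>"
 obtains A where "0 < A" "(LBINT x. indicator {x. A < \<bar>x\<bar>} x * pk x) < \<eta>"
proof -
 let ?s = "\<lambda>n x. indicator {x. real n < \<bar>x\<bar>} x * pk x"
 have "(\<lambda>n. integral\<^sup>L lborel (?s n)) ----> 0"
 proof (rule integral_tendsto_0[where s = ?s, OF integrable_pk])
  show "(\<lambda>n. ?s n x) ----> 0" for x
  proof (rule tendsto_eventually)
   obtain N :: nat where "\<bar>x\<bar> < real N" using reals_Archimedean2 by blast
   then show "\<forall>\<^sub>F n in sequentially. ?s n x = 0"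
    unfolding eventually_sequentially by (intro exI[of _ N]) (auto simp: indicator_def)
  qed
 qed (auto simp: indicator_def pk_nonneg)
 then have "eventually (\<lambda>n. integral\<^sup>L lborel (?s n) < \<eta>) sequentially"
  by (rule order_tendstoD(2)) (rule assms)
 then obtain N where "\<And>n. N <= n ==> integral\<^sup>L lborel (?s n) < \<eta>" by (auto simp: eventually_sequentially)
 from this[of "Suc N"] show thesis by (intro that[of "real (Suc N)"]) auto
qed

text \<open>The kernel is split at \<open>A\<close>. With \<open>z = g s\<close> this gives uniform
  approximation, with \<open>z = 0\<close> decay at infinity.\<close>

lemma cmod_abel_diff_le:
 assumes g [measurable]: "g \<in> borel_measurable borel" and B: "\<And>x. cmod (g x) <= B"
  and near: "\<And>x. \<bar>x\<bar> <= A ==> cmod (g (s - e * x) - z) <= \<delta>" and z: "cmod z <= B" and \<delta>: "0 <= \<delta>"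
 shows "cmod (abel e g s - z) <= \<delta> + 2 * B * (LBINT x. indicator {x. A < \<bar>x\<bar>} x * pk x)"
proof -
 have i1: "L1 (\<lambda>x. g (s - e * x) * cr (pk x))"
  by (rule integrable_mult_pk[where B = B]) (use B in auto)
 have i2: "L1 (\<lambda>x. z * cr (pk x))"
  using integrable_of_real[OF integrable_pk, where 'a = complex] by simp
 have i3: "L1 (\<lambda>x. indicator {x. A < \<bar>x\<bar>} x * pk x)"
  using integrable_mult_bounded_real[OF integrable_pk, of "indicator {x. A < \<bar>x\<bar>}" 1]
  by (simp add: mult.commute indicator_def)
 have "abel e g s - z = (LBINT x. g (s - e * x) * cr (pk x) - z * cr (pk x))"
  using i1 i2 by (simp add: abel_def integral_pk)
 also have "cmod ... <= (LBINT x. cmod (g (s - e * x) * cr (pk x) - z * cr (pk x)))"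
  by (rule integral_norm_bound)
 also have "... <= (LBINT x. \<delta> * pk x + 2 * B * (indicator {x. A < \<bar>x\<bar>} x * pk x))"
 proof (rule integral_mono)
  show "L1 (\<lambda>x. cmod (g (s - e * x) * cr (pk x) - z * cr (pk x)))"
   using i1 i2 by (intro integrable_norm bintble_diff)
  show "L1 (\<lambda>x. \<delta> * pk x + 2 * B * (indicator {x. A < \<bar>x\<bar>} x * pk x))"
   using i3 integrable_pk by (intro bintble_add integrable_mult_right)
  show "cmod (g (s - e * x) * cr (pk x) - z * cr (pk x))
    <= \<delta> * pk x + 2 * B * (indicator {x. A < \<bar>x\<bar>} x * pk x)" for x
  proof -
   have "cmod (g (s - e * x) - z) <= \<delta> + 2 * B * indicator {x. A < \<bar>x\<bar>} x"
   proof (cases "\<bar>x\<bar> <= A")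
    case False
    have "cmod (g (s - e * x) - z) <= B + B" by (intro order_trans[OF norm_triangle_ineq4] add_mono B z)
    then show ?thesis using False \<delta> by simp
   qed (use near in simp)
   then have "cmod (g (s - e * x) - z) * pk x <= (\<delta> + 2 * B * indicator {x. A < \<bar>x\<bar>} x) * pk x"
    by (intro mult_right_mono pk_nonneg)
   moreover have "cmod (g (s - e * x) * cr (pk x) - z * cr (pk x)) = cmod (g (s - e * x) - z) * pk x"
    using pk_nonneg[of x] by (simp add: norm_mult flip: left_diff_distrib)
   ultimately show ?thesis by (simp add: distrib_right mult.assoc)
  qed
 qed
 also have "... = \<delta> + 2 * B * (LBINT x. indicator {x. A < \<bar>x\<bar>} x * pk x)"
  using i3 integrable_pk by (simp add: integral_pk)
 finally show ?thesis .
qed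

text \<open>Multiply by a wide tent to make \<open>f\<close> integrable, then take an Abel mean. Its
  kernel in frequency is integrable through the exponential factor, and it still decays at infinity
  since the cut-off function has compact support.\<close>

lemma C0R_approx_ift:
 assumes f: "f \<in> C0R" and \<eta>: "0 < \<eta>"
 obtains \<phi> where "L1 \<phi>" "ift \<phi> \<in> C0R" "\<And>s. cmod (f s - ift \<phi> s) <= \<eta>"
proof -
 obtain B where B: "0 < B" "\<And>x. cmod (f x) <= B"
 proof -
  obtain B where "\<And>x. cmod (f x) <= B" using C0R_bounded[OF f] by (auto simp: bounded_iff)
  then show thesis by (intro that[of "max B 1"]) (auto intro: le_max_iff_disj[THEN iffD2])
 qed
 obtain b where b: "0 < b" "\<And>x. b <= \<bar>x\<bar> ==> cmod (f x) < \<eta> / 4"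
  using C0R_small_outside[OF f, of "\<eta> / 4"] \<eta> by auto
 \<comment> \<open>So wide that the tent differs from one by at most
   \<open>b / R <= \<eta> / (4 * B)\<close> on the interval where \<open>f\<close> need not be
   small.\<close>
 define R where "R = 4 * B * b / \<eta> + 1"
 have R: "0 < R" "B * (b / R) <= \<eta> / 4"
 proof -
  have "0 <= 4 * B * b / \<eta>" using B b \<eta> by simp
  then show "0 < R" by (simp add: R_def)
  have "4 * B * b <= R * \<eta>" using \<eta> by (simp add: R_def distrib_right)
  then show "B * (b / R) <= \<eta> / 4" using \<open>0 < R\<close> by (simp add: field_simps)
 qed
 define g where "g s = f s * of_real (tent (s / R))" for s
 have cf: "continuous_on UNIV f" using f by (simp add: C0R_def)
 have cg: "continuous_on UNIV g"
  unfolding g_def by (intro continuous_intros cf continuous_on_compose2[OF tent_continuous[of UNIV]]) (use R in auto)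
 have g0: "g s = 0" if "R <= \<bar>s\<bar>" for s using that R by (simp add: g_def tent_def abs_divide)
 have gC0: "g \<in> C0R" by (rule C0R_compact_support[OF cg g0])
 have gf: "cmod (g s) <= cmod (f s)" for s
  using tent_le[of "s / R"] by (simp add: g_def norm_mult mult_right_le_one_le)
 have gB: "cmod (g s) <= B" for s using gf B(2) order_trans by blast
 have fg: "cmod (f s - g s) <= \<eta> / 4" for s
 proof -
  have eq: "cmod (f s - g s) = cmod (f s) * (1 - tent (s / R))"
  proof -
   have "f s - g s = f s * of_real (1 - tent (s / R))" by (simp add: g_def algebra_simps)
   then show ?thesis using tent_le[of "s / R"] by (simp only: norm_mult norm_of_real)
  qed
  show ?thesis
  proof (cases "b <= \<bar>s\<bar>")
   case True
   have "cmod (f s) * (1 - tent (s / R)) <= cmod (f s) * 1" using tent_le[of "s / R"] by (intro mult_left_mono) auto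
   then show ?thesis using b(2)[OF True] eq by simp
  next
   case False
   have "1 - tent (s / R) <= \<bar>s\<bar> / R" using R by (auto simp: tent_def abs_divide)
   also have "... <= b / R" using False R by (intro divide_right_mono) auto
   finally have "cmod (f s) * (1 - tent (s / R)) <= B * (b / R)"
    using B tent_le[of "s / R"] by (intro mult_mono) auto
   then show ?thesis using R(2) unfolding eq by linarith
  qed
 qed
 have gm [measurable]: "g \<in> borel_measurable borel" by (rule measurable_contI[OF cg])
 have gi: "L1 g"
 proof (rule bintble_bound)
  show "L1 (\<lambda>s. B * indicator {-R..R} s)" by (intro integrable_mult_right integrable_interval_real)
  show "AE s in lborel. norm (g s) <= norm (B * indicator {-R..R} s)"
   using gB g0 B(1) by (intro AE_I2) (auto simp: indicator_def abs_if split: if_splits)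
 qed simp
 obtain A where A: "0 < A" "(LBINT x. indicator {x. A < \<bar>x\<bar>} x * pk x) < \<eta> / (8 * B)"
  using pk_tail[of "\<eta> / (8 * B)"] \<eta> B by auto
 obtain d where d: "0 < d" "\<And>x y. dist y x < d ==> dist (g y) (g x) < \<eta> / 4"
  using C0R_uniformly_continuous[OF gC0] \<eta> unfolding uniformly_continuous_on_def
  by (metis UNIV_I zero_less_divide_iff zero_less_numeral)
 define e where "e = d / (2 * A)"
 have e: "0 < e" using d A by (simp add: e_def)
 have ga: "cmod (abel e g s - g s) <= \<eta> / 4 + \<eta> / 4" for s
 proof -
  have "cmod (abel e g s - g s) <= \<eta> / 4 + 2 * B * (LBINT x. indicator {x. A < \<bar>x\<bar>} x * pk x)"
  proof (rule cmod_abel_diff_le[OF gm gB])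
   fix x assume x: "\<bar>x\<bar> <= A"
   have "e * \<bar>x\<bar> <= e * A" using x e by (intro mult_left_mono) auto
   also have "... < d" using d A by (simp add: e_def)
   finally have "dist (s - e * x) s < d" using e by (simp add: dist_real_def abs_mult)
   then show "cmod (g (s - e * x) - g s) <= \<eta> / 4" using d(2) by (simp add: dist_norm less_imp_le)
  qed (use \<eta> gB in auto)
  also have "2 * B * (LBINT x. indicator {x. A < \<bar>x\<bar>} x * pk x) <= 2 * B * (\<eta> / (8 * B))"
   using A(2) B(1) by (intro mult_left_mono) auto
  also have "2 * B * (\<eta> / (8 * B)) = \<eta> / 4" using B(1) by simp
  finally show ?thesis by simp
 qed
 define \<phi> where "\<phi> v = of_real (exp (- e * \<bar>v\<bar>) / (2 * pi)) * fourier g v" for v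
 have \<phi>: "L1 \<phi>" unfolding \<phi>_def using integrable_exp_abs[OF e]
  by (intro integrable_mult_fourier[OF _ gi] integrable_of_real) auto
 have ift: "ift \<phi> = abel e g" using abel_eq_ift[OF gi e] by (simp add: \<phi>_def[abs_def] fun_eq_iff)
 show thesis
 proof (rule that[OF \<phi>])
  show "cmod (f s - ift \<phi> s) <= \<eta>" for s
   using ga[of s] fg[of s] norm_triangle_ineq4[of "f s - g s" "abel e g s - g s"] \<eta> by (simp add: ift)
  show "ift \<phi> \<in> C0R" unfolding C0R_def
  proof (intro CollectI conjI continuous_on_ift[OF \<phi>] tendstoI)
   fix \<epsilon> :: real assume \<epsilon>: "0 < \<epsilon>"
   obtain A' where A': "0 < A'" "(LBINT x. indicator {x. A' < \<bar>x\<bar>} x * pk x) < \<epsilon> / (2 * B)"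
    using pk_tail[of "\<epsilon> / (2 * B)"] \<epsilon> B by auto
   show "\<forall>\<^sub>F s in at_infinity. dist (ift \<phi> s) 0 < \<epsilon>"
    unfolding eventually_at_infinity
   proof (intro exI[of _ "R + e * A'"] allI impI)
    fix s :: real assume s: "R + e * A' <= norm s"
    have "cmod (abel e g s - 0) <= 0 + 2 * B * (LBINT x. indicator {x. A' < \<bar>x\<bar>} x * pk x)"
    proof (rule cmod_abel_diff_le[OF gm gB])
     fix x assume x: "\<bar>x\<bar> <= A'"
     have "e * \<bar>x\<bar> <= e * A'" using x e by (intro mult_left_mono) auto
     then have "\<bar>e * x\<bar> <= e * A'" using e by (simp add: abs_mult)
     then have "R <= \<bar>s - e * x\<bar>" using s by simp
     then show "cmod (g (s - e * x) - 0) <= 0" by (simp add: g0)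
    qed (use B in auto)
    also have "... < \<epsilon>" using A'(2) B(1) by (simp add: field_simps)
    finally show "dist (ift \<phi> s) 0 < \<epsilon>" by (simp add: ift)
   qed
  qed
 qed
qed

section \<open>Series representations\<close>

lemma suminf_prod_decode:
 fixes G :: "nat => nat => 'b::{second_countable_topology, banach}"
 assumes 1: "\<And>j. summable (\<lambda>k. norm (G j k))" and 2: "summable (\<lambda>j. \<Sum>k. norm (G j k))"
 shows "summable (\<lambda>n. norm (case prod_decode n of (j, k) => G j k))"
  and "(\<Sum>n. case prod_decode n of (j, k) => G j k) = (\<Sum>j. \<Sum>k. G j k)"
  and "summable (\<lambda>j. norm (\<Sum>k. G j k))"
proof -
 have inf_eq: "infsum f UNIV = suminf f" if "summable (\<lambda>n. norm (f n))" for f :: "nat => 'c::banach"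
  using norm_summable_imp_has_sum[OF that summable_sums[OF summable_norm_cancel[OF that]]] by (rule infsumI)
 have n1: "infsum (\<lambda>k. norm (G j k)) UNIV = (\<Sum>k. norm (G j k))" for j
  using 1[of j] by (intro inf_eq) simp
 have sumnn: "0 <= (\<Sum>k. norm (G j k))" for j by (intro suminf_nonneg 1) simp
 have abs: "(\<lambda>p. norm ((\<lambda>(j, k). G j k) p)) summable_on UNIV \<times> UNIV"
 proof (rule Infinite_Sum.abs_summable_on_Sigma_iff[where A = UNIV and B = "\<lambda>_. UNIV" and f = "\<lambda>(j, k). G j k", THEN iffD2], intro conjI ballI)
  show "(\<lambda>k. norm (case (j, k) of (j, k) => G j k)) summable_on UNIV" for j
   using norm_summable_imp_summable_on[of "\<lambda>k. norm (G j k)"] 1[of j] by simp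
  show "(\<lambda>j. norm (infsum (\<lambda>k. norm (case (j, k) of (j, k) => G j k)) UNIV)) summable_on UNIV"
   using norm_summable_imp_summable_on[of "\<lambda>j. norm (\<Sum>k. norm (G j k))"] 2 sumnn by (simp add: n1)
 qed
 have bij: "bij_betw prod_decode UNIV (UNIV \<times> UNIV)" using bij_prod_decode by simp
 have "(\<lambda>n. norm ((\<lambda>(j, k). G j k) (prod_decode n))) summable_on UNIV"
  using abs summable_on_reindex_bij_betw[OF bij, of "\<lambda>p. norm ((\<lambda>(j, k). G j k) p)"] by simp
 then show s: "summable (\<lambda>n. norm (case prod_decode n of (j, k) => G j k))"
  using has_sum_imp_sums by (auto simp: summable_on_def summable_def)
 show sn: "summable (\<lambda>j. norm (\<Sum>k. G j k))"
 proof (rule summable_comparison_test'[OF 2, of 0])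
  show "norm (norm (\<Sum>k. G j k)) <= (\<Sum>k. norm (G j k))" for j using summable_norm[OF 1] by simp
 qed
 have "(\<Sum>n. case prod_decode n of (j, k) => G j k) = infsum (\<lambda>n. (\<lambda>(j, k). G j k) (prod_decode n)) UNIV"
  using inf_eq[OF s] by simp
 also have "... = infsum (\<lambda>(j, k). G j k) (UNIV \<times> UNIV)"
  by (rule infsum_reindex_bij_betw[OF bij])
 also have "... = infsum (\<lambda>j. infsum (\<lambda>k. G j k) UNIV) UNIV"
  by (rule infsum_Sigma'_banach[symmetric]) (rule Infinite_Sum.abs_summable_summable[OF abs])
 also have "... = infsum (\<lambda>j. \<Sum>k. G j k) UNIV" using inf_eq[OF 1] by simp
 also have "... = (\<Sum>j. \<Sum>k. G j k)" by (rule inf_eq[OF sn])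
 finally show "(\<Sum>n. case prod_decode n of (j, k) => G j k) = (\<Sum>j. \<Sum>k. G j k)" .
qed

section \<open>Coefficient classes and representable functions\<close>

lemma supnorm_upper: "f \<in> BUCR ==> cmod (f s) <= supnorm f"
proof -
 assume "f \<in> BUCR"
 then obtain B where "\<And>s. cmod (f s) <= B" by (auto simp: BUCR_def bounded_iff)
 then show ?thesis unfolding supnorm_def by (intro cSUP_upper bdd_aboveI2) auto
qed

lemma supnorm_least: "(\<And>s. cmod (f s) <= B) ==> supnorm f <= B"
 unfolding supnorm_def by (rule cSUP_least) auto

lemma supnorm_nonneg: "f \<in> BUCR ==> 0 <= supnorm f"
 using supnorm_upper[of f 0] norm_ge_zero order_trans by blast

lemma BUCR_continuous: "f \<in> BUCR ==> continuous_on UNIV f"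
 by (simp add: BUCR_def uniformly_continuous_imp_continuous)

lemma BUCR_measurable: "f \<in> BUCR ==> f \<in> borel_measurable borel"
 by (intro measurable_contI BUCR_continuous)

text \<open>Treats \<open>C0R\<close> and \<open>BUCR\<close> together. Stability under
  multiplication by \<open>BUCR\<close> is the property that later makes the smaller algebra an
  ideal of the larger one.\<close>

definition rep_class :: "(real => complex) set => bool" where
 "rep_class S \<longleftrightarrow> S \<subseteq> BUCR \<and> (\<lambda>_. 0) \<in> S \<and> (\<forall>f\<in>S. \<forall>g\<in>BUCR. (\<lambda>s. f s * g s) \<in> S)"

lemma rep_classD:
 assumes "rep_class S"
 shows "f \<in> S ==> f \<in> BUCR" "(\<lambda>_. 0) \<in> S" "f \<in> S ==> g \<in> BUCR ==> (\<lambda>s. f s * g s) \<in> S"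
 using assms by (auto simp: rep_class_def)

lemma BUCR_const: "(\<lambda>_. c) \<in> BUCR" by (auto simp: BUCR_def uniformly_continuous_on_const)

lemma BUCR_mult:
 assumes f: "f \<in> BUCR" and g: "g \<in> BUCR"
 shows "(\<lambda>s. f s * g s) \<in> BUCR"
proof -
 define A where "A = supnorm f + supnorm g + 1"
 have A: "0 < A" "cmod (f s) <= A" "cmod (g s) <= A" for s
  using supnorm_nonneg[OF f] supnorm_nonneg[OF g] supnorm_upper[OF f, of s] supnorm_upper[OF g, of s]
  by (auto simp: A_def)
 have "uniformly_continuous_on UNIV (\<lambda>s. f s * g s)" unfolding uniformly_continuous_on_def
 proof (intro allI impI)
  fix e :: real assume e: "0 < e"
  define \<delta> where "\<delta> = e / (2 * A)"
  have \<delta>: "0 < \<delta>" "A * \<delta> = e / 2" using e A(1) by (auto simp: \<delta>_def)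
  obtain d1 where d1: "0 < d1" "\<And>x y. dist y x < d1 ==> dist (f y) (f x) < \<delta>"
   using f \<delta>(1) unfolding BUCR_def uniformly_continuous_on_def by blast
  obtain d2 where d2: "0 < d2" "\<And>x y. dist y x < d2 ==> dist (g y) (g x) < \<delta>"
   using g \<delta>(1) unfolding BUCR_def uniformly_continuous_on_def by blast
  have "dist (f y * g y) (f x * g x) < e" if "dist y x < min d1 d2" for x y
  proof -
   have "f y * g y - f x * g x = f y * (g y - g x) + (f y - f x) * g x" by (simp add: algebra_simps)
   then have "dist (f y * g y) (f x * g x) <= cmod (f y) * cmod (g y - g x) + cmod (f y - f x) * cmod (g x)"
    by (metis dist_norm norm_mult norm_triangle_ineq)
   also have "... <= A * cmod (g y - g x) + cmod (f y - f x) * A"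
    by (intro add_mono mult_mono A order_refl norm_ge_zero less_imp_le[OF A(1)])
   also have "... < A * \<delta> + \<delta> * A"
    using d1(2)[of y x] d2(2)[of y x] that A(1) by (intro add_strict_mono mult_strict_left_mono mult_strict_right_mono) (auto simp: dist_norm)
   finally show ?thesis using \<delta>(2) by (simp add: mult.commute)
  qed
  then show "\<exists>d>0. \<forall>x\<in>UNIV. \<forall>x'\<in>UNIV. dist x' x < d \<longrightarrow> dist (f x' * g x') (f x * g x) < e"
   using d1(1) d2(1) by (intro exI[of _ "min d1 d2"]) auto
 qed
 moreover have "cmod (f s * g s) <= A * A" for s
  unfolding norm_mult by (intro mult_mono A norm_ge_zero less_imp_le[OF A(1)])
 then have "bounded (range (\<lambda>s. f s * g s))" by (auto simp: bounded_iff)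
 ultimately show ?thesis by (simp add: BUCR_def)
qed

lemma rep_class_BUCR: "rep_class BUCR" by (simp add: rep_class_def BUCR_const BUCR_mult)

lemma rep_class_C0R: "rep_class C0R"
proof -
 have "(\<lambda>s. f s * g s) \<in> C0R" if f: "f \<in> C0R" and g: "g \<in> BUCR" for f g
 proof -
  have "((\<lambda>s. f s * g s) \<longlongrightarrow> 0) at_infinity"
  proof (rule Lim_null_comparison)
   show "\<forall>\<^sub>F s in at_infinity. norm (f s * g s) <= cmod (f s) * supnorm g"
    using supnorm_upper[OF g] by (intro always_eventually allI) (simp add: norm_mult mult_left_mono)
   show "((\<lambda>s. cmod (f s) * supnorm g) \<longlongrightarrow> 0) at_infinity"
    using f by (auto simp: C0R_def intro!: tendsto_mult_left_zero tendsto_norm_zero)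
  qed
  then show ?thesis using f BUCR_continuous[OF g] by (auto simp: C0R_def intro!: continuous_intros)
 qed
 then show ?thesis using C0R_subset_BUCR by (auto simp: rep_class_def C0R_def)
qed

lemma zero_H1: "(\<lambda>_. 0) \<in> H1" by (simp add: H1_def fourier_def)

lemma H1_integrable: "h \<in> H1 ==> L1 h" by (simp add: H1_def)

lemma integrable_conv_integrand:
 assumes "f \<in> BUCR" "L1 h"
 shows "L1 (\<lambda>t. f (s - t) * h t)"
proof -
 have [measurable]: "f \<in> borel_measurable borel" by (rule BUCR_measurable[OF assms(1)])
 have "L1 (\<lambda>t. h t * f (s - t))"
  by (rule integrable_mult_bounded[OF assms(2), where B = "supnorm f"]) (auto intro: supnorm_upper[OF assms(1)])
 then show ?thesis by (simp add: mult.commute)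
qed

lemma cmod_conv_diff_le:
 assumes f: "f \<in> BUCR" and f': "f' \<in> BUCR" and h: "L1 h"
  and le: "\<And>t. cmod (f (s - t) - f' (s' - t)) <= B"
 shows "cmod (conv f h s - conv f' h s') <= B * L1norm h"
proof -
 have "conv f h s - conv f' h s' = (LBINT t. f (s - t) * h t - f' (s' - t) * h t)"
  unfolding conv_def using f f' h by (intro bint_diff[symmetric] integrable_conv_integrand)
 also have "cmod ... <= (LBINT t. cmod (f (s - t) * h t - f' (s' - t) * h t))" by (rule integral_norm_bound)
 also have "... <= (LBINT t. B * cmod (h t))" using f f' h le
  by (intro integral_mono integrable_norm bintble_diff integrable_conv_integrand integrable_mult_right)
   (auto simp: norm_mult mult_right_mono simp flip: left_diff_distrib)
 finally show ?thesis by (simp add: L1norm_def)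
qed

lemma cmod_conv_le:
 assumes f: "f \<in> BUCR" and h: "L1 h"
 shows "cmod (conv f h s) <= supnorm f * L1norm h"
proof -
 have "conv (\<lambda>_. 0) h s = 0" by (simp add: conv_def)
 then show ?thesis
  using cmod_conv_diff_le[OF f BUCR_const[of 0] h, where s = s and s' = s and B = "supnorm f"] supnorm_upper[OF f] by simp
qed

lemma continuous_on_conv:
 assumes f: "f \<in> BUCR" and h: "L1 h"
 shows "continuous_on UNIV (conv f h)" unfolding continuous_on_iff
proof (intro ballI allI impI)
 fix s \<epsilon> :: real assume \<epsilon>: "0 < \<epsilon>"
 define \<delta> where "\<delta> = \<epsilon> / (2 * (L1norm h + 1))"
 have \<delta>: "0 < \<delta>" using \<epsilon> L1norm_nonneg[of h] by (simp add: \<delta>_def add_nonneg_pos)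
 obtain d where d: "0 < d" "\<And>x y. dist y x < d ==> dist (f y) (f x) < \<delta>"
  using f \<delta> unfolding BUCR_def uniformly_continuous_on_def by blast
 have "dist (conv f h y) (conv f h s) < \<epsilon>" if "dist y s < d" for y
 proof -
  have "cmod (conv f h y - conv f h s) <= \<delta> * L1norm h" using d(2)[of "y - _" "s - _"] that
   by (intro cmod_conv_diff_le f h) (auto simp: dist_norm less_imp_le)
  also have "... < \<epsilon>"
   using \<epsilon> L1norm_nonneg[of h] by (simp add: \<delta>_def divide_less_eq add_nonneg_pos)
  finally show ?thesis by (simp add: dist_norm)
 qed
 then show "\<exists>d>0. \<forall>x'\<in>UNIV. dist x' s < d \<longrightarrow> dist (conv f h x') (conv f h s) < \<epsilon>"
  using d(1) by blast
qed

text \<open>There is a representation of cost at most \<open>c\<close>. Estimates are carried out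
  with such witnesses, and infima are taken only at the end, when the norms are compared.\<close>

definition Nle :: "(real => complex) set => (real => complex) => real => bool" where
 "Nle S F c \<longleftrightarrow> (\<exists>f h. is_rep S F f h \<and> (\<Sum>k. supnorm (f k) * L1norm (h k)) <= c)"

lemma Nle_mono: "Nle S F c ==> c <= d ==> Nle S F d" by (auto simp: Nle_def intro: order_trans)

lemma Aspace_iff_Nle: "F \<in> Aspace S \<longleftrightarrow> (\<exists>c. Nle S F c)"
 by (auto simp: Aspace_def Nle_def)

lemma rep_nonneg: "rep_class S ==> is_rep S F f h ==> 0 <= supnorm (f k) * L1norm (h k)"
 by (intro mult_nonneg_nonneg supnorm_nonneg L1norm_nonneg) (auto simp: is_rep_def dest: rep_classD)

lemma rep_norm_summable:
 assumes S: "rep_class S" and rep: "is_rep S F f h"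
 shows "summable (\<lambda>k. cmod (conv (f k) (h k) s))"
proof (rule summable_comparison_test'[where N = 0])
 show "summable (\<lambda>k. supnorm (f k) * L1norm (h k))" using rep by (simp add: is_rep_def)
 show "norm (cmod (conv (f k) (h k) s)) <= supnorm (f k) * L1norm (h k)" for k
  using rep cmod_conv_le rep_classD(1)[OF S] H1_integrable by (simp add: is_rep_def)
qed

lemma Nle_bound:
 assumes S: "rep_class S" and F: "Nle S F c"
 shows "cmod (F s) <= c"
proof -
 obtain f h where rep: "is_rep S F f h" and c: "(\<Sum>k. supnorm (f k) * L1norm (h k)) <= c"
  using F by (auto simp: Nle_def)
 have "cmod (F s) = cmod (\<Sum>k. conv (f k) (h k) s)" using rep by (simp add: is_rep_def)
 also have "... <= (\<Sum>k. cmod (conv (f k) (h k) s))" by (rule summable_norm[OF rep_norm_summable[OF S rep]])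
 also have "... <= (\<Sum>k. supnorm (f k) * L1norm (h k))"
  using rep cmod_conv_le rep_classD(1)[OF S] H1_integrable
  by (intro suminf_le rep_norm_summable[OF S rep]) (auto simp: is_rep_def)
 finally show ?thesis using c by simp
qed

lemma Nle_nonneg: "rep_class S ==> Nle S F c ==> 0 <= c" using Nle_bound norm_ge_zero order_trans by blast

lemma Nle_continuous:
 assumes S: "rep_class S" and F: "Nle S F c"
 shows "continuous_on UNIV F"
proof -
 obtain f h where rep: "is_rep S F f h" using F by (auto simp: Nle_def)
 have "uniform_limit UNIV (\<lambda>n s. \<Sum>k<n. conv (f k) (h k) s) (\<lambda>s. \<Sum>k. conv (f k) (h k) s) sequentially"
  using rep cmod_conv_le rep_classD(1)[OF S] H1_integrable
  by (intro Weierstrass_m_test[where M = "\<lambda>k. supnorm (f k) * L1norm (h k)"]) (auto simp: is_rep_def)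
 then have "continuous_on UNIV (\<lambda>s. \<Sum>k. conv (f k) (h k) s)"
  using rep rep_classD(1)[OF S] H1_integrable
  by (intro uniform_limit_theorem[OF _ _ trivial_limit_sequentially])
   (auto simp: is_rep_def intro!: always_eventually continuous_intros continuous_on_conv)
 moreover have "F = (\<lambda>s. \<Sum>k. conv (f k) (h k) s)" using rep by (auto simp: is_rep_def)
 ultimately show ?thesis by simp
qed

text \<open>The completeness of the representable functions: choose a representation of each term
  and enumerate the double series by \<open>prod_decode\<close>.\<close>

lemma Nle_series:
 assumes S: "rep_class S" and F: "\<And>j. Nle S (F j) (c j)" and c: "summable c" and G: "\<And>s. G s = (\<Sum>j. F j s)"
 shows "Nle S G (suminf c)"
proof -
 obtain f h where rep: "\<And>j. is_rep S (F j) (f j) (h j)" and le: "\<And>j. (\<Sum>k. supnorm (f j k) * L1norm (h j k)) <= c j"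
  using F unfolding Nle_def by metis
 let ?a = "\<lambda>j k. supnorm (f j k) * L1norm (h j k)"
 have nn: "0 <= ?a j k" for j k by (rule rep_nonneg[OF S rep])
 have s1: "summable (\<lambda>k. ?a j k)" for j using rep by (simp add: is_rep_def)
 have s2: "summable (\<lambda>j. \<Sum>k. ?a j k)"
  by (rule summable_comparison_test'[OF c, of 0]) (simp add: le suminf_nonneg[OF s1 nn])
 define f' where "f' n = (case prod_decode n of (j, k) => f j k)" for n
 define h' where "h' n = (case prod_decode n of (j, k) => h j k)" for n
 have a': "supnorm (f' n) * L1norm (h' n) = (case prod_decode n of (j, k) => ?a j k)" for n
  by (simp add: f'_def h'_def split: prod.split)
 have "summable (\<lambda>n. norm (case prod_decode n of (j, k) => ?a j k))"
  and tot: "(\<Sum>n. case prod_decode n of (j, k) => ?a j k) = (\<Sum>j. \<Sum>k. ?a j k)"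
  using s1 s2 nn by (intro suminf_prod_decode; simp)+
 then have s': "summable (\<lambda>n. supnorm (f' n) * L1norm (h' n))"
  unfolding a' by (rule_tac summable_norm_cancel)
 have G': "G s = (\<Sum>n. conv (f' n) (h' n) s)" for s
 proof -
  have cle: "cmod (conv (f j k) (h j k) s) <= ?a j k" for j k
   using rep[of j] cmod_conv_le rep_classD(1)[OF S] H1_integrable by (simp add: is_rep_def)
  have n1: "summable (\<lambda>k. cmod (conv (f j k) (h j k) s))" for j by (rule rep_norm_summable[OF S rep])
  have n2: "summable (\<lambda>j. \<Sum>k. cmod (conv (f j k) (h j k) s))"
   by (rule summable_comparison_test'[OF s2, of 0]) (simp add: suminf_nonneg[OF n1] suminf_le[OF cle n1 s1])
  have "G s = (\<Sum>j. \<Sum>k. conv (f j k) (h j k) s)" using rep by (simp add: G is_rep_def)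
  also have "... = (\<Sum>n. case prod_decode n of (j, k) => conv (f j k) (h j k) s)"
   by (rule suminf_prod_decode(2)[OF n1 n2, symmetric])
  also have "... = (\<Sum>n. conv (f' n) (h' n) s)"
   by (rule arg_cong[where f = suminf]) (auto simp: f'_def h'_def split: prod.split)
  finally show ?thesis .
 qed
 have "is_rep S G f' h'" using rep s' G' by (auto simp: is_rep_def f'_def h'_def split: prod.split)
 moreover have "(\<Sum>n. supnorm (f' n) * L1norm (h' n)) <= suminf c"
  unfolding a' tot by (rule suminf_le[OF le s2 c])
 ultimately show ?thesis by (auto simp: Nle_def)
qed

lemma Nle_zero: "rep_class S ==> Nle S (\<lambda>_. 0) 0" unfolding Nle_def is_rep_def
 by (rule exI[of _ "\<lambda>_ _. 0"], rule exI[of _ "\<lambda>_ _. 0"])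
  (auto simp: zero_H1 conv_def L1norm_def dest: rep_classD(2))

lemma Nle_conv:
 assumes S: "rep_class S" and f: "f \<in> S" and h: "h \<in> H1"
 shows "Nle S (conv f h) (supnorm f * L1norm h)"
proof -
 define f' where "f' k = (if k = 0 then f else (\<lambda>_. 0))" for k :: nat
 define h' where "h' k = (if k = 0 then h else (\<lambda>_. 0))" for k :: nat
 have a: "(\<lambda>k. supnorm (f' k) * L1norm (h' k)) = (\<lambda>k. if k = 0 then supnorm f * L1norm h else 0)"
  by (auto simp: f'_def h'_def L1norm_def)
 have c: "(\<lambda>k. conv (f' k) (h' k) s) = (\<lambda>k. if k = 0 then conv f h s else 0)" for s
  by (auto simp: f'_def h'_def conv_def)
 have "is_rep S (conv f h) f' h'"
  unfolding is_rep_def a c using sums_single[of 0 "\<lambda>_. conv f h _"] sums_single[of 0 "\<lambda>_. supnorm f * L1norm h"]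
  by (auto simp: f'_def h'_def f h zero_H1 rep_classD(2)[OF S] sums_iff)
 moreover have "(\<Sum>k. supnorm (f' k) * L1norm (h' k)) = supnorm f * L1norm h"
  unfolding a using sums_single[of 0 "\<lambda>_. supnorm f * L1norm h"] by (simp add: sums_iff)
 ultimately show ?thesis unfolding Nle_def by (metis order_refl)
qed

lemma Nle_sum:
 fixes F :: "nat => real => complex"
 assumes S: "rep_class S" and F: "\<And>k. k < n ==> Nle S (F k) (c k)"
 shows "Nle S (\<lambda>s. \<Sum>k<n. F k s) (\<Sum>k<n. c k)"
proof -
 have "Nle S (\<lambda>s. if j < n then F j s else 0) (if j < n then c j else 0)" for j
  using F Nle_zero[OF S] by auto
 moreover have "(\<lambda>j. if j < n then c j else 0) sums (\<Sum>j<n. c j)"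
  using sums_If_finite_set[of "{..<n}" c] by simp
 moreover have "(\<lambda>j. if j < n then F j s else 0) sums (\<Sum>j<n. F j s)" for s
  using sums_If_finite_set[of "{..<n}" "\<lambda>j. F j s"] by simp
 ultimately show ?thesis
  using Nle_series[OF S, of "\<lambda>j s. if j < n then F j s else 0" "\<lambda>j. if j < n then c j else 0" "\<lambda>s. \<Sum>k<n. F k s"]
  by (simp add: sums_iff)
qed

lemma Nle_add:
 assumes S: "rep_class S" and "Nle S F c" "Nle S G d"
 shows "Nle S (\<lambda>s. F s + G s) (c + d)"
 using Nle_sum[OF S, of 2 "\<lambda>k. if k = 0 then F else G" "\<lambda>k. if k = 0 then c else d"] assms
 by (simp add: numeral_2_eq_2 lessThan_Suc add.commute)

lemma Nle_scale:
 assumes S: "rep_class S" and F: "Nle S F c"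
 shows "Nle S (\<lambda>s. a * F s) (cmod a * c)"
proof -
 obtain f h where rep: "is_rep S F f h" and c: "(\<Sum>k. supnorm (f k) * L1norm (h k)) <= c"
  using F by (auto simp: Nle_def)
 define f' where "f' k = (\<lambda>s. f k s * a)" for k
 have fB: "f k \<in> BUCR" "h k \<in> H1" "f k \<in> S" for k using rep rep_classD(1)[OF S] by (auto simp: is_rep_def)
 have f'S: "f' k \<in> S" for k
  unfolding f'_def by (rule rep_classD(3)[OF S]) (use rep BUCR_const in \<open>auto simp: is_rep_def\<close>)
 have cv: "conv (f' k) (h k) s = conv (f k) (h k) s * a" for k s
  unfolding conv_def f'_def by (simp add: mult_ac flip: integral_mult_left_zero)
 have sn: "summable (\<lambda>k. supnorm (f k) * L1norm (h k) * cmod a)"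
  using rep by (intro summable_mult2) (simp add: is_rep_def)
 have le: "supnorm (f' k) * L1norm (h k) <= supnorm (f k) * L1norm (h k) * cmod a" for k
 proof -
  have "supnorm (f' k) <= supnorm (f k) * cmod a"
   by (rule supnorm_least) (simp add: f'_def norm_mult mult_right_mono supnorm_upper[OF fB(1)])
  from mult_right_mono[OF this L1norm_nonneg, of "h k"] show ?thesis by (simp add: mult_ac)
 qed
 have nn: "0 <= supnorm (f' k) * L1norm (h k)" for k
  using f'S rep_classD(1)[OF S] by (intro mult_nonneg_nonneg supnorm_nonneg L1norm_nonneg) auto
 have s': "summable (\<lambda>k. supnorm (f' k) * L1norm (h k))"
  by (rule summable_comparison_test'[OF sn, of 0]) (use le nn in simp)
 have "is_rep S (\<lambda>s. a * F s) f' h" unfolding is_rep_def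
 proof (intro conjI allI f'S fB s')
  fix s
  have "summable (\<lambda>k. conv (f k) (h k) s)"
   by (rule summable_norm_cancel[OF rep_norm_summable[OF S rep]])
  from suminf_mult2[OF this, of a] show "a * F s = (\<Sum>k. conv (f' k) (h k) s)"
   using rep by (simp add: is_rep_def cv mult.commute)
 qed
 moreover have "(\<Sum>k. supnorm (f' k) * L1norm (h k)) <= cmod a * c"
 proof -
  have "(\<Sum>k. supnorm (f' k) * L1norm (h k)) <= (\<Sum>k. supnorm (f k) * L1norm (h k) * cmod a)"
   by (rule suminf_le[OF le s' sn])
  also have "... = (\<Sum>k. supnorm (f k) * L1norm (h k)) * cmod a"
   using rep by (intro suminf_mult2[symmetric]) (simp add: is_rep_def)
  finally show ?thesis using mult_right_mono[OF c, of "cmod a"] by (simp add: mult.commute)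
 qed
 ultimately show ?thesis by (auto simp: Nle_def)
qed

lemma Nle_diff:
 assumes S: "rep_class S" and "Nle S F c" "Nle S G d"
 shows "Nle S (\<lambda>s. F s - G s) (c + d)"
 using Nle_add[OF S assms(2) Nle_scale[OF S assms(3), of "- 1"]] by simp

lemma Nle_C0R_BUCR: "Nle C0R F c ==> Nle BUCR F c"
 using C0R_subset_BUCR unfolding Nle_def is_rep_def by (meson subsetD)

text \<open>One half of \<open>\<eta>\<close> pays for cutting off the tail of a representation, the
  other for replacing the finitely many remaining coefficients by transforms of integrable
  functions.\<close>

lemma Nle_C0R_approx:
 assumes F: "Nle C0R F c" and \<eta>: "0 < \<eta>"
 obtains m :: nat and \<phi> h where "\<And>k. k < m ==> L1 (\<phi> k) \<and> h k \<in> H1 \<and> ift (\<phi> k) \<in> C0R"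
  "(\<Sum>k<m. supnorm (ift (\<phi> k)) * L1norm (h k)) <= c + \<eta>"
  "Nle C0R (\<lambda>s. F s - (\<Sum>k<m. conv (ift (\<phi> k)) (h k) s)) \<eta>"
proof -
 note S = rep_class_C0R
 obtain f h where rep: "is_rep C0R F f h" and c: "(\<Sum>k. supnorm (f k) * L1norm (h k)) <= c"
  using F by (auto simp: Nle_def)
 let ?a = "\<lambda>k. supnorm (f k) * L1norm (h k)"
 have sa: "summable ?a" using rep by (simp add: is_rep_def)
 have fh: "f k \<in> C0R" "f k \<in> BUCR" "h k \<in> H1" for k using rep rep_classD(1)[OF S] by (auto simp: is_rep_def)
 have a0: "0 <= ?a k" for k by (rule rep_nonneg[OF S rep])
 obtain m where m: "\<And>n. n \<ge> m ==> norm (\<Sum>i. ?a (i + n)) < \<eta> / 2"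
  using suminf_exist_split[OF _ sa, of "\<eta> / 2"] \<eta> by auto
 \<comment> \<open>A geometric share of \<open>\<eta> / 2\<close>, divided by the norm of
   \<open>h k\<close>; adding one keeps the quotient meaningful when that norm is zero.\<close>
 define \<delta> where "\<delta> k = \<eta> / 2 * (1 / 2) ^ Suc k / (L1norm (h k) + 1)" for k
 have \<delta>: "0 < \<delta> k" "\<delta> k * L1norm (h k) <= \<eta> / 2 * (1 / 2) ^ Suc k" for k
 proof -
  have L: "0 < L1norm (h k) + 1" using L1norm_nonneg[of "h k"] by simp
  then show "0 < \<delta> k" using \<eta> by (simp add: \<delta>_def)
  have "\<delta> k * L1norm (h k) <= \<delta> k * (L1norm (h k) + 1)" using \<open>0 < \<delta> k\<close> by simp
  also have "... = \<eta> / 2 * (1 / 2) ^ Suc k" unfolding \<delta>_def using L by (subst times_divide_eq_left) (rule nonzero_mult_div_cancel_right, simp)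
  finally show "\<delta> k * L1norm (h k) <= \<eta> / 2 * (1 / 2) ^ Suc k" .
 qed
 have "\<exists>\<phi>. L1 \<phi> \<and> ift \<phi> \<in> C0R \<and> (\<forall>s. cmod (f k s - ift \<phi> s) <= \<delta> k)" for k
  using C0R_approx_ift[OF fh(1) \<delta>(1)] by metis
 then obtain \<phi> where \<phi>: "\<And>k. L1 (\<phi> k)" "\<And>k. ift (\<phi> k) \<in> C0R"
  "\<And>k s. cmod (f k s - ift (\<phi> k) s) <= \<delta> k" by metis
 have half: "(\<Sum>k<m. \<eta> / 2 * (1 / 2) ^ Suc k) <= \<eta> / 2"
 proof -
  have "(\<Sum>k<m. (1 / 2 :: real) ^ Suc k) <= (\<Sum>k. (1 / 2) ^ Suc k)"
   using power_half_series by (intro sum_le_suminf) (auto simp: sums_iff)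
  also have "... = 1" using power_half_series by (simp add: sums_iff)
  finally have "\<eta> / 2 * (\<Sum>k<m. (1 / 2 :: real) ^ Suc k) <= \<eta> / 2 * 1" using \<eta> by (intro mult_left_mono) auto
  then show ?thesis by (simp add: sum_distrib_left)
 qed
 define d where "d k = (if k < m then (\<lambda>s. f k s - ift (\<phi> k) s) else f k)" for k
 have diffC0: "(\<lambda>s. f k s - ift (\<phi> k) s) \<in> C0R" for k
  using fh(1)[of k] \<phi>(2)[of k] unfolding C0R_def by (auto intro!: continuous_intros tendsto_eq_intros)
 have dC0: "d k \<in> C0R" for k using diffC0 fh by (simp add: d_def)
 have dB: "d k \<in> BUCR" "ift (\<phi> k) \<in> BUCR" for k using dC0 \<phi>(2) rep_classD(1)[OF S] by auto
 have dle: "supnorm (d k) * L1norm (h k) <= \<eta> / 2 * (1 / 2) ^ Suc k" if "k < m" for k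
 proof -
  have "supnorm (d k) <= \<delta> k" using that by (intro supnorm_least) (simp add: d_def \<phi>)
  then show ?thesis using \<delta>(2)[of k] L1norm_nonneg[of "h k"] by (meson mult_right_mono order_trans)
 qed
 have dtail: "(\<lambda>i. supnorm (d (i + m)) * L1norm (h (i + m))) = (\<lambda>i. ?a (i + m))" by (simp add: d_def)
 have sd: "summable (\<lambda>k. supnorm (d k) * L1norm (h k))"
  using sa dtail summable_iff_shift[of "\<lambda>k. supnorm (d k) * L1norm (h k)" m] summable_iff_shift[of ?a m] by simp
 have rep': "is_rep C0R (\<lambda>s. F s - (\<Sum>k<m. conv (ift (\<phi> k)) (h k) s)) d h"
  unfolding is_rep_def
 proof (intro conjI allI dC0 fh sd)
  fix s
  have smF: "summable (\<lambda>k. conv (f k) (h k) s)"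
   by (rule summable_norm_cancel[OF rep_norm_summable[OF S rep]])
  have fin: "(\<lambda>k. if k < m then conv (ift (\<phi> k)) (h k) s else 0) sums (\<Sum>k<m. conv (ift (\<phi> k)) (h k) s)"
   using sums_If_finite_set[of "{..<m}" "\<lambda>k. conv (ift (\<phi> k)) (h k) s"] by simp
  have cd: "conv (d k) (h k) s = conv (f k) (h k) s - (if k < m then conv (ift (\<phi> k)) (h k) s else 0)" for k
   using fh dB H1_integrable[OF fh(3)]
   by (simp add: conv_def d_def left_diff_distrib bint_diff integrable_conv_integrand)
  show "F s - (\<Sum>k<m. conv (ift (\<phi> k)) (h k) s) = (\<Sum>k. conv (d k) (h k) s)"
   unfolding cd using suminf_diff[OF smF sums_summable[OF fin]] sums_unique[OF fin] rep
   by (simp add: is_rep_def)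
 qed
 have tot: "(\<Sum>k. supnorm (d k) * L1norm (h k)) <= \<eta>"
 proof -
  have "(\<Sum>k. supnorm (d k) * L1norm (h k)) = (\<Sum>i. ?a (i + m)) + (\<Sum>k<m. supnorm (d k) * L1norm (h k))"
   using suminf_split_initial_segment[OF sd, of m] unfolding dtail .
  also have "(\<Sum>k<m. supnorm (d k) * L1norm (h k)) <= (\<Sum>k<m. \<eta> / 2 * (1 / 2) ^ Suc k)"
   by (intro sum_mono dle) simp
  finally show ?thesis using half m[of m] by simp
 qed
 show thesis
 proof (rule that[of m \<phi> h])
  show "L1 (\<phi> k) \<and> h k \<in> H1 \<and> ift (\<phi> k) \<in> C0R" for k using \<phi> fh by simp
  show "Nle C0R (\<lambda>s. F s - (\<Sum>k<m. conv (ift (\<phi> k)) (h k) s)) \<eta>"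
   using rep' tot by (auto simp: Nle_def)
  have "supnorm (ift (\<phi> k)) * L1norm (h k) <= ?a k + \<eta> / 2 * (1 / 2) ^ Suc k" for k
  proof -
   have "supnorm (ift (\<phi> k)) <= supnorm (f k) + \<delta> k"
   proof (rule supnorm_least)
    fix s
    show "cmod (ift (\<phi> k) s) <= supnorm (f k) + \<delta> k"
     using \<phi>(3)[of k s] supnorm_upper[OF fh(2), of k s] norm_triangle_sub[of "ift (\<phi> k) s" "f k s"]
     by (simp add: norm_minus_commute)
   qed
   from mult_right_mono[OF this L1norm_nonneg, of "h k"] show ?thesis
    using \<delta>(2)[of k] by (simp add: distrib_right)
  qed
  then have "(\<Sum>k<m. supnorm (ift (\<phi> k)) * L1norm (h k)) <= (\<Sum>k<m. ?a k + \<eta> / 2 * (1 / 2) ^ Suc k)"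
   by (rule sum_mono)
  also have "... <= c + \<eta> / 2"
   using half sum_le_suminf[OF sa, of "{..<m}"] a0 c by (simp add: sum.distrib)
  finally show "(\<Sum>k<m. supnorm (ift (\<phi> k)) * L1norm (h k)) <= c + \<eta>" using \<eta> by simp
 qed
qed

section \<open>Products of representable functions\<close>

text \<open>Uniqueness of the Fourier transform, tested on intervals. The Abel means of an indicator
  are transforms of integrable functions, so their pairing with \<open>m\<close> vanishes; they are
  bounded by one and converge away from the two endpoints.\<close>

lemma integral_interval_eq_0:
 assumes m: "L1 m" and z: "\<And>s. ift m s = 0"
 shows "(LBINT r. m r * indicator {a..<b} r) = 0"
proof -
 \<comment> \<open>The interval is reflected because a convolution at zero evaluates its first
   function at \<open>- t\<close>.\<close>
 let ?F = "indicator {-b<..-a} :: real => complex"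
 let ?e = "\<lambda>n. inverse (real (Suc n))"
 have F: "L1 ?F" using integrable_interval[of "-b" "-a"] by (rule bintble_bound) (auto simp: indicator_def)
 have mm [measurable]: "m \<in> borel_measurable borel" using borel_measurable_integrable[OF m] by simp
 let ?\<phi> = "\<lambda>n v. of_real (exp (- ?e n * \<bar>v\<bar>) / (2 * pi)) * fourier ?F v"
 have ae: "abel (?e n) ?F = ift (?\<phi> n)" for n by (rule ext, rule abel_eq_ift[OF F]) simp
 have \<phi>: "L1 (?\<phi> n)" for n
  using integrable_exp_abs[of "?e n"] F by (intro integrable_mult_fourier integrable_of_real) auto
 have abm [measurable]: "abel (?e n) ?F \<in> borel_measurable borel" for n
  unfolding ae using \<phi>[of n] by (intro measurable_contI continuous_on_ift)
 have zero: "(LBINT t. abel (?e n) ?F (0 - t) * m t) = 0" for n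
 proof -
  have i: "L1 (\<lambda>v. cr (exp (- ?e n * \<bar>v\<bar>) / (2 * pi)) * fourier ?F v)" by (rule \<phi>)
  have "conv (ift (?\<phi> n)) m 0 = ift (\<lambda>u. ?\<phi> n u * fourier m u) 0"
   by (rule ift_mult_fourier[OF i m, symmetric])
  also have "... = 0" unfolding fourier_eq_ift[of m] z by (simp add: ift_def)
  finally show ?thesis unfolding ae conv_def .
 qed
 have le: "cmod (abel (?e n) ?F x) <= 1" for n x
 proof -
  have "cmod (abel (?e n) ?F x) <= (LBINT t. cmod (?F (x - ?e n * t) * of_real (pk t)))"
   unfolding abel_def by (rule integral_norm_bound)
  also have "... <= (LBINT t. pk t)" using pk_nonneg
   by (intro integral_mono integrable_norm integrable_mult_pk[where B = 1] integrable_pk)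
    (auto simp: norm_mult indicator_def)
  finally show ?thesis by (simp add: integral_pk)
 qed
 have "(\<lambda>n. LBINT t. abel (?e n) ?F (0 - t) * m t) ----> (LBINT t. indicator {a..<b} t * m t)"
 proof (rule integral_dominated_convergence[where w = "\<lambda>t. cmod (m t)"])
  have "AE t in lborel. t \<noteq> a" "AE t in lborel. t \<noteq> b" by (rule AE_lborel_singleton)+
  then show "AE t in lborel. (\<lambda>n. abel (?e n) ?F (0 - t) * m t) ----> indicator {a..<b} t * m t"
  proof eventually_elim
   fix t assume t: "t \<noteq> a" "t \<noteq> b"
   have "- t \<notin> frontier {-b<..-a}"
   proof -
    have "closure {-b<..-a} \<subseteq> {-b..-a}" by (rule closure_minimal) auto
    moreover have "{-b<..<-a} \<subseteq> interior {-b<..-a}" by (rule interior_maximal) auto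
    ultimately show ?thesis using t by (force simp: frontier_def)
   qed
   then have "isCont (\<lambda>x. cr (indicator {-b<..-a} x)) (- t)"
    by (intro isCont_of_real) (simp add: isCont_indicator)
   moreover have "(\<lambda>x. cr (indicator {-b<..-a} x)) = ?F" by (auto simp: indicator_def)
   ultimately have "isCont ?F (0 - t)" by simp
   moreover have "?F (0 - t) = indicator {a..<b} t" by (auto simp: indicator_def)
   ultimately show "(\<lambda>n. abel (?e n) ?F (0 - t) * m t) ----> indicator {a..<b} t * m t"
    using abel_tendsto[of ?F 1 "0 - t"] by (intro tendsto_mult_right) (simp add: indicator_def)
  qed
  show "AE t in lborel. norm (abel (?e n) ?F (0 - t) * m t) <= cmod (m t)" for n
   using le by (intro AE_I2) (simp add: norm_mult mult_left_le_one_le)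
  have "(\<lambda>t. abel (?e n) ?F (0 - t)) \<in> borel_measurable borel" for n
   by (rule measurable_compose[OF _ abm]) measurable
  then show "(\<lambda>t. abel (?e n) ?F (0 - t) * m t) \<in> borel_measurable lborel" for n
   using mm by (simp add: borel_measurable_times)
 qed (use m in auto)
 then show ?thesis unfolding zero by (simp add: mult.commute LIMSEQ_const_iff)
qed

text \<open>The translates of \<open>h\<close> integrated over a cell of shifts. Replacing the
  single shift by the cell gives a product in \<open>H1\<close> for every cell, instead of for
  almost every shift.\<close>

definition avg :: "real => real => (real => complex) => real => complex" where
 "avg a b h t = (LBINT r. indicator {a..<b} r * h (t + r))"

lemma avg_eq: "avg a b h t = (LBINT s. h s * indicator {a..<b} (s - t))"
 using lborel_affine[of 1 "\<lambda>s. h s * indicator {a..<b} (s - t)" t]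
 by (simp add: avg_def mult.commute add.commute)

lemma avg_measurable [measurable]:
 assumes [measurable]: "h \<in> borel_measurable borel"
 shows "avg a b h \<in> borel_measurable borel" unfolding avg_def[abs_def] by measurable

lemma integrable_shift: "L1 h ==> L1 (\<lambda>r. h (t + r))" for h :: "real => complex"
 using lborel_integrable_real_affine[of h 1 t] by simp

lemma integral_shift: "(LBINT r. h (t + r)) = (LBINT r. h r)" for h :: "real => 'b::euclidean_space"
 using lborel_affine[of 1 h t] by simp

lemma cmod_avg_le:
 assumes h: "L1 h"
 shows "cmod (avg a b h t) <= L1norm h"
proof -
 have "cmod (avg a b h t) <= (LBINT r. cmod (indicator {a..<b} r * h (t + r)))"
  unfolding avg_def by (rule integral_norm_bound)
 also have "... <= (LBINT r. cmod (h (t + r)))"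
 proof (rule integral_mono)
  show "L1 (\<lambda>r. cmod (indicator {a..<b} r * h (t + r)))"
   using integrable_mult_bounded[OF integrable_shift[OF h], of "indicator {a..<b}" 1 t]
   by (intro integrable_norm) (simp add: mult.commute indicator_def)
 qed (use integrable_shift[OF h] in \<open>auto simp: indicator_def\<close>)
 also have "... = L1norm h" using integral_shift[of "\<lambda>r. cmod (h r)" t] by (simp add: L1norm_def)
 finally show ?thesis .
qed

text \<open>For \<open>u <= 0\<close> the map from \<open>r\<close> to the transform at
  \<open>u\<close> of \<open>h1 t * h2 (t + r)\<close> is a convolution, whose own transform at
  \<open>s\<close> is \<open>fourier h2 (- s)\<close> times \<open>fourier h1 (u + s)\<close>. For
  \<open>s >= 0\<close> the first factor vanishes, for \<open>s < 0\<close> the second. By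
  uniqueness its integral over every interval is zero.\<close>

lemma H1_mult_avg:
 assumes h1: "h1 \<in> H1" and h2: "h2 \<in> H1"
 shows "(\<lambda>t. h1 t * avg a b h2 t) \<in> H1"
proof -
 note i = H1_integrable[OF h1] H1_integrable[OF h2]
 note [measurable] = borel_measurable_integrable[OF i(1), simplified] borel_measurable_integrable[OF i(2), simplified]
 have int: "L1 (\<lambda>t. h1 t * avg a b h2 t)"
  by (rule integrable_mult_bounded[OF i(1) _ cmod_avg_le[OF i(2)]]) measurable
 have "fourier (\<lambda>t. h1 t * avg a b h2 t) u = 0" if u: "u <= 0" for u
 proof -
  define c where "c t = h1 (- t) * cis (u * t)" for t
  have c: "L1 c"
   unfolding c_def[abs_def] using lborel_integrable_real_affine[OF i(1), of "- 1" 0] integrable_mult_cis[of "\<lambda>t. h1 (- t)" u 0]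
   by simp
  have ic: "ift c s = fourier h1 (u + s)" for s
   using lborel_affine[of "- 1" "\<lambda>t. h1 t * cis (- (u + s) * t)" 0]
   by (simp add: ift_def fourier_eq_ift c_def mult.assoc cis_mult algebra_simps)
  have z: "ift (conv h2 c) s = 0" for s
  proof (cases "s \<ge> 0")
   case True
   then show ?thesis using h2 fourier_eq_ift[of h2 "- s"] by (simp add: ift_conv[OF c i(2)] H1_def)
  next
   case False
   then show ?thesis using h1 u by (simp add: ift_conv[OF c i(2)] H1_def ic)
  qed
  have "0 = (LBINT r. conv h2 c r * indicator {a..<b} r)"
   using integral_interval_eq_0[OF _ z] conv_Fubini(1)[OF c i(2), of "\<lambda>_. 0" 0] by simp
  also have "... = (LBINT t. c t * (LBINT s. h2 s * indicator {a..<b} (s + t)))"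
   by (rule conv_Fubini(2)[OF c i(2), where B = 1]) (auto simp: indicator_def)
  also have "... = (LBINT t. c t * avg a b h2 (- t))" by (simp add: avg_eq)
  also have "... = (LBINT t. h1 t * avg a b h2 t * cis (- u * t))"
   using lborel_affine[of "- 1" "\<lambda>t. h1 t * avg a b h2 t * cis (- u * t)" 0]
   by (simp add: c_def mult_ac)
  finally show ?thesis by (simp add: fourier_eq_ift ift_def)
 qed
 with int show ?thesis by (simp add: H1_def)
qed

section \<open>Splitting an integral over dyadic cells\<close>

lemma sums_integral_fibres:
 fixes w :: "'m => 'b::{banach, second_countable_topology}"
 assumes [measurable]: "idx \<in> measurable M (count_space (UNIV :: nat set))" and w: "integrable M w"
 shows "(\<lambda>n. LINT p|M. (if idx p = n then w p else 0)) sums (LINT p|M. w p)"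
proof -
 note [measurable] = borel_measurable_integrable[OF w]
 have i: "integrable M (\<lambda>p. if idx p = n then w p else 0)" for n by (rule bintble_bound[OF w]) auto
 have sm: "(\<lambda>n. if idx p = n then w p else 0) sums w p" for p
  using sums_single[of "idx p" "\<lambda>_. w p"] by (simp add: eq_commute)
 have smn: "summable (\<lambda>n. norm (if idx p = n then w p else 0))" for p
  using sums_single[of "idx p" "\<lambda>_. norm (w p)"] by (simp add: eq_commute if_distrib[of norm] sums_iff cong: if_cong)
 have "summable (\<lambda>n. LINT p|M. norm (if idx p = n then w p else 0))"
 proof (rule summableI_nonneg_bounded)
  fix N
  have "(\<Sum>n<N. LINT p|M. norm (if idx p = n then w p else 0)) = (LINT p|M. (\<Sum>n<N. norm (if idx p = n then w p else 0)))"
   by (intro bint_sum[symmetric] integrable_norm i)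
  also have "... <= (LINT p|M. norm (w p))" using w by (intro integral_mono integrable_norm bintble_sum i)
    (auto simp: if_distrib[of norm] cong: if_cong)
  finally show "(\<Sum>n<N. LINT p|M. norm (if idx p = n then w p else 0)) <= (LINT p|M. norm (w p))" .
 qed auto
 from sums_integral[OF i _ this] smn sm show ?thesis by (simp add: sums_iff)
qed

text \<open>The dyadic cell of length \<open>1 / 2 ^ M\<close> that contains \<open>r\<close>, coded
  as a natural number because representations are sequences.\<close>

definition cidx :: "nat => real => nat" where "cidx M r = int_encode \<lfloor>r * 2 ^ M\<rfloor>"

definition cpt :: "nat => nat => real" where "cpt M n = real_of_int (int_decode n) / 2 ^ M"

lemma cidx_measurable [measurable]: "cidx M \<in> measurable borel (count_space UNIV)"
 unfolding cidx_def[abs_def] by measurable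

lemma cidx_eq_iff: "cidx M r = n \<longleftrightarrow> r \<in> {cpt M n..<cpt M n + 1 / 2 ^ M}"
proof -
 have "cidx M r = n \<longleftrightarrow> \<lfloor>r * 2 ^ M\<rfloor> = int_decode n" by (auto simp: cidx_def)
 also have "... \<longleftrightarrow> r \<in> {cpt M n..<cpt M n + 1 / 2 ^ M}"
  by (auto simp: floor_eq_iff cpt_def pos_divide_le_eq pos_less_divide_eq simp flip: add_divide_distrib)
 finally show ?thesis .
qed

lemma cpt_cidx: "\<bar>cpt M (cidx M r) - r\<bar> < 1 / 2 ^ M" using cidx_eq_iff[of M r "cidx M r"] by auto

text \<open>The left end of the fine cell around \<open>r\<close> lies in the same coarse cell as
  \<open>r\<close>. So the difference of two step approximations of different levels is again a step
  function on the finer cells.\<close>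

lemma cidx_refine:
 assumes "m <= M"
 shows "cidx m (cpt M (cidx M r)) = cidx m r"
proof -
 define n where "n = \<lfloor>r * 2 ^ m\<rfloor>"
 define k where "k = \<lfloor>r * 2 ^ M\<rfloor>"
 have pw: "(2::real) ^ M = 2 ^ m * 2 ^ (M - m)" using assms by (simp flip: power_add)
 have "of_int n <= r * 2 ^ m" "r * 2 ^ m < of_int n + 1" by (auto simp: n_def floor_eq_iff)
 then have "of_int n * 2 ^ (M - m) <= r * 2 ^ m * 2 ^ (M - m)" "r * 2 ^ m * 2 ^ (M - m) < (of_int n + 1) * 2 ^ (M - m)"
  by (intro mult_right_mono mult_strict_right_mono; simp)+
 then have "real_of_int (n * 2 ^ (M - m)) <= r * 2 ^ M" "r * 2 ^ M < real_of_int ((n + 1) * 2 ^ (M - m))"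
  by (simp_all add: pw mult.assoc)
 then have "n * 2 ^ (M - m) <= k" "k < (n + 1) * 2 ^ (M - m)"
  unfolding k_def by (simp_all add: le_floor_iff floor_less_iff)
 then have "real_of_int (n * 2 ^ (M - m)) <= real_of_int k" "real_of_int k < real_of_int ((n + 1) * 2 ^ (M - m))"
  by (simp_all only: of_int_le_iff of_int_less_iff)
 then have "\<lfloor>real_of_int k / 2 ^ (M - m)\<rfloor> = n"
  by (auto simp: floor_eq_iff pos_le_divide_eq pos_divide_less_eq)
 moreover have "cpt M (cidx M r) * 2 ^ m = real_of_int k / 2 ^ (M - m)"
  by (simp add: cpt_def cidx_def k_def pw)
 ultimately show ?thesis by (simp add: cidx_def n_def)
qed

abbreviation (input) lb2 :: "(real \<times> real) measure" where "lb2 \<equiv> lborel \<Otimes>\<^sub>M lborel"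

abbreviation (input) shear :: "(real => complex) => (real => complex) => real \<times> real => complex" where
 "shear h1 h2 p \<equiv> h1 (fst p) * h2 (fst p + snd p)"

lemma shear_integral:
 assumes h1: "L1 h1" and h2: "L1 h2"
 shows "integrable lb2 (shear h1 h2)"
  and "(LINT p|lb2. cmod (shear h1 h2 p)) = L1norm h1 * L1norm h2"
proof -
 note [measurable] = borel_measurable_integrable[OF h1, simplified] borel_measurable_integrable[OF h2, simplified]
 have inner: "(LBINT r. cmod (h1 t * h2 (t + r))) = cmod (h1 t) * L1norm h2" for t
  using integral_shift[of "\<lambda>r. cmod (h2 r)" t] by (simp add: norm_mult L1norm_def)
 have int: "integrable lb2 (\<lambda>(t, r). h1 t * h2 (t + r))"
 proof (rule lborel_pair.Fubini_integrable)
  show "L1 (\<lambda>t. LBINT r. norm (case (t, r) of (t, r) => h1 t * h2 (t + r)))"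
   using h1 by (simp add: inner)
  show "AE t in lborel. L1 (\<lambda>r. case (t, r) of (t, r) => h1 t * h2 (t + r))"
   using integrable_shift[OF h2] by simp
 qed measurable
 then show i: "integrable lb2 (shear h1 h2)" by (simp add: case_prod_beta')
 have "(LINT p|lb2. cmod (shear h1 h2 p)) = (LBINT t. LBINT r. cmod (h1 t * h2 (t + r)))"
  using lborel_pair.integral_fst'[OF integrable_norm[OF i]] by simp
 also have "... = L1norm h1 * L1norm h2" by (simp add: inner L1norm_def)
 finally show "(LINT p|lb2. cmod (shear h1 h2 p)) = L1norm h1 * L1norm h2" .
qed

lemma integrable_mult_bounded':
 fixes f g :: "'m => complex"
 assumes f: "integrable M f" and g: "g \<in> borel_measurable M" and B: "\<And>t. cmod (g t) <= B"
 shows "integrable M (\<lambda>t. g t * f t)"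
proof (rule bintble_bound)
 show "integrable M (\<lambda>t. B * cmod (f t))" using f by auto
 show "(\<lambda>t. g t * f t) \<in> borel_measurable M" using f g by simp
 have "0 <= B" using B[of undefined] norm_ge_zero order_trans by blast
 then show "AE t in M. norm (g t * f t) <= norm (B * cmod (f t))"
  using B by (intro AE_I2) (simp add: norm_mult mult_right_mono)
qed

lemma step_measurable:
 assumes "\<And>n. k n \<in> BUCR"
 shows "(\<lambda>p. k (cidx M (snd p)) (s - fst p)) \<in> borel_measurable lb2"
proof (rule measurable_compose_countable)
 show "(\<lambda>p. k n (s - fst p)) \<in> borel_measurable lb2" for n
 proof -
  have [measurable]: "k n \<in> borel_measurable borel" by (rule BUCR_measurable[OF assms])
  show ?thesis by measurable
 qed
qed measurable

text \<open>Where \<open>k\<close> is constant in \<open>r\<close>, the integral over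
  \<open>r\<close> falls on \<open>h2\<close> alone and leaves the convolution of \<open>k n\<close>
  with the \<open>H1\<close> function \<open>e n\<close>. The \<open>L1\<close> norms of the
  \<open>e n\<close> add up to at most the total mass of the sheared product, which is the product
  of the two norms.\<close>

lemma Nle_step:
 assumes S: "rep_class S" and h1: "h1 \<in> H1" and h2: "h2 \<in> H1"
  and k: "\<And>n. k n \<in> S" "\<And>n. supnorm (k n) <= \<kappa>"
 shows "Nle S (\<lambda>s. LINT p|lb2. k (cidx M (snd p)) (s - fst p) * shear h1 h2 p) (\<kappa> * (L1norm h1 * L1norm h2))"
proof -
 note i = H1_integrable[OF h1] H1_integrable[OF h2]
 note [measurable] = borel_measurable_integrable[OF i(1), simplified] borel_measurable_integrable[OF i(2), simplified]
 note kB = rep_classD(1)[OF S k(1)]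
 have kap: "0 <= \<kappa>" using supnorm_nonneg[OF kB] k(2) order_trans by blast
 have bd: "cmod (k n x) <= \<kappa>" for n x using supnorm_upper[OF kB] k(2) order_trans by blast
 define b where "b n = cpt M n + 1 / 2 ^ M" for n
 have ind: "indicator {cpt M n..<b n} r = (if cidx M r = n then 1 else 0 :: complex)" for n r
  unfolding b_def cidx_eq_iff by (simp add: indicator_def)
 define e where "e n t = h1 t * avg (cpt M n) (b n) h2 t" for n t
 have e: "e n \<in> H1" for n unfolding e_def[abs_def] by (rule H1_mult_avg[OF h1 h2])
 let ?a = "\<lambda>n. LINT p|lb2. (if cidx M (snd p) = n then cmod (shear h1 h2 p) else 0)"
 have a: "?a sums (L1norm h1 * L1norm h2)"
  using sums_integral_fibres[of "\<lambda>p. cidx M (snd p)" lb2 "\<lambda>p. cmod (shear h1 h2 p)"] shear_integral[OF i] by simp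
 have ia: "integrable lb2 (\<lambda>p. if cidx M (snd p) = n then shear h1 h2 p else 0)" for n
  by (rule bintble_bound[OF shear_integral(1)[OF i]]) auto
 have L1e: "L1norm (e n) <= ?a n" for n
 proof -
  have in': "integrable lb2 (\<lambda>p. if cidx M (snd p) = n then cmod (shear h1 h2 p) else 0)"
   using integrable_norm[OF ia[of n]] by (simp add: if_distrib[of norm] cong: if_cong)
  have "L1norm (e n) = (LBINT t. cmod (LBINT r. (if cidx M r = n then h1 t * h2 (t + r) else 0)))"
   unfolding L1norm_def e_def avg_def ind integral_mult_right_zero[symmetric]
   by (intro bint_cong refl arg_cong[where f = cmod]) auto
  also have "... <= (LBINT t. LBINT r. (if cidx M r = n then cmod (h1 t * h2 (t + r)) else 0))"
  proof (rule integral_mono)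
   show "L1 (\<lambda>t. cmod (LBINT r. (if cidx M r = n then h1 t * h2 (t + r) else 0)))"
    using integrable_norm[OF lborel_pair.integrable_fst'[OF ia[of n]]] by (simp only: fst_conv snd_conv)
   show "L1 (\<lambda>t. LBINT r. (if cidx M r = n then cmod (h1 t * h2 (t + r)) else 0))"
    using lborel_pair.integrable_fst'[OF in'] by (simp only: fst_conv snd_conv)
   show "cmod (LBINT r. (if cidx M r = n then h1 t * h2 (t + r) else 0))
     <= (LBINT r. (if cidx M r = n then cmod (h1 t * h2 (t + r)) else 0))" for t
    using integral_norm_bound[of lborel "\<lambda>r. if cidx M r = n then h1 t * h2 (t + r) else 0"]
    by (simp add: if_distrib[of norm] cong: if_cong)
  qed
  also have "... = ?a n" using lborel_pair.integral_fst'[OF in'] by (simp only: fst_conv snd_conv)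
  finally show ?thesis .
 qed
 have cv: "conv (k n) (e n) s = (LINT p|lb2. (if cidx M (snd p) = n then k (cidx M (snd p)) (s - fst p) * shear h1 h2 p else 0))" for n s
 proof -
  have [measurable]: "k n \<in> borel_measurable borel" by (rule BUCR_measurable[OF kB])
  have "integrable lb2 (\<lambda>p. k n (s - fst p) * (if cidx M (snd p) = n then shear h1 h2 p else 0))"
   by (rule integrable_mult_bounded'[OF ia _ bd]) measurable
  then have *: "integrable lb2 (\<lambda>p. if cidx M (snd p) = n then k (cidx M (snd p)) (s - fst p) * shear h1 h2 p else 0)"
   by (rule bintble_cong[THEN iffD1, rotated 2]) auto
  have "conv (k n) (e n) s = (LBINT t. LBINT r. (if cidx M r = n then k (cidx M r) (s - t) * (h1 t * h2 (t + r)) else 0))"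
   unfolding conv_def e_def avg_def ind integral_mult_right_zero[symmetric] by (intro bint_cong refl) auto
  also have "... = (LINT p|lb2. (if cidx M (snd p) = n then k (cidx M (snd p)) (s - fst p) * shear h1 h2 p else 0))"
   using lborel_pair.integral_fst'[OF *] by (simp only: fst_conv snd_conv)
  finally show ?thesis .
 qed
 have "Nle S (\<lambda>s. LINT p|lb2. k (cidx M (snd p)) (s - fst p) * shear h1 h2 p) (\<Sum>n. \<kappa> * ?a n)"
 proof (rule Nle_series[OF S])
  show "Nle S (conv (k n) (e n)) (\<kappa> * ?a n)" for n
   by (rule Nle_mono[OF Nle_conv[OF S k(1) e] mult_mono[OF k(2) L1e kap L1norm_nonneg]])
  show "summable (\<lambda>n. \<kappa> * ?a n)" using a by (intro summable_mult) (simp add: sums_iff)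
  show "(LINT p|lb2. k (cidx M (snd p)) (s - fst p) * shear h1 h2 p) = (\<Sum>n. conv (k n) (e n) s)" for s
  proof -
   have "integrable lb2 (\<lambda>p. k (cidx M (snd p)) (s - fst p) * shear h1 h2 p)"
    by (rule integrable_mult_bounded'[OF shear_integral(1)[OF i] step_measurable[OF kB] bd])
   from sums_integral_fibres[OF _ this, of "\<lambda>p. cidx M (snd p)"] show ?thesis by (simp add: cv sums_iff)
  qed
 qed
 also have "(\<Sum>n. \<kappa> * ?a n) = \<kappa> * (L1norm h1 * L1norm h2)"
  using a by (subst suminf_mult) (auto simp: sums_iff)
 finally show ?thesis .
qed

lemma BUCR_diff:
 assumes "f \<in> BUCR" "g \<in> BUCR"
 shows "(\<lambda>x. f x - g x) \<in> BUCR"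
 using assms uniformly_continuous_on_diff[of UNIV f g] bounded_minus_comp[of f UNIV g] by (simp add: BUCR_def)

lemma BUCR_shift:
 assumes f: "f \<in> BUCR"
 shows "(\<lambda>x. f (x - r)) \<in> BUCR"
proof -
 have "uniformly_continuous_on UNIV (\<lambda>x. f (x - r))" unfolding uniformly_continuous_on_def
 proof (intro allI impI)
  fix e :: real assume "0 < e"
  then obtain d where "0 < d" "\<And>x y. dist y x < d ==> dist (f y) (f x) < e"
   using f unfolding BUCR_def uniformly_continuous_on_def by blast
  then show "\<exists>d>0. \<forall>x\<in>UNIV. \<forall>x'\<in>UNIV. dist x' x < d \<longrightarrow> dist (f (x' - r)) (f (x - r)) < e"
   by (intro exI[of _ d]) (auto simp: dist_norm)
 qed
 then show ?thesis using f by (auto simp: BUCR_def bounded_iff)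
qed

text \<open>The function \<open>k r\<close> is replaced by its value at the left end of the cell of
  level \<open>N j\<close>, giving \<open>A j\<close>. The product is \<open>A 0\<close> plus the
  corrections \<open>A (j + 1) - A j\<close>, all of them step integrals. The first costs the full
  product of norms; by uniform continuity of \<open>f2\<close> the corrections cost
  \<open>supnorm f1 * \<eta> j * L\<close>, a geometric series with sum at most
  \<open>\<epsilon>\<close>.\<close>

lemma Nle_conv_mult_conv:
 assumes S: "rep_class S" and f1: "f1 \<in> S" and f2: "f2 \<in> BUCR" and h1: "h1 \<in> H1" and h2: "h2 \<in> H1"
  and \<epsilon>: "0 < \<epsilon>"
 shows "Nle S (\<lambda>s. conv f1 h1 s * conv f2 h2 s) (supnorm f1 * L1norm h1 * (supnorm f2 * L1norm h2) + \<epsilon>)"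
proof -
 note i = H1_integrable[OF h1] H1_integrable[OF h2]
 note f1B = rep_classD(1)[OF S f1]
 note [measurable] = borel_measurable_integrable[OF i(1), simplified] borel_measurable_integrable[OF i(2), simplified]
  BUCR_measurable[OF f1B] BUCR_measurable[OF f2]
 define L where "L = L1norm h1 * L1norm h2"
 have L: "0 <= L" by (simp add: L_def L1norm_nonneg)
 have s1: "0 <= supnorm f1" "0 <= supnorm f2" by (simp_all add: supnorm_nonneg f1B f2)
 \<comment> \<open>The added one guards against a vanishing product of norms.\<close>
 define \<epsilon>' where "\<epsilon>' = \<epsilon> / (supnorm f1 * L + 1)"
 have D: "0 < supnorm f1 * L + 1" using s1 L by (simp add: add_nonneg_pos)
 have e': "0 < \<epsilon>'" "supnorm f1 * L * \<epsilon>' <= \<epsilon>"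
  using \<epsilon> D by (auto simp: \<epsilon>'_def pos_divide_le_eq algebra_simps)
 define \<eta> where "\<eta> j = \<epsilon>' * (1 / 2) ^ Suc j" for j
 have \<eta>: "0 < \<eta> j" for j using e' by (simp add: \<eta>_def)
 have "\<exists>M. \<forall>x y. \<bar>x - y\<bar> < 1 / 2 ^ M \<longrightarrow> cmod (f2 x - f2 y) <= \<eta> j" for j
 proof -
  obtain d where d: "0 < d" "\<And>x y. dist y x < d ==> dist (f2 y) (f2 x) < \<eta> j"
   using f2 \<eta>[of j] unfolding BUCR_def uniformly_continuous_on_def by blast
  obtain M where "(1 / 2) ^ M < d" using real_arch_pow_inv[OF d(1), of "1 / 2"] by auto
  then show ?thesis
   using d(2) by (intro exI[of _ M]) (force simp: dist_norm power_one_over inverse_eq_divide intro: less_imp_le)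
 qed
 then obtain M where M: "\<And>j x y. \<bar>x - y\<bar> < 1 / 2 ^ M j ==> cmod (f2 x - f2 y) <= \<eta> j" by metis
 \<comment> \<open>Partial sums of the levels are monotone, so consecutive partitions refine each
   other, and each level is at least as fine as \<open>M j\<close>.\<close>
 define N where "N j = (\<Sum>i\<le>j. M i)" for j
 have N: "N j <= N (Suc j)" "M j <= N j" for j by (simp_all add: N_def member_le_sum)
 have N': "cmod (f2 x - f2 y) <= \<eta> j" if "\<bar>x - y\<bar> < 1 / 2 ^ N j" for j x y
 proof (rule M)
  have "(1::real) / 2 ^ N j <= 1 / 2 ^ M j" using N(2)[of j] by (intro divide_left_mono power_increasing) auto
  with that show "\<bar>x - y\<bar> < 1 / 2 ^ M j" by linarith
 qed
 define k where "k r x = f1 x * f2 (x - r)" for r x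
 have kS: "k r \<in> S" for r unfolding k_def[abs_def] by (intro rep_classD(3)[OF S f1] BUCR_shift f2)
 have kB: "k r \<in> BUCR" for r by (rule rep_classD(1)[OF S kS])
 have kbd: "cmod (k r x) <= supnorm f1 * supnorm f2" for r x
  unfolding k_def norm_mult by (intro mult_mono supnorm_upper f1B f2 s1 norm_ge_zero)
 have kdiff: "cmod (k r x - k r' x) <= supnorm f1 * \<eta> j" if "\<bar>r - r'\<bar> < 1 / 2 ^ N j" for r r' x j
 proof -
  have "k r x - k r' x = f1 x * (f2 (x - r) - f2 (x - r'))" by (simp add: k_def right_diff_distrib)
  then show ?thesis unfolding norm_mult using N'[of "x - r" "x - r'" j] that supnorm_upper[OF f1B, of x]
   by (simp add: norm_mult mult_mono s1 abs_minus_commute)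
 qed
 define A where "A j s = (LINT p|lb2. k (cpt (N j) (cidx (N j) (snd p))) (s - fst p) * shear h1 h2 p)" for j s
 have Aint: "integrable lb2 (\<lambda>p. k (cpt (N j) (cidx (N j) (snd p))) (s - fst p) * shear h1 h2 p)" for j s
  by (rule integrable_mult_bounded'[OF shear_integral(1)[OF i] step_measurable[of "\<lambda>n. k (cpt (N j) n)", OF kB] kbd])
 define K where "K s p = f1 (s - fst p) * f2 (s - fst p - snd p)" for s and p :: "real \<times> real"
 have Kk: "K s p = k (snd p) (s - fst p)" for s p by (simp add: K_def k_def)
 have Kint: "integrable lb2 (\<lambda>p. K s p * shear h1 h2 p)" for s
  by (rule integrable_mult_bounded'[OF shear_integral(1)[OF i], where B = "supnorm f1 * supnorm f2"])
   (unfold K_def, measurable, use kbd Kk K_def in metis)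
 have prod: "conv f1 h1 s * conv f2 h2 s = (LINT p|lb2. K s p * shear h1 h2 p)" for s
 proof -
  have "(LINT p|lb2. K s p * shear h1 h2 p) = (LBINT t. LBINT r. K s (t, r) * (h1 t * h2 (t + r)))"
   using lborel_pair.integral_fst'[OF Kint] by simp
  also have "... = (LBINT t. f1 (s - t) * h1 t * conv f2 h2 s)"
  proof (intro bint_cong refl)
   fix t
   have "(LBINT r. K s (t, r) * (h1 t * h2 (t + r))) = (LBINT r. f1 (s - t) * h1 t * (f2 (s - (t + r)) * h2 (t + r)))"
    by (intro bint_cong refl) (simp add: K_def mult_ac diff_diff_eq)
   also have "... = f1 (s - t) * h1 t * conv f2 h2 s"
    unfolding integral_mult_right_zero conv_def using integral_shift[of "\<lambda>r. f2 (s - r) * h2 r" t] by simp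
   finally show "(LBINT r. K s (t, r) * (h1 t * h2 (t + r))) = f1 (s - t) * h1 t * conv f2 h2 s" .
  qed
  also have "... = conv f1 h1 s * conv f2 h2 s" unfolding integral_mult_left_zero by (simp add: conv_def)
  finally show ?thesis ..
 qed
 have diff_le: "cmod (A j s - conv f1 h1 s * conv f2 h2 s) <= supnorm f1 * \<eta> j * L" for j s
 proof -
  have "A j s - conv f1 h1 s * conv f2 h2 s
    = (LINT p|lb2. (k (cpt (N j) (cidx (N j) (snd p))) (s - fst p) - k (snd p) (s - fst p)) * shear h1 h2 p)"
   unfolding prod A_def by (subst bint_diff[OF Aint Kint, symmetric]) (simp add: Kk left_diff_distrib)
  also have "cmod ... <= (LINT p|lb2. supnorm f1 * \<eta> j * cmod (shear h1 h2 p))"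
  proof (rule order_trans[OF integral_norm_bound integral_mono], rule integrable_norm)
   show "integrable lb2 (\<lambda>p. (k (cpt (N j) (cidx (N j) (snd p))) (s - fst p) - k (snd p) (s - fst p)) * shear h1 h2 p)"
    using bintble_diff[OF Aint[of j s] Kint[of s]] by (simp add: Kk left_diff_distrib)
   show "cmod ((k (cpt (N j) (cidx (N j) (snd p))) (s - fst p) - k (snd p) (s - fst p)) * shear h1 h2 p)
     <= supnorm f1 * \<eta> j * cmod (shear h1 h2 p)" for p
    using kdiff[OF cpt_cidx] by (subst norm_mult) (intro mult_right_mono norm_ge_zero)
  qed (use shear_integral[OF i] in auto)
  also have "... = supnorm f1 * \<eta> j * L" using shear_integral[OF i] by (simp add: L_def)
  finally show ?thesis .
 qed
 have \<eta>lim: "\<eta> ----> 0"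
  unfolding \<eta>_def[abs_def] by (intro tendsto_mult_right_zero LIMSEQ_Suc LIMSEQ_realpow_zero) auto
 have Alim: "(\<lambda>j. A j s) ----> conv f1 h1 s * conv f2 h2 s" for s
 proof (rule LIM_zero_cancel, rule Lim_null_comparison)
  show "\<forall>\<^sub>F j in sequentially. norm (A j s - conv f1 h1 s * conv f2 h2 s) <= supnorm f1 * \<eta> j * L"
   using diff_le by simp
  show "(\<lambda>j. supnorm f1 * \<eta> j * L) ----> 0"
   by (intro tendsto_mult_left_zero tendsto_mult_right_zero \<eta>lim)
 qed
 define F where "F j s = (case j of 0 => A 0 s | Suc i => A (Suc i) s - A i s)" for j s
 define c where "c j = (case j of 0 => supnorm f1 * supnorm f2 * L | Suc i => supnorm f1 * \<eta> i * L)" for j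
 have "Nle S (\<lambda>s. conv f1 h1 s * conv f2 h2 s) (suminf c)"
 proof (rule Nle_series[OF S, where F = F])
  show "Nle S (F j) (c j)" for j
  proof (cases j)
   case 0
   have "supnorm (k (cpt (N 0) n)) <= supnorm f1 * supnorm f2" for n by (rule supnorm_least[OF kbd])
   from Nle_step[OF S h1 h2, where M = "N 0" and k = "\<lambda>n. k (cpt (N 0) n)", OF kS this] show ?thesis
    using 0 by (simp add: F_def[abs_def] c_def A_def[abs_def] L_def)
  next
   case (Suc i')
   let ?k = "\<lambda>n x. f1 x * (f2 (x - cpt (N j) n) - f2 (x - cpt (N i') (cidx (N i') (cpt (N j) n))))"
   have kk: "?k n x = k (cpt (N j) n) x - k (cpt (N i') (cidx (N i') (cpt (N j) n))) x" for n x
    by (simp add: k_def right_diff_distrib)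
   have "?k n \<in> S" for n by (intro rep_classD(3)[OF S f1] BUCR_diff BUCR_shift f2)
   moreover have "supnorm (?k n) <= supnorm f1 * \<eta> i'" for n
   proof (rule supnorm_least)
    show "cmod (?k n x) <= supnorm f1 * \<eta> i'" for x
     unfolding kk using cpt_cidx by (intro kdiff) (subst abs_minus_commute)
   qed
   ultimately have "Nle S (\<lambda>s. LINT p|lb2. ?k (cidx (N j) (snd p)) (s - fst p) * shear h1 h2 p) (supnorm f1 * \<eta> i' * L)"
    unfolding L_def by (rule Nle_step[OF S h1 h2])
   also have "(\<lambda>s. LINT p|lb2. ?k (cidx (N j) (snd p)) (s - fst p) * shear h1 h2 p) = F j"
   proof
    fix s
    have "F j s = A j s - A i' s" by (simp add: F_def Suc)
    also have "... = (LINT p|lb2. ?k (cidx (N j) (snd p)) (s - fst p) * shear h1 h2 p)" unfolding A_def kk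
     by (subst bint_diff[OF Aint Aint, symmetric]) (simp add: left_diff_distrib Suc cidx_refine[OF N(1)])
    finally show "(LINT p|lb2. ?k (cidx (N j) (snd p)) (s - fst p) * shear h1 h2 p) = F j s" ..
   qed
   finally show ?thesis by (simp add: c_def Suc)
  qed
  have half: "(\<lambda>j. supnorm f1 * \<eta> j * L) sums (supnorm f1 * (\<epsilon>' * 1) * L)"
   unfolding \<eta>_def by (intro sums_mult sums_mult2 power_half_series)
  show "summable c" using half by (subst summable_Suc_iff[symmetric]) (simp add: c_def sums_iff)
  show "conv f1 h1 s * conv f2 h2 s = (\<Sum>j. F j s)" for s
  proof -
   have "(\<lambda>j. F (Suc j) s) sums (conv f1 h1 s * conv f2 h2 s - A 0 s)"
    using telescope_sums[OF Alim] by (simp add: F_def)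
   from sums_Suc[OF this] show ?thesis by (simp add: F_def sums_iff)
  qed
 qed
 moreover have "suminf c <= supnorm f1 * L1norm h1 * (supnorm f2 * L1norm h2) + \<epsilon>"
 proof -
  have "(\<lambda>j. c (Suc j)) sums (supnorm f1 * (\<epsilon>' * 1) * L)"
   unfolding c_def \<eta>_def by (simp only: nat.case) (intro sums_mult sums_mult2 power_half_series)
  from sums_Suc[OF this] have "suminf c = supnorm f1 * (\<epsilon>' * 1) * L + supnorm f1 * supnorm f2 * L"
   unfolding sums_iff by (simp add: c_def)
  then show ?thesis using e'(2) by (simp add: L_def mult_ac)
 qed
 ultimately show ?thesis by (rule Nle_mono)
qed

text \<open>Lifts an estimate from elementary convolutions to series. It is stated with two classes
  because it is applied twice, once to each factor of a product.\<close>

lemma Nle_mult_series: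
 assumes S: "rep_class S" and R: "rep_class R" and F: "Nle R F c" and d: "0 <= d" and \<epsilon>: "0 < \<epsilon>"
  and step: "\<And>f h \<delta>. f \<in> R ==> h \<in> H1 ==> 0 < \<delta> ==> Nle S (\<lambda>s. conv f h s * G s) (supnorm f * L1norm h * d + \<delta>)"
 shows "Nle S (\<lambda>s. F s * G s) (c * d + \<epsilon>)"
proof -
 obtain f h where rep: "is_rep R F f h" and c: "(\<Sum>k. supnorm (f k) * L1norm (h k)) <= c"
  using F by (auto simp: Nle_def)
 let ?a = "\<lambda>k. supnorm (f k) * L1norm (h k)"
 have sa: "summable ?a" using rep by (simp add: is_rep_def)
 have half: "(\<lambda>k. \<epsilon> * (1 / 2) ^ Suc k) sums (\<epsilon> * 1)" by (intro sums_mult power_half_series)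
 have sums: "(\<lambda>k. ?a k * d + \<epsilon> * (1 / 2) ^ Suc k) sums (suminf ?a * d + \<epsilon> * 1)"
  by (intro sums_add half sums_mult2 summable_sums sa)
 have "Nle S (\<lambda>s. F s * G s) (\<Sum>k. ?a k * d + \<epsilon> * (1 / 2) ^ Suc k)"
 proof (rule Nle_series[OF S])
  show "Nle S (\<lambda>s. conv (f k) (h k) s * G s) (?a k * d + \<epsilon> * (1 / 2) ^ Suc k)" for k
   using rep \<epsilon> by (intro step) (auto simp: is_rep_def)
  show "summable (\<lambda>k. ?a k * d + \<epsilon> * (1 / 2) ^ Suc k)" using sums by (simp add: sums_iff)
  show "F s * G s = (\<Sum>k. conv (f k) (h k) s * G s)" for s
  proof -
   have "F s = (\<Sum>k. conv (f k) (h k) s)" using rep by (simp add: is_rep_def)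
   then show ?thesis
    using suminf_mult2[OF summable_norm_cancel[OF rep_norm_summable[OF R rep]], of s "G s"] by simp
  qed
 qed
 also have "(\<Sum>k. ?a k * d + \<epsilon> * (1 / 2) ^ Suc k) = suminf ?a * d + \<epsilon>" using sums by (simp add: sums_iff)
 finally show ?thesis using c d by (elim Nle_mono) (simp add: mult_right_mono)
qed

lemma Nle_mult:
 assumes S: "rep_class S" and F: "Nle S F c" and G: "Nle BUCR G d" and \<epsilon>: "0 < \<epsilon>"
 shows "Nle S (\<lambda>s. F s * G s) (c * d + \<epsilon>)"
proof (rule Nle_mult_series[OF S S F Nle_nonneg[OF rep_class_BUCR G] \<epsilon>])
 fix f h and \<delta> :: real assume f: "f \<in> S" and h: "h \<in> H1" and \<delta>: "0 < \<delta>"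
 have a: "0 <= supnorm f * L1norm h" by (simp add: supnorm_nonneg rep_classD(1)[OF S f] L1norm_nonneg)
 have "Nle S (\<lambda>s. G s * conv f h s) (d * (supnorm f * L1norm h) + \<delta>)"
 proof (rule Nle_mult_series[OF S rep_class_BUCR G a \<delta>])
  fix g e and \<delta>' :: real assume "g \<in> BUCR" "e \<in> H1" "0 < \<delta>'"
  from Nle_conv_mult_conv[OF S f this(1) h this(2,3)]
  show "Nle S (\<lambda>s. conv g e s * conv f h s) (supnorm g * L1norm e * (supnorm f * L1norm h) + \<delta>')"
   by (simp add: mult.commute)
 qed
 then show "Nle S (\<lambda>s. conv f h s * G s) (supnorm f * L1norm h * d + \<delta>)" by (simp add: mult.commute)
qed

section \<open>The Poisson extension\<close>

lemma poisson_eq_abel: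
 assumes w: "0 < Im w"
 shows "poisson F w = abel (Im w) F (Re w)"
proof -
 have k: "Im w / ((Re w - (Re w + - Im w * x))^2 + (Im w)^2) / pi = pk x / Im w" for x
 proof -
  have "(Re w - (Re w + - Im w * x))^2 + (Im w)^2 = (Im w)^2 * (1 + x^2)"
   by (simp add: power2_eq_square algebra_simps)
  moreover have "1 + x^2 \<noteq> 0" by (metis add_pos_nonneg less_numeral_extra(1) order_less_irrefl zero_le_power2)
  ultimately show ?thesis using w by (simp add: pk_def power2_eq_square divide_simps)
 qed
 have "poisson F w = Im w *\<^sub>R (LBINT x. of_real (pk x / Im w) * F (Re w - Im w * x))"
 proof -
  have "poisson F w = \<bar>- Im w\<bar> *\<^sub>R (LBINT x. cr (Im w / ((Re w - (Re w + - Im w * x))^2 + (Im w)^2) / pi) * F (Re w + - Im w * x))"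
   unfolding poisson_def
   by (rule lborel_affine[of "- Im w" "\<lambda>t. cr (Im w / ((Re w - t)^2 + (Im w)^2) / pi) * F t" "Re w"]) (use w in simp)
  then show ?thesis unfolding k using w by simp
 qed
 also have "(LBINT x. of_real (pk x / Im w) * F (Re w - Im w * x))
   = (LBINT x. of_real (1 / Im w) * (F (Re w - Im w * x) * of_real (pk x)))" by (intro bint_cong refl) simp
 also have "Im w *\<^sub>R ... = abel (Im w) F (Re w)"
  unfolding integral_mult_right_zero using w by (simp add: abel_def scaleR_conv_of_real)
 finally show ?thesis .
qed

lemma tilde_eq: "0 < Re z ==> tilde F z = abel (Re z) F (- Im z)" by (simp add: tilde_def poisson_eq_abel)

lemma tilde_eq_0: "\<not> 0 < Re z ==> tilde F z = 0" by (simp add: tilde_def)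

lemma ift_pk: "ift (\<lambda>x. of_real (pk x)) s = of_real (exp (- \<bar>s\<bar>))"
proof -
 let ?f = "\<lambda>v. cr (exp (- \<bar>v\<bar>))"
 have pk: "fourier ?f x = of_real (2 * pi) * of_real (pk x)" for x using integral_exp_abs_cis[of 1 "- x"]
  by (simp add: fourier_eq_ift ift_def pk_def inverse_eq_divide)
 have int: "L1 ?f" using integrable_exp_abs[of 1] by (intro integrable_of_real) simp
 have "of_real (2 * pi) * ift (\<lambda>x. of_real (pk x)) s = ift (fourier ?f) s"
  unfolding pk ift_def integral_mult_right_zero[symmetric] by (simp add: mult.assoc)
 also have "... = of_real (2 * pi) * ?f s"
 proof (rule fourier_inversion[OF int, where B = 1])
  show "L1 (fourier ?f)" unfolding pk using integrable_pk by (intro integrable_mult_right integrable_of_real)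
 qed (auto intro!: continuous_intros)
 finally show ?thesis by simp
qed

text \<open>Translates the Laplace transform of \<open>b\<close> by \<open>e\<close> into the
  half-plane; being a character of the additive group, the factor passes through
  convolutions.\<close>

definition damp :: "real => (real => complex) => real => complex" where
 "damp e b u = of_real (exp (- e * u)) * b u"

lemma damp_PL1:
 assumes b: "b \<in> PL1" and e: "0 <= e"
 shows "damp e b \<in> PL1" "cmod (damp e b u) <= cmod (b u)"
proof -
 show le: "cmod (damp e b u) <= cmod (b u)" for u
  using b e by (cases "u < 0") (auto simp: PL1_def damp_def norm_mult mult_left_le_one_le)
 have "L1 (damp e b)"
 proof (rule bintble_bound)
  show "L1 b" using b by (simp add: PL1_def)
  then have [measurable]: "b \<in> borel_measurable borel" by auto
  show "damp e b \<in> borel_measurable lborel" unfolding damp_def[abs_def] by measurable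
 qed (use le in auto)
 then show "damp e b \<in> PL1" using b by (simp add: PL1_def damp_def)
qed

lemma damp_conv: "conv (damp e b) (damp e a) = damp e (conv b a)"
proof
 fix r
 have *: "damp e b (r - t) * damp e a t = of_real (exp (- e * r)) * (b (r - t) * a t)" for t
 proof -
  have "exp (- e * r) = exp (- e * (r - t)) * exp (- e * t)" unfolding exp_add[symmetric] by (simp add: algebra_simps)
  then show ?thesis by (simp add: damp_def)
 qed
 show "conv (damp e b) (damp e a) r = damp e (conv b a) r"
  unfolding conv_def * integral_mult_right_zero by (simp add: damp_def conv_def)
qed

text \<open>The Poisson kernel acts on transforms as multiplication by
  \<open>exp (- e * \<bar>u\<bar>)\<close>. On the half line this is the multiplicative function
  \<open>exp (- e * u)\<close>, which is why the Poisson extension of such transforms respects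
  products.\<close>

lemma abel_ift:
 assumes b: "b \<in> PL1" and e: "0 < e"
 shows "abel e (ift b) s = ift (damp e b) s"
proof -
 have bi: "L1 b" using b by (simp add: PL1_def)
 have pki: "L1 (\<lambda>x. cr (pk x))" using integrable_pk by (rule integrable_of_real)
 have "integrable (lborel \<Otimes>\<^sub>M lborel) (\<lambda>(u, x). b u * of_real (pk x) * (\<lambda>(u, x). cis ((s - e * x) * u)) (u, x))"
  by (rule integrable_pair_mult[OF bi pki, where B = 1]) (auto simp: case_prod_beta')
 then have int: "integrable (lborel \<Otimes>\<^sub>M lborel) (\<lambda>(u, x). b u * of_real (pk x) * cis ((s - e * x) * u))" by simp
 have "abel e (ift b) s = (LBINT x. LBINT u. b u * of_real (pk x) * cis ((s - e * x) * u))"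
  unfolding abel_def ift_def integral_mult_left_zero[symmetric] by (intro bint_cong refl) (simp add: mult_ac)
 also have "... = (LBINT u. LBINT x. b u * of_real (pk x) * cis ((s - e * x) * u))"
  by (rule lborel_pair.Fubini_integral[OF int])
 also have "... = ift (damp e b) s" unfolding ift_def[of _ s]
 proof (intro bint_cong refl)
  fix u
  have "(LBINT x. b u * of_real (pk x) * cis ((s - e * x) * u))
    = (LBINT x. b u * cis (s * u) * (of_real (pk x) * cis (- (e * u) * x)))"
   by (intro bint_cong refl) (simp add: mult_ac cis_mult algebra_simps)
  also have "... = b u * cis (s * u) * of_real (exp (- \<bar>e * u\<bar>))"
   unfolding integral_mult_right_zero using ift_pk[of "- (e * u)"] by (simp add: ift_def)
  also have "... = damp e b u * cis (s * u)"
   using b e by (cases "u < 0") (auto simp: PL1_def damp_def abs_mult)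
  finally show "(LBINT x. b u * of_real (pk x) * cis ((s - e * x) * u)) = damp e b u * cis (s * u)" .
 qed
 finally show ?thesis .
qed

lemma laplace_eq_tilde:
 assumes b: "set_integrable lborel {0..} b"
 shows "(\<lambda>t. indicator {0..} t * b t) \<in> PL1" "laplace b = tilde (ift (\<lambda>t. indicator {0..} t * b t))"
proof -
 let ?b = "\<lambda>t. indicator {0..} t * b t"
 have eq: "?b = (\<lambda>t. indicator {0..} t *\<^sub>R b t)" by (auto simp: indicator_def)
 then show PL1: "?b \<in> PL1" using b by (auto simp: PL1_def set_integrable_def)
 show "laplace b = tilde (ift ?b)"
 proof
  fix z
  show "laplace b z = tilde (ift ?b) z"
  proof (cases "0 < Re z")
   case True
   have "laplace b z = (LBINT t. damp (Re z) ?b t * cis (- Im z * t))"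
    unfolding laplace_def set_lebesgue_integral_def using True by (simp, intro bint_cong refl)
     (auto simp: indicator_def damp_def exp_eq_polar mult_ac)
   then show ?thesis using True by (simp add: tilde_eq abel_ift[OF PL1] ift_def)
  qed (simp add: tilde_eq_0 laplace_def)
 qed
qed

definition bdd_cont :: "(real => complex) => bool" where
 "bdd_cont F \<longleftrightarrow> continuous_on UNIV F \<and> bounded (range F)"

lemma bdd_contE:
 assumes "bdd_cont F"
 obtains B where "F \<in> borel_measurable borel" "\<And>x. cmod (F x) <= B"
 using assms unfolding bdd_cont_def bounded_iff by (metis measurable_contI rangeI)

lemma Nle_bdd_cont: "rep_class S ==> Nle S F c ==> bdd_cont F"
 using Nle_bound Nle_continuous unfolding bdd_cont_def bounded_iff by blast

lemma ift_bdd_cont: "L1 b ==> bdd_cont (ift b)"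
 using continuous_on_ift cmod_ift_le unfolding bdd_cont_def bounded_iff by blast

lemma abel_integrable:
 assumes "bdd_cont F"
 shows "L1 (\<lambda>x. F (s - e * x) * of_real (pk x))"
proof -
 obtain B where [measurable]: "F \<in> borel_measurable borel" and B: "\<And>x. cmod (F x) <= B"
  by (rule bdd_contE[OF assms], rule that; blast)
 show ?thesis by (rule integrable_mult_pk[OF _ B]) measurable
qed

lemma tilde_add:
 assumes "bdd_cont F" "bdd_cont G"
 shows "tilde (\<lambda>s. F s + G s) = (\<lambda>z. tilde F z + tilde G z)"
proof
 show "tilde (\<lambda>s. F s + G s) z = tilde F z + tilde G z" for z
  by (cases "0 < Re z") (simp_all add: tilde_eq tilde_eq_0 abel_def distrib_right abel_integrable assms)
qed

lemma tilde_scale: "tilde (\<lambda>s. c * F s) = (\<lambda>z. c * tilde F z)"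
proof
 show "tilde (\<lambda>s. c * F s) z = c * tilde F z" for z
  by (cases "0 < Re z") (simp_all add: tilde_eq tilde_eq_0 abel_def mult.assoc)
qed

text \<open>A bounded continuous boundary function is recovered as the limit of the Abel means along
  a sequence of heights tending to zero.\<close>

lemma tilde_inj:
 assumes F: "bdd_cont F" and G: "bdd_cont G" and eq: "tilde F = tilde G"
 shows "F = G"
proof
 fix s
 have lim: "(\<lambda>n. abel (inverse (real (Suc n))) F s) ----> F s" if "bdd_cont F" for F
 proof -
  show ?thesis by (rule bdd_contE[OF that], rule abel_tendsto)
    (use that in \<open>auto simp: bdd_cont_def continuous_on_eq_continuous_at\<close>)
 qed
 have "abel (inverse (real (Suc n))) F s = abel (inverse (real (Suc n))) G s" for n
  using fun_cong[OF eq, of "Complex (inverse (real (Suc n))) (- s)"] by (simp add: tilde_eq)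
 then show "F s = G s" using LIMSEQ_unique[OF lim[OF F]] lim[OF G] by simp
qed

subsection \<open>An approximate identity\<close>

text \<open>A Poisson kernel of width \<open>e\<close> around \<open>t\<close>, multiplied by the
  tent over \<open>{0..2 * t}\<close>, which is \<open>fourier (hker t)\<close>. Hence its transform
  is a convolution of a \<open>C0R\<close> function bounded by one with \<open>hker t\<close> of
  norm one, and lies in the unit ball.\<close>

definition aker :: "real => real => real => complex" where
 "aker t e u = of_real (pk ((u - t) / e) / e * tent (u / t - 1))"

lemma aker_shift: "0 < t ==> 0 < e ==> aker t e (t + e * v) = of_real (pk v / e * tent (e * v / t))"
 by (simp add: aker_def add_divide_distrib)

lemma pk_scaled_integrable: "0 < e ==> L1 (\<lambda>u. cr (pk ((u - t) / e) / e))"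
 using lborel_integrable_real_affine[of "\<lambda>x. cr (pk x / e)" "1 / e" "- t / e"] integrable_pk
 by (simp add: diff_divide_distrib)

lemma ift_pk_scaled:
 assumes e: "0 < e"
 shows "ift (\<lambda>u. cr (pk ((u - t) / e) / e)) s = of_real (exp (- e * \<bar>s\<bar>)) * cis (t * s)"
proof -
 let ?\<phi> = "\<lambda>u. cr (pk ((u - t) / e) / e)"
  have "ift ?\<phi> s = (LBINT v. e *\<^sub>R (of_real (pk v / e) * cis (s * (t + e * v))))"
   unfolding ift_def using lborel_affine[of e "\<lambda>u. ?\<phi> u * cis (s * u)" t] e by simp
  also have "... = (LBINT v. cis (t * s) * (of_real (pk v) * cis ((s * e) * v)))" by (intro bint_cong refl)
    (use e in \<open>simp add: scaleR_conv_of_real mult_ac cis_mult algebra_simps\<close>)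
  also have "... = cis (t * s) * of_real (exp (- \<bar>s * e\<bar>))"
   unfolding integral_mult_right_zero using ift_pk[of "s * e"] by (simp add: ift_def)
  finally show ?thesis using e by (simp add: abs_mult mult_ac)
qed

lemma aker_integral:
 assumes "0 < t" "0 < e"
 shows "(LBINT u. aker t e u * \<psi> u) = (LBINT v. of_real (pk v * tent (e * v / t)) * \<psi> (t + e * v))"
proof -
 have "(LBINT u. aker t e u * \<psi> u) = e *\<^sub>R (LBINT v. aker t e (t + e * v) * \<psi> (t + e * v))"
  using lborel_affine[of e "\<lambda>u. aker t e u * \<psi> u" t] assms by simp
 also have "... = (LBINT v. of_real (pk v * tent (e * v / t)) * \<psi> (t + e * v))"
  unfolding integral_scaleR_right[symmetric] aker_shift[OF assms]
  by (intro bint_cong refl) (use assms in \<open>simp add: scaleR_conv_of_real\<close>)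
 finally show ?thesis .
qed

lemma aker_PL1:
 assumes t: "0 < t" and e: "0 < e"
 shows "aker t e \<in> PL1"
proof -
 have int: "L1 (aker t e)"
 proof -
  have "L1 (\<lambda>u. cr (pk ((u - t) / e) / e) * cr (tent (u / t - 1)))"
   by (rule integrable_mult_bounded[OF pk_scaled_integrable[OF e], where B = 1]) (use tent_le in auto)
  then show ?thesis by (simp add: aker_def[abs_def])
 qed
 then show "aker t e \<in> PL1" using t by (auto simp: PL1_def aker_def tent_def divide_less_0_iff)
qed

lemma ift_aker:
 assumes t: "0 < t" and e: "0 < e"
 shows "ift (aker t e) = conv (ift (\<lambda>u. cr (pk ((u - t) / e) / e))) (hker t)"
proof
 let ?\<phi> = "\<lambda>u. cr (pk ((u - t) / e) / e)"
 fix s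
 have "ift (aker t e) s = ift (\<lambda>u. ?\<phi> u * fourier (hker t) u) s"
  by (simp add: fourier_hker[OF t] aker_def[abs_def])
 then show "ift (aker t e) s = conv (ift ?\<phi>) (hker t) s"
  using ift_mult_fourier[OF pk_scaled_integrable[OF e] fourier_hker(1)[OF t]] by simp
qed

lemma Nle_aker:
 assumes t: "0 < t" and e: "0 < e"
 shows "Nle C0R (ift (aker t e)) 1"
proof -
 let ?\<phi> = "\<lambda>u. cr (pk ((u - t) / e) / e)"
 note f = ift_pk_scaled[OF e, of t]
 have "((\<lambda>s. exp (- e * \<bar>s\<bar>)) \<longlongrightarrow> 0) at_infinity"
 proof -
  have "filterlim (\<lambda>s::real. \<bar>s\<bar>) at_top at_infinity" using filterlim_norm_at_top[where 'a = real] unfolding real_norm_def .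
  then have "filterlim (\<lambda>s::real. - e * \<bar>s\<bar>) at_bot at_infinity"
   using e by (simp add: filterlim_uminus_at_bot filterlim_tendsto_pos_mult_at_top[OF tendsto_const])
  then show ?thesis by (rule filterlim_compose[OF exp_at_bot])
 qed
 then have "(ift ?\<phi> \<longlongrightarrow> 0) at_infinity"
  by (intro Lim_null_comparison[of "ift ?\<phi>" "\<lambda>s. exp (- e * \<bar>s\<bar>)"])
   (simp_all only: f norm_mult norm_of_real norm_cis, simp_all)
 then have "ift ?\<phi> \<in> C0R"
  using continuous_on_ift[OF pk_scaled_integrable[OF e]] by (simp add: C0R_def)
 from Nle_conv[OF rep_class_C0R this hker_H1[OF t]]
 have "Nle C0R (ift (aker t e)) (supnorm (ift ?\<phi>))" by (simp add: fourier_hker[OF t] ift_aker[OF t e])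
 moreover have "supnorm (ift ?\<phi>) <= 1" by (rule supnorm_least, unfold f) (use e in \<open>simp add: norm_mult\<close>)
 ultimately show ?thesis by (rule Nle_mono)
qed

text \<open>The transform is a convolution of two integrable functions. Writing \<open>aker\<close>
  back as an integral over frequencies is what later turns a uniform bound on \<open>ift d\<close>
  into a pointwise bound on a convolution with \<open>d\<close>.\<close>

lemma aker_inversion:
 assumes t: "0 < t" and e: "0 < e"
 shows "L1 (ift (aker t e))"
  and "(LBINT s. ift (aker t e) s * cis (- s * u)) = of_real (2 * pi) * aker t e u"
proof -
 have E: "L1 (\<lambda>s. cr (exp (- e * \<bar>s\<bar>)))"
  using integrable_exp_abs[OF e] by (rule integrable_of_real)
 have "L1 (ift (\<lambda>u. cr (pk ((u - t) / e) / e)))"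
  unfolding ift_pk_scaled[OF e, abs_def] using integrable_mult_cis[OF E, of t 0] by simp
 from conv_Fubini(1)[OF fourier_hker(1)[OF t] this, of "\<lambda>_. 0" 0]
 show i: "L1 (ift (aker t e))" by (simp add: ift_aker[OF t e])
 have int: "L1 (aker t e)" using aker_PL1[OF t e] by (simp add: PL1_def)
 have cont: "continuous_on UNIV pk" "continuous_on UNIV tent"
  unfolding pk_def[abs_def] using tent_continuous by (auto intro!: continuous_intros simp: add_nonneg_eq_0_iff)
 have "continuous_on UNIV (aker t e)" unfolding aker_def[abs_def] using t e
  by (intro continuous_intros continuous_on_compose2[OF cont(1)] continuous_on_compose2[OF cont(2)]) auto
 then have c: "isCont (aker t e) u" by (simp add: continuous_on_eq_continuous_at)
 have "cmod (aker t e x) <= 1 / e" for x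
 proof -
  have pk1: "pk y <= 1" for y
  proof -
   have "inverse (1 + y^2) <= 1" by (rule inverse_le_1_iff[THEN iffD2]) simp
   also have "1 <= pi" using pi_ge_two by simp
   finally show ?thesis by (simp add: pk_def divide_le_eq)
  qed
  have "\<bar>pk ((x - t) / e) / e * tent (x / t - 1)\<bar> <= 1 / e * 1"
   unfolding abs_mult using pk1 pk_nonneg tent_le e by (intro mult_mono) (simp_all add: divide_right_mono)
  then show ?thesis unfolding aker_def norm_of_real by simp
 qed
 from fourier_inversion[OF int this c]
 have "ift (fourier (aker t e)) u = of_real (2 * pi) * aker t e u"
  using lborel_integrable_real_affine[OF i, of "- 1" 0] by (simp add: fourier_eq_ift[abs_def])
 also have "ift (fourier (aker t e)) u = (LBINT s. ift (aker t e) s * cis (- s * u))"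
  using lborel_affine[of "- 1" "\<lambda>s. ift (aker t e) s * cis (- s * u)" 0]
  unfolding ift_def[of "fourier (aker t e)"] fourier_eq_ift by (simp add: mult.commute)
 finally show "(LBINT s. ift (aker t e) s * cis (- s * u)) = of_real (2 * pi) * aker t e u" .
qed

text \<open>The kernels concentrate at \<open>t\<close>: \<open>e\<^sub>n / t\<^sub>n \<rightarrow> 0\<close> makes the tent factor tend to \<open>1\<close> on the
 scale of the Poisson kernel.\<close>

definition ak :: "real => nat => real => complex" where
 "ak t n = aker (t + 1 / real (Suc n)) (1 / (real (Suc n))^2)"

lemma ak_PL1:
 assumes "0 <= t"
 shows "ak t n \<in> PL1" "L1 (ak t n)" "L1 (ift (ak t n))" "Nle C0R (ift (ak t n)) 1"
  "(LBINT s. ift (ak t n) s * cis (- s * u)) = of_real (2 * pi) * ak t n u"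
proof -
 have "0 < t + 1 / real (Suc n)" using assms by (simp add: add_nonneg_pos)
 from aker_PL1[OF this] Nle_aker[OF this] aker_inversion[OF this]
 show "ak t n \<in> PL1" "L1 (ift (ak t n))" "Nle C0R (ift (ak t n)) 1"
  "(LBINT s. ift (ak t n) s * cis (- s * u)) = of_real (2 * pi) * ak t n u" by (simp_all add: ak_def)
 then show "L1 (ak t n)" by (simp add: PL1_def)
qed

lemma ak_tendsto:
 assumes t: "0 <= t" and \<psi>: "bdd_cont \<psi>"
 shows "(\<lambda>n. LBINT u. ak t n u * \<psi> u) ----> \<psi> t"
proof -
 obtain B where [measurable]: "\<psi> \<in> borel_measurable borel" and B: "\<And>x. cmod (\<psi> x) <= B"
  by (rule bdd_contE[OF \<psi>], rule that; blast)
 let ?t = "\<lambda>n. t + 1 / real (Suc n)" and ?e = "\<lambda>n. 1 / (real (Suc n))^2"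
 have tp: "0 < ?t n" "0 < ?e n" for n using t by (simp_all add: add_nonneg_pos)
 have l0: "(\<lambda>n. 1 / real (Suc n)) ----> 0" using LIMSEQ_inverse_real_of_nat by (simp add: inverse_eq_divide)
 have tl: "?t ----> t" using tendsto_add[OF tendsto_const l0, of t] by simp
 have el: "?e ----> 0" using tendsto_power[OF l0, of 2] by (simp add: power_divide)
 have rl: "(\<lambda>n. ?e n * v / ?t n) ----> 0" for v
 proof (rule Lim_null_comparison)
  show "\<forall>\<^sub>F n in sequentially. norm (?e n * v / ?t n) <= 1 / real (Suc n) * \<bar>v\<bar>"
  proof (intro always_eventually allI)
   fix n
   have "?e n / ?t n <= ?e n / (1 / real (Suc n))" using t tp(1)[of n] by (intro divide_left_mono) auto
   also have "... = 1 / real (Suc n)" by (simp add: power2_eq_square del: of_nat_Suc)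
   finally have "?e n / ?t n * \<bar>v\<bar> <= 1 / real (Suc n) * \<bar>v\<bar>" by (rule mult_right_mono) simp
   then show "norm (?e n * v / ?t n) <= 1 / real (Suc n) * \<bar>v\<bar>"
    using tp[of n] by (simp add: abs_mult abs_divide abs_of_pos)
  qed
  show "(\<lambda>n. 1 / real (Suc n) * \<bar>v\<bar>) ----> 0" by (intro tendsto_mult_left_zero l0)
 qed
 have tc: "isCont tent 0" "tent 0 = 1" "isCont \<psi> t"
  using tent_continuous[of UNIV] \<psi> by (auto simp: continuous_on_eq_continuous_at bdd_cont_def) (simp add: tent_def)
 have "(\<lambda>n. LBINT v. of_real (pk v * tent (?e n * v / ?t n)) * \<psi> (?t n + ?e n * v))
   ----> (LBINT v. cr (pk v) * \<psi> t)"
 proof (rule integral_dominated_convergence[where w = "\<lambda>v. B * pk v"])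
  show "AE v in lborel. (\<lambda>n. of_real (pk v * tent (?e n * v / ?t n)) * \<psi> (?t n + ?e n * v)) ----> cr (pk v) * \<psi> t"
  proof (rule AE_I2)
   fix v
   have a: "(\<lambda>n. tent (?e n * v / ?t n)) ----> 1"
    using isCont_tendsto_compose[OF tc(1) rl] tc(2) by simp
   have "(\<lambda>n. ?t n + ?e n * v) ----> t + 0 * v" by (intro tendsto_add tendsto_mult tl el tendsto_const)
   then have b: "(\<lambda>n. \<psi> (?t n + ?e n * v)) ----> \<psi> t"
    by (intro isCont_tendsto_compose[OF tc(3)]) simp
   have "(\<lambda>n. of_real (pk v * tent (?e n * v / ?t n)) * \<psi> (?t n + ?e n * v)) ----> cr (pk v * 1) * \<psi> t"
    by (intro tendsto_mult tendsto_of_real a b tendsto_const)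
   then show "(\<lambda>n. of_real (pk v * tent (?e n * v / ?t n)) * \<psi> (?t n + ?e n * v)) ----> cr (pk v) * \<psi> t" by simp
  qed
  show "AE v in lborel. norm (of_real (pk v * tent (?e n * v / ?t n)) * \<psi> (?t n + ?e n * v)) <= B * pk v" for n
  proof (rule AE_I2)
   fix v
   have "cmod (of_real (pk v * tent (?e n * v / ?t n))) <= pk v"
    unfolding norm_of_real using tent_le[of "?e n * v / ?t n"] pk_nonneg[of v] by (simp add: abs_of_nonneg mult_left_le)
   then show "norm (of_real (pk v * tent (?e n * v / ?t n)) * \<psi> (?t n + ?e n * v)) <= B * pk v"
    unfolding norm_mult mult.commute[of B] by (intro mult_mono B pk_nonneg norm_ge_zero)
  qed
 qed (use integrable_pk in auto)
 then show ?thesis unfolding ak_def aker_integral[OF tp] by (simp add: integral_pk)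
qed

subsection \<open>Multiplicativity of the Poisson extension\<close>

lemma sum_fourier_PL1:
 fixes \<phi> :: "nat => real => complex"
 assumes "\<And>k. k < m ==> L1 (\<phi> k)" "\<And>k. k < m ==> h k \<in> H1"
 shows "(\<lambda>u. \<Sum>k<m. \<phi> k u * fourier (h k) u) \<in> PL1"
proof -
 have P: "(\<lambda>u. \<phi> k u * fourier (h k) u) \<in> PL1" if "k < m" for k
  using assms that by (intro mult_fourier_PL1) auto
 have "L1 (\<lambda>u. \<Sum>k<m. \<phi> k u * fourier (h k) u)"
  using P by (intro bintble_sum) (simp add: PL1_def)
 moreover have "(\<Sum>k<m. \<phi> k t * fourier (h k) t) = 0" if "t < 0" for t
  using P that by (intro sum.neutral) (simp add: PL1_def)
 ultimately show ?thesis by (simp add: PL1_def)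
qed

lemma ift_sum_fourier:
 fixes \<phi> :: "nat => real => complex"
 assumes "\<And>k. k < m ==> L1 (\<phi> k)" "\<And>k. k < m ==> h k \<in> H1"
 shows "ift (\<lambda>u. \<Sum>k<m. \<phi> k u * fourier (h k) u) s = (\<Sum>k<m. conv (ift (\<phi> k)) (h k) s)"
proof -
 have "L1 (\<lambda>u. \<phi> k u * fourier (h k) u * cis (s * u))" if "k < m" for k
  using assms that integrable_mult_cis[of "\<lambda>u. \<phi> k u * fourier (h k) u" s 0]
  by (simp add: integrable_mult_fourier H1_integrable)
 then have "ift (\<lambda>u. \<Sum>k<m. \<phi> k u * fourier (h k) u) s = (\<Sum>k<m. ift (\<lambda>u. \<phi> k u * fourier (h k) u) s)"
  unfolding ift_def sum_distrib_right by (intro bint_sum) simp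
 then show ?thesis using assms by (simp add: ift_mult_fourier H1_integrable)
qed

lemma Nle_C0R_dense:
 assumes F: "Nle C0R F c" and \<eta>: "0 < \<eta>"
 obtains b where "b \<in> PL1" "Nle C0R (\<lambda>s. F s - ift b s) \<eta>" "Nle C0R (ift b) (c + \<eta>)"
proof (rule Nle_C0R_approx[OF F \<eta>])
 fix m :: nat and \<phi> h
 assume *: "\<And>k. k < m ==> L1 (\<phi> k) \<and> h k \<in> H1 \<and> ift (\<phi> k) \<in> C0R"
  and c: "(\<Sum>k<m. supnorm (ift (\<phi> k)) * L1norm (h k)) <= c + \<eta>"
  and N: "Nle C0R (\<lambda>s. F s - (\<Sum>k<m. conv (ift (\<phi> k)) (h k) s)) \<eta>"
 define b where "b u = (\<Sum>k<m. \<phi> k u * fourier (h k) u)" for u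
 have "b \<in> PL1" unfolding b_def[abs_def] using * by (intro sum_fourier_PL1) auto
 moreover have e: "ift b s = (\<Sum>k<m. conv (ift (\<phi> k)) (h k) s)" for s
  unfolding b_def[abs_def] using * by (intro ift_sum_fourier) auto
 moreover have "Nle C0R (\<lambda>s. \<Sum>k<m. conv (ift (\<phi> k)) (h k) s) (\<Sum>k<m. supnorm (ift (\<phi> k)) * L1norm (h k))"
  using * by (intro Nle_sum rep_class_C0R Nle_conv) auto
 then have "Nle C0R (ift b) (c + \<eta>)" using c by (simp add: e[abs_def] Nle_mono)
 ultimately show thesis using N that by simp
qed

lemma tilde_mult_ift:
 assumes a: "a \<in> PL1" and b: "b \<in> PL1"
 shows "tilde (\<lambda>s. ift a s * ift b s) z = tilde (ift a) z * tilde (ift b) z"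
proof (cases "0 < Re z")
 case True
 have i: "L1 a" "L1 b" using a b by (auto simp: PL1_def)
 have "(\<lambda>s. ift a s * ift b s) = ift (conv b a)" by (simp add: ift_conv[OF i] fun_eq_iff)
 moreover have "L1 (damp (Re z) a)" "L1 (damp (Re z) b)"
  using damp_PL1(1)[OF a] damp_PL1(1)[OF b] True by (auto simp: PL1_def)
 ultimately show ?thesis using True by (simp add: tilde_eq abel_ift a b conv_PL1 ift_conv flip: damp_conv)
qed (simp add: tilde_eq_0)

lemma tilde_tendsto:
 assumes F: "\<And>n. F n \<in> borel_measurable borel" "\<And>n s. cmod (F n s) <= B" "\<And>s. (\<lambda>n. F n s) ----> G s"
 shows "(\<lambda>n. tilde (F n) z) ----> tilde G z"
proof (cases "0 < Re z")
 case True
 note [measurable] = F(1)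
 have [measurable]: "G \<in> borel_measurable borel" by (rule borel_measurable_LIMSEQ_metric[OF F(1,3)])
 have "(\<lambda>n. LBINT x. F n (- Im z - Re z * x) * of_real (pk x)) ----> (LBINT x. G (- Im z - Re z * x) * of_real (pk x))"
 proof (rule integral_dominated_convergence[where w = "\<lambda>x. B * pk x"])
  show "AE x in lborel. norm (F n (- Im z - Re z * x) * of_real (pk x)) <= B * pk x" for n
   using F(2) pk_nonneg by (intro AE_I2) (simp add: norm_mult mult_right_mono)
 qed (use F(3) integrable_pk in \<open>auto intro!: tendsto_intros\<close>)
 then show ?thesis using True by (simp add: tilde_eq abel_def)
qed (simp add: tilde_eq_0)

text \<open>Multiplication by the approximate identity moves \<open>F\<close> into the smaller
  algebra, where transforms are dense. What survives in the limit is bounded pointwise convergence,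
  which suffices for Poisson integrals.\<close>

lemma Nle_BUCR_pointwise_approx:
 assumes F: "Nle BUCR F c"
 obtains a where "\<And>n::nat. a n \<in> PL1" "\<And>n s. cmod (ift (a n) s) <= c + 2" "\<And>s. (\<lambda>n. ift (a n) s) ----> F s"
proof -
 let ?E = "\<lambda>n. ift (ak 0 n)"
 \<comment> \<open>Any fixed slack will do here, since only a bound uniform in \<open>n\<close> is
   wanted.\<close>
 have FE: "Nle C0R (\<lambda>s. ?E n s * F s) (1 * c + 1)" for n
  by (rule Nle_mult[OF rep_class_C0R ak_PL1(4) F]) simp_all
 have "\<exists>b\<in>PL1. Nle C0R (\<lambda>s. ?E n s * F s - ift b s) (1 / real (Suc n))" for n
  using Nle_C0R_dense[OF FE, of "1 / real (Suc n)" n] by (metis of_nat_0_less_iff zero_less_Suc zero_less_divide_1_iff)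
 then obtain a where a: "\<And>n. a n \<in> PL1" "\<And>n. Nle C0R (\<lambda>s. ?E n s * F s - ift (a n) s) (1 / real (Suc n))"
  by metis
 have d: "cmod (?E n s * F s - ift (a n) s) <= 1 / real (Suc n)" for n s
  by (rule Nle_bound[OF rep_class_C0R a(2)])
 have "cmod (ift (a n) s) <= c + 2" for n s
 proof -
  have "cmod (?E n s * F s) <= c + 1" using Nle_bound[OF rep_class_C0R FE] by simp
  moreover have "1 / real (Suc n) <= 1" by simp
  moreover have "cmod (ift (a n) s) <= cmod (?E n s * F s) + cmod (?E n s * F s - ift (a n) s)"
   by (metis add.commute norm_minus_commute norm_triangle_sub)
  ultimately show ?thesis using d[of n s] by linarith
 qed
 moreover have "(\<lambda>n. ift (a n) s) ----> F s" for s
 proof -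
  have "(\<lambda>n. ?E n s) ----> cis (s * 0)"
   unfolding ift_def by (rule ak_tendsto) (auto simp: bdd_cont_def bounded_iff intro!: continuous_intros exI[of _ 1])
  then have "(\<lambda>n. ?E n s * F s) ----> 1 * F s" by (intro tendsto_mult tendsto_const) simp
  moreover have "(\<lambda>n. ?E n s * F s - ift (a n) s) ----> 0"
  proof (rule Lim_null_comparison)
   show "\<forall>\<^sub>F n in sequentially. norm (?E n s * F s - ift (a n) s) <= 1 / real (Suc n)" using d by simp
   show "(\<lambda>n. 1 / real (Suc n)) ----> 0" using LIMSEQ_inverse_real_of_nat by (simp add: inverse_eq_divide)
  qed
  ultimately have "(\<lambda>n. ?E n s * F s - (?E n s * F s - ift (a n) s)) ----> 1 * F s - 0" by (rule tendsto_diff)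
  then show ?thesis by simp
 qed
 ultimately show thesis using that a(1) by blast
qed

lemma tilde_mult:
 assumes F: "Nle BUCR F c" and G: "Nle BUCR G d"
 shows "tilde (\<lambda>s. F s * G s) = (\<lambda>z. tilde F z * tilde G z)"
proof (rule Nle_BUCR_pointwise_approx[OF F], rule Nle_BUCR_pointwise_approx[OF G], rule ext)
 fix z a b
 assume a: "\<And>n::nat. a n \<in> PL1" "\<And>n s. cmod (ift (a n) s) <= c + 2" "\<And>s. (\<lambda>n. ift (a n) s) ----> F s"
  and b: "\<And>n::nat. b n \<in> PL1" "\<And>n s. cmod (ift (b n) s) <= d + 2" "\<And>s. (\<lambda>n. ift (b n) s) ----> G s"
 have m [measurable]: "ift (a n) \<in> borel_measurable borel" "ift (b n) \<in> borel_measurable borel" for n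
  using a(1) b(1) by (auto simp: PL1_def intro!: measurable_contI continuous_on_ift)
 have nn: "0 <= c + 2" using a(2)[of 0 0] norm_ge_zero order_trans by blast
 have "(\<lambda>n. tilde (\<lambda>s. ift (a n) s * ift (b n) s) z) ----> tilde (\<lambda>s. F s * G s) z"
 proof (rule tilde_tendsto[where B = "(c + 2) * (d + 2)"])
  show "cmod (ift (a n) s * ift (b n) s) <= (c + 2) * (d + 2)" for n s
   unfolding norm_mult by (intro mult_mono a b nn norm_ge_zero)
 qed (auto intro: tendsto_mult a b)
 moreover have "(\<lambda>n. tilde (ift (a n)) z * tilde (ift (b n)) z) ----> tilde F z * tilde G z"
  by (intro tendsto_mult tilde_tendsto[where B = "c + 2"] tilde_tendsto[where B = "d + 2"] a b m)
 ultimately show "tilde (\<lambda>s. F s * G s) z = tilde F z * tilde G z"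
  using LIMSEQ_unique by (simp add: tilde_mult_ift a b) 
qed

section \<open>Norm estimates for the calculus\<close>

text \<open>Convolution with a Poisson kernel of width \<open>e\<close>. On \<open>H1\<close> it
  multiplies the Fourier transform by \<open>exp (- e * u)\<close>, so damping the kernel
  \<open>\<phi> * fourier h\<close> can be carried out on \<open>h\<close> without increasing its
  norm.\<close>

definition dampH :: "real => (real => complex) => real => complex" where
 "dampH e h = conv h (\<lambda>u. cr (pk (u / e) / e))"

lemma L1norm_conv_le:
 assumes a: "L1 a" and b: "L1 b"
 shows "L1norm (conv b a) <= L1norm b * L1norm a"
proof -
 let ?a = "\<lambda>t. cr (cmod (a t))" and ?b = "\<lambda>t. cr (cmod (b t))"
 have i: "L1 ?a" "L1 ?b" using a b by auto
 have cr: "conv ?b ?a r = of_real (LBINT t. cmod (b (r - t) * a t))" for r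
  by (simp add: conv_def norm_mult flip: of_real_mult integral_complex_of_real)
 have ci: "L1 (conv ?b ?a)" by (rule conv_Fubini(1)[OF i, of "\<lambda>_. 0" 0]) auto
 have "L1norm (conv b a) <= (LBINT r. (LBINT t. cmod (b (r - t) * a t)))" unfolding L1norm_def
 proof (rule integral_mono)
  show "L1 (\<lambda>r. cmod (conv b a r))" using conv_Fubini(1)[OF a b, of "\<lambda>_. 0" 0] by simp
  show "L1 (\<lambda>r. LBINT t. cmod (b (r - t) * a t))"
   using ci unfolding cr complex_of_real_integrable_eq .
  show "cmod (conv b a r) <= (LBINT t. cmod (b (r - t) * a t))" for r
   unfolding conv_def by (rule integral_norm_bound)
 qed
 moreover have "cr (LBINT r. (LBINT t. cmod (b (r - t) * a t))) = of_real (L1norm b * L1norm a)"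
 proof -
  have "cr (LBINT r. (LBINT t. cmod (b (r - t) * a t))) = (LBINT r. conv ?b ?a r * 1)"
   unfolding cr by (simp flip: integral_complex_of_real)
  also have "... = (LBINT t. ?a t * (LBINT s. ?b s * 1))" by (rule conv_Fubini(2)[OF i, where B = 1]) auto
  also have "... = of_real (L1norm b * L1norm a)"
   unfolding integral_mult_left_zero by (simp add: L1norm_def integral_complex_of_real mult.commute)
  finally show ?thesis .
 qed
 ultimately show ?thesis unfolding of_real_eq_iff by simp
qed

lemma dampH:
 assumes h: "h \<in> H1" and e: "0 < e"
 shows "dampH e h \<in> H1" "L1norm (dampH e h) <= L1norm h"
  "fourier (dampH e h) u = of_real (exp (- e * u)) * fourier h u"
proof -
 let ?p = "\<lambda>u. cr (pk (u / e) / e)"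
 have p: "L1 ?p" using pk_scaled_integrable[OF e, of 0] by simp
 have hi: "L1 h" by (rule H1_integrable[OF h])
 have "fourier (dampH e h) u = of_real (exp (- e * \<bar>u\<bar>)) * fourier h u" for u
 proof -
  have "ift ?p (- u) = of_real (exp (- e * \<bar>u\<bar>))" using ift_pk_scaled[OF e, of 0 "- u"] by simp
  then show ?thesis unfolding dampH_def fourier_eq_ift ift_conv[OF p hi] by simp
 qed
 then show f: "fourier (dampH e h) u = of_real (exp (- e * u)) * fourier h u" for u
  using h by (cases "u <= 0") (auto simp: H1_def)
 show "dampH e h \<in> H1"
  using conv_Fubini(1)[OF p hi, of "\<lambda>_. 0" 0] h f by (auto simp: H1_def dampH_def)
 have "L1norm ?p = 1"
 proof -
  have "L1norm ?p = (LBINT u. pk (u / e) / e)"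
   unfolding L1norm_def norm_of_real using pk_nonneg e by (simp add: abs_of_nonneg)
  also have "... = 1" using lborel_affine[of "1 / e" pk 0] e integral_pk by simp
  finally show ?thesis .
 qed
 then show "L1norm (dampH e h) <= L1norm h" using L1norm_conv_le[OF p hi] by (simp add: dampH_def)
qed

text \<open>Fourier inversion writes \<open>ak\<close> as a superposition of exponentials with
  integrable weight; convolving each of them with \<open>d\<close> produces a value of
  \<open>ift d\<close>.\<close>

lemma conv_ak_bound:
 assumes d: "L1 d" and \<eta>: "\<And>s. cmod (ift d s) <= \<eta>"
 shows "cmod (conv d (ak 0 k) r) <= \<eta> * L1norm (ift (ak 0 k))"
proof -
 let ?c = "ift (ak 0 k)"
 note ci = ak_PL1(3)[OF order_refl]
 have dr: "L1 (\<lambda>t. d (r - t))" using lborel_integrable_real_affine[OF d, of "- 1" r] by simp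
 have "integrable (lborel \<Otimes>\<^sub>M lborel) (\<lambda>(t, s). d (r - t) * ?c s * (\<lambda>(t, s). cis (- s * t)) (t, s))"
  by (rule integrable_pair_mult[OF dr ci, where B = 1]) (auto simp: case_prod_beta')
 then have int: "integrable (lborel \<Otimes>\<^sub>M lborel) (\<lambda>(t, s). d (r - t) * ?c s * cis (- s * t))" by simp
 have "of_real (2 * pi) * conv d (ak 0 k) r = (LBINT t. d (r - t) * (LBINT s. ?c s * cis (- s * t)))"
  unfolding ak_PL1(5)[OF order_refl] conv_def integral_mult_right_zero[symmetric] by (simp add: mult_ac)
 also have "... = (LBINT t. LBINT s. d (r - t) * ?c s * cis (- s * t))" by (simp add: mult.assoc)
 also have "... = (LBINT s. LBINT t. d (r - t) * ?c s * cis (- s * t))"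
  by (rule lborel_pair.Fubini_integral[OF int, symmetric])
 also have "... = (LBINT s. ?c s * (cis (- s * r) * ift d s))"
 proof (intro bint_cong refl)
  fix s
  have "(LBINT t. d (r - t) * ?c s * cis (- s * t)) = (LBINT v. d v * ?c s * cis (- s * (r - v)))"
   using lborel_affine[of "- 1" "\<lambda>t. d (r - t) * ?c s * cis (- s * t)" r] by simp
  also have "... = (LBINT v. ?c s * cis (- s * r) * (d v * cis (s * v)))"
   by (intro bint_cong refl) (simp add: mult_ac cis_mult algebra_simps)
  finally show "(LBINT t. d (r - t) * ?c s * cis (- s * t)) = ?c s * (cis (- s * r) * ift d s)"
   by (simp add: ift_def[of d] mult.assoc)
 qed
 finally have eq: "of_real (2 * pi) * conv d (ak 0 k) r = (LBINT s. ?c s * (cis (- s * r) * ift d s))" .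
 have bi: "L1 (\<lambda>s. ?c s * (cis (- s * r) * ift d s))"
 proof (rule integrable_mult_bounded[OF ci])
  have [measurable]: "ift d \<in> borel_measurable borel" by (intro measurable_contI continuous_on_ift d)
  show "(\<lambda>s. cis (- s * r) * ift d s) \<in> borel_measurable borel" by measurable
  show "cmod (cis (- s * r) * ift d s) <= \<eta>" for s using \<eta> by (simp add: norm_mult)
 qed
 have "2 * pi * cmod (conv d (ak 0 k) r) = cmod (LBINT s. ?c s * (cis (- s * r) * ift d s))"
  unfolding eq[symmetric] norm_mult norm_of_real by simp
 also have "... <= (LBINT s. \<eta> * cmod (?c s))" using bi ci \<eta>
  by (intro order_trans[OF integral_norm_bound integral_mono] integrable_norm)
   (auto simp: norm_mult mult.commute mult_right_mono)
 also have "... = \<eta> * L1norm ?c" by (simp add: L1norm_def)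
 finally have "2 * pi * cmod (conv d (ak 0 k) r) <= \<eta> * L1norm ?c" .
 moreover have "1 * cmod (conv d (ak 0 k) r) <= 2 * pi * cmod (conv d (ak 0 k) r)"
  using pi_ge_two by (intro mult_right_mono) auto
 ultimately show ?thesis by simp
qed

section \<open>Strong limits of the calculus along kernels\<close>

context c0_semigroup
begin

text \<open>The condition \<open>k n u = of_real (cmod (k n u))\<close> says that the kernels are
  real and nonnegative. Scalar convergence tested on the norm of \<open>orb x u - T t x\<close> then
  yields strong convergence.\<close>

lemma op_kernel_tendsto:
 assumes t: "0 <= t" and k: "\<And>n. L1 (k n)" "\<And>n u. k n u = of_real (cmod (k n u))"
  and lim: "\<And>\<psi>. bdd_cont \<psi> ==> (\<lambda>n. LBINT u. k n u * \<psi> u) ----> \<psi> t"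
 shows "(\<lambda>n. op (k n) x) ----> T t x"
proof -
 define g where "g u = orb x u - T t x" for u
 have cc: "cont_bdd (\<lambda>_. T t x)" by (auto simp: cont_bdd_def)
 have g: "cont_bdd g"
 proof -
  have "norm (g u) <= bnd * norm x + norm (T t x)" for u
   unfolding g_def using norm_orb_le[of x u] norm_triangle_ineq4[of "orb x u" "T t x"] by linarith
  then show ?thesis
   using cont_bdd_orb[of x] unfolding cont_bdd_def g_def[abs_def] by (auto intro!: continuous_intros)
 qed
 have vc: "vint (k n) (\<lambda>_. T t x) = (LBINT u. k n u) *\<^sub>J T t x" for n
  unfolding vint_def by (rule integral_unique[OF has_integral_cs_const[OF k(1)]])
 have eq: "op (k n) x = vint (k n) g + (LBINT u. k n u) *\<^sub>J T t x" for n
  using vint_diff_right[OF k(1) cont_bdd_orb cc, of n x] by (simp add: op_def g_def[abs_def] vc)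
 have "bdd_cont (\<lambda>u. of_real (norm (g u)))"
  using g by (auto simp: bdd_cont_def cont_bdd_def bounded_iff intro!: continuous_intros)
 from lim[OF this] have "(\<lambda>n. LBINT u. cr (cmod (k n u) * norm (g u))) ----> of_real (norm (g t))"
  by (subst of_real_mult, subst k(2)[symmetric])
 moreover have "g t = 0" using t by (simp add: g_def orb_def)
 ultimately have "(\<lambda>n. LBINT u. cmod (k n u) * norm (g u)) ----> 0"
  unfolding integral_complex_of_real by (simp add: tendsto_of_real_iff[where c = 0, simplified])
 then have "(\<lambda>n. vint (k n) g) ----> 0"
  by (rule Lim_null_comparison[rotated]) (simp add: vint_norm_le[OF k(1) g])
 moreover have "(\<lambda>n. LBINT u. k n u) ----> 1"
  using lim[of "\<lambda>_. 1"] by (simp add: bdd_cont_def)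
 then have "(\<lambda>n. (LBINT u. k n u) *\<^sub>J T t x) ----> 1 *\<^sub>J T t x"
  by (intro B.tendsto tendsto_const)
 ultimately have "(\<lambda>n. vint (k n) g + (LBINT u. k n u) *\<^sub>J T t x) ----> 0 + 1 *\<^sub>J T t x"
  by (rule tendsto_add)
 then show ?thesis by (simp add: eq)
qed

lemma op_ak_tendsto:
 assumes t: "0 <= t"
 shows "(\<lambda>n. op (ak t n) x) ----> T t x"
proof (rule op_kernel_tendsto[OF t ak_PL1(2)[OF t]])
 show "ak t n u = of_real (cmod (ak t n u))" for n u
  unfolding ak_def aker_def norm_of_real using tent_le(1) pk_nonneg by (simp add: abs_of_nonneg del: of_nat_Suc)
qed (rule ak_tendsto[OF t])

lemma op_damp_tendsto:
 assumes b: "b \<in> PL1"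
 shows "(\<lambda>n. op (damp (1 / real (Suc n)) b) x) ----> op b x"
proof -
 let ?e = "\<lambda>n. 1 / real (Suc n)"
 have bi: "L1 b" using b by (simp add: PL1_def)
 have el: "?e ----> 0" using LIMSEQ_inverse_real_of_nat by (simp add: inverse_eq_divide)
 have di: "L1 (damp (?e n) b)" for n using damp_PL1(1)[OF b, of "?e n"] by (simp add: PL1_def)
 have "(\<lambda>n. L1norm (\<lambda>u. damp (?e n) b u - b u)) ----> 0" unfolding L1norm_def
 proof (rule integral_tendsto_0[where w = "\<lambda>u. 2 * cmod (b u)"])
  show "L1 (\<lambda>u. 2 * cmod (b u))" using bi by auto
  show "(\<lambda>u. cmod (damp (?e n) b u - b u)) \<in> borel_measurable lborel" for n
   using borel_measurable_integrable[OF di[of n]] borel_measurable_integrable[OF bi] by auto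
  show "(\<lambda>n. cmod (damp (?e n) b u - b u)) ----> 0" for u
  proof -
   have "(\<lambda>n. of_real (exp (- ?e n * u)) * b u - b u) ----> of_real (exp (- 0 * u)) * b u - b u"
    by (intro tendsto_intros el)
   then show ?thesis unfolding damp_def by (intro tendsto_norm_zero) simp
  qed
  show "\<bar>cmod (damp (?e n) b u - b u)\<bar> <= 2 * cmod (b u)" for n u
   using damp_PL1(2)[OF b, of "?e n" u] norm_triangle_ineq4[of "damp (?e n) b u" "b u"] by simp
 qed
 then have "(\<lambda>n. L1norm (\<lambda>u. damp (?e n) b u - b u) * (bnd * norm x)) ----> 0" by (rule tendsto_mult_left_zero)
 then have "(\<lambda>n. op (damp (?e n) b) x - op b x) ----> 0"
 proof (rule Lim_null_comparison[rotated])
  show "\<forall>\<^sub>F n in sequentially. norm (op (damp (?e n) b) x - op b x) <= L1norm (\<lambda>u. damp (?e n) b u - b u) * (bnd * norm x)"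
   using norm_op_le[OF bintble_diff[OF di bi]]
   by (intro always_eventually allI) (simp only: op_diff_left[OF di bi] mult.assoc)
 qed
 then show ?thesis by (rule LIM_zero_cancel)
qed

text \<open>Here a uniform bound on \<open>ift d\<close> becomes a bound on an operator: convolution
  with \<open>ak\<close> makes the kernel bounded, and damping makes it integrable.\<close>

lemma op_damp_conv_ak:
 assumes d: "d \<in> PL1" and \<eta>: "\<And>s. cmod (ift d s) <= \<eta>" and e: "0 < e"
 shows "norm (op (damp e (conv d (ak 0 k))) x)
  <= \<eta> * (L1norm (ift (ak 0 k)) * (LBINT u. exp (- e * \<bar>u\<bar>)) * bnd * norm x)"
proof -
 let ?f = "conv d (ak 0 k)" and ?K = "\<eta> * L1norm (ift (ak 0 k))"
 have di: "L1 d" using d by (simp add: PL1_def)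
 have f: "?f \<in> PL1" by (rule conv_PL1[OF ak_PL1(1)[OF order_refl] d])
 then have D: "L1 (damp e ?f)" using damp_PL1(1)[OF f] e by (simp add: PL1_def)
 have bd: "cmod (?f u) <= ?K" for u by (rule conv_ak_bound[OF di \<eta>])
 have "L1norm (damp e ?f) <= (LBINT u. ?K * exp (- e * \<bar>u\<bar>))" unfolding L1norm_def[of "damp e ?f"]
 proof (rule integral_mono)
  show "cmod (damp e ?f u) <= ?K * exp (- e * \<bar>u\<bar>)" for u
  proof (cases "u < 0")
   case True
   moreover have "0 <= ?K" using bd[of 0] norm_ge_zero order_trans by blast
   ultimately show ?thesis using f by (simp add: PL1_def damp_def)
  next
   case False
   then show ?thesis using bd[of u] by (simp add: damp_def norm_mult mult.commute mult_left_mono)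
  qed
 qed (use D integrable_exp_abs[OF e] in auto)
 then have "L1norm (damp e ?f) <= ?K * (LBINT u. exp (- e * \<bar>u\<bar>))" by simp
 from mult_right_mono[OF this, of "bnd * norm x"] show ?thesis
  using norm_op_le[OF D, of x] bnd_nonneg by (simp add: mult_ac)
qed

end

section \<open>Gamma-bounds for kernels whose transforms lie in the algebra\<close>

context gamma_semigroup
begin

text \<open>Each term is rescaled so that both functions lie in their unit balls, and the sum
  becomes a convex combination times \<open>D + \<eta>\<close>. The norms are enlarged slightly
  before dividing, since they may vanish; \<open>\<eta>\<close> tends to zero at the end.\<close>

lemma gam2_op_fourier_sum:
 fixes x :: "'i::countable => 'a"
 assumes fin: "finite I" and D: "0 <= D"
  and \<phi>: "\<And>i k::nat. i \<in> I ==> k < m i ==> L1 (\<phi> i k) \<and> h i k \<in> H1 \<and> ift (\<phi> i k) \<in> C0R"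
  and le: "\<And>i. i \<in> I ==> (\<Sum>k<m i. supnorm (ift (\<phi> i k)) * L1norm (h i k)) <= D"
 shows "gam2 J I (\<lambda>i. op (\<lambda>u. \<Sum>k<m i. \<phi> i k u * fourier (h i k) u) (x i)) <= D^2 * ((C^2)^2 * gam2 J I x)"
proof -
 let ?X = "\<lambda>i. op (\<lambda>u. \<Sum>k<m i. \<phi> i k u * fourier (h i k) u) (x i)"
 have main: "gam2 J I ?X <= (D + \<eta>)^2 * ((C^2)^2 * gam2 J I x)" if \<eta>: "0 < \<eta>" for \<eta>
 proof -
  let ?D = "D + \<eta>"
  have D': "0 < ?D" using D \<eta> by simp
  define P where "P i k \<longleftrightarrow> i \<in> I \<and> k < m i" for i k
  define A where "A i k = supnorm (ift (\<phi> i k))" for i k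
  define B where "B i k = L1norm (h i k)" for i k
  define \<theta> where "\<theta> i = \<eta> / (real (m i) + 1)" for i
  \<comment> \<open>Small enough that the product of the enlarged norms exceeds
    \<open>A i k * B i k\<close> by at most \<open>\<theta> i\<close>, and the
    \<open>\<theta> i\<close> add up to at most \<open>\<eta>\<close>.\<close>
  define \<delta> where "\<delta> i k = min 1 (\<theta> i / (A i k + B i k + 1))" for i k
  define p where "p i k = A i k + \<delta> i k" for i k
  define q where "q i k = B i k + \<delta> i k" for i k
  have AB: "0 <= A i k" "0 <= B i k" "cmod (ift (\<phi> i k) s) <= A i k" if "P i k" for i k s
   using \<phi>[of i k] that C0R_subset_BUCR supnorm_nonneg supnorm_upper L1norm_nonneg
   by (auto simp: P_def A_def B_def)
  have \<theta>: "0 < \<theta> i" "real (m i) * \<theta> i <= \<eta>" for i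
   using \<eta> by (auto simp: \<theta>_def pos_divide_le_eq algebra_simps)
  have \<delta>: "0 < \<delta> i k" if "P i k" for i k
   using AB[OF that] \<theta>(1)[of i] by (simp add: \<delta>_def add_nonneg_pos)
  have pq: "0 < p i k" "0 < q i k" "p i k * q i k <= A i k * B i k + \<theta> i" if "P i k" for i k
  proof -
   note AB' = AB[OF that] and \<delta>' = \<delta>[OF that]
   show "0 < p i k" "0 < q i k" using AB' \<delta>' by (auto simp: p_def q_def add_nonneg_pos)
   have "0 < A i k + B i k + 1" using AB' by simp
   then have "\<delta> i k * (A i k + B i k + 1) <= \<theta> i"
    by (subst pos_le_divide_eq[symmetric]) (auto simp: \<delta>_def)
   moreover have "\<delta> i k * \<delta> i k <= \<delta> i k * 1" using \<delta>' by (intro mult_left_mono) (auto simp: \<delta>_def)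
   ultimately show "p i k * q i k <= A i k * B i k + \<theta> i" by (simp add: p_def q_def algebra_simps)
  qed
  define c where "c i k = (if P i k then p i k * q i k / ?D else 0)" for i k
  define \<phi>' where "\<phi>' i k = (if P i k then (\<lambda>u. \<phi> i k u / of_real (p i k)) else (\<lambda>_. 0))" for i k
  define h' where "h' i k = (if P i k then (\<lambda>u. h i k u / of_real (q i k)) else (\<lambda>_. 0))" for i k
  \<comment> \<open>A common index range for all \<open>i\<close>; the weights are zero beyond
    \<open>m i\<close>.\<close>
  define L where "L = {..<(\<Sum>i\<in>I. m i)}"
  have mL: "{..<m i} \<subseteq> L" if "i \<in> I" for i
   using member_le_sum[OF that _ fin, of m] by (auto simp: L_def)
  have fh': "fourier (h' i k) u = (if P i k then fourier (h i k) u / of_real (q i k) else 0)" for i k u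
   by (simp add: h'_def fourier_def)
  have \<phi>'i: "L1 (\<phi>' i k)" and h'H: "h' i k \<in> H1" for i k
  proof -
   show "L1 (\<phi>' i k)" using \<phi>[of i k] by (auto simp: \<phi>'_def P_def)
   show "h' i k \<in> H1"
   proof (cases "P i k")
    case True
    then have "L1 (h' i k)" using \<phi>[of i k] H1_integrable by (auto simp: h'_def P_def)
    then show ?thesis using \<phi>[of i k] True by (auto simp: H1_def fh' P_def)
   qed (simp add: h'_def zero_H1)
  qed
  have phi1: "cmod (ift (\<phi>' i k) s) <= 1" for i k s
  proof (cases "P i k")
   case True
   have "ift (\<phi>' i k) s = ift (\<phi> i k) s / of_real (p i k)"
    using True by (simp add: \<phi>'_def ift_def)
   moreover have "cmod (ift (\<phi> i k) s) <= p i k" using AB(3)[OF True, of s] \<delta>[OF True] by (simp add: p_def)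
   ultimately show ?thesis using pq(1)[OF True] by (simp add: norm_divide)
  qed (simp add: \<phi>'_def ift_def)
  have h1: "L1norm (h' i k) <= 1" for i k
  proof (cases "P i k")
   case True
   have "L1norm (h' i k) = L1norm (h i k) / q i k"
    using True pq(2)[OF True] by (simp add: h'_def L1norm_def norm_divide)
   moreover have "L1norm (h i k) <= q i k" using \<delta>[OF True] by (simp add: q_def B_def)
   ultimately show ?thesis using pq(2)[OF True] by simp
  qed (simp add: h'_def L1norm_def)
  define S where "S i k = op (\<lambda>u. \<phi>' i k u * fourier (h' i k) u)" for i k
  have Si: "L1 (\<lambda>u. \<phi>' i k u * fourier (h' i k) u)" for i k
   by (rule integrable_mult_fourier[OF \<phi>'i H1_integrable[OF h'H]])
  have "gam2 J I (\<lambda>i. \<Sum>l\<in>L. c i l *\<^sub>R S i l (x i)) <= (C^2)^2 * gam2 J I x"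
  proof (rule gam2_convex_combination[OF fin])
   show "finite L" by (simp add: L_def)
   show "0 <= c i l" for i l using pq[of i l] D' by (auto simp: c_def intro!: divide_nonneg_pos mult_nonneg_nonneg less_imp_le)
   show "(\<Sum>l\<in>L. c i l) <= 1" if i: "i \<in> I" for i
   proof -
    have "(\<Sum>l\<in>L. c i l) = (\<Sum>k<m i. c i k)"
     using mL[OF i] by (intro sum.mono_neutral_right) (auto simp: c_def P_def L_def)
    also have "... = (\<Sum>k<m i. p i k * q i k) / ?D" using i by (simp add: c_def P_def sum_divide_distrib)
    also have "(\<Sum>k<m i. p i k * q i k) <= (\<Sum>k<m i. A i k * B i k + \<theta> i)"
     using i by (intro sum_mono pq) (simp add: P_def)
    also have "... <= ?D" using le[OF i] \<theta>(2)[of i] by (simp add: sum.distrib A_def B_def)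
    finally show ?thesis using D' by (simp add: divide_right_mono)
   qed
   show "S i l (r *\<^sub>R y) = r *\<^sub>R S i l y" for i l r y
    using cbounded_op_op[OF Si[of i l]] by (simp add: S_def cbounded_op_def linear_simps)
   show "gam2 J (I \<times> L) (\<lambda>(i, l). S i l (y (i, l))) <= (C^2)^2 * gam2 J (I \<times> L) y" for y
   proof -
    have "gam2 J (I \<times> L) (\<lambda>p. op (\<lambda>u. \<phi>' (fst p) (snd p) u * fourier (h' (fst p) (snd p)) u) (y p)) <= (C^2)^2 * gam2 J (I \<times> L) y"
    proof (rule gam2_op_fourier_le)
     show "finite (I \<times> L)" using fin by (simp add: L_def)
     show "cmod (ift (\<phi>' (fst z) (snd z)) s) <= 1" for z s using phi1 .
     show "L1norm (h' (fst z) (snd z)) <= 1" for z using h1 .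
    qed (auto simp: \<phi>'i h'H)
    then show ?thesis by (simp add: S_def case_prod_beta')
   qed
  qed simp
  moreover have "(\<Sum>l\<in>L. c i l *\<^sub>R S i l (x i)) = (1 / ?D) *\<^sub>R ?X i" if i: "i \<in> I" for i
  proof -
   have ints: "L1 (\<lambda>u. \<phi> i k u * fourier (h i k) u)" if "k < m i" for k
    using \<phi>[OF i that] integrable_mult_fourier[of "\<phi> i k" "h i k"] H1_integrable[of "h i k"] by simp
   have "(\<Sum>l\<in>L. c i l *\<^sub>R S i l (x i)) = (\<Sum>k<m i. c i k *\<^sub>R S i k (x i))"
    using mL[OF i] by (intro sum.mono_neutral_right) (auto simp: c_def P_def L_def)
   also have "... = (\<Sum>k<m i. (1 / ?D) *\<^sub>R op (\<lambda>u. \<phi> i k u * fourier (h i k) u) (x i))"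
   proof (intro sum.cong refl)
    fix k assume "k \<in> {..<m i}"
    then have Pk: "P i k" using i by (simp add: P_def)
    have int: "L1 (\<lambda>u. \<phi> i k u * fourier (h i k) u)"
     using \<phi>[of i k] Pk by (auto simp: P_def intro: integrable_mult_fourier H1_integrable)
    have "S i k (x i) = op (\<lambda>u. of_real (1 / (p i k * q i k)) * (\<phi> i k u * fourier (h i k) u)) (x i)"
     unfolding S_def fh' \<phi>'_def using Pk by simp
    also have "... = (1 / (p i k * q i k)) *\<^sub>R op (\<lambda>u. \<phi> i k u * fourier (h i k) u) (x i)"
     unfolding op_scale_left[OF int] by (simp only: cs_of_real)
    finally show "c i k *\<^sub>R S i k (x i) = (1 / ?D) *\<^sub>R op (\<lambda>u. \<phi> i k u * fourier (h i k) u) (x i)"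
     using pq[OF Pk] Pk by (simp add: c_def)
   qed
   also have "... = (1 / ?D) *\<^sub>R ?X i"
    unfolding scaleR_sum_right[symmetric] using ints by (subst op_sum_left) auto
   finally show ?thesis .
  qed
  ultimately have "gam2 J I (\<lambda>i. (1 / ?D) *\<^sub>R ?X i) <= (C^2)^2 * gam2 J I x"
   using gam2_cong[of I "\<lambda>i. \<Sum>l\<in>L. c i l *\<^sub>R S i l (x i)" "\<lambda>i. (1 / ?D) *\<^sub>R ?X i"] by simp
  then have "(1 / ?D)^2 * gam2 J I ?X <= (C^2)^2 * gam2 J I x" unfolding gam2_scaleR .
  from mult_left_mono[OF this, of "?D^2"] show ?thesis using D' by (simp add: power_divide)
 qed
 have "(\<lambda>n. (D + inverse (real (Suc n)))^2 * ((C^2)^2 * gam2 J I x)) ----> (D + 0)^2 * ((C^2)^2 * gam2 J I x)"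
  by (intro tendsto_intros LIMSEQ_inverse_real_of_nat)
 then show ?thesis
  using main by (intro LIMSEQ_le_const[where X = "\<lambda>n. (D + inverse (real (Suc n)))^2 * ((C^2)^2 * gam2 J I x)"]) auto
qed

text \<open>Approximating \<open>ift (b i)\<close> by finite sums leaves an error that is small only
  in the norm of the algebra, hence uniformly. After damping, and on vectors of the form
  \<open>op (damp e (ak 0 k)) (x i)\<close>, such an error is small as an operator. The damping is
  removed in \<open>step2\<close>, the vectors in the last limit.\<close>

theorem gam2_op_le:
 fixes x :: "'i::countable => 'a"
 assumes fin: "finite I" and c: "0 <= c"
  and b: "\<And>i. i \<in> I ==> b i \<in> PL1" "\<And>i. i \<in> I ==> Nle C0R (ift (b i)) c"
 shows "gam2 J I (\<lambda>i. op (b i) (x i)) <= c^2 * ((C^2)^2 * gam2 J I x)"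
proof -
 let ?e = "\<lambda>n. 1 / real (Suc n)"
 have el: "?e ----> 0" using LIMSEQ_inverse_real_of_nat by (simp add: inverse_eq_divide)
 have ep: "0 < ?e n" for n by simp
 \<comment> \<open>Damping is moved onto the \<open>H1\<close> functions, where it does not raise
   the norm, so the bound for finite sums applies to the damped approximants.\<close>
 have step1: "gam2 J I (\<lambda>i. op (damp e (b i)) (op (damp e (ak 0 k)) (x i)))
   <= c^2 * ((C^2)^2 * gam2 J I (\<lambda>i. op (damp e (ak 0 k)) (x i)))" if e: "0 < e" for e k
 proof -
  let ?y = "\<lambda>i. op (damp e (ak 0 k)) (x i)"
  define R where "R n i z \<longleftrightarrow> (\<forall>k<fst z. L1 (fst (snd z) k) \<and> snd (snd z) k \<in> H1 \<and> ift (fst (snd z) k) \<in> C0R) \<and>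
    (\<Sum>k<fst z. supnorm (ift (fst (snd z) k)) * L1norm (snd (snd z) k)) <= c + ?e n \<and>
    Nle C0R (\<lambda>s. ift (b i) s - (\<Sum>k<fst z. conv (ift (fst (snd z) k)) (snd (snd z) k) s)) (?e n)"
   for n i and z :: "nat \<times> (nat => real => complex) \<times> (nat => real => complex)"
  have "\<exists>z. R n i z" if "i \<in> I" for i and n :: nat
  proof (rule Nle_C0R_approx[OF b(2)[OF that] ep[of n]])
   fix m :: nat and \<phi> h
   assume "\<And>k. k < m ==> L1 (\<phi> k) \<and> h k \<in> H1 \<and> ift (\<phi> k) \<in> C0R"
    "(\<Sum>k<m. supnorm (ift (\<phi> k)) * L1norm (h k)) <= c + ?e n"
    "Nle C0R (\<lambda>s. ift (b i) s - (\<Sum>k<m. conv (ift (\<phi> k)) (h k) s)) (?e n)"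
   note * = this
   show ?thesis by (rule exI[of _ "(m, \<phi>, h)"]) (use * in \<open>simp add: R_def\<close>)
  qed
  note ex = this
  define z where "z n i = (SOME z. R n i z)" for n i
  have z: "R n i (z n i)" if "i \<in> I" for n i unfolding z_def by (rule someI_ex[OF ex[OF that]])
  define m where "m n i = fst (z n i)" for n i
  define \<phi> where "\<phi> n i = fst (snd (z n i))" for n i
  define h where "h n i = snd (snd (z n i))" for n i
  have *: "L1 (\<phi> n i k) \<and> h n i k \<in> H1 \<and> ift (\<phi> n i k) \<in> C0R" if "i \<in> I" "k < m n i" for n i k
   using z[OF that(1)] that(2) by (auto simp: R_def m_def \<phi>_def h_def)
  have tot: "(\<Sum>k<m n i. supnorm (ift (\<phi> n i k)) * L1norm (h n i k)) <= c + ?e n"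
   and N: "Nle C0R (\<lambda>s. ift (b i) s - (\<Sum>k<m n i. conv (ift (\<phi> n i k)) (h n i k) s)) (?e n)" if "i \<in> I" for n i
   using z[OF that] by (auto simp: R_def m_def \<phi>_def h_def)
  define b' where "b' n i u = (\<Sum>k<m n i. \<phi> n i k u * fourier (h n i k) u)" for n i u
  have b'P: "b' n i \<in> PL1" if i: "i \<in> I" for n i unfolding b'_def[abs_def] using *[OF i]
   by (intro sum_fourier_PL1) auto
  have b'ift: "ift (b' n i) s = (\<Sum>k<m n i. conv (ift (\<phi> n i k)) (h n i k) s)" if i: "i \<in> I" for n i s
   unfolding b'_def[abs_def] using *[OF i] by (intro ift_sum_fourier) auto
  have bound: "gam2 J I (\<lambda>i. op (damp e (b' n i)) (?y i)) <= (c + ?e n)^2 * ((C^2)^2 * gam2 J I ?y)" for n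
  proof -
   have eq: "damp e (b' n i) = (\<lambda>u. \<Sum>k<m n i. \<phi> n i k u * fourier (dampH e (h n i k)) u)" if i: "i \<in> I" for i
    unfolding damp_def[abs_def] b'_def sum_distrib_left
    by (rule ext, intro sum.cong refl) (use *[OF i] dampH(3)[OF _ e] in auto)
   have "gam2 J I (\<lambda>i. op (damp e (b' n i)) (?y i))
     = gam2 J I (\<lambda>i. op (\<lambda>u. \<Sum>k<m n i. \<phi> n i k u * fourier (dampH e (h n i k)) u) (?y i))"
    by (rule gam2_cong) (simp only: eq)
   also have "... <= (c + ?e n)^2 * ((C^2)^2 * gam2 J I ?y)"
   proof (rule gam2_op_fourier_sum[OF fin])
    show "0 <= c + ?e n" using c by simp
    show "L1 (\<phi> n i k) \<and> dampH e (h n i k) \<in> H1 \<and> ift (\<phi> n i k) \<in> C0R"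
     if "i \<in> I" "k < m n i" for i k using *[OF that] dampH(1)[OF _ e] by auto
    show "(\<Sum>k<m n i. supnorm (ift (\<phi> n i k)) * L1norm (dampH e (h n i k))) <= c + ?e n" if i: "i \<in> I" for i
    proof (rule order_trans[OF sum_mono tot[OF i]])
     fix k assume "k \<in> {..<m n i}"
     then show "supnorm (ift (\<phi> n i k)) * L1norm (dampH e (h n i k)) <= supnorm (ift (\<phi> n i k)) * L1norm (h n i k)"
      using *[OF i, of k n] dampH(2)[OF _ e] C0R_subset_BUCR supnorm_nonneg by (intro mult_left_mono) auto
    qed
   qed
   finally show ?thesis .
  qed
  have "(\<lambda>n. op (damp e (b' n i)) (?y i)) ----> op (damp e (b i)) (?y i)" if i: "i \<in> I" for i
  proof -
   define K where "K = L1norm (ift (ak 0 k)) * (LBINT u. exp (- e * \<bar>u\<bar>)) * bnd * norm (x i)"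
   have "norm (op (damp e (b i)) (?y i) - op (damp e (b' n i)) (?y i)) <= ?e n * K" for n
   proof -
    define d where "d u = b i u - b' n i u" for u
    have ints: "L1 (b i)" "L1 (b' n i)" using b(1)[OF i] b'P[OF i] by (auto simp: PL1_def)
    have dP: "d \<in> PL1" using b(1)[OF i] b'P[OF i, of n] by (auto simp: PL1_def d_def[abs_def])
    have "ift d s = ift (b i) s - ift (b' n i) s" for s
     unfolding ift_def d_def left_diff_distrib using ints integrable_mult_cis[of _ s 0]
     by (intro bint_diff) auto
    then have dle: "cmod (ift d s) <= ?e n" for s
     using Nle_bound[OF rep_class_C0R N[OF i, of n], of s] by (simp add: b'ift[OF i])
    have dd: "damp e d = (\<lambda>u. damp e (b i) u - damp e (b' n i) u)"
     by (simp add: fun_eq_iff damp_def d_def right_diff_distrib)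
    have dPs: "damp e (b i) \<in> PL1" "damp e (b' n i) \<in> PL1" "damp e d \<in> PL1" "damp e (ak 0 k) \<in> PL1"
     using damp_PL1(1) b(1)[OF i] b'P[OF i] dP ak_PL1(1)[OF order_refl] e by auto
    have "op (damp e (b i)) (?y i) - op (damp e (b' n i)) (?y i) = op (damp e d) (?y i)"
     unfolding dd using dPs by (intro op_diff_left[symmetric]) (auto simp: PL1_def)
    also have "... = op (damp e (conv d (ak 0 k))) (x i)"
     using op_conv[OF dPs(4,3), of "x i"] op_commute[OF dPs(4,3), of "x i"] by (simp add: damp_conv)
    finally show ?thesis using op_damp_conv_ak[OF dP dle e, of k "x i"] by (simp add: K_def)
   qed
   then have "(\<lambda>n. op (damp e (b i)) (?y i) - op (damp e (b' n i)) (?y i)) ----> 0"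
    by (intro Lim_null_comparison[OF always_eventually tendsto_mult_left_zero[OF el]]) blast
   from tendsto_diff[OF tendsto_const[of "op (damp e (b i)) (?y i)"] this] show ?thesis by simp
  qed
  then have "(\<lambda>n. gam2 J I (\<lambda>i. op (damp e (b' n i)) (?y i))) ----> gam2 J I (\<lambda>i. op (damp e (b i)) (?y i))"
   by (rule gam2_tendsto[OF fin])
  moreover have "(\<lambda>n. (c + ?e n)^2 * ((C^2)^2 * gam2 J I ?y)) ----> (c + 0)^2 * ((C^2)^2 * gam2 J I ?y)"
   by (intro tendsto_intros el)
  ultimately show ?thesis using bound by (auto intro: LIMSEQ_le)
 qed
 have step2: "gam2 J I (\<lambda>i. op (b i) (op (ak 0 k) (x i))) <= c^2 * ((C^2)^2 * gam2 J I (\<lambda>i. op (ak 0 k) (x i)))" for k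
 proof (rule LIMSEQ_le)
  note cP = ak_PL1(1)[OF order_refl, of k]
  show "(\<lambda>n. gam2 J I (\<lambda>i. op (damp (?e n) (b i)) (op (damp (?e n) (ak 0 k)) (x i)))) ----> gam2 J I (\<lambda>i. op (b i) (op (ak 0 k) (x i)))"
  proof (rule gam2_tendsto[OF fin])
   fix i assume i: "i \<in> I"
   have "op (damp (?e n) (b i)) (op (damp (?e n) (ak 0 k)) (x i)) = op (damp (?e n) (conv (ak 0 k) (b i))) (x i)" for n
    using op_conv[OF damp_PL1(1)[OF b(1)[OF i]] damp_PL1(1)[OF cP], of "?e n" "?e n" "x i"] by (simp add: damp_conv)
   then show "(\<lambda>n. op (damp (?e n) (b i)) (op (damp (?e n) (ak 0 k)) (x i))) ----> op (b i) (op (ak 0 k) (x i))"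
    using op_damp_tendsto[OF conv_PL1[OF b(1)[OF i] cP], of "x i"] op_conv[OF b(1)[OF i] cP, of "x i"] by simp
  qed
  show "(\<lambda>n. c^2 * ((C^2)^2 * gam2 J I (\<lambda>i. op (damp (?e n) (ak 0 k)) (x i)))) ----> c^2 * ((C^2)^2 * gam2 J I (\<lambda>i. op (ak 0 k) (x i)))"
   by (intro tendsto_mult tendsto_const gam2_tendsto[OF fin] op_damp_tendsto cP)
 qed (use step1[OF ep] in blast)
 show ?thesis
 proof (rule LIMSEQ_le)
  show "(\<lambda>n. gam2 J I (\<lambda>i. op (b i) (op (ak 0 n) (x i)))) ----> gam2 J I (\<lambda>i. op (b i) (x i))"
  proof (rule gam2_tendsto[OF fin])
   fix i assume "i \<in> I"
   then have "bounded_linear (op (b i))" using cbounded_op_op[of "b i"] b(1)[of i] by (simp add: cbounded_op_def PL1_def)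
   then show "(\<lambda>n. op (b i) (op (ak 0 n) (x i))) ----> op (b i) (x i)"
    by (rule bounded_linear.tendsto[OF _ op_ak_tendsto[OF order_refl, simplified]])
  qed
  show "(\<lambda>n. c^2 * ((C^2)^2 * gam2 J I (\<lambda>i. op (ak 0 n) (x i)))) ----> c^2 * ((C^2)^2 * gam2 J I x)"
   by (intro tendsto_mult tendsto_const gam2_tendsto[OF fin] op_ak_tendsto[OF order_refl, simplified])
 qed (use step2 in blast)
qed

end

section \<open>The calculus on \<open>\<A>\<^sub>0\<close>\<close>

lemma ift_diff:
 assumes "a \<in> PL1" "b \<in> PL1"
 shows "(\<lambda>u. a u - b u) \<in> PL1" "ift (\<lambda>u. a u - b u) s = ift a s - ift b s"
 using assms integrable_mult_cis[of a s 0] integrable_mult_cis[of b s 0]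
 by (auto simp: PL1_def ift_def left_diff_distrib)

lemma ift_add:
 assumes "a \<in> PL1" "b \<in> PL1"
 shows "(\<lambda>u. a u + b u) \<in> PL1" "ift (\<lambda>u. a u + b u) s = ift a s + ift b s"
 using assms integrable_mult_cis[of a s 0] integrable_mult_cis[of b s 0]
 by (auto simp: PL1_def ift_def distrib_right)

lemma ift_scale:
 assumes "b \<in> PL1"
 shows "(\<lambda>u. c * b u) \<in> PL1" "ift (\<lambda>u. c * b u) s = c * ift b s"
 using assms by (auto simp: PL1_def ift_def mult.assoc)

lemma inverse_Suc_tendsto: "(\<lambda>n. 1 / real (Suc n)) ----> 0"
 using LIMSEQ_inverse_real_of_nat by (simp add: inverse_eq_divide)

definition apx :: "(real => complex) => nat => real => complex" where
 "apx F n = (SOME b. b \<in> PL1 \<and> Nle C0R (\<lambda>s. F s - ift b s) (1 / real (Suc n)))"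

lemma apx:
 assumes "Nle C0R F c"
 shows "apx F n \<in> PL1" "Nle C0R (\<lambda>s. F s - ift (apx F n) s) (1 / real (Suc n))"
  "Nle C0R (ift (apx F n)) (c + 1 / real (Suc n))"
proof -
 have "0 < 1 / real (Suc n)" by simp
 then have "\<exists>b. b \<in> PL1 \<and> Nle C0R (\<lambda>s. F s - ift b s) (1 / real (Suc n))"
  using Nle_C0R_dense[OF assms] by metis
 from someI_ex[OF this] show *: "apx F n \<in> PL1" "Nle C0R (\<lambda>s. F s - ift (apx F n) s) (1 / real (Suc n))"
  by (auto simp: apx_def)
 show "Nle C0R (ift (apx F n)) (c + 1 / real (Suc n))" using Nle_diff[OF rep_class_C0R assms *(2)] by simp
qed

context c0_semigroup
begin

definition R :: "(real => complex) => 'a => 'a" where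
 "R F x = lim (\<lambda>n. op (apx F n) x)"

lemma op_linear: "b \<in> PL1 ==> cbounded_op J (op b)" "b \<in> PL1 ==> bounded_linear (op b)"
 using cbounded_op_op[of b] by (auto simp: PL1_def cbounded_op_def)

end

context gamma_semigroup
begin

text \<open>The gamma estimate for a single index is a norm estimate; it makes \<open>op b\<close>
  depend continuously on \<open>ift b\<close> in the norm of the algebra, which is what allows
  extension by density.\<close>

lemma norm_op_le_Nle:
 assumes b: "b \<in> PL1" and c: "Nle C0R (ift b) c"
 shows "norm (op b x) <= C^2 * c * norm x"
proof -
 have c0: "0 <= c" by (rule Nle_nonneg[OF rep_class_C0R c])
 have "gam2 J {0::nat} (\<lambda>i. op b x) <= c^2 * ((C^2)^2 * gam2 J {0::nat} (\<lambda>_. x))"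
  by (rule gam2_op_le[OF _ c0]) (use b c in auto)
 then have "(norm (op b x))^2 <= (C^2 * c * norm x)^2"
  by (simp add: gam2_singleton power_mult_distrib mult_ac)
 moreover have "0 <= C^2 * c * norm x" using c0 by simp
 ultimately show ?thesis by (rule power2_le_imp_le)
qed

lemma norm_op_diff_le:
 assumes a: "a \<in> PL1" and b: "b \<in> PL1" and c: "Nle C0R (\<lambda>s. ift a s - ift b s) c"
 shows "norm (op a x - op b x) <= C^2 * c * norm x"
proof -
 have "norm (op (\<lambda>u. a u - b u) x) <= C^2 * c * norm x"
  by (rule norm_op_le_Nle) (use c ift_diff[OF a b] in \<open>simp_all add: fun_eq_iff[of "ift (\<lambda>u. a u - b u)" "\<lambda>s. ift a s - ift b s", THEN iffD2]\<close>)
 then show ?thesis using a b by (simp add: op_diff_left PL1_def)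
qed

lemma op_apx_convergent:
 assumes F: "Nle C0R F c"
 shows "(\<lambda>n. op (apx F n) x) ----> R F x"
proof -
 let ?e = "\<lambda>n. 1 / real (Suc n)"
 have d: "norm (op (apx F m) x - op (apx F n) x) <= C^2 * (?e n + ?e m) * norm x" for m n
 proof (rule norm_op_diff_le[OF apx(1)[OF F] apx(1)[OF F]])
  have "Nle C0R (\<lambda>s. (F s - ift (apx F n) s) - (F s - ift (apx F m) s)) (?e n + ?e m)"
   by (intro Nle_diff rep_class_C0R apx(2)[OF F])
  then show "Nle C0R (\<lambda>s. ift (apx F m) s - ift (apx F n) s) (?e n + ?e m)" by simp
 qed
 have "Cauchy (\<lambda>n. op (apx F n) x)" unfolding Cauchy_def
 proof (intro allI impI)
  fix \<epsilon> :: real assume \<epsilon>: "0 < \<epsilon>"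
  have "(\<lambda>n. 2 * C^2 * ?e n * norm x) ----> 2 * C^2 * 0 * norm x" by (intro tendsto_intros inverse_Suc_tendsto)
  from order_tendstoD(2)[OF this, of \<epsilon>] \<epsilon>
  have "eventually (\<lambda>n. 2 * C^2 * ?e n * norm x < \<epsilon>) sequentially" by simp
  then obtain M where M: "\<And>n. n \<ge> M ==> 2 * C^2 * ?e n * norm x < \<epsilon>"
   unfolding eventually_sequentially by blast
  have "dist (op (apx F m) x) (op (apx F n) x) < \<epsilon>" if "m \<ge> M" "n \<ge> M" for m n
  proof -
   have "?e n <= ?e M" "?e m <= ?e M" using that by (auto intro!: divide_left_mono)
   then have "?e n + ?e m <= 2 * ?e M" by linarith
   then have "C^2 * (?e n + ?e m) * norm x <= C^2 * (2 * ?e M) * norm x"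
    by (intro mult_right_mono mult_left_mono) auto
   then show ?thesis using d[of m n] M[OF order_refl] by (simp add: dist_norm mult_ac)
  qed
  then show "\<exists>M. \<forall>m\<ge>M. \<forall>n\<ge>M. dist (op (apx F m) x) (op (apx F n) x) < \<epsilon>" by blast
 qed
 then show ?thesis unfolding R_def by (simp add: Cauchy_convergent_iff convergent_LIMSEQ_iff)
qed

lemma R_op_diff_le:
 assumes F: "Nle C0R F c'" and b: "b \<in> PL1" and c: "Nle C0R (\<lambda>s. F s - ift b s) c"
 shows "norm (R F x - op b x) <= C^2 * c * norm x"
proof (rule LIMSEQ_le)
 let ?e = "\<lambda>n. 1 / real (Suc n)"
 show "(\<lambda>n. norm (op (apx F n) x - op b x)) ----> norm (R F x - op b x)"
  by (intro tendsto_intros op_apx_convergent[OF F])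
 have "(\<lambda>n. C^2 * (c + ?e n) * norm x) ----> C^2 * (c + 0) * norm x"
  by (intro tendsto_intros inverse_Suc_tendsto)
 then show "(\<lambda>n. C^2 * (c + ?e n) * norm x) ----> C^2 * c * norm x" by simp
 have "norm (op (apx F n) x - op b x) <= C^2 * (c + ?e n) * norm x" for n
 proof (rule norm_op_diff_le[OF apx(1)[OF F] b])
  have "Nle C0R (\<lambda>s. (F s - ift b s) - (F s - ift (apx F n) s)) (c + ?e n)"
   by (intro Nle_diff rep_class_C0R apx(2)[OF F] c)
  then show "Nle C0R (\<lambda>s. ift (apx F n) s - ift b s) (c + ?e n)" by simp
 qed
 then show "\<exists>N. \<forall>n\<ge>N. norm (op (apx F n) x - op b x) <= C^2 * (c + ?e n) * norm x" by blast
qed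

text \<open>The limit does not depend on the chosen approximants, so sums, multiples and
  convolutions of them may be used to compute \<open>R\<close>.\<close>

lemma op_tendsto_R:
 assumes F: "Nle C0R F c'" and b: "\<And>n. b n \<in> PL1" and c: "\<And>n. Nle C0R (\<lambda>s. F s - ift (b n) s) (c n)" "c ----> 0"
 shows "(\<lambda>n. op (b n) x) ----> R F x"
proof -
 have "(\<lambda>n. C^2 * c n * norm x) ----> 0" by (intro tendsto_mult_left_zero tendsto_mult_right_zero c)
 then have "(\<lambda>n. R F x - op (b n) x) ----> 0"
  by (rule Lim_null_comparison[rotated]) (use R_op_diff_le[OF F b c(1)] in simp)
 from tendsto_diff[OF tendsto_const[of "R F x"] this] show ?thesis by simp
qed

lemma R_ift:
 assumes "b \<in> PL1" "Nle C0R (ift b) c"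
 shows "R (ift b) = op b"
proof
 show "R (ift b) x = op b x" for x
  using R_op_diff_le[OF assms(2,1), of 0 x] Nle_zero[OF rep_class_C0R] by simp
qed

lemma op_eq_of_ift:
 assumes "a \<in> PL1" "b \<in> PL1" "ift a = ift b"
 shows "op a = op b"
proof
 show "op a x = op b x" for x
  using norm_op_diff_le[OF assms(1,2), of 0 x] Nle_zero[OF rep_class_C0R] assms(3) by simp
qed

lemma norm_R_le:
 assumes F: "Nle C0R F c"
 shows "norm (R F x) <= C^2 * c * norm x"
proof -
 have z: "(\<lambda>_. 0) \<in> PL1" "ift (\<lambda>_. 0) s = 0" for s by (auto simp: PL1_def ift_def)
 have "op (\<lambda>_. 0) x = 0" using op_scale_left[of "\<lambda>_. 0" 0 x] by simp
 then show ?thesis using R_op_diff_le[OF F z(1), of c x] F by (simp add: z(2))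
qed

lemma R_cbounded:
 assumes F: "Nle C0R F c"
 shows "cbounded_op J (R F)"
proof -
 note lim = op_apx_convergent[OF F]
 note bl = op_linear(2)[OF apx(1)[OF F]]
 have "R F (x + y) = R F x + R F y" for x y
 proof (rule LIMSEQ_unique[OF lim])
  show "(\<lambda>n. op (apx F n) (x + y)) ----> R F x + R F y"
   using tendsto_add[OF lim lim, of x y] by (simp add: linear_simps(1)[OF bl])
 qed
 moreover have "R F (r *\<^sub>R x) = r *\<^sub>R R F x" for r x
 proof (rule LIMSEQ_unique[OF lim])
  show "(\<lambda>n. op (apx F n) (r *\<^sub>R x)) ----> r *\<^sub>R R F x"
   using tendsto_scaleR[OF tendsto_const lim, of r x] by (simp add: linear_simps(5)[OF bl])
 qed
 ultimately have "bounded_linear (R F)"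
  by (rule bounded_linear_intro[where K = "C^2 * c"]) (use norm_R_le[OF F] in \<open>simp add: mult_ac\<close>)
 moreover have "R F (J x) = J (R F x)" for x
 proof (rule LIMSEQ_unique[OF lim])
  show "(\<lambda>n. op (apx F n) (J x)) ----> J (R F x)"
   using J.tendsto[OF lim, of x] op_linear(1)[OF apx(1)[OF F]] by (simp add: cbounded_op_def)
 qed
 ultimately show ?thesis by (simp add: cbounded_op_def)
qed

lemma R_add:
 assumes F: "Nle C0R F c" and G: "Nle C0R G d"
 shows "R (\<lambda>s. F s + G s) x = R F x + R G x"
proof (rule LIMSEQ_unique)
 let ?b = "\<lambda>n u. apx F n u + apx G n u"
 show "(\<lambda>n. op (?b n) x) ----> R (\<lambda>s. F s + G s) x"
 proof (rule op_tendsto_R[OF Nle_add[OF rep_class_C0R F G] ift_add(1)[OF apx(1)[OF F] apx(1)[OF G]]])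
  show "Nle C0R (\<lambda>s. F s + G s - ift (?b n) s) (1 / real (Suc n) + 1 / real (Suc n))" for n
   using Nle_add[OF rep_class_C0R apx(2)[OF F] apx(2)[OF G], of n n]
   by (simp add: ift_add(2)[OF apx(1)[OF F] apx(1)[OF G]] algebra_simps del: of_nat_Suc)
  show "(\<lambda>n. 1 / real (Suc n) + 1 / real (Suc n)) ----> 0"
   using tendsto_add[OF inverse_Suc_tendsto inverse_Suc_tendsto] by simp
 qed
 have "op (?b n) x = op (apx F n) x + op (apx G n) x" for n
  using apx(1)[OF F] apx(1)[OF G] by (intro op_add_left) (auto simp: PL1_def)
 then show "(\<lambda>n. op (?b n) x) ----> R F x + R G x"
  using tendsto_add[OF op_apx_convergent[OF F] op_apx_convergent[OF G]] by simp
qed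

lemma R_scale:
 assumes F: "Nle C0R F c"
 shows "R (\<lambda>s. a * F s) x = a *\<^sub>J R F x"
proof (rule LIMSEQ_unique)
 let ?b = "\<lambda>n u. a * apx F n u"
 show "(\<lambda>n. op (?b n) x) ----> R (\<lambda>s. a * F s) x"
 proof (rule op_tendsto_R[OF Nle_scale[OF rep_class_C0R F] ift_scale(1)[OF apx(1)[OF F]]])
  show "Nle C0R (\<lambda>s. a * F s - ift (?b n) s) (cmod a * (1 / real (Suc n)))" for n
   using Nle_scale[OF rep_class_C0R apx(2)[OF F], of a n]
   by (simp add: ift_scale(2)[OF apx(1)[OF F]] right_diff_distrib del: of_nat_Suc)
  show "(\<lambda>n. cmod a * (1 / real (Suc n))) ----> 0" by (intro tendsto_mult_right_zero inverse_Suc_tendsto)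
 qed
 have "op (?b n) x = a *\<^sub>J op (apx F n) x" for n
  using apx(1)[OF F] by (intro op_scale_left) (auto simp: PL1_def)
 then show "(\<lambda>n. op (?b n) x) ----> a *\<^sub>J R F x"
  using B.tendsto[OF tendsto_const op_apx_convergent[OF F]] by simp
qed

lemma R_mult:
 assumes F: "Nle C0R F c" and G: "Nle C0R G d"
 shows "R (\<lambda>s. F s * G s) x = R F (R G x)"
proof (rule LIMSEQ_unique)
 let ?e = "\<lambda>n. 1 / real (Suc n)"
 let ?a = "apx F" and ?b = "apx G"
 note S = rep_class_C0R
 note aP = apx(1)[OF F] and bP = apx(1)[OF G]
 have e: "0 < ?e n" for n by simp
 have Fc: "0 <= c" by (rule Nle_nonneg[OF S F])
 show "(\<lambda>n. op (conv (?b n) (?a n)) x) ----> R (\<lambda>s. F s * G s) x"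
 proof (rule op_tendsto_R[OF Nle_mult[OF S F Nle_C0R_BUCR[OF G] zero_less_one] conv_PL1[OF aP bP]])
  fix n
  \<comment> \<open>The product error is split as \<open>F * (G - b) + (F - a) * b\<close>; the two
    extra summands \<open>?e n\<close> are the slack of the product estimate.\<close>
  have "Nle C0R (\<lambda>s. F s * (G s - ift (?b n) s) + (F s - ift (?a n) s) * ift (?b n) s)
    ((c * ?e n + ?e n) + (?e n * (d + ?e n) + ?e n))"
   by (intro Nle_add Nle_mult S F Nle_C0R_BUCR[OF apx(2)[OF G]] Nle_C0R_BUCR[OF apx(3)[OF G]] apx(2)[OF F] e)
  moreover have "ift (conv (?b n) (?a n)) s = ift (?a n) s * ift (?b n) s" for s
   using aP bP by (intro ift_conv) (auto simp: PL1_def)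
  ultimately show "Nle C0R (\<lambda>s. F s * G s - ift (conv (?b n) (?a n)) s)
    ((c * ?e n + ?e n) + (?e n * (d + ?e n) + ?e n))" by (simp add: algebra_simps del: of_nat_Suc)
 next
  have "(\<lambda>n. (c * ?e n + ?e n) + (?e n * (d + ?e n) + ?e n)) ----> (c * 0 + 0) + (0 * (d + 0) + 0)"
   by (intro tendsto_intros inverse_Suc_tendsto)
  then show "(\<lambda>n. (c * ?e n + ?e n) + (?e n * (d + ?e n) + ?e n)) ----> 0" by simp
 qed
 have eq: "op (conv (?b n) (?a n)) x = op (?a n) (op (?b n) x - R G x) + op (?a n) (R G x)" for n
  using op_conv[OF aP bP] by (simp flip: linear_simps(1)[OF op_linear(2)[OF aP]])
 have "(\<lambda>n. C^2 * (c + 1) * norm (op (?b n) x - R G x)) ----> 0"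
  by (intro tendsto_mult_right_zero tendsto_norm_zero LIM_zero op_apx_convergent[OF G])
 then have "(\<lambda>n. op (?a n) (op (?b n) x - R G x)) ----> 0"
 proof (rule Lim_null_comparison[rotated])
  have "norm (op (?a n) y) <= C^2 * (c + 1) * norm y" for n y
   by (rule norm_op_le_Nle[OF aP Nle_mono[OF apx(3)[OF F]]]) simp
  then show "\<forall>\<^sub>F n in sequentially. norm (op (?a n) (op (?b n) x - R G x)) <= C^2 * (c + 1) * norm (op (?b n) x - R G x)"
   by simp
 qed
 from tendsto_add[OF this op_apx_convergent[OF F, of "R G x"]]
 show "(\<lambda>n. op (conv (?b n) (?a n)) x) ----> R F (R G x)" by (simp add: eq)
qed

lemma gam2_R_le:
 fixes x :: "'i::countable => 'a"
 assumes fin: "finite I" and c: "0 <= c" and F: "\<And>i. i \<in> I ==> Nle C0R (F i) c"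
 shows "gam2 J I (\<lambda>i. R (F i) (x i)) <= c^2 * ((C^2)^2 * gam2 J I x)"
proof (rule LIMSEQ_le)
 show "(\<lambda>n. gam2 J I (\<lambda>i. op (apx (F i) n) (x i))) ----> gam2 J I (\<lambda>i. R (F i) (x i))"
  by (rule gam2_tendsto[OF fin op_apx_convergent[OF F]])
 have "(\<lambda>n. (c + 1 / real (Suc n))^2 * ((C^2)^2 * gam2 J I x)) ----> (c + 0)^2 * ((C^2)^2 * gam2 J I x)"
  by (intro tendsto_intros inverse_Suc_tendsto)
 then show "(\<lambda>n. (c + 1 / real (Suc n))^2 * ((C^2)^2 * gam2 J I x)) ----> c^2 * ((C^2)^2 * gam2 J I x)" by simp
 have "gam2 J I (\<lambda>i. op (apx (F i) n) (x i)) <= (c + 1 / real (Suc n))^2 * ((C^2)^2 * gam2 J I x)" for n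
  by (rule gam2_op_le[OF fin _ apx(1)[OF F] apx(3)[OF F]]) (use c in auto)
 then show "\<exists>N. \<forall>n\<ge>N. gam2 J I (\<lambda>i. op (apx (F i) n) (x i)) <= (c + 1 / real (Suc n))^2 * ((C^2)^2 * gam2 J I x)"
  by blast
qed

end

subsection \<open>The norms on the half-plane\<close>

lemma Anorm_le:
 assumes S: "rep_class S" and F: "Nle S F c"
 shows "Anorm S F <= c"
proof -
 obtain f h where rep: "is_rep S F f h" and c: "(\<Sum>k. supnorm (f k) * L1norm (h k)) <= c"
  using F by (auto simp: Nle_def)
 have "Anorm S F <= (\<Sum>k. supnorm (f k) * L1norm (h k))" unfolding Anorm_def
 proof (rule cInf_lower)
  show "bdd_below {\<Sum>k. supnorm (f k) * L1norm (h k) |f h. is_rep S F f h}"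
   by (rule bdd_belowI[of _ 0]) (auto intro!: suminf_nonneg rep_nonneg[OF S] simp: is_rep_def)
 qed (use rep in blast)
 with c show ?thesis by simp
qed

lemma Anorm_less:
 assumes "F \<in> Aspace S" "Anorm S F < c"
 shows "Nle S F c"
proof -
 have "{\<Sum>k. supnorm (f k) * L1norm (h k) |f h. is_rep S F f h} \<noteq> {}" using assms(1) by (auto simp: Aspace_def)
 from cInf_lessD[OF this assms(2)[unfolded Anorm_def]] show ?thesis by (auto simp: Nle_def intro: less_imp_le)
qed

lemma Anorm_nonneg:
 assumes S: "rep_class S" and F: "F \<in> Aspace S"
 shows "0 <= Anorm S F" unfolding Anorm_def
 by (rule cInf_greatest) (use F in \<open>auto simp: Aspace_def intro!: suminf_nonneg rep_nonneg[OF S] simp: is_rep_def\<close>)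

lemma AnormC_le:
 assumes S: "rep_class S" and F: "Nle S F c"
 shows "tilde F \<in> AspaceC S" "AnormC S (tilde F) <= c"
proof -
 have FA: "F \<in> Aspace S" using F by (auto simp: Aspace_iff_Nle)
 then show "tilde F \<in> AspaceC S" by (simp add: AspaceC_def)
 have "AnormC S (tilde F) <= Anorm S F" unfolding AnormC_def
 proof (rule cInf_lower)
  show "bdd_below {Anorm S F' |F'. F' \<in> Aspace S \<and> tilde F' = tilde F}"
   by (rule bdd_belowI[of _ 0]) (auto intro: Anorm_nonneg[OF S])
 qed (use FA in blast)
 then show "AnormC S (tilde F) <= c" using Anorm_le[OF S F] by simp
qed

text \<open>Injectivity of the Poisson extension leaves a single preimage, so the infimum over
  preimages is one over the representations of \<open>F\<close>.\<close>

lemma AnormC_less: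
 assumes S: "rep_class S" and G: "tilde F \<in> AspaceC S" "AnormC S (tilde F) < c" and F: "bdd_cont F"
 shows "Nle S F c"
proof -
 have "{Anorm S F' |F'. F' \<in> Aspace S \<and> tilde F' = tilde F} \<noteq> {}" using G(1) by (auto simp: AspaceC_def)
 from cInf_lessD[OF this G(2)[unfolded AnormC_def]]
 obtain F' where F': "F' \<in> Aspace S" "tilde F' = tilde F" "Anorm S F' < c" by auto
 then have N: "Nle S F' c" by (simp add: Anorm_less)
 have "F' = F" by (rule tilde_inj[OF Nle_bdd_cont[OF S N] F F'(2)])
 with N show ?thesis by simp
qed

lemma AspaceC_E:
 assumes S: "rep_class S" and G: "G \<in> AspaceC S"
 obtains F where "G = tilde F" "bdd_cont F" "\<And>c. AnormC S G < c ==> Nle S F c"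
proof -
 obtain F where F: "F \<in> Aspace S" "G = tilde F" using G by (auto simp: AspaceC_def)
 then have b: "bdd_cont F" using Nle_bdd_cont[OF S] by (auto simp: Aspace_iff_Nle)
 show thesis by (rule that[OF F(2) b]) (use AnormC_less[OF S _ _ b] G F in auto)
qed

text \<open>Infima need not be attained; this passes from every cost above the norm to the norm
  itself.\<close>

lemma le_mult_greater:
 fixes y K a :: real
 assumes "\<And>c. a < c ==> y <= K * c"
 shows "y <= K * a"
proof (rule LIMSEQ_le_const)
 have "(\<lambda>n. K * (a + 1 / real (Suc n))) ----> K * (a + 0)" by (intro tendsto_intros inverse_Suc_tendsto)
 then show "(\<lambda>n. K * (a + 1 / real (Suc n))) ----> K * a" by simp
qed (use assms in auto)

lemma AnormC_nonneg:
 assumes S: "rep_class S" and G: "G \<in> AspaceC S"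
 shows "0 <= AnormC S G"
proof (rule AspaceC_E[OF S G])
 fix F assume N: "\<And>c. AnormC S G < c ==> Nle S F c"
 have "0 <= 1 * AnormC S G" by (rule le_mult_greater) (use Nle_nonneg[OF S N] in simp)
 then show ?thesis by simp
qed

lemma AspaceC_add:
 assumes S: "rep_class S" and F: "F \<in> AspaceC S" and G: "G \<in> AspaceC S"
 shows "(\<lambda>z. F z + G z) \<in> AspaceC S"
proof (rule AspaceC_E[OF S F], rule AspaceC_E[OF S G])
 fix f g assume f: "F = tilde f" "bdd_cont f" "\<And>c. AnormC S F < c ==> Nle S f c"
  and g: "G = tilde g" "bdd_cont g" "\<And>c. AnormC S G < c ==> Nle S g c"
 have "Nle S (\<lambda>s. f s + g s) ((AnormC S F + 1) + (AnormC S G + 1))"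
  by (intro Nle_add S f(3) g(3)) auto
 from AnormC_le(1)[OF S this] show ?thesis by (simp add: f g tilde_add)
qed

lemma AspaceC_scale:
 assumes S: "rep_class S" and F: "F \<in> AspaceC S"
 shows "(\<lambda>z. a * F z) \<in> AspaceC S"
proof (rule AspaceC_E[OF S F])
 fix f assume f: "F = tilde f" "\<And>c. AnormC S F < c ==> Nle S f c"
 have "Nle S (\<lambda>s. a * f s) (cmod a * (AnormC S F + 1))" by (intro Nle_scale S f) auto
 from AnormC_le(1)[OF S this] show ?thesis by (simp add: f(1) tilde_scale)
qed

text \<open>For \<open>S\<close> equal to \<open>C0R\<close> this is the ideal property, for
  \<open>S\<close> equal to \<open>BUCR\<close> the algebra property. The slack in the product
  estimate disappears in the infimum, so the norm is submultiplicative with constant one.\<close>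

lemma AspaceC_mult:
 assumes S: "rep_class S" and SB: "\<And>F c. Nle S F c ==> Nle BUCR F c"
  and F: "F \<in> AspaceC BUCR" and G: "G \<in> AspaceC S"
 shows "(\<lambda>z. F z * G z) \<in> AspaceC S" "AnormC S (\<lambda>z. F z * G z) <= AnormC BUCR F * AnormC S G"
proof -
 have "(\<lambda>z. F z * G z) \<in> AspaceC S \<and> AnormC S (\<lambda>z. F z * G z) <= AnormC BUCR F * AnormC S G"
 proof (rule AspaceC_E[OF rep_class_BUCR F], rule AspaceC_E[OF S G])
  fix f g assume f: "F = tilde f" "\<And>c. AnormC BUCR F < c ==> Nle BUCR f c"
   and g: "G = tilde g" "\<And>c. AnormC S G < c ==> Nle S g c"
  let ?e = "\<lambda>n. 1 / real (Suc n)"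
  have e: "0 < ?e n" for n by simp
  have N: "Nle BUCR f (AnormC BUCR F + ?e n)" "Nle S g (AnormC S G + ?e n)" for n
   using e by (intro f(2) g(2); simp)+
  have eq: "(\<lambda>z. F z * G z) = tilde (\<lambda>s. g s * f s)"
   using tilde_mult[OF N(1) SB[OF N(2)]] f(1) g(1) by (simp add: mult.commute)
  have P: "Nle S (\<lambda>s. g s * f s) ((AnormC S G + ?e n) * (AnormC BUCR F + ?e n) + ?e n)" for n
   by (rule Nle_mult[OF S N(2) N(1) e])
  have "AnormC S (\<lambda>z. F z * G z) <= AnormC BUCR F * AnormC S G"
  proof (rule LIMSEQ_le_const)
   have "(\<lambda>n. (AnormC S G + ?e n) * (AnormC BUCR F + ?e n) + ?e n) ----> (AnormC S G + 0) * (AnormC BUCR F + 0) + 0"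
    by (intro tendsto_intros inverse_Suc_tendsto)
   then show "(\<lambda>n. (AnormC S G + ?e n) * (AnormC BUCR F + ?e n) + ?e n) ----> AnormC BUCR F * AnormC S G"
    by (simp add: mult.commute)
  qed (use AnormC_le(2)[OF S P] eq in auto)
  with AnormC_le(1)[OF S P] eq show ?thesis by simp
 qed
 then show "(\<lambda>z. F z * G z) \<in> AspaceC S" "AnormC S (\<lambda>z. F z * G z) <= AnormC BUCR F * AnormC S G" by simp_all
qed

lemma AspaceC_C0R_BUCR:
 assumes G: "G \<in> AspaceC C0R"
 shows "G \<in> AspaceC BUCR" "AnormC BUCR G <= AnormC C0R G"
proof -
 have "G \<in> AspaceC BUCR \<and> AnormC BUCR G <= 1 * AnormC C0R G"
 proof (rule AspaceC_E[OF rep_class_C0R G])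
  fix F assume F: "G = tilde F" "\<And>c. AnormC C0R G < c ==> Nle C0R F c"
  have N: "Nle BUCR F c" if "AnormC C0R G < c" for c by (rule Nle_C0R_BUCR[OF F(2)[OF that]])
  have "AnormC BUCR G <= 1 * AnormC C0R G"
   by (rule le_mult_greater) (use AnormC_le(2)[OF rep_class_BUCR N] F(1) in simp)
  moreover have "G \<in> AspaceC BUCR" using AnormC_le(1)[OF rep_class_BUCR N[OF less_add_one]] F(1) by simp
  ultimately show ?thesis by simp
 qed
 then show "G \<in> AspaceC BUCR" "AnormC BUCR G <= AnormC C0R G" by simp_all
qed

text \<open>Bridges two conventions: gamma-boundedness admits any real constant,
  \<open>gamma_const\<close> only nonnegative ones.\<close>

lemma gamma_ineq_max: "gamma_ineq J \<T> C ==> gamma_ineq J \<T> (max C 0)"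
proof -
 assume *: "gamma_ineq J \<T> C"
 have "0 <= gauss_norm J xs" for xs unfolding gauss_norm_def by simp
 then have "C * gauss_norm J xs <= max C 0 * gauss_norm J xs" for xs by (simp add: mult_right_mono)
 then show ?thesis using * unfolding gamma_ineq_def by (meson order_trans)
qed

text \<open>The transform of an integrable function is handled separately, so that \<open>L\<^sub>b \<in> \<A>\<^sub>0\<close> need not
 be proved.\<close>

definition (in c0_semigroup) rho :: "(complex => complex) => 'a => 'a" where
 "rho G = (if G \<in> AspaceC C0R then R (SOME F. F \<in> Aspace C0R \<and> tilde F = G)
  else op (SOME b. b \<in> PL1 \<and> tilde (ift b) = G))"

context gamma_semigroup
begin

lemma rho_tilde:
 assumes F: "Nle C0R F c"
 shows "rho (tilde F) = R F"
proof -
 let ?F = "SOME F'. F' \<in> Aspace C0R \<and> tilde F' = tilde F"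
 have FA: "F \<in> Aspace C0R" using F by (auto simp: Aspace_iff_Nle)
 then have *: "?F \<in> Aspace C0R \<and> tilde ?F = tilde F" by (rule_tac someI[of _ F]) simp
 then obtain c' where "Nle C0R ?F c'" unfolding Aspace_iff_Nle by blast
 from tilde_inj[OF Nle_bdd_cont[OF rep_class_C0R this] Nle_bdd_cont[OF rep_class_C0R F]] *
 have "?F = F" by blast
 then show ?thesis using FA by (simp add: rho_def AspaceC_def)
qed

lemma rho_tilde_ift:
 assumes b: "b \<in> PL1"
 shows "rho (tilde (ift b)) = op b"
proof -
 have bc: "bdd_cont (ift b')" if "b' \<in> PL1" for b' using that by (intro ift_bdd_cont) (simp add: PL1_def)
 show ?thesis
 proof (cases "tilde (ift b) \<in> AspaceC C0R")
  case True
  then have "Nle C0R (ift b) (AnormC C0R (tilde (ift b)) + 1)" by (intro AnormC_less rep_class_C0R bc b) auto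
  then show ?thesis using rho_tilde R_ift b by simp
 next
  case False
  let ?b = "SOME b'. b' \<in> PL1 \<and> tilde (ift b') = tilde (ift b)"
  have *: "?b \<in> PL1 \<and> tilde (ift ?b) = tilde (ift b)" by (rule someI[of _ b]) (simp add: b)
  from * have "ift ?b = ift b" using tilde_inj[OF bc bc[OF b], of ?b] by blast
  with * have "op ?b = op b" using op_eq_of_ift[OF _ b] by blast
  then show ?thesis using False by (simp add: rho_def)
 qed
qed

lemma norm_rho_le:
 assumes G: "G \<in> AspaceC C0R"
 shows "norm (rho G x) <= C^2 * AnormC C0R G * norm x"
proof (rule AspaceC_E[OF rep_class_C0R G])
 fix F assume F: "G = tilde F" "\<And>c. AnormC C0R G < c ==> Nle C0R F c"
 have "norm (rho G x) <= C^2 * norm x * AnormC C0R G"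
  by (rule le_mult_greater) (use norm_R_le[OF F(2)] rho_tilde[OF F(2)] F(1) in \<open>simp add: mult_ac\<close>)
 then show ?thesis by (simp add: mult_ac)
qed

lemma gam2_rho_le:
 fixes x :: "'i::countable => 'a"
 assumes fin: "finite I" and G: "\<And>i. i \<in> I ==> G i \<in> unit_ball (AspaceC C0R) (AnormC C0R)"
 shows "gam2 J I (\<lambda>i. rho (G i) (x i)) <= (C^2)^2 * gam2 J I x"
proof (rule LIMSEQ_le_const)
 let ?e = "\<lambda>n. 1 / real (Suc n)"
 have "(\<lambda>n. (1 + ?e n)^2 * ((C^2)^2 * gam2 J I x)) ----> (1 + 0)^2 * ((C^2)^2 * gam2 J I x)"
  by (intro tendsto_intros inverse_Suc_tendsto)
 then show "(\<lambda>n. (1 + ?e n)^2 * ((C^2)^2 * gam2 J I x)) ----> (C^2)^2 * gam2 J I x" by simp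
 have "\<exists>F. \<forall>c>1. Nle C0R F c \<and> G i = tilde F" if "i \<in> I" for i
 proof (rule AspaceC_E[OF rep_class_C0R, of "G i"])
  show "G i \<in> AspaceC C0R" using G[OF that] by (simp add: unit_ball_def)
  fix F assume "G i = tilde F" "\<And>c. AnormC C0R (G i) < c ==> Nle C0R F c"
  then show ?thesis using G[OF that] by (intro exI[of _ F]) (auto simp: unit_ball_def)
 qed
 from bchoice[OF ballI[OF this]]
 obtain F where F: "\<forall>i\<in>I. \<forall>c>1. Nle C0R (F i) c \<and> G i = tilde (F i)" ..
 have "gam2 J I (\<lambda>i. rho (G i) (x i)) <= (1 + ?e n)^2 * ((C^2)^2 * gam2 J I x)" for n
 proof -
  have N: "Nle C0R (F i) (1 + ?e n)" "G i = tilde (F i)" if "i \<in> I" for i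
   using bspec[OF F that] by (auto dest: spec[of _ "1 + ?e n"])
  have "gam2 J I (\<lambda>i. rho (G i) (x i)) = gam2 J I (\<lambda>i. R (F i) (x i))"
   by (rule gam2_cong) (use N rho_tilde[OF N(1)] in simp)
  also have "... <= (1 + ?e n)^2 * ((C^2)^2 * gam2 J I x)" by (rule gam2_R_le[OF fin _ N(1)]) auto
  finally show ?thesis .
 qed
 then show "\<exists>N. \<forall>n\<ge>N. gam2 J I (\<lambda>i. rho (G i) (x i)) <= (1 + ?e n)^2 * ((C^2)^2 * gam2 J I x)" by blast
qed

lemma gamma_ineq_rho: "gamma_ineq J (rho ` unit_ball (AspaceC C0R) (AnormC C0R)) (C^2)"
proof (rule gam2_gamma_ineq)
 fix n :: nat and S x assume "\<And>i. i < n ==> S i \<in> rho ` unit_ball (AspaceC C0R) (AnormC C0R)"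
 then have "\<forall>i. \<exists>G. i < n \<longrightarrow> G \<in> unit_ball (AspaceC C0R) (AnormC C0R) \<and> S i = rho G" by blast
 then obtain G where G: "\<And>i. i < n ==> G i \<in> unit_ball (AspaceC C0R) (AnormC C0R) \<and> S i = rho (G i)" by metis
 have "gam2 J {..<n} (\<lambda>i. S i (x i)) = gam2 J {..<n} (\<lambda>i. rho (G i) (x i))"
  by (rule gam2_cong) (use G in simp)
 also have "... <= (C^2)^2 * gam2 J {..<n} x" by (rule gam2_rho_le) (use G in auto)
 finally show "gam2 J {..<n} (\<lambda>i. S i (x i)) <= (C^2)^2 * gam2 J {..<n} x" .
qed simp

lemma rho_cbounded:
 assumes "G \<in> AspaceC C0R"
 shows "cbounded_op J (rho G)"
proof (rule AspaceC_E[OF rep_class_C0R assms])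
 fix F assume F: "G = tilde F" "\<And>c. AnormC C0R G < c ==> Nle C0R F c"
 show ?thesis using R_cbounded[OF F(2)[OF less_add_one]] rho_tilde[OF F(2)[OF less_add_one]] F(1) by simp
qed

lemma onorm_rho_le:
 assumes G: "G \<in> AspaceC C0R"
 shows "onorm (rho G) <= C^2 * AnormC C0R G"
 by (rule onorm_bound) (use norm_rho_le[OF G] AnormC_nonneg[OF rep_class_C0R G] in auto)

theorem rho0_prop_rho: "rho0_prop J T rho" unfolding rho0_prop_def
proof (intro conjI allI impI)
 note S = rep_class_C0R
 show "bounded_hom J (AspaceC C0R) (AnormC C0R) rho" unfolding bounded_hom_def
 proof (intro conjI ballI allI)
  fix F G assume F: "F \<in> AspaceC C0R" and G: "G \<in> AspaceC C0R"
  show "rho (\<lambda>z. F z + G z) = (\<lambda>x. rho F x + rho G x)"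
  proof (rule AspaceC_E[OF S F], rule AspaceC_E[OF S G])
   fix f g assume f: "F = tilde f" "bdd_cont f" "\<And>c. AnormC C0R F < c ==> Nle C0R f c"
    and g: "G = tilde g" "bdd_cont g" "\<And>c. AnormC C0R G < c ==> Nle C0R g c"
   note N = f(3)[OF less_add_one] g(3)[OF less_add_one]
   show ?thesis using rho_tilde[OF N(1)] rho_tilde[OF N(2)] rho_tilde[OF Nle_add[OF S N]] R_add[OF N]
    by (simp add: f g fun_eq_iff tilde_add)
  qed
  show "rho (\<lambda>z. F z * G z) = rho F \<circ> rho G"
  proof (rule AspaceC_E[OF S F], rule AspaceC_E[OF S G])
   fix f g assume f: "F = tilde f" "\<And>c. AnormC C0R F < c ==> Nle C0R f c"
    and g: "G = tilde g" "\<And>c. AnormC C0R G < c ==> Nle C0R g c"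
   note N = f(2)[OF less_add_one] g(2)[OF less_add_one]
   show ?thesis
    using rho_tilde[OF N(1)] rho_tilde[OF N(2)] rho_tilde[OF Nle_mult[OF S N(1) Nle_C0R_BUCR[OF N(2)] zero_less_one]]
     R_mult[OF N] tilde_mult[OF Nle_C0R_BUCR[OF N(1)] Nle_C0R_BUCR[OF N(2)]]
    by (simp add: f(1) g(1) fun_eq_iff)
  qed
 next
  fix c F assume F: "F \<in> AspaceC C0R"
  show "rho (\<lambda>z. c * F z) = (\<lambda>x. c *\<^sub>J rho F x)"
  proof (rule AspaceC_E[OF S F])
   fix f assume f: "F = tilde f" "\<And>c. AnormC C0R F < c ==> Nle C0R f c"
   note N = f(2)[OF less_add_one]
   show ?thesis using rho_tilde[OF N] rho_tilde[OF Nle_scale[OF S N]] R_scale[OF N]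
    by (simp add: f(1) fun_eq_iff tilde_scale)
  qed
 qed (use rho_cbounded onorm_rho_le in auto)
 show "gamma_bounded_map J (AspaceC C0R) (AnormC C0R) rho" unfolding gamma_bounded_map_def gamma_bounded_def
 proof (intro conjI ballI exI)
  show "gamma_ineq J (rho ` unit_ball (AspaceC C0R) (AnormC C0R)) (C^2)" by (rule gamma_ineq_rho)
  show "onorm S <= C^2" if "S \<in> rho ` unit_ball (AspaceC C0R) (AnormC C0R)" for S
  proof -
   obtain G where G: "S = rho G" "G \<in> AspaceC C0R" "AnormC C0R G <= 1" using \<open>S \<in> _\<close> by (auto simp: unit_ball_def)
   then show ?thesis using onorm_rho_le[OF G(2)] mult_left_mono[OF G(3), of "C^2"] by simp
  qed
 qed (auto simp: unit_ball_def rho_cbounded)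
 fix b :: "real => complex" assume b: "set_integrable lborel {0..} b"
 show "rho (laplace b) = (\<lambda>x. integral {0..} (\<lambda>t. b t *\<^sub>J T t x))"
  using rho_tilde_ift[OF laplace_eq_tilde(1)[OF b]]
  by (simp add: laplace_eq_tilde(2)[OF b] integral_eq_op fun_eq_iff)
qed

end

section \<open>Homomorphisms of the half-plane algebras\<close>

abbreviation (input) "A0 \<equiv> AspaceC C0R"
abbreviation (input) "N0 \<equiv> AnormC C0R"
abbreviation (input) "A1 \<equiv> AspaceC BUCR"
abbreviation (input) "N1 \<equiv> AnormC BUCR"

definition ekern :: "real => nat => complex => complex" where
 "ekern t n = tilde (ift (ak t n))"

lemma ekern: "0 <= t ==> ekern t n \<in> A0" "0 <= t ==> N0 (ekern t n) <= 1"
 using AnormC_le[OF rep_class_C0R ak_PL1(4)] by (auto simp: ekern_def)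

lemma bounded_homD:
 assumes "bounded_hom J Z N \<rho>"
 shows "F \<in> Z ==> cbounded_op J (\<rho> F)"
  "F \<in> Z ==> G \<in> Z ==> \<rho> (\<lambda>z. F z + G z) x = \<rho> F x + \<rho> G x"
  "F \<in> Z ==> \<rho> (\<lambda>z. c * F z) x = cscale J c (\<rho> F x)"
  "F \<in> Z ==> G \<in> Z ==> \<rho> (\<lambda>z. F z * G z) x = \<rho> F (\<rho> G x)"
  "F \<in> Z ==> bounded_linear (\<rho> F)" using assms by (auto simp: bounded_hom_def cbounded_op_def)

lemma bounded_hom_bound:
 assumes \<rho>: "bounded_hom J Z N \<rho>" and N: "\<And>F. F \<in> Z ==> 0 <= N F"
 obtains K where "0 <= K" "\<And>F x. F \<in> Z ==> norm (\<rho> F x) <= K * N F * norm x"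
proof -
 obtain C where C: "\<And>F. F \<in> Z ==> onorm (\<rho> F) <= C * N F"
  using \<rho> unfolding bounded_hom_def by blast
 have "norm (\<rho> F x) <= max C 0 * N F * norm x" if F: "F \<in> Z" for F x
 proof -
  have "norm (\<rho> F x) <= onorm (\<rho> F) * norm x" by (rule onorm[OF bounded_homD(5)[OF \<rho> F]])
  also have "... <= (C * N F) * norm x" by (intro mult_right_mono C F) simp
  also have "... <= (max C 0 * N F) * norm x" using N[OF F] by (intro mult_right_mono) auto
  finally show ?thesis .
 qed
 then show thesis by (intro that[of "max C 0"]) auto
qed

section \<open>Uniqueness, extension and comparison of constants\<close>

context c0_semigroup
begin

lemma rho0_tilde_ift:
 assumes \<rho>: "rho0_prop J T \<rho>" and b: "b \<in> PL1"
 shows "\<rho> (tilde (ift b)) = op b"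
proof -
 have eq: "(\<lambda>t. indicator {0..} t * b t) = b" using b by (auto simp: PL1_def indicator_def fun_eq_iff)
 have "set_integrable lborel {0..} b"
 proof -
  have "(\<lambda>t. indicator {0..} t *\<^sub>R b t) = b" using b by (auto simp: PL1_def indicator_def fun_eq_iff)
  then show ?thesis using b by (simp add: set_integrable_def PL1_def)
 qed
 moreover from this have "\<rho> (laplace b) = op (\<lambda>t. indicator {0..} t * b t)"
  using \<rho> unfolding rho0_prop_def integral_eq_op by blast
 ultimately show ?thesis using laplace_eq_tilde(2)[of b] unfolding eq by simp
qed

lemma rho0_ekern_tendsto:
 assumes "rho0_prop J T \<rho>" "0 <= t"
 shows "(\<lambda>n. \<rho> (ekern t n) x) ----> T t x"
 using op_ak_tendsto[OF assms(2), of x] rho0_tilde_ift[OF assms(1) ak_PL1(1)[OF assms(2)]]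
 by (simp add: ekern_def)

lemma gamma_ineq_semigroup:
 assumes \<rho>: "rho0_prop J T \<rho>" and K: "0 <= K" "gamma_ineq J (\<rho> ` unit_ball A0 N0) K"
 shows "gamma_ineq J (T ` {0..}) K"
proof (rule gam2_gamma_ineq[OF K(1)])
 fix n :: nat and S x assume "\<And>i. i < n ==> S i \<in> T ` {0..}"
 then have "\<forall>i\<in>{..<n}. \<exists>s. 0 <= s \<and> S i = T s" by fastforce
 from bchoice[OF this] obtain t where t: "\<And>i. i < n ==> 0 <= t i \<and> S i = T (t i)" by auto
 have "(\<lambda>k. gam2 J {..<n} (\<lambda>i. \<rho> (ekern (t i) k) (x i))) ----> gam2 J {..<n} (\<lambda>i. S i (x i))"
  by (rule gam2_tendsto) (use t rho0_ekern_tendsto[OF \<rho>] in auto)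
 moreover have "gam2 J {..<n} (\<lambda>i. \<rho> (ekern (t i) k) (x i)) <= K^2 * gam2 J {..<n} x" for k
  by (rule gamma_ineq_gam2[OF K(2,1)]) (use t ekern in \<open>auto simp: unit_ball_def\<close>)
 ultimately show "gam2 J {..<n} (\<lambda>i. S i (x i)) <= K^2 * gam2 J {..<n} x"
  by (intro LIMSEQ_le_const2) auto
qed

text \<open>On transforms of half-line densities every such homomorphism is \<open>op\<close>, and
  boundedness carries the equality to their closure. The approximants \<open>apx f n\<close> do not
  depend on the homomorphism, so both values are limits of the same sequence.\<close>

lemma rho0_unique:
 assumes \<rho>1: "rho0_prop J T \<rho>1" and \<rho>2: "rho0_prop J T \<rho>2" and F: "F \<in> A0"
 shows "\<rho>1 F = \<rho>2 F"
proof (rule AspaceC_E[OF rep_class_C0R F])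
 note S = rep_class_C0R
 fix f assume f: "F = tilde f" "bdd_cont f" "\<And>c. N0 F < c ==> Nle C0R f c"
 note fN = f(3)[OF less_add_one]
 let ?b = "\<lambda>n. apx f n"
 have lim: "(\<lambda>n. op (?b n) x) ----> \<rho> F x" if \<rho>: "rho0_prop J T \<rho>" for \<rho> x
 proof -
  have hom: "bounded_hom J A0 N0 \<rho>" using \<rho> by (simp add: rho0_prop_def)
  show ?thesis
  proof (rule bounded_hom_bound[OF hom AnormC_nonneg[OF S]])
   fix K assume K: "0 <= K" "\<And>F x. F \<in> A0 ==> norm (\<rho> F x) <= K * N0 F * norm x"
   have "norm (op (?b n) x - \<rho> F x) <= K * (1 / real (Suc n)) * norm x" for n
   proof -
    let ?g = "ift (?b n)"
    note bP = apx(1)[OF fN, of n] and gN = apx(3)[OF fN, of n] and dN = apx(2)[OF fN, of n]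
    have gA: "tilde ?g \<in> A0" by (rule AnormC_le(1)[OF S gN])
    have "(\<lambda>s. f s - ?g s) = (\<lambda>s. f s + (- 1) * ?g s)" by auto
    then have "tilde (\<lambda>s. f s - ?g s) = tilde (\<lambda>s. f s + (- 1) * ?g s)" by (simp only:)
    also have "... = (\<lambda>z. tilde f z + tilde (\<lambda>s. (- 1) * ?g s) z)"
     by (intro tilde_add f(2) Nle_bdd_cont[OF S Nle_scale[OF S gN]])
    also have "... = (\<lambda>z. F z + (- 1) * tilde ?g z)" by (simp only: tilde_scale f(1))
    finally have td: "tilde (\<lambda>s. f s - ?g s) = (\<lambda>z. F z + (- 1) * tilde ?g z)" .
    have "\<rho> (tilde (\<lambda>s. f s - ?g s)) x = \<rho> F x + (- 1) *\<^sub>J \<rho> (tilde ?g) x"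
     unfolding td using bounded_homD(2,3)[OF hom] F gA AspaceC_scale[OF S gA] by metis
    also have "... = \<rho> F x - op (?b n) x" by (simp add: rho0_tilde_ift[OF \<rho> bP] C.scale_minus_left)
    finally have "norm (\<rho> F x - op (?b n) x) <= K * N0 (tilde (\<lambda>s. f s - ?g s)) * norm x"
     using K(2)[OF AnormC_le(1)[OF S dN], of x] by simp
    also have "... <= K * (1 / real (Suc n)) * norm x"
     by (intro mult_right_mono mult_left_mono AnormC_le(2)[OF S dN] K(1)) simp
    finally show ?thesis by (simp add: norm_minus_commute)
   qed
   then have "(\<lambda>n. op (?b n) x - \<rho> F x) ----> 0"
    by (intro Lim_null_comparison[OF always_eventually tendsto_mult_left_zero[OF tendsto_mult_right_zero[OF inverse_Suc_tendsto]]]) blast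
   then show ?thesis by (rule LIM_zero_cancel)
  qed
 qed
 show ?thesis using LIMSEQ_unique[OF lim[OF \<rho>1] lim[OF \<rho>2]] by (simp add: fun_eq_iff)
qed

text \<open>An extension is determined by \<open>\<rho>' F = lim \<rho> (F e\<^sub>n)\<close>, where \<open>e\<^sub>n\<close> is the approximate identity.\<close>

lemma mult_ekern:
 assumes "F \<in> A1"
 shows "(\<lambda>z. F z * ekern 0 n z) \<in> A0" "N0 (\<lambda>z. F z * ekern 0 n z) <= N1 F"
proof -
 note m = AspaceC_mult[OF rep_class_C0R Nle_C0R_BUCR assms ekern(1)[OF order_refl], of n]
 show "(\<lambda>z. F z * ekern 0 n z) \<in> A0" by (rule m(1))
 show "N0 (\<lambda>z. F z * ekern 0 n z) <= N1 F"
  using m(2) mult_left_mono[OF ekern(2)[OF order_refl, of n] AnormC_nonneg[OF rep_class_BUCR assms]] by simp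
qed

lemma extension_tendsto:
 assumes \<rho>: "rho0_prop J T \<rho>" and \<rho>': "bounded_hom J A1 N1 \<rho>'" "extends_on A0 \<rho>' \<rho>" and F: "F \<in> A1"
 shows "(\<lambda>n. \<rho> (\<lambda>z. F z * ekern 0 n z) x) ----> \<rho>' F x"
proof -
 have e: "ekern 0 n \<in> A0" for n by (simp add: ekern)
 have "\<rho> (\<lambda>z. F z * ekern 0 n z) x = \<rho>' F (\<rho> (ekern 0 n) x)" for n
  using bounded_homD(4)[OF \<rho>'(1) F AspaceC_C0R_BUCR(1)[OF e]] \<rho>'(2) mult_ekern(1)[OF F] e
  by (simp add: extends_on_def)
 then show ?thesis
  using bounded_linear.tendsto[OF bounded_homD(5)[OF \<rho>'(1) F] rho0_ekern_tendsto[OF \<rho> order_refl]]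
  by simp
qed

text \<open>The smaller unit ball is contained in the larger one. Conversely, multiplying by the
  approximate identity maps the larger ball into the smaller, and strong limits keep the constant.
  So the admissible constants agree, and not only their infima.\<close>

lemma gamma_ineq_extension:
 assumes \<rho>: "rho0_prop J T \<rho>" and \<rho>': "bounded_hom J A1 N1 \<rho>'" "extends_on A0 \<rho>' \<rho>" and K: "0 <= K"
 shows "gamma_ineq J (\<rho>' ` unit_ball A1 N1) K \<longleftrightarrow> gamma_ineq J (\<rho> ` unit_ball A0 N0) K"
proof
 assume *: "gamma_ineq J (\<rho>' ` unit_ball A1 N1) K"
 have "\<rho> ` unit_ball A0 N0 \<subseteq> \<rho>' ` unit_ball A1 N1"
 proof
  fix S assume "S \<in> \<rho> ` unit_ball A0 N0"
  then obtain G where G: "G \<in> A0" "N0 G <= 1" "S = \<rho> G" by (auto simp: unit_ball_def)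
  then have "S = \<rho>' G" "G \<in> unit_ball A1 N1"
   using \<rho>'(2) AspaceC_C0R_BUCR[OF G(1)] by (auto simp: extends_on_def unit_ball_def)
  then show "S \<in> \<rho>' ` unit_ball A1 N1" by blast
 qed
 with * show "gamma_ineq J (\<rho> ` unit_ball A0 N0) K" unfolding gamma_ineq_def by (meson order_trans)
next
 assume *: "gamma_ineq J (\<rho> ` unit_ball A0 N0) K"
 show "gamma_ineq J (\<rho>' ` unit_ball A1 N1) K"
 proof (rule gam2_gamma_ineq[OF K])
  fix n :: nat and S x assume "\<And>i. i < n ==> S i \<in> \<rho>' ` unit_ball A1 N1"
  then have "\<forall>i\<in>{..<n}. \<exists>F. F \<in> unit_ball A1 N1 \<and> S i = \<rho>' F" by blast
  from bchoice[OF this] obtain F where F: "\<And>i. i < n ==> F i \<in> A1 \<and> N1 (F i) <= 1 \<and> S i = \<rho>' (F i)"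
   by (auto simp: unit_ball_def)
  have "(\<lambda>k. gam2 J {..<n} (\<lambda>i. \<rho> (\<lambda>z. F i z * ekern 0 k z) (x i))) ----> gam2 J {..<n} (\<lambda>i. S i (x i))"
   by (rule gam2_tendsto) (use F extension_tendsto[OF \<rho> \<rho>'] in auto)
  moreover have "gam2 J {..<n} (\<lambda>i. \<rho> (\<lambda>z. F i z * ekern 0 k z) (x i)) <= K^2 * gam2 J {..<n} x" for k
  proof (rule gamma_ineq_gam2[OF * K])
   show "\<rho> (\<lambda>z. F i z * ekern 0 k z) \<in> \<rho> ` unit_ball A0 N0" if "i \<in> {..<n}" for i
    using F[of i] that mult_ekern[of "F i" k] by (auto simp: unit_ball_def)
  qed simp
  ultimately show "gam2 J {..<n} (\<lambda>i. S i (x i)) <= K^2 * gam2 J {..<n} x"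
   by (intro LIMSEQ_le_const2) auto
 qed
qed

text \<open>By commutativity the limit exists on vectors \<open>\<rho> G x\<close> with
  \<open>G\<close> in the smaller algebra. The vectors \<open>\<rho> (ekern 0 m) x\<close>
  approximate \<open>x\<close>, and the operators
  \<open>\<rho> (\<lambda>z. F z * ekern 0 n z)\<close> are bounded uniformly in \<open>n\<close>,
  so the sequence is Cauchy on every vector.\<close>

lemma extension_exists:
 assumes \<rho>: "rho0_prop J T \<rho>"
 shows "\<exists>\<rho>'. bounded_hom J A1 N1 \<rho>' \<and> extends_on A0 \<rho>' \<rho>"
proof -
 have hom: "bounded_hom J A0 N0 \<rho>" using \<rho> by (simp add: rho0_prop_def)
 show ?thesis
 proof (rule bounded_hom_bound[OF hom AnormC_nonneg[OF rep_class_C0R]])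
  fix K assume K: "0 <= K" "\<And>F x. F \<in> A0 ==> norm (\<rho> F x) <= K * N0 F * norm x"
  let ?e = "ekern 0"
  have e: "?e n \<in> A0" for n by (simp add: ekern)
  note elim = rho0_ekern_tendsto[OF \<rho> order_refl, simplified]
  define \<rho>' where "\<rho>' F x = lim (\<lambda>n. \<rho> (\<lambda>z. F z * ?e n z) x)" for F x
  have bd: "norm (\<rho> (\<lambda>z. F z * ?e n z) x) <= K * N1 F * norm x" if F: "F \<in> A1" for F n x
   using order_trans[OF K(2)[OF mult_ekern(1)[OF F]] mult_right_mono[OF mult_left_mono[OF mult_ekern(2)[OF F] K(1)] norm_ge_zero]] .
  have FG: "(\<lambda>z. F z * G z) \<in> A0" if "F \<in> A1" "G \<in> A0" for F G
   by (rule AspaceC_mult(1)[OF rep_class_C0R Nle_C0R_BUCR that])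
  have swap: "\<rho> (\<lambda>z. F z * ?e n z) (\<rho> G x) = \<rho> (\<lambda>z. F z * G z) (\<rho> (?e n) x)" if F: "F \<in> A1" and G: "G \<in> A0" for F G n x
  proof -
   have "\<rho> (\<lambda>z. F z * ?e n z) (\<rho> G x) = \<rho> (\<lambda>z. F z * ?e n z * G z) x"
    using bounded_homD(4)[OF hom FG[OF F e] G] by simp
   also have "(\<lambda>z. F z * ?e n z * G z) = (\<lambda>z. F z * G z * ?e n z)" by (simp add: mult_ac)
   also have "\<rho> ... x = \<rho> (\<lambda>z. F z * G z) (\<rho> (?e n) x)"
    using bounded_homD(4)[OF hom FG[OF F G] e] by simp
   finally show ?thesis .
  qed
  have swap_lim: "(\<lambda>n. \<rho> (\<lambda>z. F z * ?e n z) (\<rho> G x)) ----> \<rho> (\<lambda>z. F z * G z) x" if F: "F \<in> A1" and G: "G \<in> A0" for F G x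
   unfolding swap[OF F G] by (rule bounded_linear.tendsto[OF bounded_homD(5)[OF hom FG[OF F G]] elim])
  have lim: "(\<lambda>n. \<rho> (\<lambda>z. F z * ?e n z) x) ----> \<rho>' F x" if F: "F \<in> A1" for F x
  proof -
   let ?u = "\<lambda>n. \<rho> (\<lambda>z. F z * ?e n z)"
   have bl: "bounded_linear (?u n)" for n by (rule bounded_homD(5)[OF hom FG[OF F e]])
   have N: "0 <= N1 F" by (rule AnormC_nonneg[OF rep_class_BUCR F])
   have "Cauchy (\<lambda>n. ?u n x)" unfolding Cauchy_def
   proof (intro allI impI)
    fix \<epsilon> :: real assume \<epsilon>: "0 < \<epsilon>"
    have "(\<lambda>m. K * N1 F * norm (x - \<rho> (?e m) x)) ----> K * N1 F * norm (x - x)"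
     by (intro tendsto_intros elim)
    from order_tendstoD(2)[OF this, of "\<epsilon> / 4"] \<epsilon>
    \<comment> \<open>The vector \<open>\<rho> (ekern 0 m) x\<close> lies where convergence is
      already known and is so close to \<open>x\<close> that the uniform bound absorbs the
      difference.\<close>
    obtain m where m: "K * N1 F * norm (x - \<rho> (?e m) x) < \<epsilon> / 4" by (auto simp: eventually_sequentially)
    let ?y = "\<rho> (?e m) x"
    have "Cauchy (\<lambda>n. ?u n ?y)" using swap_lim[OF F e] by (rule LIMSEQ_imp_Cauchy)
    from CauchyD[OF this, of "\<epsilon> / 4"] \<epsilon>
    obtain M where M: "\<And>k n. k \<ge> M ==> n \<ge> M ==> norm (?u k ?y - ?u n ?y) < \<epsilon> / 4" by auto
    have "dist (?u k x) (?u n x) < \<epsilon>" if "k \<ge> M" "n \<ge> M" for k n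
    proof -
     have "?u k x - ?u n x = ?u k (x - ?y) - ?u n (x - ?y) + (?u k ?y - ?u n ?y)"
      by (simp add: linear_simps(2)[OF bl])
     then have "norm (?u k x - ?u n x) <= norm (?u k (x - ?y)) + norm (?u n (x - ?y)) + norm (?u k ?y - ?u n ?y)"
      using norm_triangle_ineq[of "?u k (x - ?y) - ?u n (x - ?y)" "?u k ?y - ?u n ?y"]
       norm_triangle_ineq4[of "?u k (x - ?y)" "?u n (x - ?y)"] by simp
     then show ?thesis
      using bd[OF F, of k "x - ?y"] bd[OF F, of n "x - ?y"] m M[OF that] \<epsilon> unfolding dist_norm by linarith
    qed
    then show "\<exists>M. \<forall>k\<ge>M. \<forall>n\<ge>M. dist (?u k x) (?u n x) < \<epsilon>" by blast
   qed
   then show ?thesis unfolding \<rho>'_def by (simp add: Cauchy_convergent_iff convergent_LIMSEQ_iff)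
  qed
  have \<rho>'G: "\<rho>' F (\<rho> G x) = \<rho> (\<lambda>z. F z * G z) x" if "F \<in> A1" "G \<in> A0" for F G x
   by (rule LIMSEQ_unique[OF lim[OF that(1)] swap_lim[OF that]])
  have \<rho>'bd: "norm (\<rho>' F x) <= K * N1 F * norm x" if F: "F \<in> A1" for F x
   by (rule LIMSEQ_le_const2[OF tendsto_norm[OF lim[OF F]]]) (use bd[OF F] in blast)
  have \<rho>'c: "cbounded_op J (\<rho>' F)" if F: "F \<in> A1" for F
  proof -
   note h = bounded_homD(1,5)[OF hom FG[OF F e]]
   have "\<rho>' F (x + y) = \<rho>' F x + \<rho>' F y" for x y
   proof (rule LIMSEQ_unique[OF lim[OF F]])
    show "(\<lambda>n. \<rho> (\<lambda>z. F z * ?e n z) (x + y)) ----> \<rho>' F x + \<rho>' F y"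
     unfolding linear_simps(1)[OF h(2)] by (intro tendsto_add lim F)
   qed
   moreover have "\<rho>' F (r *\<^sub>R x) = r *\<^sub>R \<rho>' F x" for r x
   proof (rule LIMSEQ_unique[OF lim[OF F]])
    show "(\<lambda>n. \<rho> (\<lambda>z. F z * ?e n z) (r *\<^sub>R x)) ----> r *\<^sub>R \<rho>' F x"
     unfolding linear_simps(5)[OF h(2)] by (intro tendsto_scaleR tendsto_const lim F)
   qed
   ultimately have "bounded_linear (\<rho>' F)"
    by (rule bounded_linear_intro[where K = "K * N1 F"]) (use \<rho>'bd[OF F] in \<open>simp add: mult_ac\<close>)
   moreover have "\<rho>' F (J x) = J (\<rho>' F x)" for x
   proof (rule LIMSEQ_unique[OF lim[OF F]])
    show "(\<lambda>n. \<rho> (\<lambda>z. F z * ?e n z) (J x)) ----> J (\<rho>' F x)"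
     using J.tendsto[OF lim[OF F, of x]] h(1) by (simp add: cbounded_op_def)
   qed
   ultimately show ?thesis by (simp add: cbounded_op_def)
  qed
  have "bounded_hom J A1 N1 \<rho>'" unfolding bounded_hom_def
  proof (intro conjI ballI allI exI[of _ K])
   fix F G assume F: "F \<in> A1" and G: "G \<in> A1"
   show "\<rho>' (\<lambda>z. F z + G z) = (\<lambda>x. \<rho>' F x + \<rho>' G x)"
   proof
    fix x
    have "\<rho> (\<lambda>z. (F z + G z) * ?e n z) x = \<rho> (\<lambda>z. F z * ?e n z) x + \<rho> (\<lambda>z. G z * ?e n z) x" for n
     using bounded_homD(2)[OF hom FG[OF F e] FG[OF G e]] by (simp add: distrib_right)
    then show "\<rho>' (\<lambda>z. F z + G z) x = \<rho>' F x + \<rho>' G x"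
     using LIMSEQ_unique[OF lim[OF AspaceC_add[OF rep_class_BUCR F G]]] tendsto_add[OF lim[OF F, of x] lim[OF G, of x]] by simp
   qed
   show "\<rho>' (\<lambda>z. F z * G z) = \<rho>' F \<circ> \<rho>' G"
   proof
    fix x
    have FG1: "(\<lambda>z. F z * G z) \<in> A1" by (rule AspaceC_mult(1)[OF rep_class_BUCR _ F G])
    have "\<rho> (\<lambda>z. F z * G z * ?e n z) x = \<rho>' F (\<rho> (\<lambda>z. G z * ?e n z) x)" for n
     using \<rho>'G[OF F FG[OF G e]] by (simp add: mult.assoc)
    moreover have "(\<lambda>n. \<rho>' F (\<rho> (\<lambda>z. G z * ?e n z) x)) ----> \<rho>' F (\<rho>' G x)"
     using \<rho>'c[OF F] by (intro bounded_linear.tendsto[OF _ lim[OF G]]) (simp add: cbounded_op_def)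
    ultimately show "\<rho>' (\<lambda>z. F z * G z) x = (\<rho>' F \<circ> \<rho>' G) x"
     using LIMSEQ_unique[OF lim[OF FG1, of x]] by simp
   qed
  next
   fix c F assume F: "F \<in> A1"
   show "\<rho>' (\<lambda>z. c * F z) = (\<lambda>x. c *\<^sub>J \<rho>' F x)"
   proof
    fix x
    have "\<rho> (\<lambda>z. c * F z * ?e n z) x = c *\<^sub>J \<rho> (\<lambda>z. F z * ?e n z) x" for n
     using bounded_homD(3)[OF hom FG[OF F e]] by (simp add: mult.assoc)
    moreover have "(\<lambda>n. c *\<^sub>J \<rho> (\<lambda>z. F z * ?e n z) x) ----> c *\<^sub>J \<rho>' F x"
     by (intro B.tendsto tendsto_const lim F)
    ultimately show "\<rho>' (\<lambda>z. c * F z) x = c *\<^sub>J \<rho>' F x"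
     using LIMSEQ_unique[OF lim[OF AspaceC_scale[OF rep_class_BUCR F], of c x]] by simp
   qed
  next
   fix F assume F: "F \<in> A1"
   show "cbounded_op J (\<rho>' F)" by (rule \<rho>'c[OF F])
   show "onorm (\<rho>' F) <= K * N1 F"
    by (rule onorm_bound) (use \<rho>'bd[OF F] K(1) AnormC_nonneg[OF rep_class_BUCR F] in auto)
  qed
  moreover have "extends_on A0 \<rho>' \<rho>" unfolding extends_on_def
  proof (intro ballI ext)
   fix F x assume F: "F \<in> A0"
   have "\<rho> (\<lambda>z. F z * ?e n z) x = \<rho> F (\<rho> (?e n) x)" for n by (rule bounded_homD(4)[OF hom F e])
   then show "\<rho>' F x = \<rho> F x" using LIMSEQ_unique[OF lim[OF AspaceC_C0R_BUCR(1)[OF F], of x]]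
     bounded_linear.tendsto[OF bounded_homD(5)[OF hom F] elim[of x]] by simp
  qed
  ultimately show ?thesis by blast
 qed
qed

lemma gamma_bounded_semigroup:
 "gamma_bounded J (T ` {0..}) \<longleftrightarrow> (\<exists>K\<ge>0. gamma_ineq J (T ` {0..}) K)"
proof
 assume "gamma_bounded J (T ` {0..})"
 then obtain K where "gamma_ineq J (T ` {0..}) K" by (auto simp: gamma_bounded_def)
 from gamma_ineq_max[OF this] show "\<exists>K\<ge>0. gamma_ineq J (T ` {0..}) K" by (intro exI[of _ "max K 0"]) simp
next
 assume "\<exists>K\<ge>0. gamma_ineq J (T ` {0..}) K"
 moreover have "\<exists>M. \<forall>S\<in>T ` {0..}. onorm S <= M" using semigroup by (auto simp: bounded_C0_semigroup_def)
 ultimately show "gamma_bounded J (T ` {0..})" using T_op by (auto simp: gamma_bounded_def)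
qed

lemma rho0_gamma_ineq:
 assumes "rho0_prop J T \<rho>"
 shows "\<exists>K\<ge>0. gamma_ineq J (\<rho> ` unit_ball A0 N0) K"
proof -
 obtain K where "gamma_ineq J (\<rho> ` unit_ball A0 N0) K"
  using assms by (auto simp: rho0_prop_def gamma_bounded_map_def gamma_bounded_def)
 from gamma_ineq_max[OF this] show ?thesis by (intro exI[of _ "max K 0"]) simp
qed

lemma gamma_const_le: "0 <= K ==> gamma_ineq J \<T> K ==> gamma_const J \<T> <= K"
 unfolding gamma_const_def by (rule cInf_lower) (auto intro: bdd_belowI[of _ 0])

lemma rho0_prop_exists:
 assumes K: "0 <= K" "gamma_ineq J (T ` {0..}) K"
 shows "\<exists>\<rho>. rho0_prop J T \<rho> \<and> gamma_ineq J (\<rho> ` unit_ball A0 N0) (K^2)"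
proof -
 interpret gamma_semigroup J T K by standard (use K in auto)
 show ?thesis using rho0_prop_rho gamma_ineq_rho by blast
qed

lemma gamma_const_le_map:
 assumes \<rho>: "rho0_prop J T \<rho>"
 shows "gamma_const J (T ` {0..}) <= gamma_map J A0 N0 \<rho>"
 unfolding gamma_map_def gamma_const_def[of J "\<rho> ` unit_ball A0 N0"]
proof (rule cInf_greatest)
 show "{C. 0 <= C \<and> gamma_ineq J (\<rho> ` unit_ball A0 N0) C} \<noteq> {}" using rho0_gamma_ineq[OF \<rho>] by blast
qed (use gamma_const_le gamma_ineq_semigroup[OF \<rho>] in blast)

text \<open>For every admissible constant \<open>K\<close> of the semigroup the construction yields
  a homomorphism with constant \<open>K^2\<close>, and by uniqueness it agrees with
  \<open>\<rho>\<close> on the unit ball. It remains to let \<open>K\<close> approach the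
  infimum.\<close>

lemma gamma_map_le:
 assumes \<rho>: "rho0_prop J T \<rho>"
 shows "gamma_map J A0 N0 \<rho> <= (gamma_const J (T ` {0..}))^2"
proof -
 let ?A = "{C. 0 <= C \<and> gamma_ineq J (T ` {0..}) C}" and ?g = "gamma_const J (T ` {0..})"
 have ne: "?A \<noteq> {}" using rho0_gamma_ineq[OF \<rho>] gamma_ineq_semigroup[OF \<rho>] by blast
 have le: "gamma_map J A0 N0 \<rho> <= K^2" if K: "0 <= K" "gamma_ineq J (T ` {0..}) K" for K
 proof -
  obtain \<rho>1 where \<rho>1: "rho0_prop J T \<rho>1" "gamma_ineq J (\<rho>1 ` unit_ball A0 N0) (K^2)"
   using rho0_prop_exists[OF K] by blast
  have "\<rho> ` unit_ball A0 N0 = \<rho>1 ` unit_ball A0 N0"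
   using rho0_unique[OF \<rho> \<rho>1(1)] by (intro image_cong) (auto simp: unit_ball_def)
  then show ?thesis using \<rho>1(2) by (simp add: gamma_map_def gamma_const_le)
 qed
 have "gamma_map J A0 N0 \<rho> <= (?g + 1 / real (Suc n))^2" for n
 proof -
  have "Inf ?A < ?g + 1 / real (Suc n)" by (simp add: gamma_const_def)
  from cInf_lessD[OF ne this] obtain K where K: "0 <= K" "gamma_ineq J (T ` {0..}) K" "K < ?g + 1 / real (Suc n)" by auto
  then have "K^2 <= (?g + 1 / real (Suc n))^2" by (intro power_mono) auto
  with le[OF K(1,2)] show ?thesis by simp
 qed
 moreover have "(\<lambda>n. (?g + 1 / real (Suc n))^2) ----> (?g + 0)^2"
  by (intro tendsto_intros inverse_Suc_tendsto)
 ultimately show ?thesis by (intro LIMSEQ_le_const[where X = "\<lambda>n. (?g + 1 / real (Suc n))^2"]) auto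
qed

lemma extension_gamma:
 assumes \<rho>: "rho0_prop J T \<rho>" and \<rho>': "bounded_hom J A1 N1 \<rho>'" "extends_on A0 \<rho>' \<rho>"
 shows "gamma_bounded_map J A1 N1 \<rho>'" "gamma_map J A1 N1 \<rho>' = gamma_map J A0 N0 \<rho>"
proof -
 note iff = gamma_ineq_extension[OF \<rho> \<rho>']
 have "{C. 0 <= C \<and> gamma_ineq J (\<rho>' ` unit_ball A1 N1) C} = {C. 0 <= C \<and> gamma_ineq J (\<rho> ` unit_ball A0 N0) C}"
  using iff by blast
 then show "gamma_map J A1 N1 \<rho>' = gamma_map J A0 N0 \<rho>" by (simp add: gamma_map_def gamma_const_def)
 show "gamma_bounded_map J A1 N1 \<rho>'"
 proof (rule bounded_hom_bound[OF \<rho>'(1) AnormC_nonneg[OF rep_class_BUCR]])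
  fix K assume K: "0 <= K" "\<And>F x. F \<in> A1 ==> norm (\<rho>' F x) <= K * N1 F * norm x"
  have "onorm (\<rho>' F) <= K" if F: "F \<in> A1" "N1 F <= 1" for F
  proof (rule onorm_bound[OF K(1)])
   fix x :: 'a
   have "K * N1 F * norm x <= K * norm x" using F(2) K(1) by (intro mult_right_mono mult_left_le) auto
   then show "norm (\<rho>' F x) <= K * norm x" using K(2)[OF F(1), of x] by linarith
  qed
  moreover have "cbounded_op J (\<rho>' F)" if "F \<in> A1" for F by (rule bounded_homD(1)[OF \<rho>'(1) that])
  moreover have "\<exists>C. gamma_ineq J (\<rho>' ` unit_ball A1 N1) C" using iff rho0_gamma_ineq[OF \<rho>] by blast
  ultimately show ?thesis by (auto simp: gamma_bounded_map_def gamma_bounded_def unit_ball_def)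
 qed
qed

end

theorem mainTheorem17:
  fixes J :: "'a::banach \<Rightarrow> 'a" and T :: "real \<Rightarrow> 'a \<Rightarrow> 'a"
  assumes "complex_structure J"
    and "bounded_C0_semigroup J T"
  shows "(gamma_bounded J (T ` {0..}) \<longleftrightarrow> (\<exists>\<rho>. rho0_prop J T \<rho>)) \<and>
    (gamma_bounded J (T ` {0..}) \<longrightarrow>
      (\<forall>\<rho>1 \<rho>2. rho0_prop J T \<rho>1 \<and> rho0_prop J T \<rho>2 \<longrightarrow> (\<forall>F\<in>AspaceC C0R. \<rho>1 F = \<rho>2 F)) \<and>
      (\<forall>\<rho>. rho0_prop J T \<rho> \<longrightarrow>
         gamma_const J (T ` {0..}) \<le> gamma_map J (AspaceC C0R) (AnormC C0R) \<rho> \<and>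
         gamma_map J (AspaceC C0R) (AnormC C0R) \<rho> \<le> (gamma_const J (T ` {0..}))\<^sup>2 \<and>
         (\<exists>\<rho>'. bounded_hom J (AspaceC BUCR) (AnormC BUCR) \<rho>' \<and> extends_on (AspaceC C0R) \<rho>' \<rho>) \<and>
         (\<forall>\<rho>1 \<rho>2. bounded_hom J (AspaceC BUCR) (AnormC BUCR) \<rho>1 \<and> extends_on (AspaceC C0R) \<rho>1 \<rho> \<and>
                    bounded_hom J (AspaceC BUCR) (AnormC BUCR) \<rho>2 \<and> extends_on (AspaceC C0R) \<rho>2 \<rho>
                    \<longrightarrow> (\<forall>F\<in>AspaceC BUCR. \<rho>1 F = \<rho>2 F)) \<and>
         (\<forall>\<rho>'. bounded_hom J (AspaceC BUCR) (AnormC BUCR) \<rho>' \<and> extends_on (AspaceC C0R) \<rho>' \<rho> \<longrightarrow>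
            gamma_bounded_map J (AspaceC BUCR) (AnormC BUCR) \<rho>' \<and>
            gamma_map J (AspaceC BUCR) (AnormC BUCR) \<rho>' = gamma_map J (AspaceC C0R) (AnormC C0R) \<rho>)))"
proof -
 interpret c0_semigroup J T by standard (use assms in auto)
 have "gamma_bounded J (T ` {0..}) \<longleftrightarrow> (\<exists>\<rho>. rho0_prop J T \<rho>)"
 proof
  assume "gamma_bounded J (T ` {0..})"
  then obtain K where "0 <= K" "gamma_ineq J (T ` {0..}) K" unfolding gamma_bounded_semigroup by blast
  then show "\<exists>\<rho>. rho0_prop J T \<rho>" using rho0_prop_exists by blast
 next
  assume "\<exists>\<rho>. rho0_prop J T \<rho>"
  then obtain \<rho> where \<rho>: "rho0_prop J T \<rho>" by blast
  obtain K where "0 <= K" "gamma_ineq J (\<rho> ` unit_ball A0 N0) K" using rho0_gamma_ineq[OF \<rho>] by blast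
  then show "gamma_bounded J (T ` {0..})"
   unfolding gamma_bounded_semigroup using gamma_ineq_semigroup[OF \<rho>] by blast
 qed
 moreover have "\<rho>1 F = \<rho>2 F"
  if "rho0_prop J T \<rho>" "bounded_hom J A1 N1 \<rho>1" "extends_on A0 \<rho>1 \<rho>"
   "bounded_hom J A1 N1 \<rho>2" "extends_on A0 \<rho>2 \<rho>" "F \<in> A1" for \<rho> \<rho>1 \<rho>2 F
  using LIMSEQ_unique[OF extension_tendsto[OF that(1,2,3,6)] extension_tendsto[OF that(1,4,5,6)]] by (rule ext)
 ultimately show ?thesis
  using rho0_unique gamma_const_le_map gamma_map_le extension_exists extension_gamma by simp
qed

end
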